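(* Let $\mathcal{A}$ be a finite von Neumann algebra and $\mathcal{U}$ its algebra of affiliated operators. (1) If $M$ is an $\mathcal{A}$-module in $\mathbf{P}$, then $\mathcal{U}\otimes_{\mathcal{A}}M\subseteq E(M)$. (2) If $M$ is a finitely generated projective $\mathcal{A}$-module, then $\mathcal{U}\otimes_{\mathcal{A}}M=E(M)$.
   Context: A von Neumann algebra is finite if it has a normal faithful trace $\mathrm{tr}_{\mathcal{A}}$; such a trace is fixed and extended to square matrices by summing the diagonal traces. Modules are left modules. Dimension: if $P$ is a finitely generated projective $\mathcal{A}$-module, choose $n$ and $f:\mathcal{A}^n\to\mathcal{A}^n$ with $f=f^2=f^*$ and image (isomorphic to) $P$, and put $\dim_{\mathcal{A}}(P)=\mathrm{tr}_{\mathcal{A}}(f)$; for any $\mathcal{A}$-module $M$, $\dim_{\mathcal{A}}(M)=\sup\{\dim_{\mathcal{A}}(P): P\text{ a finitely generated projective submodule of }M\}$. The class $\mathbf{P}$ consists of the $\mathcal{A}$-modules having no nonzero submodule of dimension zero. $\mathcal{U}$ is the algebra of operators affiliated to $\mathcal{A}$, i.e. the closed densely defined operators on $l^2(\mathcal{A})$ (the Hilbert space completion of $\mathcal{A}$ for $\langle a,b\rangle=\mathrm{tr}_{\mathcal{A}}(ab^* )$) commuting with the commutant of $\mathcal{A}$; it equals the classical ring of quotients of the Ore ring $\mathcal{A}$. $E(M)$ is the injective envelope of the $\mathcal{A}$-module $M$, unique up to isomorphism over $M$. Here $M$ is regarded as a submodule of $\mathcal{U}\otimes_{\mathcal{A}}M$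 via $m\mapsto 1\otimes m$; the inclusion in (1) means that, as $\mathcal{A}$-modules, $\mathcal{U}\otimes_{\mathcal{A}}M$ is contained in a copy of $E(M)$ compatibly with the embeddings of $M$, and the equality in (2) means that $m\mapsto 1\otimes m$ makes $\mathcal{U}\otimes_{\mathcal{A}}M$ an injective envelope of $M$. *)

theory Defs
  imports
    "HOL-Analysis.Analysis"
    "HOL-Algebra.Module"
    "HOL-Algebra.Generated_Groups"
    "HOL-Algebra.Free_Abelian_Groups"
begin

section \<open>Complex Hilbert spaces and von Neumann algebras\<close>

text \<open>The complex inner product is linear in the first argument.  Norm and topology are those of
  the underlying real inner product space.\<close>

class complex_hilbert = real_inner + complete_space +
  fixes scaleC :: "complex \<Rightarrow> 'a \<Rightarrow> 'a"
    and cinner :: "'a \<Rightarrow> 'a \<Rightarrow> complex"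
  assumes scaleC_add_right: "scaleC c (x + y) = scaleC c x + scaleC c y"
    and scaleC_add_left: "scaleC (c + d) x = scaleC c x + scaleC d x"
    and scaleC_scaleC: "scaleC c (scaleC d x) = scaleC (c * d) x"
    and scaleC_of_real: "scaleC (complex_of_real r) x = scaleR r x"
    and cinner_commute: "cinner x y = cnj (cinner y x)"
    and cinner_add_left: "cinner (x + y) z = cinner x z + cinner y z"
    and cinner_scaleC_left: "cinner (scaleC c x) y = c * cinner x y"
    and inner_eq_Re_cinner: "inner x y = Re (cinner x y)"

text \<open>The type \<open>'h \<Rightarrow>\<^sub>L 'h\<close> of the library consists of the bounded real-linear operators;
  \<open>B(H)\<close> is the subset of those that commute with complex scalars.\<close>

definition bounded_ops :: "('h::complex_hilbert \<Rightarrow>\<^sub>L 'h) set" where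
  "bounded_ops = {T. \<forall>c x. blinfun_apply T (scaleC c x) = scaleC c (blinfun_apply T x)}"

definition adj :: "('h::complex_hilbert \<Rightarrow>\<^sub>L 'h) \<Rightarrow> ('h \<Rightarrow>\<^sub>L 'h)" where
  "adj T = (THE S. \<forall>x y. cinner (blinfun_apply T x) y = cinner x (blinfun_apply S y))"

definition scaleC_op :: "complex \<Rightarrow> ('h::complex_hilbert \<Rightarrow>\<^sub>L 'h) \<Rightarrow> ('h \<Rightarrow>\<^sub>L 'h)" where
  "scaleC_op c T = Blinfun (\<lambda>x. scaleC c (blinfun_apply T x))"

definition commutant :: "('h::complex_hilbert \<Rightarrow>\<^sub>L 'h) set \<Rightarrow> ('h \<Rightarrow>\<^sub>L 'h) set" where
  "commutant S = {T \<in> bounded_ops. \<forall>s\<in>S. T o\<^sub>L s = s o\<^sub>L T}"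

definition von_neumann_algebra :: "('h::complex_hilbert \<Rightarrow>\<^sub>L 'h) set \<Rightarrow> bool" where
  "von_neumann_algebra A \<longleftrightarrow>
     A \<subseteq> bounded_ops \<and> (\<forall>a\<in>A. adj a \<in> A) \<and> commutant (commutant A) = A"

definition op_le :: "('h::complex_hilbert \<Rightarrow>\<^sub>L 'h) \<Rightarrow> ('h \<Rightarrow>\<^sub>L 'h) \<Rightarrow> bool" where
  "op_le S T \<longleftrightarrow> (\<forall>x. cinner (blinfun_apply (T - S) x) x \<in> \<real> \<and>
                       0 \<le> Re (cinner (blinfun_apply (T - S) x) x))"

definition is_lub_in :: "('h::complex_hilbert \<Rightarrow>\<^sub>L 'h) set \<Rightarrow> ('h \<Rightarrow>\<^sub>L 'h) set \<Rightarrow> ('h \<Rightarrow>\<^sub>L 'h) \<Rightarrow> bool" where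
  "is_lub_in A D s \<longleftrightarrow> s \<in> A \<and> (\<forall>d\<in>D. op_le d s) \<and>
     (\<forall>t\<in>A. (\<forall>d\<in>D. op_le d t) \<longrightarrow> op_le s t)"

text \<open>A normal faithful (finite, positive) trace.  Normality: the trace preserves suprema of
  upward directed families of positive elements.\<close>

definition normal_faithful_trace ::
    "('h::complex_hilbert \<Rightarrow>\<^sub>L 'h) set \<Rightarrow> (('h \<Rightarrow>\<^sub>L 'h) \<Rightarrow> complex) \<Rightarrow> bool" where
  "normal_faithful_trace A tr \<longleftrightarrow>
     (\<forall>a\<in>A. \<forall>b\<in>A. tr (a + b) = tr a + tr b) \<and>
     (\<forall>c. \<forall>a\<in>A. tr (scaleC_op c a) = c * tr a) \<and>
     (\<forall>a\<in>A. \<forall>b\<in>A. tr (a o\<^sub>L b) = tr (b o\<^sub>L a)) \<and>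
     (\<forall>a\<in>A. op_le 0 a \<longrightarrow> tr a \<in> \<real> \<and> 0 \<le> Re (tr a)) \<and>
     (\<forall>a\<in>A. op_le 0 a \<and> tr a = 0 \<longrightarrow> a = 0) \<and>
     (\<forall>D s. D \<subseteq> A \<and> D \<noteq> {} \<and> (\<forall>d\<in>D. op_le 0 d) \<and>
            (\<forall>d\<in>D. \<forall>e\<in>D. \<exists>f\<in>D. op_le d f \<and> op_le e f) \<and> is_lub_in A D s
        \<longrightarrow> Re (tr s) = (SUP d\<in>D. Re (tr d)))"

definition finite_von_neumann_algebra ::
    "('h::complex_hilbert \<Rightarrow>\<^sub>L 'h) set \<Rightarrow> (('h \<Rightarrow>\<^sub>L 'h) \<Rightarrow> complex) \<Rightarrow> bool" where
  "finite_von_neumann_algebra A tr \<longleftrightarrow> von_neumann_algebra A \<and> normal_faithful_trace A tr"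

definition op_ring :: "('h::complex_hilbert \<Rightarrow>\<^sub>L 'h) set \<Rightarrow> ('h \<Rightarrow>\<^sub>L 'h) ring" where
  "op_ring A = \<lparr>carrier = A, monoid.mult = (o\<^sub>L), monoid.one = id_blinfun, ring.zero = 0, ring.add = (+)\<rparr>"

section \<open>The algebra of affiliated operators\<close>

text \<open>\<open>l2_completion A tr \<eta>\<close>: the Hilbert space \<open>'k\<close> is the completion \<open>l\<^sup>2(A)\<close> of \<open>A\<close> for
  \<open>\<langle>a, b\<rangle> = tr (a b\<^sup>*)\<close>, with canonical map \<open>\<eta>\<close>.  The completion is given by its defining
  property rather than by Cauchy sequences; it is unique up to a unique unitary compatible
  with \<open>\<eta>\<close>.\<close>

definition l2_completion :: "('h::complex_hilbert \<Rightarrow>\<^sub>L 'h) set \<Rightarrow> (('h \<Rightarrow>\<^sub>L 'h) \<Rightarrow> complex) \<Rightarrow>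
    (('h \<Rightarrow>\<^sub>L 'h) \<Rightarrow> 'k::complex_hilbert) \<Rightarrow> bool" where
  "l2_completion A tr \<eta> \<longleftrightarrow>
     (\<forall>a\<in>A. \<forall>b\<in>A. \<eta> (a + b) = \<eta> a + \<eta> b) \<and>
     (\<forall>c. \<forall>a\<in>A. \<eta> (scaleC_op c a) = scaleC c (\<eta> a)) \<and>
     (\<forall>a\<in>A. \<forall>b\<in>A. cinner (\<eta> a) (\<eta> b) = tr (a o\<^sub>L adj b)) \<and>
     closure (\<eta> ` A) = UNIV"

text \<open>The action of \<open>A\<close> on \<open>l\<^sup>2(A)\<close>: the bounded extension of left multiplication.\<close>

definition left_reg :: "('h::complex_hilbert \<Rightarrow>\<^sub>L 'h) set \<Rightarrow> (('h \<Rightarrow>\<^sub>L 'h) \<Rightarrow> 'k::complex_hilbert) \<Rightarrow>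
    ('h \<Rightarrow>\<^sub>L 'h) \<Rightarrow> ('k \<Rightarrow>\<^sub>L 'k)" where
  "left_reg A \<eta> a = (THE T. \<forall>b\<in>A. blinfun_apply T (\<eta> b) = \<eta> (a o\<^sub>L b))"

text \<open>Unbounded operators are represented by their graphs.\<close>

definition linear_operator :: "('k::complex_hilbert \<times> 'k) set \<Rightarrow> bool" where
  "linear_operator T \<longleftrightarrow> single_valued T \<and> (0, 0) \<in> T \<and>
     (\<forall>x y x' y'. (x, y) \<in> T \<and> (x', y') \<in> T \<longrightarrow> (x + x', y + y') \<in> T) \<and>
     (\<forall>c x y. (x, y) \<in> T \<longrightarrow> (scaleC c x, scaleC c y) \<in> T)"

definition closed_densely_defined :: "('k::complex_hilbert \<times> 'k) set \<Rightarrow> bool" where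
  "closed_densely_defined T \<longleftrightarrow> linear_operator T \<and> closed T \<and> closure (Domain T) = UNIV"

definition op_graph :: "('k::complex_hilbert \<Rightarrow>\<^sub>L 'k) \<Rightarrow> ('k \<times> 'k) set" where
  "op_graph S = {(x, blinfun_apply S x) | x. True}"

text \<open>\<open>T\<close> commutes with the bounded operator \<open>S\<close> in the sense \<open>S T \<subseteq> T S\<close>.\<close>

definition affiliated :: "('k::complex_hilbert \<Rightarrow>\<^sub>L 'k) set \<Rightarrow> ('k \<times> 'k) set set" where
  "affiliated N = {T. closed_densely_defined T \<and>
     (\<forall>S\<in>commutant N. \<forall>(x, y)\<in>T. (blinfun_apply S x, blinfun_apply S y) \<in> T)}"

text \<open>Sum and product in \<open>\<U>\<close> are the closures of the algebraic sum and of the composition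
  (\<open>T O S\<close> is the graph of \<open>x \<mapsto> S (T x)\<close>).\<close>

definition affiliated_ring :: "('h::complex_hilbert \<Rightarrow>\<^sub>L 'h) set \<Rightarrow>
    (('h \<Rightarrow>\<^sub>L 'h) \<Rightarrow> 'k::complex_hilbert) \<Rightarrow> ('k \<times> 'k) set ring" where
  "affiliated_ring A \<eta> =
     \<lparr>carrier = affiliated (left_reg A \<eta> ` A),
      monoid.mult = (\<lambda>S T. closure (T O S)),
      monoid.one = op_graph id_blinfun,
      ring.zero = op_graph 0,
      ring.add = (\<lambda>S T. closure {(x, y + z) | x y z. (x, y) \<in> S \<and> (x, z) \<in> T})\<rparr>"

definition affiliated_incl :: "('h::complex_hilbert \<Rightarrow>\<^sub>L 'h) set \<Rightarrow>
    (('h \<Rightarrow>\<^sub>L 'h) \<Rightarrow> 'k::complex_hilbert) \<Rightarrow> ('h \<Rightarrow>\<^sub>L 'h) \<Rightarrow> ('k \<times> 'k) set" where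
  "affiliated_incl A \<eta> a = op_graph (left_reg A \<eta> a)"

section \<open>Left modules over noncommutative rings\<close>

text \<open>We reuse the record of HOL-Algebra modules, whose locale \<open>module\<close> requires
  a commutative ring.  The fields \<open>mult\<close> and \<open>one\<close> of that record play no role.\<close>

locale left_module = R?: ring R + M?: abelian_group M
  for R :: "('r, 'u) ring_scheme" (structure) and M :: "('r, 'm, 'v) module_scheme" (structure) +
  assumes smult_closed [simp, intro]:
      "\<lbrakk>a \<in> carrier R; x \<in> carrier M\<rbrakk> \<Longrightarrow> a \<odot>\<^bsub>M\<^esub> x \<in> carrier M"
    and smult_l_distr:
      "\<lbrakk>a \<in> carrier R; b \<in> carrier R; x \<in> carrier M\<rbrakk> \<Longrightarrow>
        (a \<oplus> b) \<odot>\<^bsub>M\<^esub> x = a \<odot>\<^bsub>M\<^esub> x \<oplus>\<^bsub>M\<^esub> b \<odot>\<^bsub>M\<^esub> x"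
    and smult_r_distr:
      "\<lbrakk>a \<in> carrier R; x \<in> carrier M; y \<in> carrier M\<rbrakk> \<Longrightarrow>
        a \<odot>\<^bsub>M\<^esub> (x \<oplus>\<^bsub>M\<^esub> y) = a \<odot>\<^bsub>M\<^esub> x \<oplus>\<^bsub>M\<^esub> a \<odot>\<^bsub>M\<^esub> y"
    and smult_assoc:
      "\<lbrakk>a \<in> carrier R; b \<in> carrier R; x \<in> carrier M\<rbrakk> \<Longrightarrow>
        (a \<otimes> b) \<odot>\<^bsub>M\<^esub> x = a \<odot>\<^bsub>M\<^esub> (b \<odot>\<^bsub>M\<^esub> x)"
    and smult_one [simp]: "x \<in> carrier M \<Longrightarrow> \<one> \<odot>\<^bsub>M\<^esub> x = x"

definition lmod_hom :: "('r, 'u) ring_scheme \<Rightarrow> ('r, 'm, 'v) module_scheme \<Rightarrow>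
    ('r, 'n, 'w) module_scheme \<Rightarrow> ('m \<Rightarrow> 'n) set" where
  "lmod_hom R M N = {f. f \<in> carrier M \<rightarrow> carrier N \<and>
     (\<forall>x\<in>carrier M. \<forall>y\<in>carrier M. f (x \<oplus>\<^bsub>M\<^esub> y) = f x \<oplus>\<^bsub>N\<^esub> f y) \<and>
     (\<forall>a\<in>carrier R. \<forall>x\<in>carrier M. f (a \<odot>\<^bsub>M\<^esub> x) = a \<odot>\<^bsub>N\<^esub> f x)}"

definition lmod_isomorphic :: "('r, 'u) ring_scheme \<Rightarrow> ('r, 'm, 'v) module_scheme \<Rightarrow>
    ('r, 'n, 'w) module_scheme \<Rightarrow> bool" where
  "lmod_isomorphic R M N \<longleftrightarrow> (\<exists>f\<in>lmod_hom R M N. bij_betw f (carrier M) (carrier N))"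

text \<open>The free left module \<open>R\<^bsup>(I)\<^esup>\<close>; in particular \<open>R\<^sup>n\<close> is \<open>free_module R {..<n}\<close>.\<close>

definition free_module :: "('r, 'u) ring_scheme \<Rightarrow> 'i set \<Rightarrow> ('r, 'i \<Rightarrow> 'r) module" where
  "free_module R I =
     \<lparr>carrier = {x \<in> I \<rightarrow>\<^sub>E carrier R. finite {i\<in>I. x i \<noteq> \<zero>\<^bsub>R\<^esub>}},
      monoid.mult = undefined, monoid.one = undefined,
      ring.zero = (\<lambda>i\<in>I. \<zero>\<^bsub>R\<^esub>),
      ring.add = (\<lambda>x y. \<lambda>i\<in>I. x i \<oplus>\<^bsub>R\<^esub> y i),
      smult = (\<lambda>a x. \<lambda>i\<in>I. a \<otimes>\<^bsub>R\<^esub> x i)\<rparr>"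

definition finitely_generated :: "('r, 'u) ring_scheme \<Rightarrow> ('r, 'm, 'v) module_scheme \<Rightarrow> bool" where
  "finitely_generated R M \<longleftrightarrow> left_module R M \<and>
     (\<exists>S. finite S \<and> S \<subseteq> carrier M \<and> (\<forall>N. submodule N R M \<and> S \<subseteq> N \<longrightarrow> N = carrier M))"

text \<open>Projective: a direct summand of a free module.  Basis sets in the carrier type suffice,
  since \<open>P\<close> is a quotient of the free module on its own carrier.\<close>

definition projective_module :: "('r, 'u) ring_scheme \<Rightarrow> ('r, 'm, 'v) module_scheme \<Rightarrow> bool" where
  "projective_module R P \<longleftrightarrow> left_module R P \<and>
     (\<exists>(I :: 'm set) i p. i \<in> lmod_hom R P (free_module R I) \<and>
        p \<in> lmod_hom R (free_module R I) P \<and> (\<forall>x\<in>carrier P. p (i x) = x))"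

definition fg_projective :: "('r, 'u) ring_scheme \<Rightarrow> ('r, 'm, 'v) module_scheme \<Rightarrow> bool" where
  "fg_projective R P \<longleftrightarrow> finitely_generated R P \<and> projective_module R P"

text \<open>Injectivity is the extension property along inclusions of submodules.  HOL cannot quantify
  over all types inside a definition, so the type \<open>'c\<close> of the test modules is a parameter.
  By Baer's criterion, testing on \<open>'c = 'r\<close> (which contains the left ideals of \<open>R\<close>) already
  implies injectivity with respect to every type.\<close>

definition injective_module :: "'c itself \<Rightarrow> ('r, 'u) ring_scheme \<Rightarrow> ('r, 'e, 'v) module_scheme \<Rightarrow> bool" where
  "injective_module TYPE('c) R E \<longleftrightarrow> left_module R E \<and>
     (\<forall>(L :: ('r, 'c) module) N f.
        left_module R L \<and> submodule N R L \<and> f \<in> lmod_hom R (L\<lparr>carrier := N\<rparr>) E \<longrightarrow>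
        (\<exists>g\<in>lmod_hom R L E. \<forall>x\<in>N. g x = f x))"

definition essential_extension :: "('r, 'u) ring_scheme \<Rightarrow> ('r, 'm, 'v) module_scheme \<Rightarrow>
    ('r, 'e, 'w) module_scheme \<Rightarrow> ('m \<Rightarrow> 'e) \<Rightarrow> bool" where
  "essential_extension R M E i \<longleftrightarrow>
     left_module R M \<and> left_module R E \<and> i \<in> lmod_hom R M E \<and> inj_on i (carrier M) \<and>
     (\<forall>N. submodule N R E \<and> N \<inter> i ` carrier M = {\<zero>\<^bsub>E\<^esub>} \<longrightarrow> N = {\<zero>\<^bsub>E\<^esub>})"

definition injective_envelope :: "'c itself \<Rightarrow> ('r, 'u) ring_scheme \<Rightarrow> ('r, 'm, 'v) module_scheme \<Rightarrow>
    ('r, 'e, 'w) module_scheme \<Rightarrow> ('m \<Rightarrow> 'e) \<Rightarrow> bool" where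
  "injective_envelope TYPE('c) R M E i \<longleftrightarrow>
     injective_module TYPE('c) R E \<and> essential_extension R M E i"

section \<open>Extension of scalars\<close>

text \<open>For a ring homomorphism \<open>\<phi>: R \<rightarrow> S\<close> and a left \<open>R\<close>-module \<open>M\<close>, the tensor product
  \<open>S \<otimes>\<^sub>R M\<close> is the free abelian group on \<open>S \<times> M\<close> modulo the following relations.\<close>

definition tensor_relations :: "('r, 'u) ring_scheme \<Rightarrow> ('s, 'v) ring_scheme \<Rightarrow> ('r \<Rightarrow> 's) \<Rightarrow>
    ('r, 'm, 'w) module_scheme \<Rightarrow> ('s \<times> 'm \<Rightarrow>\<^sub>0 int) set" where
  "tensor_relations R S \<phi> M =
     {frag_of (s \<oplus>\<^bsub>S\<^esub> t, m) - frag_of (s, m) - frag_of (t, m) | s t m.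
        s \<in> carrier S \<and> t \<in> carrier S \<and> m \<in> carrier M} \<union>
     {frag_of (s, m \<oplus>\<^bsub>M\<^esub> n) - frag_of (s, m) - frag_of (s, n) | s m n.
        s \<in> carrier S \<and> m \<in> carrier M \<and> n \<in> carrier M} \<union>
     {frag_of (s \<otimes>\<^bsub>S\<^esub> \<phi> r, m) - frag_of (s, r \<odot>\<^bsub>M\<^esub> m) | s r m.
        s \<in> carrier S \<and> r \<in> carrier R \<and> m \<in> carrier M}"

definition tensor_null :: "('r, 'u) ring_scheme \<Rightarrow> ('s, 'v) ring_scheme \<Rightarrow> ('r \<Rightarrow> 's) \<Rightarrow>
    ('r, 'm, 'w) module_scheme \<Rightarrow> ('s \<times> 'm \<Rightarrow>\<^sub>0 int) set" where
  "tensor_null R S \<phi> M =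
     generate (free_Abelian_group (carrier S \<times> carrier M)) (tensor_relations R S \<phi> M)"

definition pure_tensor :: "('r, 'u) ring_scheme \<Rightarrow> ('s, 'v) ring_scheme \<Rightarrow> ('r \<Rightarrow> 's) \<Rightarrow>
    ('r, 'm, 'w) module_scheme \<Rightarrow> 's \<Rightarrow> 'm \<Rightarrow> ('s \<times> 'm \<Rightarrow>\<^sub>0 int) set" where
  "pure_tensor R S \<phi> M s m =
     tensor_null R S \<phi> M #>\<^bsub>free_Abelian_group (carrier S \<times> carrier M)\<^esub> frag_of (s, m)"

text \<open>The scalar multiplication \<open>s \<odot> (t \<otimes> m) = (s t) \<otimes> m\<close> on cosets: the union below is over
  equal cosets.\<close>

definition extend_scalars :: "('r, 'u) ring_scheme \<Rightarrow> ('s, 'v) ring_scheme \<Rightarrow> ('r \<Rightarrow> 's) \<Rightarrow>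
    ('r, 'm, 'w) module_scheme \<Rightarrow> ('s, ('s \<times> 'm \<Rightarrow>\<^sub>0 int) set) module" where
  "extend_scalars R S \<phi> M =
     (let F = free_Abelian_group (carrier S \<times> carrier M); K = tensor_null R S \<phi> M in
      \<lparr>carrier = carrier (F Mod K),
       monoid.mult = undefined, monoid.one = undefined,
       ring.zero = \<one>\<^bsub>F Mod K\<^esub>,
       ring.add = (\<otimes>\<^bsub>F Mod K\<^esub>),
       smult = (\<lambda>s X. \<Union>x\<in>X. K #>\<^bsub>F\<^esub> frag_extend (\<lambda>(t, m). frag_of (s \<otimes>\<^bsub>S\<^esub> t, m)) x)\<rparr>)"

definition restrict_scalars :: "('r \<Rightarrow> 's) \<Rightarrow> ('s, 'm) module \<Rightarrow> ('r, 'm) module" where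
  "restrict_scalars \<phi> N =
     \<lparr>carrier = carrier N, monoid.mult = monoid.mult N, monoid.one = monoid.one N,
      ring.zero = ring.zero N, ring.add = ring.add N,
      smult = (\<lambda>r x. \<phi> r \<odot>\<^bsub>N\<^esub> x)\<rparr>"

text \<open>\<open>\<U> \<otimes>\<^sub>A M\<close> as a left \<open>A\<close>-module, and the map \<open>m \<mapsto> 1 \<otimes> m\<close>.\<close>

definition affiliated_tensor :: "('h::complex_hilbert \<Rightarrow>\<^sub>L 'h) set \<Rightarrow>
    (('h \<Rightarrow>\<^sub>L 'h) \<Rightarrow> 'k::complex_hilbert) \<Rightarrow> ('h \<Rightarrow>\<^sub>L 'h, 'm) module \<Rightarrow>
    ('h \<Rightarrow>\<^sub>L 'h, (('k \<times> 'k) set \<times> 'm \<Rightarrow>\<^sub>0 int) set) module" where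
  "affiliated_tensor A \<eta> M =
     restrict_scalars (affiliated_incl A \<eta>)
       (extend_scalars (op_ring A) (affiliated_ring A \<eta>) (affiliated_incl A \<eta>) M)"

definition affiliated_tensor_map :: "('h::complex_hilbert \<Rightarrow>\<^sub>L 'h) set \<Rightarrow>
    (('h \<Rightarrow>\<^sub>L 'h) \<Rightarrow> 'k::complex_hilbert) \<Rightarrow> ('h \<Rightarrow>\<^sub>L 'h, 'm) module \<Rightarrow>
    'm \<Rightarrow> (('k \<times> 'k) set \<times> 'm \<Rightarrow>\<^sub>0 int) set" where
  "affiliated_tensor_map A \<eta> M m =
     pure_tensor (op_ring A) (affiliated_ring A \<eta>) (affiliated_incl A \<eta>) M
       \<one>\<^bsub>affiliated_ring A \<eta>\<^esub> m"

section \<open>Dimension and the class \<open>P\<close>\<close>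

text \<open>Endomorphisms of the left module \<open>A\<^sup>n\<close> are the maps \<open>x \<mapsto> x F\<close> for \<open>n \<times> n\<close>-matrices \<open>F\<close>
  over \<open>A\<close>; \<open>projection_matrix A n F\<close> says \<open>F = F\<^sup>2 = F\<^sup>*\<close>.\<close>

definition projection_matrix :: "('h::complex_hilbert \<Rightarrow>\<^sub>L 'h) set \<Rightarrow> nat \<Rightarrow>
    (nat \<Rightarrow> nat \<Rightarrow> ('h \<Rightarrow>\<^sub>L 'h)) \<Rightarrow> bool" where
  "projection_matrix A n F \<longleftrightarrow>
     (\<forall>i<n. \<forall>j<n. F i j \<in> A \<and> (\<Sum>k<n. F i k o\<^sub>L F k j) = F i j \<and> adj (F j i) = F i j)"

definition matrix_map :: "nat \<Rightarrow> (nat \<Rightarrow> nat \<Rightarrow> ('h::complex_hilbert \<Rightarrow>\<^sub>L 'h)) \<Rightarrow>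
    (nat \<Rightarrow> ('h \<Rightarrow>\<^sub>L 'h)) \<Rightarrow> (nat \<Rightarrow> ('h \<Rightarrow>\<^sub>L 'h))" where
  "matrix_map n F x = (\<lambda>j\<in>{..<n}. \<Sum>i<n. x i o\<^sub>L F i j)"

definition matrix_image :: "('h::complex_hilbert \<Rightarrow>\<^sub>L 'h) set \<Rightarrow> nat \<Rightarrow>
    (nat \<Rightarrow> nat \<Rightarrow> ('h \<Rightarrow>\<^sub>L 'h)) \<Rightarrow> ('h \<Rightarrow>\<^sub>L 'h, nat \<Rightarrow> ('h \<Rightarrow>\<^sub>L 'h)) module" where
  "matrix_image A n F =
     (free_module (op_ring A) {..<n})
       \<lparr>carrier := matrix_map n F ` carrier (free_module (op_ring A) {..<n})\<rparr>"

definition fgp_dim :: "('h::complex_hilbert \<Rightarrow>\<^sub>L 'h) set \<Rightarrow> (('h \<Rightarrow>\<^sub>L 'h) \<Rightarrow> complex) \<Rightarrow>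
    ('h \<Rightarrow>\<^sub>L 'h, 'm) module \<Rightarrow> real" where
  "fgp_dim A tr P = (SOME d. \<exists>n F. projection_matrix A n F \<and>
     lmod_isomorphic (op_ring A) (matrix_image A n F) P \<and> d = Re (\<Sum>i<n. tr (F i i)))"

definition vn_dim :: "('h::complex_hilbert \<Rightarrow>\<^sub>L 'h) set \<Rightarrow> (('h \<Rightarrow>\<^sub>L 'h) \<Rightarrow> complex) \<Rightarrow>
    ('h \<Rightarrow>\<^sub>L 'h, 'm) module \<Rightarrow> ereal" where
  "vn_dim A tr M = Sup {ereal (fgp_dim A tr (M\<lparr>carrier := P\<rparr>)) | P.
     submodule P (op_ring A) M \<and> fg_projective (op_ring A) (M\<lparr>carrier := P\<rparr>)}"

definition class_P :: "('h::complex_hilbert \<Rightarrow>\<^sub>L 'h) set \<Rightarrow> (('h \<Rightarrow>\<^sub>L 'h) \<Rightarrow> complex) \<Rightarrow>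
    ('h \<Rightarrow>\<^sub>L 'h, 'm) module \<Rightarrow> bool" where
  "class_P A tr M \<longleftrightarrow> left_module (op_ring A) M \<and>
     (\<forall>N. submodule N (op_ring A) M \<and> vn_dim A tr (M\<lparr>carrier := N\<rparr>) = 0 \<longrightarrow> N = {\<zero>\<^bsub>M\<^esub>})"

end

theory Submission
  imports Defs
begin

text \<open>
  Let \<open>G\<close> be the commutant of the left regular representation on \<open>K = l\<^sup>2(A)\<close> and \<open>N\<close> the commutant
  of \<open>G\<close>.  The vector \<open>\<Omega> = \<eta> 1\<close> gives a faithful trace on \<open>N\<close> and hence a dimension for closed
  \<open>G\<close>-invariant subspaces of \<open>K\<close> and \<open>K \<times> K\<close>.  An operator and its adjoint have kernels of equal
  dimension, because the resolvents of \<open>X\<^sup>*X\<close> and \<open>XX\<^sup>*\<close> have equal trace.  So the graphs of the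
  affiliated operators are the single-valued invariant subspaces of \<open>K \<times> K\<close> that have the dimension
  of \<open>K\<close>; none has a proper affiliated extension, which makes \<open>\<U>\<close> a ring, and the orthogonal projection
  onto the orthogonal complement of a graph shows that each is a left fraction \<open>t\<^sup>-\<^sup>1 b\<close> over \<open>N\<close>.  Normality of
  the trace shows that every element of \<open>N\<close> is carried into \<open>A\<close> by an injective element of \<open>A\<close>, so \<open>\<U>\<close>
  is a ring of left quotients of \<open>A\<close>.

  A homomorphism \<open>f\<close> from a left ideal \<open>I\<close> of \<open>A\<close> to \<open>\<U>\<close> is a right multiplication: the pairs \<open>(\<xi>, \<omega>)\<close>
  with \<open>(\<xi>, x \<omega>) \<in> f x\<close> for finitely many \<open>x \<in> I\<close> form an invariant subspace of known dimension, and
  the dimension is continuous along decreasing sequences.  By Baer's criterion \<open>\<U>\<close> is an injective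
  \<open>A\<close>-module.

  Every \<open>x\<close> in \<open>\<U> \<otimes> M\<close> has a denominator, \<open>s x = 1 \<otimes> m\<close>, so \<open>\<U> \<otimes> M\<close> is essential over the image
  of \<open>M\<close>.  For \<open>M\<close> in \<open>P\<close> the torsion submodule has dimension zero, so \<open>M\<close> and \<open>E(M)\<close> are torsion-free;
  being also divisible, \<open>E(M)\<close> is a \<open>\<U>\<close>-module and \<open>u \<otimes> m \<mapsto> u m\<close> embeds \<open>\<U> \<otimes> M\<close>.  For finitely
  generated projective \<open>M\<close> a dual basis exhibits \<open>\<U> \<otimes> M\<close> as a direct summand of some \<open>\<U>\<^sup>n\<close>.
\<close>

\<comment> \<open>The Hilbert space theory is real: K x K then needs no complex structure of its
  own, and since multiplication by i belongs to \<open>G\<close>, invariance under \<open>G\<close>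
  carries complex linearity along. That \<open>N\<close> is just the image of \<open>A\<close> is
  never established; the weaker statement about denominators does its work. Sums and compositions of
  closed operators need not be closable or densely defined. Left fractions supply an affiliated
  operator around the algebraic result, right fractions supply a domain that survives intersections
  and preimages, and maximality carries identities from such a domain to the closures. For
  self-injectivity the obstacle is that a left ideal need not have an element of least kernel. Sums
  of squares make the kernels directed downwards, and as dimensions are real numbers a sequence
  suffices to reach their infimum. A single element \<open>s\<close> determines a solution only
  modulo \<open>ker s\<close>; therefore multivalued relations are intersected, and the dimension of
  their zero fibre is tracked along with that of the relation.\<close>
subclass (in complex_hilbert) banach ..

section \<open>Real Hilbert spaces\<close>

text \<open>A minimizing sequence for the distance to \<open>S\<close> is Cauchy by the
  parallelogram law, because midpoints stay in \<open>S\<close>; its limit leaves a remainder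
  orthogonal to \<open>S\<close>, since moving it along any \<open>y\<close> cannot bring it
  closer.\<close>

lemma orthogonal_decomposition_exists:
  fixes S :: "'a::{real_inner,banach} set"
  assumes "subspace S" "closed S"
  shows "\<exists>p\<in>S. \<forall>y\<in>S. inner (x - p) y = 0"
proof -
  define V where "V = (\<lambda>y. (norm (x - y))\<^sup>2) ` S"
  have V0: "V \<noteq> {}" using subspace_0[OF assms(1)] by (auto simp: V_def)
  have bV: "bdd_below V" by (auto simp: V_def intro!: bdd_belowI[where m=0])
  have Inf_le: "Inf V \<le> (norm (x - y))\<^sup>2" if "y \<in> S" for y
    using that bV by (auto simp: V_def intro: cInf_lower)
  have "\<exists>y\<in>S. (norm (x - y))\<^sup>2 < Inf V + 1 / real (Suc n)" for n
  proof -
    have "Inf V < Inf V + 1 / real (Suc n)" by simp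
    from cInf_lessD[OF V0 this] show ?thesis by (auto simp: V_def)
  qed
  then obtain f where fS: "\<And>n. f n \<in> S"
    and fn: "\<And>n. (norm (x - f n))\<^sup>2 < Inf V + 1 / real (Suc n)" by metis
  have par: "(norm (f n - f m))\<^sup>2 \<le> 2 / real (Suc n) + 2 / real (Suc m)" for n m
  proof -
    have "(1/2) *\<^sub>R (f n + f m) \<in> S" using assms(1) fS by (auto intro: subspace_add subspace_scale)
    from Inf_le[OF this]
    have 1: "4 * Inf V \<le> (norm ((x - f n) + (x - f m)))\<^sup>2"
    proof -
      have "(x - f n) + (x - f m) = 2 *\<^sub>R (x - (1/2) *\<^sub>R (f n + f m))"
        by (simp add: algebra_simps scaleR_2)
      then have "(norm ((x - f n) + (x - f m)))\<^sup>2 = 4 * (norm (x - (1/2) *\<^sub>R (f n + f m)))\<^sup>2"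
        by (simp add: power_mult_distrib)
      then show ?thesis using Inf_le[OF \<open>(1/2) *\<^sub>R (f n + f m) \<in> S\<close>] by simp
    qed
    have "(norm (f n - f m))\<^sup>2 + (norm ((x - f n) + (x - f m)))\<^sup>2
        = 2 * (norm (x - f n))\<^sup>2 + 2 * (norm (x - f m))\<^sup>2"
      by (simp add: power2_norm_eq_inner inner_simps inner_commute algebra_simps)
    then show ?thesis using 1 fn[of n] fn[of m] by simp
  qed
  have "Cauchy f"
  proof (rule CauchyI)
    fix e :: real assume e: "e > 0"
    obtain M where M: "4 / e\<^sup>2 < real M" using reals_Archimedean2 by blast
    have "norm (f n - f m) < e" if "n \<ge> M" "m \<ge> M" for n m
    proof -
      have "4 / e\<^sup>2 < real (Suc n)" "4 / e\<^sup>2 < real (Suc m)" using M that by linarith+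
      then have "4 < e\<^sup>2 * real (Suc n)" "4 < e\<^sup>2 * real (Suc m)"
        using e by (simp_all add: field_simps)
      then have "2 / real (Suc n) < e\<^sup>2/2" "2 / real (Suc m) < e\<^sup>2/2"
        by (simp_all add: field_simps)
      then have "(norm (f n - f m))\<^sup>2 < e\<^sup>2" using par[of n m] by linarith
      then show ?thesis using e by (simp add: power_less_imp_less_base)
    qed
    then show "\<exists>M. \<forall>m\<ge>M. \<forall>n\<ge>M. norm (f m - f n) < e" by blast
  qed
  then obtain p where p: "f \<longlonglongrightarrow> p" using Cauchy_convergent convergent_def by blast
  have pS: "p \<in> S" using assms(2) fS p closed_sequentially by blast
  have pmin: "(norm (x - p))\<^sup>2 \<le> Inf V"
  proof (rule LIMSEQ_le)
    show "(\<lambda>n. (norm (x - f n))\<^sup>2) \<longlonglongrightarrow> (norm (x - p))\<^sup>2" by (intro tendsto_intros p)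
    show "(\<lambda>n. Inf V + 1 / real (Suc n)) \<longlonglongrightarrow> Inf V"
      using tendsto_add[OF tendsto_const LIMSEQ_inverse_real_of_nat] by (simp add: inverse_eq_divide)
    show "\<exists>N. \<forall>n\<ge>N. (norm (x - f n))\<^sup>2 \<le> Inf V + 1 / real (Suc n)" using fn less_imp_le by blast
  qed
  have "inner (x - p) y = 0" if y: "y \<in> S" for y
  proof (cases "y = 0")
    case False
    \<comment> \<open>The value of \<open>t\<close> at which
      \<open>norm ((x - p) - t *\<^sub>R y)\<close> is least.\<close>
    define t where "t = inner (x - p) y / inner y y"
    have "p + t *\<^sub>R y \<in> S" using assms(1) pS y by (auto intro: subspace_add subspace_scale)
    from order_trans[OF pmin Inf_le[OF this]]
    have "(norm (x - p))\<^sup>2 \<le> (norm ((x - p) - t *\<^sub>R y))\<^sup>2"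
      unfolding diff_diff_eq .
    also have "\<dots> = (norm (x - p))\<^sup>2 - 2 * t * inner (x - p) y + t\<^sup>2 * inner y y"
      unfolding power2_norm_eq_inner
      by (simp add: inner_diff_left inner_diff_right inner_commute algebra_simps power2_eq_square)
    also have "\<dots> = (norm (x - p))\<^sup>2 - (inner (x - p) y)\<^sup>2 / inner y y"
      using False by (simp add: t_def power2_eq_square field_simps)
    finally have "(inner (x - p) y)\<^sup>2 / inner y y \<le> 0" by simp
    moreover have "inner y y > 0" using False by simp
    ultimately have "(inner (x - p) y)\<^sup>2 \<le> 0" by (simp add: divide_le_0_iff)
    then show ?thesis by simp
  qed simp
  then show ?thesis using pS by blast
qed

lemma orthogonal_decomposition_unique:
  fixes S :: "'a::real_inner set"
  assumes "subspace S" "p \<in> S" "q \<in> S"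
    and "\<And>y. y \<in> S \<Longrightarrow> inner (x - p) y = 0" "\<And>y. y \<in> S \<Longrightarrow> inner (x - q) y = 0"
  shows "p = q"
proof -
  have "p - q \<in> S" using assms subspace_diff by blast
  then have "inner (x - q) (p - q) - inner (x - p) (p - q) = 0" using assms by simp
  then have "inner (p - q) (p - q) = 0" by (simp add: inner_simps algebra_simps)
  then show ?thesis by simp
qed

section \<open>Orthogonal projections and complements\<close>

definition orth_proj :: "'a::{real_inner,banach} set \<Rightarrow> 'a \<Rightarrow>\<^sub>L 'a" where
  "orth_proj S = Blinfun (\<lambda>x. THE p. p \<in> S \<and> (\<forall>y\<in>S. inner (x - p) y = 0))"

lemma orth_proj:
  fixes S :: "'a::{real_inner,banach} set"
  assumes "subspace S" "closed S"
  shows orth_proj_in: "orth_proj S x \<in> S"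
    and orth_proj_orth: "y \<in> S \<Longrightarrow> inner (x - orth_proj S x) y = 0"
proof -
  define f where "f x = (THE p. p \<in> S \<and> (\<forall>y\<in>S. inner (x - p) y = 0))" for x
  have ex1: "\<exists>!p. p \<in> S \<and> (\<forall>y\<in>S. inner (x - p) y = 0)" for x
    using orthogonal_decomposition_exists[OF assms, of x]
      orthogonal_decomposition_unique[OF assms(1)] by blast
  have f: "f x \<in> S" "\<And>y. y \<in> S \<Longrightarrow> inner (x - f x) y = 0" for x
    using theI'[OF ex1[of x]] by (auto simp: f_def)
  have add: "f (x + z) = f x + f z" for x z
  proof (rule orthogonal_decomposition_unique[OF assms(1) f(1)])
    show "f x + f z \<in> S" using f(1) subspace_add[OF assms(1)] by blast
    show "inner (x + z - (f x + f z)) y = 0" if "y \<in> S" for y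
      using f(2)[OF that, of x] f(2)[OF that, of z] by (simp add: inner_simps)
  qed (rule f(2))
  have scale: "f (c *\<^sub>R x) = c *\<^sub>R f x" for c x
  proof (rule orthogonal_decomposition_unique[OF assms(1) f(1)])
    show "c *\<^sub>R f x \<in> S" using f(1) subspace_scale[OF assms(1)] by blast
    show "inner (c *\<^sub>R x - c *\<^sub>R f x) y = 0" if "y \<in> S" for y
      using f(2)[OF that, of x] by (simp flip: scaleR_diff_right)
  qed (rule f(2))
  have nrm: "norm (f x) \<le> norm x" for x
  proof -
    have "inner (x - f x) (f x) = 0" using f by blast
    then have "(norm (f x))\<^sup>2 = inner x (f x)" by (simp add: power2_norm_eq_inner inner_simps)
    also have "\<dots> \<le> norm x * norm (f x)" by (rule norm_cauchy_schwarz)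
    finally show ?thesis by (cases "f x = 0") (auto simp: power2_eq_square)
  qed
  have "bounded_linear f"
    by (rule bounded_linear_intro[where K=1]) (use add scale nrm in auto)
  then have eq: "blinfun_apply (orth_proj S) x = f x" for x
    unfolding orth_proj_def f_def[symmetric] by (simp add: bounded_linear_Blinfun_apply)
  show "orth_proj S x \<in> S" "y \<in> S \<Longrightarrow> inner (x - orth_proj S x) y = 0"
    unfolding eq using f by blast+
qed

lemma orth_proj_eqI:
  assumes "subspace S" "closed S" "p \<in> S" "\<And>y. y \<in> S \<Longrightarrow> inner (x - p) y = 0"
  shows "orth_proj S x = p"
  by (rule orthogonal_decomposition_unique[OF assms(1) orth_proj_in[OF assms(1,2)] assms(3)])
    (use orth_proj_orth[OF assms(1,2)] assms(4) in auto)

lemma orth_proj_id: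
  assumes "subspace S" "closed S" "x \<in> S" shows "orth_proj S x = x"
  by (rule orth_proj_eqI) (use assms in auto)

lemma orth_proj_selfadjoint:
  assumes "subspace S" "closed S"
  shows "inner (orth_proj S x) y = inner x (orth_proj S y)"
  using orth_proj_orth[OF assms orth_proj_in[OF assms, of y], of x]
    orth_proj_orth[OF assms orth_proj_in[OF assms, of x], of y]
  by (simp add: inner_simps inner_commute)

lemma inner_orth_proj:
  assumes "subspace S" "closed S"
  shows "inner (orth_proj S x) x = (norm (orth_proj S x))\<^sup>2"
  using orth_proj_orth[OF assms orth_proj_in[OF assms, of x], of x]
  by (simp add: power2_norm_eq_inner inner_simps inner_commute)

definition ortho :: "'a::real_inner set \<Rightarrow> 'a set" where
  "ortho S = {x. \<forall>y\<in>S. inner x y = 0}"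

lemma subspace_ortho [simp]: "subspace (ortho S)"
  by (auto simp: ortho_def subspace_def inner_simps)

lemma closed_ortho [simp]: "closed (ortho S)"
proof -
  have "ortho S = (\<Inter>y\<in>S. {x. inner x y = 0})" by (auto simp: ortho_def)
  moreover have "closed {x. inner x y = 0}" for y :: 'a
    by (intro closed_Collect_eq continuous_intros)
  ultimately show ?thesis by auto
qed

lemma orth_proj_zero_iff:
  assumes "subspace S" "closed S"
  shows "orth_proj S x = 0 \<longleftrightarrow> x \<in> ortho S"
proof
  show "orth_proj S x = 0 \<Longrightarrow> x \<in> ortho S"
    using orth_proj_orth[OF assms, of _ x] by (auto simp: ortho_def)
  show "x \<in> ortho S \<Longrightarrow> orth_proj S x = 0"
    by (rule orth_proj_eqI[OF assms]) (use subspace_0[OF assms(1)] in \<open>auto simp: ortho_def\<close>)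
qed

lemma orth_proj_fixed_iff:
  assumes "subspace S" "closed S"
  shows "orth_proj S x = x \<longleftrightarrow> x \<in> S"
  using orth_proj_in[OF assms, of x] orth_proj_id[OF assms] by auto

lemma diff_orth_proj_ortho:
  assumes "subspace S" "closed S"
  shows "x - orth_proj S x \<in> ortho S"
  using orth_proj_orth[OF assms] by (auto simp: ortho_def)

lemma orth_proj_ortho:
  assumes "subspace S" "closed S"
  shows "orth_proj (ortho S) x = x - orth_proj S x"
  by (rule orth_proj_eqI[OF subspace_ortho closed_ortho diff_orth_proj_ortho[OF assms]])
    (use orth_proj_in[OF assms] in \<open>auto simp: ortho_def inner_commute\<close>)

lemma ortho_ortho:
  fixes S :: "'a::{real_inner,banach} set"
  assumes "subspace S" "closed S"
  shows "ortho (ortho S) = S"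
proof -
  have "x \<in> ortho (ortho S) \<longleftrightarrow> x \<in> S" for x
    using orth_proj_zero_iff[OF subspace_ortho closed_ortho, of S x] orth_proj_ortho[OF assms, of x]
      orth_proj_fixed_iff[OF assms, of x] by auto
  then show ?thesis by blast
qed

lemma subspace_closure:
  fixes S :: "'a::real_normed_vector set"
  assumes "subspace S" shows "subspace (closure S)"
proof (rule subspaceI)
  show "0 \<in> closure S" using subspace_0[OF assms] closure_subset by blast
next
  fix x y assume "x \<in> closure S" "y \<in> closure S"
  then obtain f g where "\<And>n. f n \<in> S" "f \<longlonglongrightarrow> x" "\<And>n. g n \<in> S" "g \<longlonglongrightarrow> y"
    by (metis closure_sequential)
  then show "x + y \<in> closure S"
    unfolding closure_sequential using subspace_add[OF assms] tendsto_add
    by (intro exI[of _ "\<lambda>n. f n + g n"]) blast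
next
  fix c :: real and x assume "x \<in> closure S"
  then obtain f where "\<And>n. f n \<in> S" "f \<longlonglongrightarrow> x" by (metis closure_sequential)
  then show "c *\<^sub>R x \<in> closure S"
    unfolding closure_sequential using subspace_scale[OF assms] tendsto_scaleR[OF tendsto_const]
    by (intro exI[of _ "\<lambda>n. c *\<^sub>R f n"]) blast
qed

lemma ortho_closure: "ortho (closure S) = ortho S"
proof
  show "ortho (closure S) \<subseteq> ortho S" using closure_subset[of S] by (auto simp: ortho_def)
  show "ortho S \<subseteq> ortho (closure S)"
  proof
    fix x assume "x \<in> ortho S"
    then have "S \<subseteq> {y. inner x y = 0}" by (auto simp: ortho_def)
    moreover have "closed {y. inner x y = 0}" by (intro closed_Collect_eq continuous_intros)
    ultimately show "x \<in> ortho (closure S)" using closure_minimal by (auto simp: ortho_def)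
  qed
qed

text \<open>This converts density into the vanishing of an orthogonal complement, the form in which
  dense ranges and dense domains are checked throughout.\<close>

lemma ortho_eq_0_iff_dense:
  fixes S :: "'a::{real_inner,banach} set"
  assumes "subspace S"
  shows "closure S = UNIV \<longleftrightarrow> ortho S = {0}"
proof -
  have U: "ortho (UNIV::'a set) = {0}" by (auto simp: ortho_def intro: inner_eq_zero_iff[THEN iffD1])
  have Z: "ortho ({0}::'a set) = UNIV" by (auto simp: ortho_def)
  have "ortho (ortho (closure S)) = closure S"
    using assms by (intro ortho_ortho) (auto intro: subspace_closure)
  then show ?thesis using ortho_closure[of S] U Z by auto
qed

lemma riesz_representation:
  fixes f :: "'a::{real_inner,banach} \<Rightarrow> real"
  assumes "bounded_linear f"
  shows "\<exists>v. \<forall>x. f x = inner x v"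
proof (cases "\<forall>x. f x = 0")
  case True
  then show ?thesis by (intro exI[of _ 0]) simp
next
  case False
  then obtain z where z: "f z \<noteq> 0" by blast
  interpret f: bounded_linear f by fact
  define S where "S = {x. f x = 0}"
  have S: "subspace S" "closed S"
    unfolding S_def
    by (auto simp: subspace_def f.add f.scaleR f.zero
        intro!: closed_Collect_eq f.continuous_on continuous_intros)
  \<comment> \<open>The functional vanishes on \<open>S\<close>, so it is determined by its value on
    the single direction \<open>w\<close> orthogonal to \<open>S\<close>.\<close>
  define w where "w = z - orth_proj S z"
  have fw: "f w = f z" using orth_proj_in[OF S, of z] by (simp add: w_def f.diff S_def)
  have w: "w \<in> ortho S" unfolding w_def by (rule diff_orth_proj_ortho[OF S])
  have w0: "inner w w \<noteq> 0" using z fw f.zero by force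
  have "f x = inner x ((f w / inner w w) *\<^sub>R w)" for x
  proof -
    have "x - (f x / f w) *\<^sub>R w \<in> S" using z fw by (simp add: S_def f.diff f.scaleR)
    then have "inner w (x - (f x / f w) *\<^sub>R w) = 0" using w by (auto simp: ortho_def)
    then have "inner x w = (f x / f w) * inner w w" by (simp add: inner_diff_right inner_commute)
    then show ?thesis using w0 z fw by (simp add: field_simps)
  qed
  then show ?thesis by blast
qed

text \<open>The adjoint for the real inner product. It is available on
  \<open>'a \<times> 'a\<close>, which is not declared complex, and it agrees with
  \<open>adj\<close> on complex linear operators (\<open>adj_eq_hadj\<close>).\<close>

definition hadj :: "('a::{real_inner,banach} \<Rightarrow>\<^sub>L 'a) \<Rightarrow> ('a \<Rightarrow>\<^sub>L 'a)" where
  "hadj T = (SOME S. \<forall>x y. inner (T x) y = inner x (blinfun_apply S y))"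

lemma hadj: "inner (blinfun_apply T x) y = inner x (hadj T y)"
proof -
  have "\<exists>v. \<forall>x. inner (T x) y = inner x v" for y
    by (rule riesz_representation) (intro bounded_linear_intros)
  then obtain g where g: "\<And>x y. inner (T x) y = inner x (g y)" by metis
  have ext: "u = v" if "\<And>x. inner x u = inner x v" for u v :: 'a
    using that[of "u - v"] by (metis inner_eq_zero_iff inner_diff_right right_minus_eq)
  have "bounded_linear g"
  proof (rule bounded_linear_intro[where K="norm T"])
    show "g (x + y) = g x + g y" for x y
      by (rule ext) (simp add: g[symmetric] inner_add_right)
    show "g (c *\<^sub>R x) = c *\<^sub>R g x" for c x
      by (rule ext) (simp add: g[symmetric])
    show "norm (g x) \<le> norm x * norm T" for x
    proof -
      have "(norm (g x))\<^sup>2 = inner (T (g x)) x" by (simp add: g power2_norm_eq_inner)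
      also have "\<dots> \<le> norm (T (g x)) * norm x" by (rule norm_cauchy_schwarz)
      also have "\<dots> \<le> (norm T * norm (g x)) * norm x"
        by (intro mult_right_mono norm_blinfun) auto
      finally have "norm (g x) * norm (g x) \<le> (norm x * norm T) * norm (g x)"
        by (simp add: power2_eq_square mult_ac)
      then show ?thesis by (cases "norm (g x) = 0") (auto simp: mult_le_cancel_right)
    qed
  qed
  then have "\<exists>S. \<forall>x y. inner (T x) y = inner x (blinfun_apply S y)"
    using g by (intro exI[of _ "Blinfun g"]) (simp add: bounded_linear_Blinfun_apply)
  from someI_ex[OF this] show ?thesis unfolding hadj_def by blast
qed

lemma hadj': "inner x (blinfun_apply T y) = inner (hadj T x) y"
  by (metis hadj inner_commute)

lemma blinfun_inner_ext:
  fixes S T :: "'b::real_normed_vector \<Rightarrow>\<^sub>L 'a::real_inner"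
  assumes "\<And>x y. inner (S x) y = inner (T x) y" shows "S = T"
proof (rule blinfun_eqI)
  fix x
  have "inner (S x - T x) (S x - T x) = 0" using assms by (simp add: inner_diff_left)
  then show "S x = T x" by simp
qed

lemma hadj_unique: "(\<And>x y. inner (blinfun_apply T x) y = inner x (blinfun_apply S y)) \<Longrightarrow> hadj T = S"
  by (rule blinfun_inner_ext) (metis hadj' hadj inner_commute)

lemma hadj_hadj [simp]: "hadj (hadj T) = T"
  by (rule hadj_unique) (metis hadj inner_commute)

lemma hadj_compose: "hadj (S o\<^sub>L T) = hadj T o\<^sub>L hadj S"
  by (rule hadj_unique) (simp add: hadj)

lemma hadj_add: "hadj (S + T) = hadj S + hadj T"
  by (rule hadj_unique) (simp add: hadj blinfun.bilinear_simps inner_simps)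

lemma hadj_diff: "hadj (S - T) = hadj S - hadj T"
  by (rule hadj_unique) (simp add: hadj blinfun.bilinear_simps inner_simps)

lemma hadj_scaleR: "hadj (c *\<^sub>R T) = c *\<^sub>R hadj T"
  by (rule hadj_unique) (simp add: hadj blinfun.bilinear_simps)

lemma hadj_0 [simp]: "hadj 0 = 0"
  by (rule hadj_unique) simp

lemma hadj_id [simp]: "hadj id_blinfun = id_blinfun"
  by (rule hadj_unique) simp

lemma hadj_orth_proj: "subspace S \<Longrightarrow> closed S \<Longrightarrow> hadj (orth_proj S) = orth_proj S"
  by (rule hadj_unique) (rule orth_proj_selfadjoint)

lemma hadj_compose_zero_iff: "hadj T (blinfun_apply T x) = 0 \<longleftrightarrow> T x = 0"
  by (metis hadj inner_eq_zero_iff inner_zero_right blinfun.zero_right)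

lemma ker_hadj: "{x. hadj T x = 0} = ortho (range (blinfun_apply T))"
proof -
  have "hadj T x = 0 \<longleftrightarrow> (\<forall>y. inner x (T y) = 0)" for x
    by (metis hadj' inner_eq_zero_iff inner_zero_left)
  then show ?thesis by (auto simp: ortho_def)
qed

lemma subspace_range_blinfun: "subspace (range (blinfun_apply T))"
  by (metis subspace_UNIV blinfun.bounded_linear_right bounded_linear.linear linear_subspace_image)

lemma subspace_ker_blinfun: "subspace {x. blinfun_apply T x = 0}"
  by (auto simp: subspace_def blinfun.bilinear_simps)

lemma closed_ker_blinfun: "closed {x. blinfun_apply T x = 0}"
  by (intro closed_Collect_eq continuous_intros)

lemma dense_range_iff_ker_hadj:
  "closure (range (blinfun_apply T)) = UNIV \<longleftrightarrow> {x. hadj T x = 0} = {0}"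
  by (simp add: ker_hadj ortho_eq_0_iff_dense subspace_range_blinfun)

section \<open>Positive operators and their resolvents\<close>

definition hpos :: "('a::{real_inner,banach} \<Rightarrow>\<^sub>L 'a) \<Rightarrow> bool" where
  "hpos C \<longleftrightarrow> hadj C = C \<and> (\<forall>x. 0 \<le> inner (C x) x)"

lemma hpos_hadj_compose: "hpos (hadj T o\<^sub>L T)"
proof -
  have "0 \<le> inner (hadj T (T x)) x" for x
    by (metis hadj inner_commute inner_ge_zero)
  then show ?thesis by (auto simp: hpos_def hadj_compose)
qed

lemma hpos_add: "hpos S \<Longrightarrow> hpos T \<Longrightarrow> hpos (S + T)"
  by (auto simp: hpos_def hadj_add blinfun.bilinear_simps inner_simps)

lemma hpos_scaleR: "0 \<le> c \<Longrightarrow> hpos T \<Longrightarrow> hpos (c *\<^sub>R T)"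
  by (auto simp: hpos_def hadj_scaleR blinfun.bilinear_simps)

lemma hpos_0 [simp]: "hpos 0"
  by (auto simp: hpos_def)

lemma hpos_sum: "(\<And>i. i \<in> I \<Longrightarrow> hpos (f i)) \<Longrightarrow> hpos (\<Sum>i\<in>I. f i)"
  by (induction I rule: infinite_finite_induct) (auto intro: hpos_add)

text \<open>This is (1 + C)^-1. Resolvents take the place of spectral projections: they commute with
  whatever commutes with \<open>C\<close>, and those of n C converge to the projection onto the
  kernel.\<close>

definition resolvent :: "('a::{real_inner,banach} \<Rightarrow>\<^sub>L 'a) \<Rightarrow> ('a \<Rightarrow>\<^sub>L 'a)" where
  "resolvent C = Blinfun (inv_into UNIV (\<lambda>x. x + blinfun_apply C x))"

text \<open>Positivity gives \<open>norm x \<le> norm (x + C x)\<close>, so 1 + C is injective with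
  closed range; a vector orthogonal to the range is orthogonal to its own image, which forces it to
  be zero.\<close>

lemma resolvent:
  fixes C :: "'a::{real_inner,banach} \<Rightarrow>\<^sub>L 'a"
  assumes "hpos C"
  shows resolvent_right: "resolvent C x + C (resolvent C x) = x"
    and resolvent_left: "resolvent C (x + C x) = x"
proof -
  define f where "f = (\<lambda>x. x + blinfun_apply C x)"
  have bl: "bounded_linear f" unfolding f_def by (intro bounded_linear_intros)
  interpret f: bounded_linear f by fact
  have low: "norm x \<le> norm (f x)" for x
  proof (cases "x = 0")
    case False
    have "(norm x)\<^sup>2 \<le> inner (f x) x"
      using assms by (auto simp: f_def inner_add_left power2_norm_eq_inner hpos_def)
    also have "\<dots> \<le> norm (f x) * norm x" by (rule norm_cauchy_schwarz)
    finally show ?thesis using False by (simp add: power2_eq_square)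
  qed simp
  have "complete (f ` UNIV)"
    by (rule complete_isometric_image[where e=1]) (use bl low in \<open>auto simp: complete_UNIV\<close>)
  then have cl: "closed (range f)" by (rule complete_imp_closed)
  have sub: "subspace (range f)" using f.linear linear_subspace_image subspace_UNIV by blast
  have "ortho (range f) = {0}"
  proof -
    have "y = 0" if "y \<in> ortho (range f)" for y
    proof -
      have "inner y (f y) = 0" using that by (auto simp: ortho_def)
      then have "inner y y + inner (C y) y = 0" by (simp add: f_def inner_add_right inner_commute)
      moreover have "0 \<le> inner (C y) y" "0 \<le> inner y y" using assms by (auto simp: hpos_def)
      ultimately have "inner y y = 0" by linarith
      then show ?thesis by simp
    qed
    then show ?thesis using subspace_0[OF subspace_ortho] by blast
  qed
  then have surj: "surj f" using ortho_eq_0_iff_dense[OF sub] cl by (simp add: closure_closed)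
  have inj: "inj f"
  proof (rule injI)
    fix x y assume "f x = f y"
    then have "norm (x - y) \<le> 0" using low[of "x - y"] by (simp add: f.diff)
    then show "x = y" by simp
  qed
  have fi: "f (inv_into UNIV f y) = y" for y using surj surj_f_inv_f by metis
  have "bounded_linear (inv_into UNIV f)"
  proof (rule bounded_linear_intro[where K=1])
    show "inv_into UNIV f (x + y) = inv_into UNIV f x + inv_into UNIV f y" for x y
      by (rule injD[OF inj]) (simp add: fi f.add)
    show "inv_into UNIV f (c *\<^sub>R x) = c *\<^sub>R inv_into UNIV f x" for c x
      by (rule injD[OF inj]) (simp add: fi f.scaleR)
    show "norm (inv_into UNIV f x) \<le> norm x * 1" for x using low[of "inv_into UNIV f x"] by (simp add: fi)
  qed
  then have eq: "resolvent C x = inv_into UNIV f x" for x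
    unfolding resolvent_def f_def[symmetric] by (simp add: bounded_linear_Blinfun_apply)
  show "resolvent C x + C (resolvent C x) = x" using fi[of x] by (simp add: eq f_def)
  show "resolvent C (x + C x) = x" using inv_f_f[OF inj, of x] by (simp add: eq f_def)
qed

lemma resolvent_unique:
  assumes "hpos C" "y + C y = x" shows "resolvent C x = y"
  using resolvent_left[OF assms(1), of y] assms(2) by simp

lemma norm_resolvent_le:
  assumes "hpos C" shows "norm (resolvent C x) \<le> norm x"
proof (cases "resolvent C x = 0")
  case False
  let ?y = "resolvent C x"
  have "(norm ?y)\<^sup>2 \<le> inner ?y ?y + inner (C ?y) ?y"
    using assms by (auto simp: hpos_def power2_norm_eq_inner)
  also have "\<dots> = inner x ?y" by (simp flip: inner_add_left add: resolvent_right[OF assms])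
  also have "\<dots> \<le> norm x * norm ?y" by (rule norm_cauchy_schwarz)
  finally show ?thesis using False by (simp add: power2_eq_square)
qed simp

lemma resolvent_selfadjoint:
  assumes "hpos C" shows "hadj (resolvent C) = resolvent C"
proof (rule hadj_unique)
  fix x y
  let ?u = "resolvent C x" and ?v = "resolvent C y"
  have "inner ?u y = inner ?u ?v + inner ?u (C ?v)"
    by (simp flip: inner_add_right add: resolvent_right[OF assms])
  also have "\<dots> = inner ?u ?v + inner (C ?u) ?v" using assms by (simp add: hpos_def hadj')
  also have "\<dots> = inner x ?v" by (simp flip: inner_add_left add: resolvent_right[OF assms])
  finally show "inner ?u y = inner x ?v" .
qed

lemma inner_resolvent_eq:
  assumes "hpos C"
  shows "inner (resolvent C x) x = (norm (resolvent C x))\<^sup>2 + inner (C (resolvent C x)) (resolvent C x)"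
proof -
  let ?u = "resolvent C x"
  have "inner ?u x = inner ?u (?u + C ?u)" by (simp add: resolvent_right[OF assms])
  then show ?thesis by (simp add: inner_add_right power2_norm_eq_inner inner_commute)
qed

lemma hpos_resolvent:
  assumes "hpos C" shows "hpos (resolvent C)"
proof -
  have "0 \<le> inner (resolvent C x) x" for x
    using inner_resolvent_eq[OF assms, of x] assms by (simp add: hpos_def)
  then show ?thesis using resolvent_selfadjoint[OF assms] by (simp add: hpos_def)
qed

lemma inner_resolvent_le: 
  assumes "hpos C" shows "inner (resolvent C x) x \<le> (norm x)\<^sup>2"
proof -
  have "inner (resolvent C x) x \<le> norm (resolvent C x) * norm x" by (rule norm_cauchy_schwarz)
  also have "\<dots> \<le> norm x * norm x" by (intro mult_right_mono norm_resolvent_le assms) auto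
  finally show ?thesis by (simp add: power2_eq_square)
qed

text \<open>The variational principle behind the operator monotonicity of the inverse.\<close>

lemma resolvent_variational:
  assumes "hpos C"
  shows "2 * inner x v - inner v v - inner (C v) v \<le> inner (resolvent C x) x"
proof -
  let ?u = "resolvent C x"
  have s: "inner (C ?u) v = inner (C v) ?u"
    using assms by (metis hpos_def hadj inner_commute)
  have "0 \<le> inner (?u - v) (?u - v) + inner (C (?u - v)) (?u - v)"
    using assms by (auto simp: hpos_def)
  also have "\<dots> = inner ?u ?u + inner (C ?u) ?u - 2 * (inner ?u v + inner (C ?u) v)
      + inner v v + inner (C v) v"
    using s by (simp add: blinfun.diff_right inner_diff_left inner_diff_right inner_commute algebra_simps)
  also have "inner ?u v + inner (C ?u) v = inner x v"
    by (simp flip: inner_add_left add: resolvent_right[OF assms])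
  also have "inner ?u ?u + inner (C ?u) ?u = inner (resolvent C x) x"
    using inner_resolvent_eq[OF assms] by (simp add: power2_norm_eq_inner)
  finally show ?thesis by simp
qed

text \<open>If 1 + B is at most k (1 + C), then (1 + C)^-1 is at most k (1 + B)^-1: the variational
  bound for \<open>B\<close> is evaluated at a multiple of the optimal vector for
  \<open>C\<close>.\<close>

lemma resolvent_antimono:
  assumes "hpos B" "hpos C" "k > 0"
    and "\<And>v. inner v v + inner (B v) v \<le> k * (inner v v + inner (C v) v)"
  shows "inner (resolvent C x) x \<le> k * inner (resolvent B x) x"
proof -
  let ?v = "resolvent C x"
  have Cv: "inner ?v ?v + inner (C ?v) ?v = inner ?v x"
    using inner_resolvent_eq[OF assms(2)] by (simp add: power2_norm_eq_inner)
  \<comment> \<open>With the factor 1/k the quadratic terms are at most half of the linear term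
    \<open>2 * inner x ?w\<close>.\<close>
  let ?w = "(1/k) *\<^sub>R ?v"
  have "inner ?w ?w + inner (B ?w) ?w = (1/k)\<^sup>2 * (inner ?v ?v + inner (B ?v) ?v)"
    by (simp add: blinfun.scaleR_right algebra_simps power2_eq_square)
  also have "\<dots> \<le> (1/k)\<^sup>2 * (k * inner ?v x)"
    using assms(4)[of ?v] Cv by (intro mult_left_mono) auto
  also have "\<dots> = (1/k) * inner ?v x" using assms(3) by (simp add: power2_eq_square)
  finally have "(1/k) * inner ?v x \<le> 2 * inner x ?w - inner ?w ?w - inner (B ?w) ?w"
    by (simp add: inner_commute)
  also have "\<dots> \<le> inner (resolvent B x) x" by (rule resolvent_variational[OF assms(1)])
  finally show ?thesis using assms(3) by (simp add: field_simps)
qed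

section \<open>Limits of operators\<close>

lemma ortho_ortho_eq_closure:
  fixes S :: "'a::{real_inner,banach} set"
  assumes "subspace S" shows "ortho (ortho S) = closure S"
  by (metis assms closed_closure ortho_closure ortho_ortho subspace_closure)

lemma tendsto_blinfun_on_closure:
  fixes T :: "nat \<Rightarrow> 'a::real_normed_vector \<Rightarrow>\<^sub>L 'b::real_normed_vector"
  assumes K: "\<And>n. norm (T n) \<le> K"
    and S: "\<And>y. y \<in> S \<Longrightarrow> (\<lambda>n. T n y) \<longlonglongrightarrow> blinfun_apply L y" and x: "x \<in> closure S"
  shows "(\<lambda>n. T n x) \<longlonglongrightarrow> L x"
proof (rule LIMSEQ_I)
  fix e :: real assume e: "e > 0"
  have K0: "0 \<le> K" using K[of 0] norm_ge_zero order_trans by blast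
  \<comment> \<open>The summand 1 keeps \<open>M\<close> positive even when \<open>K\<close> and
    \<open>norm L\<close> are zero.\<close>
  define M where "M = K + norm L + 1"
  have M: "M > 0" using K0 by (simp add: M_def add_nonneg_pos)
  obtain y where y: "y \<in> S" "dist y x < e / (2 * M)"
    using x e M unfolding closure_approachable by (metis divide_pos_pos mult_pos_pos zero_less_numeral)
  obtain n0 where n0: "\<And>n. n \<ge> n0 \<Longrightarrow> norm (T n y - L y) < e / 2"
    using LIMSEQ_D[OF S[OF y(1)], of "e/2"] e by auto
  have "norm (T n x - L x) < e" if "n \<ge> n0" for n
  proof -
    have eq: "T n x - L x = T n (x - y) + (T n y - L y) - L (x - y)"
      by (simp add: blinfun.bilinear_simps)
    have "norm (T n x - L x) \<le> norm (T n (x - y)) + norm (T n y - L y) + norm (L (x - y))"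
      unfolding eq using norm_triangle_ineq4[of "T n (x - y) + (T n y - L y)" "L (x - y)"]
        norm_triangle_ineq[of "T n (x - y)" "T n y - L y"] by linarith
    also have "\<dots> < norm (T n) * norm (x - y) + e/2 + norm L * norm (x - y)"
      using n0[OF that] norm_blinfun[of "T n" "x - y"] norm_blinfun[of L "x - y"] by linarith
    also have "\<dots> \<le> K * norm (x - y) + e/2 + norm L * norm (x - y)"
      using K by (simp add: mult_right_mono)
    also have "\<dots> \<le> M * norm (x - y) + e/2"
      by (simp add: M_def algebra_simps)
    also have "\<dots> \<le> M * (e / (2 * M)) + e/2"
      using y(2) M by (intro add_right_mono mult_left_mono) (auto simp: dist_norm norm_minus_commute)
    also have "\<dots> = e" using M by simp
    finally show ?thesis .
  qed
  then show "\<exists>no. \<forall>n\<ge>no. norm (T n x - L x) < e" by blast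
qed

text \<open>Since \<open>(1 + n C)\<^sup>-\<^sup>1 C = (1 - (1 + n C)\<^sup>-\<^sup>1) / n\<close>, the resolvents kill the range of \<open>C\<close>
  in the limit and fix its kernel.\<close>

lemma resolvent_tendsto_ker:
  fixes C :: "'a::{real_inner,banach} \<Rightarrow>\<^sub>L 'a"
  assumes "hpos C"
  shows "(\<lambda>n. resolvent (real n *\<^sub>R C) x) \<longlonglongrightarrow> orth_proj {x. C x = 0} x"
proof -
  let ?K = "{x. blinfun_apply C x = 0}"
  have K: "subspace ?K" "closed ?K" by (rule subspace_ker_blinfun closed_ker_blinfun)+
  have hp: "hpos (real n *\<^sub>R C)" for n using assms by (simp add: hpos_scaleR)
  define R where "R = (\<lambda>n. resolvent (real n *\<^sub>R C))"
  have nR: "norm (R n) \<le> 1" for n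
    by (rule norm_blinfun_bound) (use norm_resolvent_le[OF hp] in \<open>auto simp: R_def\<close>)
  have fix_ker: "R n y = y" if "C y = 0" for n y
    unfolding R_def by (rule resolvent_unique[OF hp]) (simp add: that blinfun.scaleR_left)
  have ran: "(\<lambda>n. R n y) \<longlonglongrightarrow> blinfun_apply 0 y" if y: "y \<in> range C" for y
  proof -
    obtain z where z: "y = C z" using y by blast
    have eq: "real n *\<^sub>R R n y = z - R n z" for n
    proof -
      have "R n (z + (real n *\<^sub>R C) z) = z" unfolding R_def by (rule resolvent_left[OF hp])
      then show ?thesis using z by (simp add: blinfun.bilinear_simps algebra_simps)
    qed
    \<comment> \<open>The index starts at 1 because the estimate divides by it;
      \<open>LIMSEQ_imp_Suc\<close> shifts back.\<close>
    have bound: "norm (R (Suc n) y) \<le> (2 * norm z) * (1 / real (Suc n))" for n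
    proof -
      have "norm (z - R (Suc n) z) \<le> norm z + norm (R (Suc n) z)" by (rule norm_triangle_ineq4)
      also have "\<dots> \<le> 2 * norm z" using norm_resolvent_le[OF hp, of "Suc n" z] unfolding R_def by linarith
      finally have "real (Suc n) * norm (R (Suc n) y) \<le> 2 * norm z"
        unfolding eq[symmetric] by simp
      then show ?thesis by (simp add: field_simps)
    qed
    have "(\<lambda>n. (2 * norm z) * (1 / real (Suc n))) \<longlonglongrightarrow> 0"
      using tendsto_mult[OF tendsto_const LIMSEQ_inverse_real_of_nat, of "2 * norm z"]
      by (simp add: inverse_eq_divide)
    then have "(\<lambda>n. R (Suc n) y) \<longlonglongrightarrow> 0"
      by (rule Lim_null_comparison[rotated]) (use bound in \<open>auto intro!: always_eventually\<close>)
    from LIMSEQ_imp_Suc[OF this] show ?thesis by simp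
  qed
  let ?p = "orth_proj ?K x"
  \<comment> \<open>For self-adjoint \<open>C\<close> the closed range is the orthogonal complement
    of the kernel, so \<open>x\<close> splits into a part that every resolvent fixes and a part that
    is killed in the limit.\<close>
  have "hadj C = C" using assms by (simp add: hpos_def)
  then have "?K = ortho (range C)" using ker_hadj[of C] by simp
  then have "ortho ?K = closure (range C)"
    by (simp add: ortho_ortho_eq_closure subspace_range_blinfun)
  then have "x - ?p \<in> closure (range C)" using diff_orth_proj_ortho[OF K, of x] by simp
  from tendsto_blinfun_on_closure[OF nR ran this]
  have "(\<lambda>n. R n (x - ?p)) \<longlonglongrightarrow> 0" by simp
  then have "(\<lambda>n. R n (x - ?p) + ?p) \<longlonglongrightarrow> 0 + ?p" by (intro tendsto_intros)
  moreover have "R n (x - ?p) + ?p = R n x" for n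
    using fix_ker[of ?p n] orth_proj_in[OF K, of x] by (simp add: blinfun.diff_right)
  ultimately show ?thesis by (simp add: R_def)
qed

lemma norm_orth_proj_diff:
  assumes "subspace S" "closed S" "subspace S'" "closed S'" "S \<subseteq> S'"
  shows "(norm (orth_proj S' x - orth_proj S x))\<^sup>2 = (norm (orth_proj S' x))\<^sup>2 - (norm (orth_proj S x))\<^sup>2"
proof -
  let ?p = "orth_proj S x" and ?q = "orth_proj S' x"
  have p: "?p \<in> S" using orth_proj_in assms by blast
  have "inner (x - ?p) ?p = 0" "inner (x - ?q) ?p = 0"
    using orth_proj_orth[OF assms(1,2)] orth_proj_orth[OF assms(3,4)] p assms(5) by blast+
  then have "inner ?q ?p = inner ?p ?p" by (simp add: inner_diff_left)
  then show ?thesis by (simp add: power2_norm_eq_inner inner_simps inner_commute)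
qed

text \<open>The squared norms of the projections of \<open>x\<close> decrease, hence converge; by
  Pythagoras (\<open>norm_orth_proj_diff\<close>) their differences are squared distances, so the
  projections themselves form a Cauchy sequence.\<close>

lemma orth_proj_Inter_tendsto:
  fixes S :: "nat \<Rightarrow> 'a::{real_inner,banach} set"
  assumes sub: "\<And>n. subspace (S n)" and cl: "\<And>n. closed (S n)" and dec: "\<And>n. S (Suc n) \<subseteq> S n"
  shows "(\<lambda>n. orth_proj (S n) x) \<longlonglongrightarrow> orth_proj (\<Inter>n. S n) x"
proof -
  have mono: "S m \<subseteq> S n" if "n \<le> m" for n m
    using that dec by (rule lift_Suc_antimono_le[of S, rotated]) 
  define a where "a n = (norm (orth_proj (S n) x))\<^sup>2" for n
  have diff: "(norm (orth_proj (S n) x - orth_proj (S m) x))\<^sup>2 = a n - a m" if "n \<le> m" for n m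
    unfolding a_def by (intro norm_orth_proj_diff sub cl mono that)
  have "decseq a"
    unfolding decseq_def
  proof (intro allI impI)
    fix m n :: nat assume "m \<le> n"
    from diff[OF this] show "a n \<le> a m" by (metis zero_le_power2 diff_ge_0_iff_ge)
  qed
  then have "convergent a"
    by (intro Bseq_monoseq_convergent decseq_imp_monoseq)
      (auto intro!: decseq_bounded[where B=0] simp: a_def)
  then have ca: "Cauchy a" by (rule convergent_Cauchy)
  have "Cauchy (\<lambda>n. orth_proj (S n) x)"
  proof (rule CauchyI)
    fix e :: real assume "e > 0"
    then obtain M where M: "\<And>m n. m \<ge> M \<Longrightarrow> n \<ge> M \<Longrightarrow> norm (a m - a n) < e\<^sup>2"
      using CauchyD[OF ca, of "e\<^sup>2"] by auto
    have *: "norm (orth_proj (S n) x - orth_proj (S m) x) < e" if "M \<le> n" "n \<le> m" for n m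
    proof -
      have "(norm (orth_proj (S n) x - orth_proj (S m) x))\<^sup>2 < e\<^sup>2"
        using M[of n m] that diff[of n m] by simp
      then show ?thesis using \<open>e > 0\<close> by (simp add: power_less_imp_less_base)
    qed
    have "norm (orth_proj (S n) x - orth_proj (S m) x) < e" if "M \<le> n" "M \<le> m" for n m
      using *[of n m] *[of m n] that by (cases "n \<le> m") (auto simp: norm_minus_commute)
    then show "\<exists>M. \<forall>m\<ge>M. \<forall>n\<ge>M. norm (orth_proj (S m) x - orth_proj (S n) x) < e" by blast
  qed
  then obtain p where p: "(\<lambda>n. orth_proj (S n) x) \<longlonglongrightarrow> p"
    using Cauchy_convergent convergent_def by blast
  have "orth_proj (\<Inter>n. S n) x = p"
  proof (rule orth_proj_eqI)
    show "subspace (\<Inter>n. S n)" using sub by (intro subspace_Inter) auto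
    show "closed (\<Inter>n. S n)" using cl by auto
    have "p \<in> S n" for n
    proof (rule Lim_in_closed_set[OF cl _ _ p])
      show "\<forall>\<^sub>F m in sequentially. orth_proj (S m) x \<in> S n"
        using orth_proj_in[OF sub cl] mono by (intro eventually_sequentiallyI[of n]) blast
    qed simp
    then show "p \<in> (\<Inter>n. S n)" by blast
    fix y assume y: "y \<in> (\<Inter>n. S n)"
    have "(\<lambda>n. inner (x - orth_proj (S n) x) y) \<longlonglongrightarrow> inner (x - p) y" by (intro tendsto_intros p)
    moreover have "inner (x - orth_proj (S n) x) y = 0" for n
      using orth_proj_orth[OF sub cl] y by blast
    ultimately show "inner (x - p) y = 0" by (simp add: LIMSEQ_const_iff)
  qed
  then show ?thesis using p by simp
qed

section \<open>Commutants and invariant subspaces\<close>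

text \<open>The commutant inside the real operators. If \<open>imag\<close> belongs to
  \<open>G\<close>, its elements are complex linear automatically, which is how
  \<open>commutant_eq_hcomm\<close> recovers the complex commutant.\<close>

definition hcomm :: "('a::{real_inner,banach} \<Rightarrow>\<^sub>L 'a) set \<Rightarrow> ('a \<Rightarrow>\<^sub>L 'a) set" where
  "hcomm G = {T. \<forall>S\<in>G. \<forall>x. blinfun_apply T (blinfun_apply S x) = blinfun_apply S (blinfun_apply T x)}"

definition ginv :: "('a::{real_inner,banach} \<Rightarrow>\<^sub>L 'a) set \<Rightarrow> 'a set \<Rightarrow> bool" where
  "ginv G Z \<longleftrightarrow> subspace Z \<and> closed Z \<and> (\<forall>S\<in>G. \<forall>x\<in>Z. blinfun_apply S x \<in> Z)"

lemma hcomm_D: "T \<in> hcomm G \<Longrightarrow> S \<in> G \<Longrightarrow> blinfun_apply T (blinfun_apply S x) = blinfun_apply S (blinfun_apply T x)"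
  by (auto simp: hcomm_def)

lemma hcomm_compose: "S \<in> hcomm G \<Longrightarrow> T \<in> hcomm G \<Longrightarrow> S o\<^sub>L T \<in> hcomm G"
  by (auto simp: hcomm_def)

lemma hcomm_add: "S \<in> hcomm G \<Longrightarrow> T \<in> hcomm G \<Longrightarrow> S + T \<in> hcomm G"
  by (auto simp: hcomm_def blinfun.bilinear_simps)

lemma hcomm_diff: "S \<in> hcomm G \<Longrightarrow> T \<in> hcomm G \<Longrightarrow> S - T \<in> hcomm G"
  by (auto simp: hcomm_def blinfun.bilinear_simps)

lemma hcomm_uminus: "S \<in> hcomm G \<Longrightarrow> - S \<in> hcomm G"
  by (auto simp: hcomm_def blinfun.bilinear_simps)

lemma hcomm_id [simp]: "id_blinfun \<in> hcomm G"
  by (auto simp: hcomm_def)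

lemma hcomm_0 [simp]: "0 \<in> hcomm G"
  by (auto simp: hcomm_def)

lemma hcomm_scaleR: "S \<in> hcomm G \<Longrightarrow> c *\<^sub>R S \<in> hcomm G"
  by (auto simp: hcomm_def blinfun.bilinear_simps)

lemma hcomm_hadj:
  assumes "\<And>S. S \<in> G \<Longrightarrow> hadj S \<in> G" "T \<in> hcomm G" shows "hadj T \<in> hcomm G"
proof -
  have "hadj T o\<^sub>L S = S o\<^sub>L hadj T" if "S \<in> G" for S
  proof -
    have "T o\<^sub>L hadj S = hadj S o\<^sub>L T"
      using hcomm_D[OF assms(2) assms(1)[OF that]] by (intro blinfun_eqI) simp
    from arg_cong[OF this, of hadj] show ?thesis by (simp add: hadj_compose)
  qed
  then have "(hadj T o\<^sub>L S) x = (S o\<^sub>L hadj T) x" if "S \<in> G" for S x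
    using that by simp
  then show ?thesis by (simp add: hcomm_def)
qed

lemma hcomm_resolvent:
  assumes "C \<in> hcomm G" "hpos C" shows "resolvent C \<in> hcomm G"
proof -
  have "resolvent C (S x) = S (resolvent C x)" if "S \<in> G" for S x
  proof (rule resolvent_unique[OF assms(2)])
    have "S (resolvent C x) + C (S (resolvent C x)) = S (resolvent C x + C (resolvent C x))"
      using hcomm_D[OF assms(1) that] by (simp add: blinfun.add_right)
    then show "S (resolvent C x) + C (S (resolvent C x)) = S x"
      by (simp add: resolvent_right[OF assms(2)])
  qed
  then show ?thesis by (auto simp: hcomm_def)
qed

lemma ginvD: "ginv G Z \<Longrightarrow> subspace Z" "ginv G Z \<Longrightarrow> closed Z"
  "ginv G Z \<Longrightarrow> S \<in> G \<Longrightarrow> x \<in> Z \<Longrightarrow> blinfun_apply S x \<in> Z"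
  by (auto simp: ginv_def)

lemma ginv_ker: "T \<in> hcomm G \<Longrightarrow> ginv G {x. blinfun_apply T x = 0}"
  by (auto simp: ginv_def subspace_ker_blinfun closed_ker_blinfun hcomm_D)

lemma ginv_Inter: "(\<And>Z. Z \<in> F \<Longrightarrow> ginv G Z) \<Longrightarrow> ginv G (\<Inter>F)"
  by (auto simp: ginv_def intro!: subspace_Inter closed_Inter)

lemma ginv_Int: "ginv G Y \<Longrightarrow> ginv G Z \<Longrightarrow> ginv G (Y \<inter> Z)"
  using ginv_Inter[of "{Y, Z}" G] by auto

lemma ginv_UNIV [simp]: "ginv G UNIV"
  by (auto simp: ginv_def)

lemma ginv_closure:
  assumes "subspace Z" "\<And>S x. S \<in> G \<Longrightarrow> x \<in> Z \<Longrightarrow> blinfun_apply S x \<in> Z"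
  shows "ginv G (closure Z)"
proof -
  have "S x \<in> closure Z" if S: "S \<in> G" and x: "x \<in> closure Z" for S x
  proof -
    obtain f where f: "\<And>n. f n \<in> Z" "f \<longlonglongrightarrow> x" using x by (metis closure_sequential)
    have "(\<lambda>n. S (f n)) \<longlonglongrightarrow> S x" by (intro tendsto_intros f)
    moreover have "\<forall>n. S (f n) \<in> Z" using f(1) assms(2)[OF S] by simp
    ultimately show ?thesis unfolding closure_sequential by (intro exI conjI)
  qed
  then show ?thesis using assms(1) by (auto simp: ginv_def subspace_closure)
qed

lemma ginv_ortho:
  assumes "\<And>S. S \<in> G \<Longrightarrow> hadj S \<in> G" "\<And>S x. S \<in> G \<Longrightarrow> x \<in> Z \<Longrightarrow> blinfun_apply S x \<in> Z"
  shows "ginv G (ortho Z)"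
proof -
  have "S x \<in> ortho Z" if "S \<in> G" "x \<in> ortho Z" for S x
    using that assms(2)[OF assms(1)[OF that(1)]] by (auto simp: ortho_def hadj)
  then show ?thesis by (auto simp: ginv_def)
qed

text \<open>As \<open>G\<close> contains the adjoints of its elements, it respects the splitting
  into \<open>Z\<close> and its complement. Invariant closed subspaces thus become projections of
  the commutant, to which a trace applies.\<close>

lemma hcomm_orth_proj:
  assumes "\<And>S. S \<in> G \<Longrightarrow> hadj S \<in> G" "ginv G Z" shows "orth_proj Z \<in> hcomm G"
proof -
  note Z = ginvD[OF assms(2)]
  have "orth_proj Z (S x) = S (orth_proj Z x)" if S: "S \<in> G" for S x
  proof (rule orth_proj_eqI[OF Z(1,2)])
    show "S (orth_proj Z x) \<in> Z" using Z(3)[OF S orth_proj_in[OF Z(1,2)]] .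
    fix y assume "y \<in> Z"
    then have "hadj S y \<in> Z" using Z(3) assms(1)[OF S] by blast
    then show "inner (S x - S (orth_proj Z x)) y = 0"
      using orth_proj_orth[OF Z(1,2)] by (simp add: hadj flip: blinfun.diff_right)
  qed
  then show ?thesis by (auto simp: hcomm_def)
qed

section \<open>Trace and dimension of invariant subspaces\<close>

text \<open>\<open>S\<close> acting diagonally on two copies; the commutant of these operators
  consists of the 2 x 2 matrices over the commutant of \<open>G\<close>.\<close>

definition amp :: "('a::{real_inner,banach} \<Rightarrow>\<^sub>L 'a) \<Rightarrow> (('a \<times> 'a) \<Rightarrow>\<^sub>L ('a \<times> 'a))" where
  "amp S = Blinfun (\<lambda>z. (S (fst z), S (snd z)))"

lemma amp_apply [simp]: "amp S z = (S (fst z), S (snd z))"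
  unfolding amp_def
  by (subst bounded_linear_Blinfun_apply)
    (auto intro!: bounded_linear_Pair bounded_linear_compose[OF blinfun.bounded_linear_right]
      bounded_linear_fst bounded_linear_snd)

lemma hadj_amp: "hadj (amp S) = amp (hadj S)"
  by (rule hadj_unique) (simp add: hadj inner_prod_def)

definition inl_blinfun :: "'a::real_normed_vector \<Rightarrow>\<^sub>L ('a \<times> 'a)" where
  "inl_blinfun = Blinfun (\<lambda>x. (x, 0))"

definition inr_blinfun :: "'a::real_normed_vector \<Rightarrow>\<^sub>L ('a \<times> 'a)" where
  "inr_blinfun = Blinfun (\<lambda>x. (0, x))"

lemma inl_blinfun_apply [simp]: "inl_blinfun x = (x, 0)"
  unfolding inl_blinfun_def
  by (subst bounded_linear_Blinfun_apply) (auto intro!: bounded_linear_Pair bounded_linear_ident)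

lemma inr_blinfun_apply [simp]: "inr_blinfun x = (0, x)"
  unfolding inr_blinfun_def
  by (subst bounded_linear_Blinfun_apply) (auto intro!: bounded_linear_Pair bounded_linear_ident)

abbreviation ent11 where "ent11 X \<equiv> fst_blinfun o\<^sub>L X o\<^sub>L inl_blinfun"
abbreviation ent12 where "ent12 X \<equiv> fst_blinfun o\<^sub>L X o\<^sub>L inr_blinfun"
abbreviation ent21 where "ent21 X \<equiv> snd_blinfun o\<^sub>L X o\<^sub>L inl_blinfun"
abbreviation ent22 where "ent22 X \<equiv> snd_blinfun o\<^sub>L X o\<^sub>L inr_blinfun"

lemma ent_apply:
  fixes X :: "('a::real_normed_vector \<times> 'a) \<Rightarrow>\<^sub>L ('a \<times> 'a)"
  shows "X (x, y) = (ent11 X x + ent12 X y, ent21 X x + ent22 X y)"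
proof -
  have "X (x, y) = X (x, 0) + X (0, y)" using blinfun.add_right[of X "(x, 0)" "(0, y)"] by simp
  then show ?thesis by (simp add: prod_eq_iff)
qed

lemma orth_proj_inject:
  assumes "subspace S" "closed S" "subspace S'" "closed S'" "orth_proj S = orth_proj S'"
  shows "S = S'"
proof (rule Set.set_eqI)
  show "x \<in> S \<longleftrightarrow> x \<in> S'" for x
    using orth_proj_fixed_iff[OF assms(1,2), of x] orth_proj_fixed_iff[OF assms(3,4), of x] assms(5)
    by simp
qed

text \<open>The trace on \<open>N\<close> is the vector functional
  \<open>\<lambda>x. inner (x \<Omega>) \<Omega>\<close>, so it is continuous along strong limits by
  its very form; faithfulness is the statement that \<Omega> separates \<open>N\<close>.\<close>

locale tracial =
  fixes G :: "('a::{real_inner,banach} \<Rightarrow>\<^sub>L 'a) set" and \<Omega> :: 'a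
  assumes hadj_G: "S \<in> G \<Longrightarrow> hadj S \<in> G"
    and trace_comm: "x \<in> hcomm G \<Longrightarrow> y \<in> hcomm G \<Longrightarrow>
      inner (blinfun_apply x (blinfun_apply y \<Omega>)) \<Omega> = inner (y (x \<Omega>)) \<Omega>"
    and separating: "x \<in> hcomm G \<Longrightarrow> blinfun_apply x \<Omega> = 0 \<Longrightarrow> x = 0"
begin

abbreviation N :: "('a \<Rightarrow>\<^sub>L 'a) set" where "N \<equiv> hcomm G"
abbreviation N2 :: "(('a \<times> 'a) \<Rightarrow>\<^sub>L ('a \<times> 'a)) set" where "N2 \<equiv> hcomm (amp ` G)"

lemma hadj_G2: "S \<in> amp ` G \<Longrightarrow> hadj S \<in> amp ` G"
  using hadj_G by (auto simp: hadj_amp)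

lemma hadj_N: "x \<in> N \<Longrightarrow> hadj x \<in> N" by (rule hcomm_hadj[OF hadj_G])

lemma hadj_N2: "X \<in> N2 \<Longrightarrow> hadj X \<in> N2" by (rule hcomm_hadj[OF hadj_G2])

lemma N2_D:
  assumes "X \<in> N2" "S \<in> G"
  shows "blinfun_apply X (blinfun_apply S x, blinfun_apply S y) = (S (fst (blinfun_apply X (x, y))), S (snd (X (x, y))))"
  using hcomm_D[OF assms(1), of "amp S" "(x, y)"] assms(2) by simp

lemma ent_in_N:
  assumes "X \<in> N2"
  shows "ent11 X \<in> N" "ent12 X \<in> N" "ent21 X \<in> N" "ent22 X \<in> N"
  using N2_D[OF assms, where y=0] N2_D[OF assms, where x=0] by (auto simp: hcomm_def)

text \<open>The sum of the traces of the two diagonal entries, not normalized: the whole of K x K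
  has dimension \<open>2 * unit_dm\<close>.\<close>

definition \<tau>2 :: "(('a \<times> 'a) \<Rightarrow>\<^sub>L ('a \<times> 'a)) \<Rightarrow> real" where
  "\<tau>2 X = inner (X (\<Omega>, 0)) (\<Omega>, 0) + inner (X (0, \<Omega>)) (0, \<Omega>)"

lemma \<tau>2_ent: "\<tau>2 X = inner (ent11 X \<Omega>) \<Omega> + inner (ent22 X \<Omega>) \<Omega>"
  by (simp add: \<tau>2_def inner_prod_def)

lemma \<tau>2_comm:
  assumes "X \<in> N2" "Y \<in> N2" shows "\<tau>2 (X o\<^sub>L Y) = \<tau>2 (Y o\<^sub>L X)"
proof -
  have *: "\<tau>2 (A o\<^sub>L B) = inner (ent11 A (ent11 B \<Omega>)) \<Omega> + inner (ent12 A (ent21 B \<Omega>)) \<Omega>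
     + inner (ent21 A (ent12 B \<Omega>)) \<Omega> + inner (ent22 A (ent22 B \<Omega>)) \<Omega>"
    for A B :: "('a \<times> 'a) \<Rightarrow>\<^sub>L ('a \<times> 'a)"
    using ent_apply[of A "fst (B (\<Omega>, 0))" "snd (B (\<Omega>, 0))"]
      ent_apply[of A "fst (B (0, \<Omega>))" "snd (B (0, \<Omega>))"]
    unfolding \<tau>2_def by (simp add: inner_prod_def inner_add_left)
  note X = ent_in_N[OF assms(1)] and Y = ent_in_N[OF assms(2)]
  show ?thesis
    unfolding *
    using trace_comm[OF X(1) Y(1)] trace_comm[OF X(2) Y(3)] trace_comm[OF X(3) Y(2)]
      trace_comm[OF X(4) Y(4)] by linarith
qed

lemma \<tau>2_add: "\<tau>2 (X + Y) = \<tau>2 X + \<tau>2 Y"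
  by (simp add: \<tau>2_def blinfun.add_left inner_add_left)

lemma \<tau>2_diff: "\<tau>2 (X - Y) = \<tau>2 X - \<tau>2 Y"
  by (simp add: \<tau>2_def blinfun.diff_left inner_diff_left)

lemma \<tau>2_scaleR: "\<tau>2 (c *\<^sub>R X) = c * \<tau>2 X"
  by (simp add: \<tau>2_def blinfun.scaleR_left algebra_simps)

lemma \<tau>2_tendsto: "(\<And>v. (\<lambda>n. blinfun_apply (X n) v) \<longlonglongrightarrow> blinfun_apply Y v) \<Longrightarrow> (\<lambda>n. \<tau>2 (X n)) \<longlonglongrightarrow> \<tau>2 Y"
  unfolding \<tau>2_def by (intro tendsto_add tendsto_inner tendsto_const)

definition dm :: "('a \<times> 'a) set \<Rightarrow> real" where "dm Z = \<tau>2 (orth_proj Z)"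
definition dm1 :: "'a set \<Rightarrow> real" where "dm1 Z = inner (orth_proj Z \<Omega>) \<Omega>"
definition unit_dm :: real where "unit_dm = inner \<Omega> \<Omega>"

text \<open>Rank equality: \<open>X\<^sup>*X\<close> and \<open>XX\<^sup>*\<close> have resolvents of equal trace.\<close>

lemma dm_ker_hadj:
  assumes X: "X \<in> N2"
  shows "dm {v. blinfun_apply X v = 0} = dm {v. hadj X v = 0}"
proof -
  define C where "C = hadj X o\<^sub>L X"
  define C' where "C' = X o\<^sub>L hadj X"
  have C: "hpos C" "C \<in> N2" using X by (auto simp: C_def hpos_hadj_compose hcomm_compose hadj_N2)
  have C': "hpos C'" "C' \<in> N2" using hpos_hadj_compose[of "hadj X"] X
    by (auto simp: C'_def hcomm_compose hadj_N2)
  have hp: "hpos (real n *\<^sub>R C)" "hpos (real n *\<^sub>R C')" for n using C C' by (simp_all add: hpos_scaleR)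
  define R where "R n = resolvent (real n *\<^sub>R C)" for n
  define R' where "R' n = resolvent (real n *\<^sub>R C')" for n
  have R_N2: "R n \<in> N2" for n unfolding R_def by (intro hcomm_resolvent hcomm_scaleR C hp)
  \<comment> \<open>With Y = \<open>hadj X\<close> this is (1 + n X Y)^-1 = 1 - n X (1 + n Y X)^-1
    Y. Moving X to the other end under the trace produces n (1 + n Y X)^-1 Y X = 1 - (1 + n Y X)^-1,
    so the two resolvents have equal trace.\<close>
  have R': "R' n = id_blinfun - real n *\<^sub>R (X o\<^sub>L (R n o\<^sub>L hadj X))" for n
  proof (rule blinfun_eqI)
    fix v
    let ?w = "R n (hadj X v)"
    have "?w + real n *\<^sub>R hadj X (X ?w) = hadj X v"
      using resolvent_right[OF hp(1), of n "hadj X v"] by (simp add: R_def C_def blinfun.scaleR_left)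
    from arg_cong[OF this, of "\<lambda>u. real n *\<^sub>R X u"]
    have "real n *\<^sub>R X ?w + real n *\<^sub>R real n *\<^sub>R X (hadj X (X ?w)) = real n *\<^sub>R X (hadj X v)"
      by (simp add: blinfun.bilinear_simps scaleR_add_right)
    then have "R' n v = v - real n *\<^sub>R X ?w"
      unfolding R'_def
      by (intro resolvent_unique[OF hp(2)]) (simp add: C'_def blinfun.bilinear_simps scaleR_diff_right algebra_simps)
    then show "R' n v = (id_blinfun - real n *\<^sub>R (X o\<^sub>L (R n o\<^sub>L hadj X))) v"
      by (simp add: blinfun.bilinear_simps)
  qed
  have R: "real n *\<^sub>R ((R n o\<^sub>L hadj X) o\<^sub>L X) = id_blinfun - R n" for n
  proof (rule blinfun_eqI)
    fix v
    have "R n (v + real n *\<^sub>R C v) = v"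
      using resolvent_left[OF hp(1), of n v] by (simp add: R_def blinfun.scaleR_left)
    then show "(real n *\<^sub>R ((R n o\<^sub>L hadj X) o\<^sub>L X)) v = (id_blinfun - R n) v"
      by (simp add: C_def blinfun.bilinear_simps algebra_simps)
  qed
  have eq: "\<tau>2 (R' n) = \<tau>2 (R n)" for n
  proof -
    have "\<tau>2 (X o\<^sub>L (R n o\<^sub>L hadj X)) = \<tau>2 ((R n o\<^sub>L hadj X) o\<^sub>L X)"
      by (intro \<tau>2_comm hcomm_compose X R_N2 hadj_N2)
    then have "\<tau>2 (R' n) = \<tau>2 id_blinfun - \<tau>2 (real n *\<^sub>R ((R n o\<^sub>L hadj X) o\<^sub>L X))"
      by (simp add: R' \<tau>2_diff \<tau>2_scaleR)
    then show ?thesis by (simp add: R \<tau>2_diff)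
  qed
  have "(\<lambda>n. \<tau>2 (R n)) \<longlonglongrightarrow> \<tau>2 (orth_proj {v. C v = 0})"
    unfolding R_def by (intro \<tau>2_tendsto resolvent_tendsto_ker C)
  moreover have "(\<lambda>n. \<tau>2 (R' n)) \<longlonglongrightarrow> \<tau>2 (orth_proj {v. C' v = 0})"
    unfolding R'_def by (intro \<tau>2_tendsto resolvent_tendsto_ker C')
  ultimately have "\<tau>2 (orth_proj {v. C v = 0}) = \<tau>2 (orth_proj {v. C' v = 0})"
    unfolding eq by (rule LIMSEQ_unique)
  moreover have "{v. C v = 0} = {v. X v = 0}" "{v. C' v = 0} = {v. hadj X v = 0}"
    using hadj_compose_zero_iff[of X] hadj_compose_zero_iff[of "hadj X"] by (auto simp: C_def C'_def)
  ultimately show ?thesis by (simp add: dm_def)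
qed

lemma separating_N2:
  assumes X: "X \<in> N2" and "blinfun_apply X (\<Omega>, 0) = 0" "X (0, \<Omega>) = 0" shows "X = 0"
proof -
  have "ent11 X \<Omega> = 0" "ent12 X \<Omega> = 0" "ent21 X \<Omega> = 0" "ent22 X \<Omega> = 0" using assms by auto
  then have "ent11 X = 0" "ent12 X = 0" "ent21 X = 0" "ent22 X = 0"
    using separating ent_in_N[OF X] by blast+
  then have "X (x, y) = 0" for x y
    using ent_apply[of X x y] by (simp only: zero_blinfun.rep_eq zero_prod_def add_0)
  then show ?thesis by (intro blinfun_eqI) auto
qed

lemma dm_diff:
  assumes "ginv (amp ` G) Z" "ginv (amp ` G) Z'" "Z \<subseteq> Z'"
  shows "dm Z' - dm Z = (norm (orth_proj Z' (\<Omega>, 0) - orth_proj Z (\<Omega>, 0)))\<^sup>2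
     + (norm (orth_proj Z' (0, \<Omega>) - orth_proj Z (0, \<Omega>)))\<^sup>2"
  unfolding dm_def \<tau>2_def using assms
  by (simp add: norm_orth_proj_diff inner_orth_proj ginvD)

text \<open>If the dimensions agree, the difference of the projections kills
  \<open>(\<Omega>, 0)\<close> and \<open>(0, \<Omega>)\<close> by Pythagoras, hence vanishes
  because these vectors separate \<open>N2\<close>.\<close>

lemma dm_eq_imp_eq:
  assumes Z: "ginv (amp ` G) Z" "ginv (amp ` G) Z'" "Z \<subseteq> Z'" and le: "dm Z' \<le> dm Z"
  shows "Z = Z'"
proof -
  let ?X = "orth_proj Z' - orth_proj Z"
  have "(norm (?X (\<Omega>, 0)))\<^sup>2 + (norm (?X (0, \<Omega>)))\<^sup>2 \<le> 0"
    using dm_diff[OF Z] le by (simp add: blinfun.diff_left)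
  then have "(norm (?X (\<Omega>, 0)))\<^sup>2 = 0" "(norm (?X (0, \<Omega>)))\<^sup>2 = 0"
    using zero_le_power2[of "norm (?X (\<Omega>, 0))"] zero_le_power2[of "norm (?X (0, \<Omega>))"] by linarith+
  then have "?X = 0"
    by (intro separating_N2 hcomm_diff hcomm_orth_proj hadj_G2 Z) auto
  then have "orth_proj Z = orth_proj Z'" by simp
  then show ?thesis by (rule orth_proj_inject[OF ginvD(1,2)[OF Z(1)] ginvD(1,2)[OF Z(2)]])
qed

lemma dm1_diff:
  assumes "ginv G Z" "ginv G Z'" "Z \<subseteq> Z'"
  shows "dm1 Z' - dm1 Z = (norm (orth_proj Z' \<Omega> - orth_proj Z \<Omega>))\<^sup>2"
  unfolding dm1_def using assms by (simp add: norm_orth_proj_diff inner_orth_proj ginvD)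

lemma dm1_mono: "ginv G Z \<Longrightarrow> ginv G Z' \<Longrightarrow> Z \<subseteq> Z' \<Longrightarrow> dm1 Z \<le> dm1 Z'"
  using dm1_diff[of Z Z'] by (metis diff_ge_0_iff_ge zero_le_power2)

lemma dm1_eq_imp_eq:
  assumes Z: "ginv G Z" "ginv G Z'" "Z \<subseteq> Z'" and le: "dm1 Z' \<le> dm1 Z"
  shows "Z = Z'"
proof -
  let ?X = "orth_proj Z' - orth_proj Z"
  have "(norm (?X \<Omega>))\<^sup>2 = 0"
    using dm1_diff[OF Z] le zero_le_power2[of "norm (?X \<Omega>)"] unfolding blinfun.diff_left by linarith
  then have "?X = 0"
    by (intro separating hcomm_diff hcomm_orth_proj hadj_G Z) auto
  then have "orth_proj Z = orth_proj Z'" by simp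
  then show ?thesis by (rule orth_proj_inject[OF ginvD(1,2)[OF Z(1)] ginvD(1,2)[OF Z(2)]])
qed

lemma dm1_UNIV: "dm1 UNIV = unit_dm"
  by (simp add: dm1_def unit_dm_def orth_proj_id)

lemma dm1_0: "dm1 {0} = 0"
proof -
  have "orth_proj {0} \<Omega> = 0" by (rule orth_proj_eqI) (auto simp: subspace_0)
  then show ?thesis by (simp add: dm1_def)
qed

lemma dm1_nonneg: "ginv G Z \<Longrightarrow> 0 \<le> dm1 Z"
  by (simp add: dm1_def inner_orth_proj ginvD)

section \<open>Invariant subspaces of K x K as relations: domain, zero fibre, converse\<close>

lemma subspace_Domain: "subspace T \<Longrightarrow> subspace (Domain T)"
  unfolding Domain_fst by (intro linear_subspace_image linear_fst)

lemma subspace_zero_fibre: "subspace (T :: ('a \<times> 'a) set) \<Longrightarrow> subspace {w. (0, w) \<in> T}"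
proof -
  assume "subspace T"
  then have "subspace (blinfun_apply inr_blinfun -` T)"
    by (intro linear_subspace_vimage bounded_linear.linear blinfun.bounded_linear_right)
  then show ?thesis by (simp add: vimage_def)
qed

lemma ginv_closure_Domain:
  assumes "ginv (amp ` G) T" shows "ginv G (closure (Domain T))"
proof (rule ginv_closure)
  show "subspace (Domain T)" using assms by (auto simp: ginv_def intro: subspace_Domain)
  show "S x \<in> Domain T" if "S \<in> G" "x \<in> Domain T" for S x
    using that ginvD(3)[OF assms, of "amp S"] by fastforce
qed

lemma ginv_zero_fibre:
  assumes "ginv (amp ` G) T" shows "ginv G {w. (0, w) \<in> T}"
proof -
  have "closed ((\<lambda>w. (0, w)) -` T)"
    using ginvD(2)[OF assms] by (intro closed_vimage) (auto intro!: continuous_intros)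
  then have "closed {w. (0, w) \<in> T}" by (simp add: vimage_def)
  moreover have "(0, S w) \<in> T" if "S \<in> G" "(0, w) \<in> T" for S w
    using ginvD(3)[OF assms, of "amp S" "(0, w)"] that by simp
  ultimately show ?thesis
    using subspace_zero_fibre[OF ginvD(1)[OF assms]] by (auto simp: ginv_def)
qed

lemma ginv_converse:
  assumes "ginv (amp ` G) T" shows "ginv (amp ` G) (T\<inverse>)"
proof -
  have eq: "T\<inverse> = prod.swap -` T" by auto
  have "closed (T\<inverse>)"
    unfolding eq using ginvD(2)[OF assms] by (intro closed_vimage) (auto intro!: continuous_intros)
  moreover have "linear (prod.swap :: 'a \<times> 'a \<Rightarrow> 'a \<times> 'a)" by (rule linearI) auto
  then have "subspace (T\<inverse>)"
    unfolding eq using ginvD(1)[OF assms] by (rule linear_subspace_vimage)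
  moreover have "(S (fst z), S (snd z)) \<in> T\<inverse>" if "S \<in> G" "z \<in> T\<inverse>" for S z
    using ginvD(3)[OF assms, of "amp S" "prod.swap z"] that by auto
  ultimately show ?thesis by (auto simp: ginv_def)
qed

text \<open>Rank--nullity for the first projection restricted to \<open>T\<close>.\<close>

lemma dm_Domain:
  assumes T: "ginv (amp ` G) T"
  shows "dm T = dm1 (closure (Domain T)) + dm1 {w. (0, w) \<in> T}"
proof -
  let ?P = "orth_proj T" and ?D = "closure (Domain T)" and ?F = "{w. (0, w) \<in> T}"
  define p1 :: "('a \<times> 'a) \<Rightarrow>\<^sub>L ('a \<times> 'a)" where "p1 = inl_blinfun o\<^sub>L fst_blinfun"
  have p1: "p1 v = (fst v, 0)" for v by (simp add: p1_def)
  have p1_N2: "p1 \<in> N2" by (auto simp: hcomm_def p1)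
  have hp1: "hadj p1 = p1" by (rule hadj_unique) (simp add: p1 inner_prod_def)
  note T' = ginvD(1,2)[OF T]
  note D = ginvD(1,2)[OF ginv_closure_Domain[OF T]]
  note F = ginvD(1,2)[OF ginv_zero_fibre[OF T]]
  \<comment> \<open>\<open>X\<close> is the first projection restricted to \<open>T\<close>. Its
    kernel is the complement of \<open>T\<close> plus the zero fibre; the kernel of its adjoint is
    the complement of the closed domain times K. Equating their dimensions is the claim.\<close>
  define X where "X = p1 o\<^sub>L ?P"
  have hX: "hadj X = ?P o\<^sub>L p1" by (simp add: X_def hadj_compose hp1 hadj_orth_proj T')
  have X_N2: "X \<in> N2" unfolding X_def by (intro hcomm_compose p1_N2 hcomm_orth_proj hadj_G2 T)
  have kerX: "orth_proj {v. X v = 0} v = v - ?P v + (0, orth_proj ?F (snd v))" for v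
  proof (rule orth_proj_eqI[OF subspace_ker_blinfun closed_ker_blinfun])
    let ?f = "orth_proj ?F (snd v)"
    have f: "(0, ?f) \<in> T" using orth_proj_in[OF F] by blast
    have "?P (v - ?P v + (0, ?f)) = (0, ?f)"
      using orth_proj_id[OF T' f] orth_proj_id[OF T' orth_proj_in[OF T']]
      by (simp add: blinfun.bilinear_simps)
    then show "v - ?P v + (0, ?f) \<in> {v. X v = 0}" by (simp add: X_def p1 zero_prod_def)
    fix u assume "u \<in> {v. X v = 0}"
    then have u: "fst (?P u) = 0" by (simp add: X_def p1 zero_prod_def)
    then have uF: "snd (?P u) \<in> ?F" using orth_proj_in[OF T', of u] by (metis mem_Collect_eq prod.collapse)
    have "v - (v - ?P v + (0, ?f)) = ?P v - (0, ?f)" by simp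
    then have "inner (v - (v - ?P v + (0, ?f))) u = inner (?P v) u - inner (?P (0, ?f)) u"
      using orth_proj_id[OF T' f] by (simp add: inner_diff_left)
    also have "\<dots> = inner v (?P u) - inner (0, ?f) (?P u)"
      by (simp only: orth_proj_selfadjoint[OF T'])
    also have "\<dots> = inner (snd v - ?f) (snd (?P u))"
      using u by (simp add: inner_prod_def inner_diff_left)
    also have "\<dots> = 0" by (rule orth_proj_orth[OF F uF])
    finally show "inner (v - (v - ?P v + (0, ?f))) u = 0" .
  qed
  have kerX': "orth_proj {v. hadj X v = 0} v = (fst v - orth_proj ?D (fst v), snd v)" for v
  proof (rule orth_proj_eqI[OF subspace_ker_blinfun closed_ker_blinfun])
    have eq: "hadj X v = 0 \<longleftrightarrow> fst v \<in> ortho ?D" for v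
    proof -
      have "hadj X v = 0 \<longleftrightarrow> (fst v, 0) \<in> ortho T"
        using orth_proj_zero_iff[OF T'] by (simp add: hX p1)
      also have "\<dots> \<longleftrightarrow> fst v \<in> ortho (Domain T)" by (auto simp: ortho_def inner_prod_def)
      finally show ?thesis by (simp add: ortho_closure)
    qed
    show "(fst v - orth_proj ?D (fst v), snd v) \<in> {v. hadj X v = 0}"
      using diff_orth_proj_ortho[OF D] by (simp add: eq)
    fix u assume "u \<in> {v. hadj X v = 0}"
    then have "fst u \<in> ortho ?D" by (simp add: eq)
    then have "inner (fst u) (orth_proj ?D (fst v)) = 0"
      using orth_proj_in[OF D, of "fst v"] by (simp add: ortho_def)
    then have "inner (orth_proj ?D (fst v)) (fst u) = 0" by (simp add: inner_commute)
    then show "inner (v - (fst v - orth_proj ?D (fst v), snd v)) u = 0"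
      by (simp add: inner_prod_def)
  qed
  have "dm {v. X v = 0} = 2 * unit_dm - dm T + dm1 ?F"
    unfolding dm_def \<tau>2_def kerX dm1_def unit_dm_def by (simp add: inner_simps inner_prod_def)
  moreover have "dm {v. hadj X v = 0} = 2 * unit_dm - dm1 ?D"
    unfolding dm_def \<tau>2_def kerX' dm1_def unit_dm_def by (simp add: inner_simps inner_prod_def)
  ultimately show ?thesis using dm_ker_hadj[OF X_N2] by simp
qed

text \<open>The coordinate swap is an isometry that exchanges \<open>(\<Omega>, 0)\<close> and
  \<open>(0, \<Omega>)\<close>.\<close>

lemma dm_converse:
  assumes T: "ginv (amp ` G) T" shows "dm (T\<inverse>) = dm T"
proof -
  note T' = ginvD(1,2)[OF T] and C' = ginvD(1,2)[OF ginv_converse[OF T]]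
  have "orth_proj (T\<inverse>) v = prod.swap (orth_proj T (prod.swap v))" for v
  proof (rule orth_proj_eqI[OF C'])
    show "prod.swap (orth_proj T (prod.swap v)) \<in> T\<inverse>"
      using orth_proj_in[OF T', of "prod.swap v"] by (metis converse_iff prod.collapse swap_simp)
    fix y assume "y \<in> T\<inverse>"
    then have "prod.swap y \<in> T" by auto
    from orth_proj_orth[OF T' this, of "prod.swap v"]
    show "inner (v - prod.swap (orth_proj T (prod.swap v))) y = 0"
      by (simp add: inner_prod_def)
  qed
  then show ?thesis by (simp add: dm_def \<tau>2_def inner_prod_def)
qed

lemma dm_Inter_tendsto:
  assumes "\<And>n. ginv (amp ` G) (Z n)" "\<And>n. Z (Suc n) \<subseteq> Z n"
  shows "(\<lambda>n. dm (Z n)) \<longlonglongrightarrow> dm (\<Inter>n. Z n)"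
  unfolding dm_def by (intro \<tau>2_tendsto orth_proj_Inter_tendsto ginvD[OF assms(1)] assms(2))

lemma dm1_Inter_tendsto:
  assumes "\<And>n. ginv G (Z n)" "\<And>n. Z (Suc n) \<subseteq> Z n"
  shows "(\<lambda>n. dm1 (Z n)) \<longlonglongrightarrow> dm1 (\<Inter>n. Z n)"
  unfolding dm1_def by (intro tendsto_intros orth_proj_Inter_tendsto ginvD[OF assms(1)] assms(2))

end

section \<open>The ring of affiliated operators\<close>

definition gr :: "('a::real_normed_vector \<Rightarrow>\<^sub>L 'a) \<Rightarrow> ('a \<times> 'a) set" where
  "gr a = {(x, y). y = a x}"

lemma mem_gr [simp]: "(x, y) \<in> gr a \<longleftrightarrow> y = a x"
  by (simp add: gr_def)

text \<open>The relation t^-1 b. Written this way it is closed from the start, with no choice of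
  domain; for injective \<open>t\<close> it is the graph of an operator on all \<open>x\<close> with
  \<open>b x\<close> in the range of \<open>t\<close>.\<close>

definition lfrac :: "('a::real_normed_vector \<Rightarrow>\<^sub>L 'a) \<Rightarrow> ('a \<Rightarrow>\<^sub>L 'a) \<Rightarrow> ('a \<times> 'a) set" where
  "lfrac t b = {(x, y). t y = b x}"

lemma mem_lfrac [simp]: "(x, y) \<in> lfrac t b \<longleftrightarrow> t y = b x"
  by (simp add: lfrac_def)

definition aff_add :: "('a::real_normed_vector \<times> 'a) set \<Rightarrow> ('a \<times> 'a) set \<Rightarrow> ('a \<times> 'a) set" where
  "aff_add S T = closure {(x, y + z) | x y z. (x, y) \<in> S \<and> (x, z) \<in> T}"

definition aff_mult :: "('a::real_normed_vector \<times> 'a) set \<Rightarrow> ('a \<times> 'a) set \<Rightarrow> ('a \<times> 'a) set" where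
  "aff_mult S T = closure (T O S)"

lemma aff_addI: "(x, y) \<in> S \<Longrightarrow> (x, z) \<in> T \<Longrightarrow> (x, y + z) \<in> aff_add S T"
  unfolding aff_add_def by (rule subsetD[OF closure_subset]) auto

lemma aff_multI: "(x, y) \<in> T \<Longrightarrow> (y, z) \<in> S \<Longrightarrow> (x, z) \<in> aff_mult S T"
  unfolding aff_mult_def by (rule subsetD[OF closure_subset]) auto

context tracial
begin

text \<open>Complex scalars are covered by \<open>G\<close>-invariance once \<open>imag\<close> is
  in \<open>G\<close>; \<open>affiliated_eq\<close> then identifies this set with
  \<open>affiliated\<close>.\<close>

definition aff :: "('a \<times> 'a) set set" where
  "aff = {T. ginv (amp ` G) T \<and> single_valued T \<and> closure (Domain T) = UNIV}"

text \<open>The future denominators: by finiteness injectivity alone forces a dense range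
  (\<open>NI_dense\<close>), so these elements become units among the affiliated operators.\<close>

definition NI :: "('a \<Rightarrow>\<^sub>L 'a) set" where
  "NI = {t \<in> N. \<forall>x. t x = 0 \<longrightarrow> x = 0}"

lemma affD:
  assumes "T \<in> aff"
  shows "ginv (amp ` G) T" "single_valued T" "closure (Domain T) = UNIV"
    "subspace T" "closed T"
  using assms by (auto simp: aff_def ginv_def)

lemma aff_invariant: "T \<in> aff \<Longrightarrow> S \<in> G \<Longrightarrow> (x, y) \<in> T \<Longrightarrow> (blinfun_apply S x, blinfun_apply S y) \<in> T"
  using ginvD(3)[OF affD(1), of T "amp S" "(x, y)"] by simp

lemma aff_unique: "T \<in> aff \<Longrightarrow> (x, y) \<in> T \<Longrightarrow> (x, z) \<in> T \<Longrightarrow> y = z"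
  using affD(2) by (auto dest: single_valuedD)

lemma single_valued_iff_zero_fibre:
  fixes T :: "('a \<times> 'a) set"
  assumes "subspace T" shows "single_valued T \<longleftrightarrow> {w. (0, w) \<in> T} = {0}"
proof
  have 0: "(0, 0) \<in> T" using subspace_0[OF assms] by (simp add: zero_prod_def)
  then show "{w. (0, w) \<in> T} = {0}" if "single_valued T"
    using single_valuedD[OF that] by auto
  assume fibre: "{w. (0, w) \<in> T} = {0}"
  show "single_valued T"
  proof (rule single_valuedI)
    fix x y z assume "(x, y) \<in> T" "(x, z) \<in> T"
    then have "(x, y) - (x, z) \<in> T" by (rule subspace_diff[OF assms])
    then have "y - z \<in> {w. (0, w) \<in> T}" by simp
    then show "y = z" unfolding fibre by simp
  qed
qed

lemma dm_aff: assumes "T \<in> aff" shows "dm T = unit_dm"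
proof -
  have "{w. (0, w) \<in> T} = {0}"
    by (rule iffD1[OF single_valued_iff_zero_fibre[OF affD(4)[OF assms]] affD(2)[OF assms]])
  then show ?thesis by (simp add: dm_Domain[OF affD(1)[OF assms]] affD(3)[OF assms] dm1_UNIV dm1_0)
qed

text \<open>Rank-nullity gives the closed domain the full dimension, and faithfulness then makes it
  the whole space.\<close>

lemma affI:
  assumes T: "ginv (amp ` G) T" "single_valued T" and le: "unit_dm \<le> dm T"
  shows "T \<in> aff"
proof -
  have "{w. (0, w) \<in> T} = {0}"
    by (rule iffD1[OF single_valued_iff_zero_fibre[OF ginvD(1)[OF T(1)]] T(2)])
  then have "unit_dm \<le> dm1 (closure (Domain T))" using dm_Domain[OF T(1)] le by (simp add: dm1_0)
  then have "closure (Domain T) = UNIV"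
    by (intro dm1_eq_imp_eq ginv_closure_Domain T) (auto simp: dm1_UNIV)
  then show ?thesis using T by (simp add: aff_def)
qed

text \<open>Finiteness enters here: an affiliated operator has no proper affiliated extension.\<close>

lemma aff_maximal: "S \<in> aff \<Longrightarrow> T \<in> aff \<Longrightarrow> S \<subseteq> T \<Longrightarrow> S = T"
  by (rule dm_eq_imp_eq) (auto simp: dm_aff affD)

lemma ginv_gr: assumes "a \<in> N" shows "ginv (amp ` G) (gr a)"
proof -
  have "closed (gr a)"
    unfolding gr_def case_prod_beta' by (intro closed_Collect_eq continuous_intros)
  moreover have "subspace (gr a)"
    by (auto simp: subspace_def gr_def blinfun.bilinear_simps zero_prod_def)
  ultimately show ?thesis using hcomm_D[OF assms] by (auto simp: ginv_def gr_def)
qed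

lemma gr_aff: "a \<in> N \<Longrightarrow> gr a \<in> aff"
  using ginv_gr[of a] by (auto simp: aff_def single_valued_def gr_def Domain_iff)

lemma NI_I: "t \<in> N \<Longrightarrow> (\<And>x. blinfun_apply t x = 0 \<Longrightarrow> x = 0) \<Longrightarrow> t \<in> NI"
  unfolding NI_def by (intro CollectI conjI allI impI)

lemma NI_N: "t \<in> NI \<Longrightarrow> t \<in> N" unfolding NI_def by (elim CollectE conjE)

lemma NI_eq_0: "t \<in> NI \<Longrightarrow> blinfun_apply t x = 0 \<Longrightarrow> x = 0"
  unfolding NI_def by (elim CollectE conjE allE impE)

lemma NI_cancel: "t \<in> NI \<Longrightarrow> t x = t y \<Longrightarrow> x = y"
  using NI_eq_0[of t "x - y"] by (simp add: blinfun.diff_right)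

text \<open>The converse of \<open>gr t\<close> has the dimension of \<open>gr t\<close>, hence is
  again affiliated, and its dense domain is the range of \<open>t\<close>.\<close>

lemma NI_dense: assumes "t \<in> NI" shows "closure (range (blinfun_apply t)) = UNIV"
proof -
  have inv: "ginv (amp ` G) ((gr t)\<inverse>)" by (intro ginv_converse ginv_gr NI_N assms)
  have "(gr t)\<inverse> \<in> aff"
  proof (rule affI[OF inv])
    show "single_valued ((gr t)\<inverse>)" using NI_cancel[OF assms] by (auto simp: single_valued_def)
    show "unit_dm \<le> dm ((gr t)\<inverse>)"
      using dm_aff[OF gr_aff] dm_converse[OF ginv_gr] NI_N[OF assms] by simp
  qed
  moreover have "Domain ((gr t)\<inverse>) = range t" by auto
  ultimately show ?thesis using affD(3) by metis
qed

lemma NI_hadj: assumes "t \<in> NI" shows "hadj t \<in> NI"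
proof (rule NI_I[OF hadj_N[OF NI_N[OF assms]]])
  fix x assume "hadj t x = 0"
  then have "x \<in> {x. hadj t x = 0}" by simp
  then show "x = 0" using NI_dense[OF assms] unfolding dense_range_iff_ker_hadj by simp
qed

lemma NI_id [simp]: "id_blinfun \<in> NI" by (rule NI_I) auto

lemma NI_compose: "s \<in> NI \<Longrightarrow> t \<in> NI \<Longrightarrow> s o\<^sub>L t \<in> NI"
  by (rule NI_I) (auto intro: hcomm_compose NI_N dest: NI_eq_0)

text \<open>\<open>lfrac t b\<close> is the kernel of the matrix \<open>X\<close> sending
  \<open>(x, y)\<close> to \<open>(b x - t y, 0)\<close>. The range of \<open>t\<close> is dense, so
  the adjoint of \<open>X\<close> kills exactly the vectors with zero first component, a space of
  dimension \<open>unit_dm\<close>; rank equality gives \<open>lfrac t b\<close> the same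
  dimension.\<close>

lemma lfrac_aff:
  assumes t: "t \<in> NI" and b: "b \<in> N" shows "lfrac t b \<in> aff"
proof -
  define X :: "('a \<times> 'a) \<Rightarrow>\<^sub>L ('a \<times> 'a)"
    where "X = inl_blinfun o\<^sub>L ((b o\<^sub>L fst_blinfun) - (t o\<^sub>L snd_blinfun))"
  have X: "X (x, y) = (b x - t y, 0)" for x y by (simp add: X_def blinfun.diff_left)
  have X_N2: "X \<in> N2"
    using hcomm_D[OF b] hcomm_D[OF NI_N[OF t]] by (auto simp: hcomm_def X blinfun.diff_right)
  have ker: "{v. X v = 0} = lfrac t b" by (auto simp: X zero_prod_def)
  have dense: "x = 0" if "\<And>y. inner x (t y) = 0" for x
  proof -
    have "x \<in> ortho (range t)" using that by (auto simp: ortho_def)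
    then show ?thesis
      using NI_dense[OF t] ortho_eq_0_iff_dense[OF subspace_range_blinfun, of t] by auto
  qed
  have "{v. hadj X v = 0} = {v. fst v = 0}"
  proof (intro Set.set_eqI iffI)
    fix v assume "v \<in> {v. hadj X v = 0}"
    then have "inner v (X (0, y)) = 0" for y using hadj'[of v X "(0, y)"] by simp
    then have "inner (fst v) (t y) = 0" for y by (simp add: X inner_prod_def)
    then show "v \<in> {v. fst v = 0}" by (simp add: dense)
  next
    fix v :: "'a \<times> 'a" assume "v \<in> {v. fst v = 0}"
    then have "inner v (X (x, y)) = 0" for x y by (simp add: X inner_prod_def)
    then have "v \<in> ortho (range X)" by (auto simp: ortho_def)
    then show "v \<in> {v. hadj X v = 0}" by (simp add: ker_hadj)
  qed
  moreover have "orth_proj {v :: 'a \<times> 'a. fst v = 0} v = (0, snd v)" for v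
    by (rule orth_proj_eqI)
      (auto simp: subspace_def inner_prod_def intro!: closed_Collect_eq continuous_intros)
  then have "dm {v. fst v = 0} = unit_dm"
    by (simp add: dm_def \<tau>2_def unit_dm_def inner_prod_def)
  ultimately have "dm (lfrac t b) = unit_dm" using dm_ker_hadj[OF X_N2] ker by simp
  moreover have "single_valued (lfrac t b)"
    using NI_cancel[OF t] by (auto simp: single_valued_def)
  ultimately show ?thesis using ginv_ker[OF X_N2] ker by (auto intro!: affI)
qed

text \<open>The second row of the projection \<open>Q\<close> onto the complement of
  \<open>T\<close> yields the equation \<open>ent21 Q x + ent22 Q y = 0\<close> on \<open>T\<close>.
  The entry \<open>ent22 Q\<close> is injective because a vector with
  \<open>inner (Q (0, y)) (0, y) = 0\<close> lies in \<open>T\<close>. Only one inclusion is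
  checked; maximality turns it into equality.\<close>

lemma aff_eq_lfrac:
  assumes T: "T \<in> aff" shows "\<exists>t\<in>NI. \<exists>b\<in>N. T = lfrac t b"
proof -
  note T' = affD(4,5)[OF T]
  define Q where "Q = id_blinfun - orth_proj T"
  have Q_N2: "Q \<in> N2" unfolding Q_def by (intro hcomm_diff hcomm_id hcomm_orth_proj hadj_G2 affD T)
  have Q0: "Q v = 0 \<longleftrightarrow> v \<in> T" for v
    using orth_proj_fixed_iff[OF T', of v] by (auto simp: Q_def blinfun.diff_left)
  have Qi: "inner (Q v) v = (norm (Q v))\<^sup>2" for v
    using inner_orth_proj[OF subspace_ortho closed_ortho, of T v] orth_proj_ortho[OF T', of v]
    by (simp add: Q_def blinfun.diff_left)
  note ent = ent_in_N[OF Q_N2]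
  have t: "ent22 Q \<in> NI"
  proof -
    have "y = 0" if "ent22 Q y = 0" for y
    proof -
      have "inner (Q (0, y)) (0, y) = 0" using that by (simp add: inner_prod_def)
      then have "(0, y) \<in> T" using Qi[of "(0, y)"] Q0 by simp
      then show "y = 0" using aff_unique[OF T, of 0 y 0] subspace_0[OF T'(1)] by (simp add: zero_prod_def)
    qed
    then show ?thesis by (rule NI_I[OF ent(4)])
  qed
  moreover have b: "- ent21 Q \<in> N" using ent by (intro hcomm_uminus)
  moreover have "T = lfrac (ent22 Q) (- ent21 Q)"
  proof (rule aff_maximal[OF T lfrac_aff[OF t b]])
    show "T \<subseteq> lfrac (ent22 Q) (- ent21 Q)"
    proof (rule subrelI)
      fix x y assume "(x, y) \<in> T"
      then have "Q (x, y) = 0" by (simp add: Q0)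
      then have "ent21 Q x + ent22 Q y = 0"
        using ent_apply[of Q x y] by (simp add: zero_prod_def)
      then show "(x, y) \<in> lfrac (ent22 Q) (- ent21 Q)"
        by (simp add: blinfun.minus_left add_eq_0_iff)
    qed
  qed
  ultimately show ?thesis by blast
qed

text \<open>The first column of the projection onto \<open>T\<close> consists of pairs in
  \<open>T\<close>, and its first entry is injective because \<open>T\<close> has dense domain. This
  parametrizes in general only a part of \<open>T\<close>, which is enough to control
  domains.\<close>

lemma aff_supset_rfrac:
  assumes T: "T \<in> aff" shows "\<exists>s\<in>NI. \<exists>a\<in>N. \<forall>z. (s z, a z) \<in> T"
proof -
  note T' = affD(4,5)[OF T]
  let ?P = "orth_proj T"
  have "?P \<in> N2" by (intro hcomm_orth_proj hadj_G2 affD T)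
  note ent = ent_in_N[OF this]
  have "z = 0" if "ent11 ?P z = 0" for z
  proof -
    have "(norm (?P (z, 0)))\<^sup>2 = 0"
      using that inner_orth_proj[OF T', of "(z, 0)"] by (simp add: inner_prod_def)
    then have "(z, 0) \<in> ortho T" using orth_proj_zero_iff[OF T'] by simp
    then have "z \<in> ortho (Domain T)" by (auto simp: ortho_def inner_prod_def)
    then show "z = 0"
      using ortho_eq_0_iff_dense[OF subspace_Domain[OF T'(1)]] affD(3)[OF T] by auto
  qed
  then have "ent11 ?P \<in> NI" by (rule NI_I[OF ent(1)])
  moreover have "(ent11 ?P z, ent21 ?P z) \<in> T" for z
    using orth_proj_in[OF T', of "(z, 0)"] by simp
  ultimately show ?thesis using ent by blast
qed

text \<open>A right fraction inside the operator t^-1 a is a pair \<open>s\<close>, \<open>b\<close>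
  with \<open>t (b z) = a (s z)\<close>.\<close>

lemma ore_right:
  assumes "t \<in> NI" "a \<in> N" shows "\<exists>s\<in>NI. \<exists>b\<in>N. a o\<^sub>L s = t o\<^sub>L b"
proof -
  obtain s b where sb: "s \<in> NI" "b \<in> N" "\<And>z. (s z, b z) \<in> lfrac t a"
    using aff_supset_rfrac[OF lfrac_aff[OF assms]] by blast
  then have "a o\<^sub>L s = t o\<^sub>L b" by (intro blinfun_eqI) simp
  then show ?thesis using sb by blast
qed

text \<open>Adjoints turn the right Ore condition into the left one.\<close>

lemma ore_left:
  assumes "s \<in> NI" "a \<in> N" shows "\<exists>t\<in>NI. \<exists>b\<in>N. t o\<^sub>L a = b o\<^sub>L s"
proof -
  obtain t b where tb: "t \<in> NI" "b \<in> N" "hadj a o\<^sub>L t = hadj s o\<^sub>L b"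
    using ore_right[OF NI_hadj[OF assms(1)] hadj_N[OF assms(2)]] by blast
  have "hadj t o\<^sub>L a = hadj b o\<^sub>L s"
    using arg_cong[OF tb(3), of hadj] by (simp add: hadj_compose)
  then show ?thesis using tb NI_hadj hadj_N by blast
qed

text \<open>A notion of large domain that, unlike density, survives intersections and preimages.\<close>

definition ess_dense :: "'a set \<Rightarrow> bool" where
  "ess_dense D \<longleftrightarrow> (\<exists>s\<in>NI. \<forall>z. s z \<in> D)"

lemma ess_dense_mono: "ess_dense D \<Longrightarrow> D \<subseteq> D' \<Longrightarrow> ess_dense D'"
  unfolding ess_dense_def by blast

lemma ess_dense_UNIV [simp]: "ess_dense UNIV"
  using NI_id unfolding ess_dense_def by blast

lemma ess_dense_range: "t \<in> NI \<Longrightarrow> ess_dense (range t)"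
  by (auto simp: ess_dense_def)

lemma ess_dense_Domain: "T \<in> aff \<Longrightarrow> ess_dense (Domain T)"
  using aff_supset_rfrac[of T] by (auto simp: ess_dense_def)

text \<open>\<open>T\<close> sends s (r z) to a (r z), and the Ore condition a r = s' d places this
  value in \<open>D\<close>.\<close>

lemma ess_dense_preimage:
  assumes "T \<in> aff" "ess_dense D"
  shows "ess_dense {x. \<exists>y\<in>D. (x, y) \<in> T}"
proof -
  obtain s a where s: "s \<in> NI" "a \<in> N" "\<And>z. (s z, a z) \<in> T" using aff_supset_rfrac[OF assms(1)] by blast
  obtain s' where s': "s' \<in> NI" "\<And>z. s' z \<in> D" using assms(2) by (auto simp: ess_dense_def)
  obtain r d where r: "r \<in> NI" "d \<in> N" "a o\<^sub>L r = s' o\<^sub>L d" using ore_right[OF s'(1) s(2)] by blast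
  have "a (r z) = s' (d z)" for z using r(3) by (metis blinfun_apply_blinfun_compose)
  then have "\<exists>y\<in>D. ((s o\<^sub>L r) z, y) \<in> T" for z
    using s(3)[of "r z"] s'(2)[of "d z"] by auto
  then show ?thesis
    unfolding ess_dense_def using NI_compose[OF s(1) r(1)] by (intro bexI[of _ "s o\<^sub>L r"]) auto
qed

lemma ess_dense_Int:
  assumes "ess_dense D" "ess_dense E" shows "ess_dense (D \<inter> E)"
proof -
  obtain s where s: "s \<in> NI" "\<And>z. s z \<in> D" using assms(1) by (auto simp: ess_dense_def)
  have "ess_dense {z. \<exists>y\<in>E. (z, y) \<in> gr s}"
    by (intro ess_dense_preimage gr_aff NI_N s assms)
  then obtain r where r: "r \<in> NI" "\<And>z. s (r z) \<in> E" by (auto simp: ess_dense_def)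
  show ?thesis unfolding ess_dense_def
    using NI_compose[OF s(1) r(1)] s(2) r(2) by (intro bexI[of _ "s o\<^sub>L r"]) auto
qed

text \<open>\<open>B\<close> itself need be neither linear nor invariant. Restricting
  \<open>T\<close> to the range of an \<open>s\<close> in \<open>NI\<close> that maps into the
  domain of \<open>B\<close> gives an invariant subspace within \<open>B\<close>; its closure is
  affiliated, and maximality identifies it with \<open>T\<close>.\<close>

lemma aff_closure_eq:
  assumes T: "T \<in> aff" and B: "B \<subseteq> T" "ess_dense (Domain B)"
  shows "closure B = T"
proof -
  obtain s where s: "s \<in> NI" "\<And>z. s z \<in> Domain B" using B(2) by (auto simp: ess_dense_def)
  define B' where "B' = T \<inter> (range s \<times> UNIV)"
  have B': "B' \<subseteq> B"
  proof (rule subrelI)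
    fix x y assume xy: "(x, y) \<in> B'"
    then obtain y' where "(x, y') \<in> B" using s(2) by (auto simp: B'_def)
    then show "(x, y) \<in> B" using xy B(1) aff_unique[OF T, of x y y'] by (auto simp: B'_def)
  qed
  have sub: "subspace B'"
    unfolding B'_def by (intro subspace_inter affD(4) T subspace_Times subspace_range_blinfun subspace_UNIV)
  have le: "closure B' \<subseteq> T" by (intro closure_minimal affD(5) T) (auto simp: B'_def)
  have "closure B' \<in> aff"
    unfolding aff_def
  proof (intro CollectI conjI)
    have "amp S v \<in> B'" if "S \<in> G" "v \<in> B'" for S v
      using that aff_invariant[OF T, of S "fst v" "snd v"] hcomm_D[OF NI_N[OF s(1)], of S, symmetric]
      by (auto simp: B'_def)
    then show "ginv (amp ` G) (closure B')" by (intro ginv_closure sub) auto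
    show "single_valued (closure B')" using le affD(2)[OF T] by (meson single_valued_subset)
    have "range s \<subseteq> Domain B'" using s(2) B(1) by (fastforce simp: B'_def)
    also have "\<dots> \<subseteq> Domain (closure B')" using closure_subset by (rule Domain_mono)
    finally show "closure (Domain (closure B')) = UNIV"
      using NI_dense[OF s(1)] closure_mono by blast
  qed
  from aff_maximal[OF this T le] show ?thesis
    using closure_mono[OF B'] closure_minimal[OF B(1) affD(5)[OF T]] by simp
qed

text \<open>The working principle for identities in the ring: two affiliated operators that agree on
  an essentially dense set are both the closure of their intersection.\<close>

lemma aff_eqI:
  assumes "S \<in> aff" "T \<in> aff" "ess_dense D" "\<And>x. x \<in> D \<Longrightarrow> \<exists>y. (x, y) \<in> S \<and> (x, y) \<in> T"
  shows "S = T"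
proof -
  have "ess_dense (Domain (S \<inter> T))" by (rule ess_dense_mono[OF assms(3)]) (use assms(4) in blast)
  then have "closure (S \<inter> T) = S" "closure (S \<inter> T) = T"
    using aff_closure_eq[OF assms(1), of "S \<inter> T"] aff_closure_eq[OF assms(2), of "S \<inter> T"] by auto
  then show ?thesis by simp
qed

text \<open>Closability comes from an affiliated operator \<open>V\<close> around \<open>B\<close>;
  for sums and products it remains to exhibit such a \<open>V\<close>.\<close>

lemma aff_subset_imp:
  assumes "V \<in> aff" "B \<subseteq> V" "ess_dense (Domain B)"
  shows "closure B \<in> aff"
  using aff_closure_eq[OF assms] assms(1) by simp

text \<open>With r t = r' t' the algebraic sum of t^-1 b and t'^-1 b' is contained in (r t)^-1 (r b
  + r' b').\<close>

lemma aff_add_closed: assumes "S \<in> aff" "T \<in> aff" shows "aff_add S T \<in> aff"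
proof -
  obtain t b where S: "t \<in> NI" "b \<in> N" "S = lfrac t b" using aff_eq_lfrac[OF assms(1)] by blast
  obtain t' b' where T: "t' \<in> NI" "b' \<in> N" "T = lfrac t' b'" using aff_eq_lfrac[OF assms(2)] by blast
  obtain r r' where r: "r \<in> NI" "r' \<in> N" "r o\<^sub>L t = r' o\<^sub>L t'" using ore_left[OF T(1) NI_N[OF S(1)]] by blast
  have rt: "r (t y) = r' (t' y)" for y using r(3) by (metis blinfun_apply_blinfun_compose)
  show ?thesis unfolding aff_add_def
  proof (rule aff_subset_imp)
    show "lfrac (r o\<^sub>L t) ((r o\<^sub>L b) + (r' o\<^sub>L b')) \<in> aff"
      by (intro lfrac_aff NI_compose hcomm_add hcomm_compose NI_N[OF r(1)] S T r)
    show "{(x, y + z) |x y z. (x, y) \<in> S \<and> (x, z) \<in> T} \<subseteq> lfrac (r o\<^sub>L t) ((r o\<^sub>L b) + (r' o\<^sub>L b'))"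
      using rt by (auto simp: S T blinfun.bilinear_simps)
    have "Domain {(x, y + z) |x y z. (x, y) \<in> S \<and> (x, z) \<in> T} = Domain S \<inter> Domain T" by auto
    then show "ess_dense (Domain {(x, y + z) |x y z. (x, y) \<in> S \<and> (x, z) \<in> T})"
      by (simp add: ess_dense_Int ess_dense_Domain assms)
  qed
qed

text \<open>With u b = c t' the composition of t'^-1 b' followed by t^-1 b is contained in (u t)^-1
  c b'.\<close>

lemma aff_mult_closed: assumes "S \<in> aff" "T \<in> aff" shows "aff_mult S T \<in> aff"
proof -
  obtain t b where S: "t \<in> NI" "b \<in> N" "S = lfrac t b" using aff_eq_lfrac[OF assms(1)] by blast
  obtain t' b' where T: "t' \<in> NI" "b' \<in> N" "T = lfrac t' b'" using aff_eq_lfrac[OF assms(2)] by blast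
  obtain u c where u: "u \<in> NI" "c \<in> N" "u o\<^sub>L b = c o\<^sub>L t'" using ore_left[OF T(1) S(2)] by blast
  have uc: "u (b y) = c (t' y)" for y using u(3) by (metis blinfun_apply_blinfun_compose)
  show ?thesis unfolding aff_mult_def
  proof (rule aff_subset_imp)
    show "lfrac (u o\<^sub>L t) (c o\<^sub>L b') \<in> aff" by (intro lfrac_aff NI_compose hcomm_compose S T u)
    show "T O S \<subseteq> lfrac (u o\<^sub>L t) (c o\<^sub>L b')" using uc by (auto simp: S T)
    have "Domain (T O S) = {x. \<exists>y\<in>Domain S. (x, y) \<in> T}" by auto
    then show "ess_dense (Domain (T O S))"
      by (simp add: ess_dense_preimage ess_dense_Domain assms)
  qed
qed

section \<open>Ring axioms for the affiliated operators\<close>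

definition aff_ring :: "('a \<times> 'a) set ring" where
  "aff_ring = \<lparr>carrier = aff, monoid.mult = aff_mult, monoid.one = gr id_blinfun,
     ring.zero = gr 0, ring.add = aff_add\<rparr>"

lemma aff_add_assoc:
  assumes "R \<in> aff" "S \<in> aff" "T \<in> aff"
  shows "aff_add (aff_add R S) T = aff_add R (aff_add S T)"
proof (rule aff_eqI)
  show "ess_dense (Domain R \<inter> (Domain S \<inter> Domain T))"
    by (intro ess_dense_Int ess_dense_Domain assms)
  fix x assume "x \<in> Domain R \<inter> (Domain S \<inter> Domain T)"
  then obtain r s t where "(x, r) \<in> R" "(x, s) \<in> S" "(x, t) \<in> T" by blast
  then have "(x, r + s + t) \<in> aff_add (aff_add R S) T" "(x, r + (s + t)) \<in> aff_add R (aff_add S T)"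
    by (blast intro: aff_addI)+
  then show "\<exists>y. (x, y) \<in> aff_add (aff_add R S) T \<and> (x, y) \<in> aff_add R (aff_add S T)"
    by (auto simp: add.assoc)
qed (intro aff_add_closed assms)+

lemma aff_add_commute: "aff_add S T = aff_add T S"
proof -
  have "{(x, y + z) | x y z. (x, y) \<in> S \<and> (x, z) \<in> T} = {(x, y + z) | x y z. (x, y) \<in> T \<and> (x, z) \<in> S}"
    by (auto simp: add.commute) (metis add.commute)+
  then show ?thesis by (simp add: aff_add_def)
qed

lemma gr_0_add: assumes "T \<in> aff" shows "aff_add (gr 0) T = T"
proof (rule aff_eqI[OF _ assms ess_dense_Domain[OF assms]])
  fix x assume "x \<in> Domain T"
  then obtain y where "(x, y) \<in> T" by blast
  then show "\<exists>y. (x, y) \<in> aff_add (gr 0) T \<and> (x, y) \<in> T"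
    using aff_addI[of x 0 "gr 0" y T] by auto
qed (intro aff_add_closed gr_aff hcomm_0 assms)

lemma aff_neg:
  assumes T: "T \<in> aff" shows "\<exists>S\<in>aff. aff_add S T = gr 0"
proof -
  obtain t b where tb: "t \<in> NI" "b \<in> N" "T = lfrac t b" using aff_eq_lfrac[OF T] by blast
  let ?S = "lfrac t (- b)"
  have S: "?S \<in> aff" by (intro lfrac_aff tb hcomm_uminus)
  have "aff_add ?S T = gr 0"
  proof (rule aff_eqI[OF _ gr_aff[OF hcomm_0] ess_dense_Domain[OF T]])
    fix x assume "x \<in> Domain T"
    then obtain y where "(x, y) \<in> T" by blast
    moreover from this have "(x, - y) \<in> ?S" by (simp add: tb blinfun.bilinear_simps)
    ultimately show "\<exists>y. (x, y) \<in> aff_add ?S T \<and> (x, y) \<in> gr 0"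
      using aff_addI[of x "- y" ?S y T] by auto
  qed (intro aff_add_closed S T)
  then show ?thesis using S by blast
qed

lemma aff_mult_assoc:
  assumes "R \<in> aff" "S \<in> aff" "T \<in> aff"
  shows "aff_mult (aff_mult R S) T = aff_mult R (aff_mult S T)"
proof (rule aff_eqI)
  let ?D = "{x. \<exists>y\<in>{y. \<exists>z\<in>Domain R. (y, z) \<in> S}. (x, y) \<in> T}"
  show "ess_dense ?D" by (intro ess_dense_preimage ess_dense_Domain assms)
  fix x assume "x \<in> ?D"
  then obtain y z w where "(x, y) \<in> T" "(y, z) \<in> S" "(z, w) \<in> R" by blast
  then have "(x, w) \<in> aff_mult (aff_mult R S) T" "(x, w) \<in> aff_mult R (aff_mult S T)"
    by (blast intro: aff_multI)+
  then show "\<exists>y. (x, y) \<in> aff_mult (aff_mult R S) T \<and> (x, y) \<in> aff_mult R (aff_mult S T)" by blast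
qed (intro aff_mult_closed assms)+

lemma aff_mult_add_left:
  assumes "R \<in> aff" "S \<in> aff" "T \<in> aff"
  shows "aff_mult (aff_add R S) T = aff_add (aff_mult R T) (aff_mult S T)"
proof (rule aff_eqI)
  let ?D = "{x. \<exists>y\<in>Domain R \<inter> Domain S. (x, y) \<in> T}"
  show "ess_dense ?D" by (intro ess_dense_preimage ess_dense_Int ess_dense_Domain assms)
  fix x assume "x \<in> ?D"
  then obtain y z w where "(x, y) \<in> T" "(y, z) \<in> R" "(y, w) \<in> S" by blast
  then have "(x, z + w) \<in> aff_mult (aff_add R S) T" "(x, z + w) \<in> aff_add (aff_mult R T) (aff_mult S T)"
    by (blast intro: aff_multI aff_addI)+
  then show "\<exists>y. (x, y) \<in> aff_mult (aff_add R S) T \<and> (x, y) \<in> aff_add (aff_mult R T) (aff_mult S T)"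
    by blast
qed (intro aff_mult_closed aff_add_closed assms)+

lemma aff_mult_add_right:
  assumes "R \<in> aff" "S \<in> aff" "T \<in> aff"
  shows "aff_mult T (aff_add R S) = aff_add (aff_mult T R) (aff_mult T S)"
proof (rule aff_eqI)
  let ?D = "{x. \<exists>y\<in>Domain T. (x, y) \<in> R} \<inter> {x. \<exists>y\<in>Domain T. (x, y) \<in> S}"
  show "ess_dense ?D" by (intro ess_dense_preimage ess_dense_Int ess_dense_Domain assms)
  fix x assume "x \<in> ?D"
  then obtain y y' z z' where *: "(x, y) \<in> R" "(y, z) \<in> T" "(x, y') \<in> S" "(y', z') \<in> T" by blast
  then have "(y + y', z + z') \<in> T" using subspace_add[OF affD(4)[OF assms(3)], of "(y, z)" "(y', z')"] by simp
  with * have "(x, z + z') \<in> aff_mult T (aff_add R S)" "(x, z + z') \<in> aff_add (aff_mult T R) (aff_mult T S)"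
    by (blast intro: aff_multI aff_addI)+
  then show "\<exists>y. (x, y) \<in> aff_mult T (aff_add R S) \<and> (x, y) \<in> aff_add (aff_mult T R) (aff_mult T S)"
    by blast
qed (intro aff_mult_closed aff_add_closed assms)+

lemma gr_id_mult:
  assumes "T \<in> aff"
  shows "aff_mult (gr id_blinfun) T = T" "aff_mult T (gr id_blinfun) = T"
  using aff_closure_eq[OF assms subset_refl ess_dense_Domain[OF assms]]
  by (simp_all add: aff_mult_def gr_def relcomp_unfold)

lemma ring_aff_ring: "ring aff_ring"
proof (intro ringI abelian_groupI monoidI)
  show "\<exists>y\<in>carrier aff_ring. y \<oplus>\<^bsub>aff_ring\<^esub> x = \<zero>\<^bsub>aff_ring\<^esub>" if "x \<in> carrier aff_ring" for x
    using aff_neg that by (simp add: aff_ring_def)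
  show "x \<oplus>\<^bsub>aff_ring\<^esub> y = y \<oplus>\<^bsub>aff_ring\<^esub> x" for x y by (simp add: aff_ring_def aff_add_commute)
qed (simp_all add: aff_ring_def aff_add_closed aff_mult_closed gr_aff aff_add_assoc aff_mult_assoc
      gr_0_add gr_id_mult aff_mult_add_left aff_mult_add_right)

section \<open>The embedding of \<open>N\<close>, its units and denominators\<close>

lemma gr_add: "a \<in> N \<Longrightarrow> b \<in> N \<Longrightarrow> gr (a + b) = aff_add (gr a) (gr b)"
  by (rule aff_eqI[OF gr_aff aff_add_closed ess_dense_UNIV])
    (auto simp: gr_aff hcomm_add blinfun.add_left intro: aff_addI)

lemma gr_mult: "a \<in> N \<Longrightarrow> b \<in> N \<Longrightarrow> gr (a o\<^sub>L b) = aff_mult (gr a) (gr b)"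
  by (rule aff_eqI[OF gr_aff aff_mult_closed ess_dense_UNIV])
    (auto simp: gr_aff hcomm_compose intro: aff_multI)

lemma gr_inject: "gr a = gr b \<longleftrightarrow> a = b"
  by (auto simp: gr_def set_eq_iff intro: blinfun_eqI)

lemma gr_NI_unit:
  assumes "t \<in> NI"
  shows "(gr t)\<inverse> \<in> aff" "aff_mult (gr t) ((gr t)\<inverse>) = gr id_blinfun"
    "aff_mult ((gr t)\<inverse>) (gr t) = gr id_blinfun"
proof -
  have "(gr t)\<inverse> = lfrac t id_blinfun" by auto
  then show inv: "(gr t)\<inverse> \<in> aff" using lfrac_aff[OF assms] by simp
  note t = gr_aff[OF NI_N[OF assms]] and 1 = gr_aff[OF hcomm_id]
  show "aff_mult (gr t) ((gr t)\<inverse>) = gr id_blinfun"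
    by (rule aff_eqI[OF aff_mult_closed[OF t inv] 1 ess_dense_range[OF assms]])
      (auto intro!: aff_multI)
  show "aff_mult ((gr t)\<inverse>) (gr t) = gr id_blinfun"
    by (rule aff_eqI[OF aff_mult_closed[OF inv t] 1 ess_dense_UNIV])
      (auto intro!: aff_multI)
qed

lemma aff_denominator:
  assumes "T \<in> aff" shows "\<exists>t\<in>NI. \<exists>b\<in>N. aff_mult (gr t) T = gr b"
proof -
  obtain t b where tb: "t \<in> NI" "b \<in> N" "T = lfrac t b" using aff_eq_lfrac[OF assms] by blast
  have "aff_mult (gr t) T = gr b"
  proof (rule aff_eqI[OF _ gr_aff[OF tb(2)] ess_dense_Domain[OF assms]])
    fix x assume "x \<in> Domain T"
    then obtain y where "(x, y) \<in> T" by blast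
    then show "\<exists>y. (x, y) \<in> aff_mult (gr t) T \<and> (x, y) \<in> gr b"
      using aff_multI[of x y T "t y" "gr t"] by (auto simp: tb)
  qed (intro aff_mult_closed gr_aff NI_N tb assms)
  then show ?thesis using tb by blast
qed

text \<open>The witness is the Moore--Penrose inverse of \<open>s\<close>.\<close>

lemma aff_partial_inverse:
  assumes s: "s \<in> N"
  shows "\<exists>w\<in>aff. aff_mult w (gr s) = gr (orth_proj (ortho {x. s x = 0}))"
proof -
  let ?K = "{x. blinfun_apply s x = 0}" and ?R = "range (blinfun_apply s)"
  let ?e = "orth_proj (ortho ?K)"
  \<comment> \<open>The domain is the range of \<open>s\<close> plus its orthogonal complement: the
    condition on \<open>p - s z\<close> says that \<open>s z\<close> is the projection of
    \<open>p\<close> to the closed range, and \<open>z\<close> is the preimage orthogonal to the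
    kernel.\<close>
  define w where "w = {(p, z). z \<in> ortho ?K \<and> p - s z \<in> ortho ?R}"
  note K = subspace_ker_blinfun[of s] closed_ker_blinfun[of s]
  have se: "s (?e x) = s x" for x
    using orth_proj_in[OF K, of x] orth_proj_ortho[OF K, of x] by (simp add: blinfun.diff_right)
  have gK: "ginv G (ortho ?K)" using hcomm_D[OF s] by (intro ginv_ortho hadj_G) auto
  have gR: "ginv G (ortho ?R)"
  proof (intro ginv_ortho hadj_G)
    fix S y assume S: "S \<in> G" and "y \<in> ?R"
    then obtain x where "y = s x" by auto
    then have "S y = s (S x)" using hcomm_D[OF s S, of x] by simp
    then show "S y \<in> ?R" by simp
  qed
  have e_N: "?e \<in> N" by (intro hcomm_orth_proj hadj_G gK)
  have "closed ({v. snd v \<in> ortho ?K} \<inter> {v. fst v - s (snd v) \<in> ortho ?R})"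
  proof (intro closed_Int)
    show "closed {v :: 'a \<times> 'a. snd v \<in> ortho ?K}"
      using closed_vimage_snd[OF closed_ortho[of ?K]] by (simp add: vimage_def)
    have "closed ((\<lambda>v. fst v - s (snd v)) -` ortho ?R)"
      by (intro closed_vimage closed_ortho continuous_intros)
    then show "closed {v. fst v - s (snd v) \<in> ortho ?R}" by (simp add: vimage_def)
  qed
  moreover have "w = {v. snd v \<in> ortho ?K} \<inter> {v. fst v - s (snd v) \<in> ortho ?R}" by (auto simp: w_def)
  ultimately have cl: "closed w" by simp
  have sub: "subspace w"
  proof (rule subspaceI)
    show "0 \<in> w" by (simp add: w_def zero_prod_def subspace_0)
    fix u v assume u: "u \<in> w" and v: "v \<in> w"
    have "(fst u - s (snd u)) + (fst v - s (snd v)) \<in> ortho ?R"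
      using u v by (intro subspace_add) (auto simp: w_def)
    then show "u + v \<in> w" using u v
      by (auto simp: w_def blinfun.add_right algebra_simps intro: subspace_add[OF subspace_ortho])
  next
    fix c :: real and u assume u: "u \<in> w"
    have "c *\<^sub>R (fst u - s (snd u)) \<in> ortho ?R" using u by (intro subspace_scale) (auto simp: w_def)
    then show "c *\<^sub>R u \<in> w" using u
      by (auto simp: w_def blinfun.scaleR_right scaleR_diff_right intro: subspace_scale[OF subspace_ortho])
  qed
  have inv: "amp S v \<in> w" if "S \<in> G" "v \<in> w" for S v
    using ginvD(3)[OF gK that(1), of "snd v"] ginvD(3)[OF gR that(1), of "fst v - s (snd v)"] that(2)
      hcomm_D[OF s that(1), of "snd v"]
    by (auto simp: w_def blinfun.diff_right)
  have "z = 0" if "(0, z) \<in> w" for z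
  proof -
    have z: "z \<in> ortho ?K" "- s z \<in> ortho ?R" using that by (auto simp: w_def)
    then have "inner (- s z) (s z) = 0" by (auto simp: ortho_def)
    then have "z \<in> ?K" by simp
    then have "inner z z = 0" using z(1) unfolding ortho_def by blast
    then show ?thesis by simp
  qed
  moreover have "(0, 0) \<in> w" using subspace_0[OF sub] by (simp add: zero_prod_def)
  ultimately have sv: "single_valued w" unfolding single_valued_iff_zero_fibre[OF sub] by blast
  have w1: "(s x, ?e x) \<in> w" for x
    using orth_proj_in[OF subspace_ortho closed_ortho, of ?K x] subspace_0[OF subspace_ortho, of ?R]
    by (simp add: w_def se)
  have w2: "(y, 0) \<in> w" if "y \<in> ortho ?R" for y
    using that subspace_0[OF subspace_ortho, of ?K] by (simp add: w_def)
  have "y = 0" if y: "y \<in> ortho (Domain w)" for y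
  proof -
    have "y \<in> ortho ?R" using y w1 by (auto simp: ortho_def)
    then have "y \<in> Domain w" using w2 by blast
    then have "inner y y = 0" using y by (auto simp: ortho_def)
    then show ?thesis by simp
  qed
  then have "ortho (Domain w) = {0}" using subspace_0[OF subspace_ortho] by blast
  then have "closure (Domain w) = UNIV" by (simp add: ortho_eq_0_iff_dense subspace_Domain sub)
  then have w_aff: "w \<in> aff" using sub cl inv sv by (auto simp: aff_def ginv_def)
  have "aff_mult w (gr s) = gr ?e"
  proof (rule aff_eqI[OF _ gr_aff[OF e_N] ess_dense_UNIV])
    show "\<exists>y. (x, y) \<in> aff_mult w (gr s) \<and> (x, y) \<in> gr ?e" for x
      using aff_multI[of x "s x" "gr s" "?e x" w] w1 by auto
  qed (intro aff_mult_closed w_aff gr_aff s)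
  then show ?thesis using w_aff by blast
qed

end

section \<open>Self-injectivity of the ring of affiliated operators\<close>

lemma blinfun_compose_assoc: "(a o\<^sub>L b) o\<^sub>L c = a o\<^sub>L (b o\<^sub>L c)"
  by (rule blinfun_eqI) simp

text \<open>\<open>A0\<close> stands for the image of \<open>A\<close> in \<open>N\<close>.
  \<open>A0_denominator\<close> expresses how much of \<open>N\<close> it fills; it allows
  coefficients from \<open>N\<close>, and then from \<open>aff\<close>, to be pulled through
  \<open>f\<close>.\<close>

locale ideal_hom = tracial G \<Omega>
  for G :: "('a::{real_inner,banach} \<Rightarrow>\<^sub>L 'a) set" and \<Omega> :: 'a +
  fixes A0 :: "('a \<Rightarrow>\<^sub>L 'a) set" and I0 :: "('a \<Rightarrow>\<^sub>L 'a) set" and f :: "('a \<Rightarrow>\<^sub>L 'a) \<Rightarrow> ('a \<times> 'a) set"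
  assumes A0_N: "A0 \<subseteq> N"
    and A0_compose: "a \<in> A0 \<Longrightarrow> b \<in> A0 \<Longrightarrow> a o\<^sub>L b \<in> A0"
    and A0_hadj: "a \<in> A0 \<Longrightarrow> hadj a \<in> A0"
    and A0_denominator: "x \<in> N \<Longrightarrow> \<exists>r\<in>A0 \<inter> NI. r o\<^sub>L x \<in> A0"
    and I0_A0: "I0 \<subseteq> A0"
    and I0_0: "0 \<in> I0"
    and I0_add: "x \<in> I0 \<Longrightarrow> y \<in> I0 \<Longrightarrow> x + y \<in> I0"
    and I0_compose: "a \<in> A0 \<Longrightarrow> x \<in> I0 \<Longrightarrow> a o\<^sub>L x \<in> I0"
    and f_aff: "x \<in> I0 \<Longrightarrow> f x \<in> aff"
    and f_compose: "a \<in> A0 \<Longrightarrow> x \<in> I0 \<Longrightarrow> f (a o\<^sub>L x) = aff_mult (gr a) (f x)"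
begin

lemma I0_N: "x \<in> I0 \<Longrightarrow> x \<in> N" using I0_A0 A0_N by blast

lemma NI_gr_cancel:
  assumes "t \<in> NI" "S \<in> aff" "T \<in> aff" "aff_mult (gr t) S = aff_mult (gr t) T" shows "S = T"
proof -
  note t = gr_NI_unit[OF assms(1)] and gt = gr_aff[OF NI_N[OF assms(1)]]
  have "aff_mult ((gr t)\<inverse>) (aff_mult (gr t) V) = V" if "V \<in> aff" for V
    using aff_mult_assoc[OF t(1) gt that] t(3) gr_id_mult(1)[OF that] by simp
  then show ?thesis using assms by metis
qed

text \<open>One injective \<open>q\<close> in \<open>A0\<close> carries both coefficients into
  \<open>A0\<close>, where \<open>f_compose\<close> applies; \<open>q\<close> is cancelled
  afterwards.\<close>

lemma f_linear_N:
  assumes I: "x \<in> I0" "s \<in> I0" and N: "t \<in> N" "c \<in> N" and eq: "t o\<^sub>L x = c o\<^sub>L s"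
  shows "aff_mult (gr t) (f x) = aff_mult (gr c) (f s)"
proof -
  obtain r where r: "r \<in> A0" "r \<in> NI" "r o\<^sub>L t \<in> A0" using A0_denominator[OF N(1)] by blast
  obtain r' where r': "r' \<in> A0" "r' \<in> NI" "r' o\<^sub>L (r o\<^sub>L c) \<in> A0"
    using A0_denominator[OF hcomm_compose[OF NI_N[OF r(2)] N(2)]] by blast
  define q where "q = r' o\<^sub>L r"
  have q: "q \<in> NI" "q \<in> A0" unfolding q_def using r r' by (auto intro: NI_compose A0_compose)
  have qt: "q o\<^sub>L t \<in> A0" "q o\<^sub>L c \<in> A0"
    using A0_compose[OF r'(1) r(3)] r'(3) by (simp_all add: q_def blinfun_compose_assoc)
  have "(q o\<^sub>L t) o\<^sub>L x = (q o\<^sub>L c) o\<^sub>L s" using eq by (simp add: blinfun_compose_assoc)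
  then have "aff_mult (gr (q o\<^sub>L t)) (f x) = aff_mult (gr (q o\<^sub>L c)) (f s)"
    using f_compose[OF qt(1) I(1)] f_compose[OF qt(2) I(2)] by simp
  then have "aff_mult (gr q) (aff_mult (gr t) (f x)) = aff_mult (gr q) (aff_mult (gr c) (f s))"
    by (simp add: gr_mult N NI_N q aff_mult_assoc gr_aff f_aff I)
  then show ?thesis
    by (rule NI_gr_cancel[OF q(1), rotated 2]) (intro aff_mult_closed gr_aff N f_aff I)+
qed

lemma f_linear_aff:
  assumes I: "x \<in> I0" "s \<in> I0" and U: "v \<in> aff" and eq: "gr x = aff_mult v (gr s)"
  shows "f x = aff_mult v (f s)"
proof -
  obtain t c where tc: "t \<in> NI" "c \<in> N" "aff_mult (gr t) v = gr c" using aff_denominator[OF U] by blast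
  note gt = gr_aff[OF NI_N[OF tc(1)]]
  have "gr (t o\<^sub>L x) = gr (c o\<^sub>L s)"
    using eq tc(3) aff_mult_assoc[OF gt U gr_aff[OF I0_N[OF I(2)]]]
    by (simp add: gr_mult NI_N tc I0_N I)
  then have "t o\<^sub>L x = c o\<^sub>L s" by (simp add: gr_inject)
  from f_linear_N[OF I NI_N[OF tc(1)] tc(2) this]
  have "aff_mult (gr t) (f x) = aff_mult (gr t) (aff_mult v (f s))"
    using aff_mult_assoc[OF gt U f_aff[OF I(2)]] tc(3) by simp
  then show ?thesis
    by (rule NI_gr_cancel[OF tc(1), rotated 2]) (intro aff_mult_closed f_aff U I)+
qed

abbreviation ker :: "('a \<Rightarrow>\<^sub>L 'a) \<Rightarrow> 'a set" where "ker x \<equiv> {\<omega>. blinfun_apply x \<omega> = 0}"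

text \<open>If w is the partial inverse of \<open>s\<close>, then w s is the projection onto the
  complement of \<open>ker s\<close>, so x = (x w) s whenever \<open>x\<close> vanishes on
  \<open>ker s\<close>. Pulling the coefficient x w through \<open>f\<close> shows that g = w f(s)
  works for all such \<open>x\<close>.\<close>

lemma principal_solution:
  assumes s: "s \<in> I0"
  shows "\<exists>g\<in>aff. \<forall>x\<in>I0. ker s \<subseteq> ker x \<longrightarrow> f x = aff_mult (gr x) g"
proof -
  let ?e = "orth_proj (ortho (ker s))"
  obtain w where w: "w \<in> aff" "aff_mult w (gr s) = gr ?e"
    using aff_partial_inverse[OF I0_N[OF s]] by blast
  have "f x = aff_mult (gr x) (aff_mult w (f s))" if x: "x \<in> I0" "ker s \<subseteq> ker x" for x
  proof -
    have e_N: "?e \<in> N"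
      using hcomm_D[OF I0_N[OF s]] by (intro hcomm_orth_proj hadj_G ginv_ortho) auto
    have "blinfun_apply x (?e \<omega>) = x \<omega>" for \<omega>
    proof -
      note K = subspace_ker_blinfun[of s] closed_ker_blinfun[of s]
      have "x (orth_proj (ker s) \<omega>) = 0" using orth_proj_in[OF K, of \<omega>] x(2) by auto
      then show ?thesis by (simp add: orth_proj_ortho[OF K] blinfun.diff_right)
    qed
    then have "x o\<^sub>L ?e = x" by (intro blinfun_eqI) simp
    then have "gr x = aff_mult (aff_mult (gr x) w) (gr s)"
      using w aff_mult_assoc[OF gr_aff[OF I0_N[OF x(1)]] w(1) gr_aff[OF I0_N[OF s]]]
        gr_mult[OF I0_N[OF x(1)] e_N] by simp
    from f_linear_aff[OF x(1) s aff_mult_closed[OF gr_aff[OF I0_N[OF x(1)]] w(1)] this]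
    show ?thesis using aff_mult_assoc[OF gr_aff[OF I0_N[OF x(1)]] w(1) f_aff[OF s]] by simp
  qed
  then show ?thesis using aff_mult_closed[OF w(1) f_aff[OF s]] by blast
qed

text \<open>All pairs \<open>(\<xi>, \<omega>)\<close> that a solution \<open>u\<close> of \<open>f x = x u\<close> may contain, for the \<open>x\<close> that vanish
  on \<open>ker s\<close>.\<close>

definition candidates :: "('a \<Rightarrow>\<^sub>L 'a) \<Rightarrow> ('a \<times> 'a) set" where
  "candidates s = {(\<xi>, \<omega>). \<forall>x\<in>I0. ker s \<subseteq> ker x \<longrightarrow> (\<xi>, x \<omega>) \<in> f x}"

lemma candidates_antimono: "ker s' \<subseteq> ker s \<Longrightarrow> candidates s' \<subseteq> candidates s"
  unfolding candidates_def by blast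

lemma ginv_candidates: "ginv (amp ` G) (candidates s)"
proof -
  have *: "ginv (amp ` G) {v. (fst v, x (snd v)) \<in> f x}" if x: "x \<in> I0" for x
  proof -
    note fx = f_aff[OF x]
    have "closed ((\<lambda>v. (fst v, x (snd v))) -` f x)"
      by (intro closed_vimage affD[OF fx] continuous_intros)
    moreover have "subspace {v. (fst v, x (snd v)) \<in> f x}"
    proof (rule subspaceI)
      show "0 \<in> {v. (fst v, x (snd v)) \<in> f x}"
        using subspace_0[OF affD(4)[OF fx]] by (simp add: zero_prod_def)
      show "u + v \<in> {v. (fst v, x (snd v)) \<in> f x}"
        if "u \<in> {v. (fst v, x (snd v)) \<in> f x}" "v \<in> {v. (fst v, x (snd v)) \<in> f x}" for u v
        using subspace_add[OF affD(4)[OF fx], of "(fst u, x (snd u))" "(fst v, x (snd v))"] that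
        by (simp add: blinfun.add_right)
      show "c *\<^sub>R u \<in> {v. (fst v, x (snd v)) \<in> f x}" if "u \<in> {v. (fst v, x (snd v)) \<in> f x}" for c u
        using subspace_scale[OF affD(4)[OF fx], of "(fst u, x (snd u))" c] that
        by (simp add: blinfun.scaleR_right)
    qed
    moreover have "amp S v \<in> {v. (fst v, x (snd v)) \<in> f x}"
      if "S \<in> G" "v \<in> {v. (fst v, x (snd v)) \<in> f x}" for S v
      using aff_invariant[OF fx that(1), of "fst v" "x (snd v)"] that(2)
        hcomm_D[OF I0_N[OF x] that(1), of "snd v"] by simp
    ultimately show ?thesis by (auto simp: ginv_def vimage_def)
  qed
  have "candidates s = \<Inter>((\<lambda>x. {v. (fst v, blinfun_apply x (snd v)) \<in> f x}) ` {x \<in> I0. ker s \<subseteq> ker x})"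
    by (auto simp: candidates_def)
  also have "ginv (amp ` G) \<dots>" by (rule ginv_Inter) (use * in blast)
  finally show ?thesis .
qed

lemma zero_fibre_candidates:
  assumes s: "s \<in> I0" shows "{\<omega>. (0, \<omega>) \<in> candidates s} = ker s"
proof (intro Set.set_eqI iffI)
  have 0: "(0, y) \<in> f x \<longleftrightarrow> y = 0" if "x \<in> I0" for x y
    using aff_unique[OF f_aff[OF that], of 0 y 0] subspace_0[OF affD(4)[OF f_aff[OF that]]]
    by (auto simp: zero_prod_def)
  fix \<omega>
  show "\<omega> \<in> ker s" if "\<omega> \<in> {\<omega>. (0, \<omega>) \<in> candidates s}"
    using that s 0[OF s, of "s \<omega>"] by (simp add: candidates_def)
  show "\<omega> \<in> {\<omega>. (0, \<omega>) \<in> candidates s}" if "\<omega> \<in> ker s"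
    unfolding candidates_def using that 0 by auto
qed

text \<open>The principal solution is contained in \<open>candidates s\<close>, so the domain is
  dense; the zero fibre is \<open>ker s\<close> because \<open>s\<close> itself is among the
  tests.\<close>

lemma dm_candidates:
  assumes s: "s \<in> I0" shows "dm (candidates s) = unit_dm + dm1 (ker s)"
proof -
  obtain g where g: "g \<in> aff" "\<And>x. x \<in> I0 \<Longrightarrow> ker s \<subseteq> ker x \<Longrightarrow> f x = aff_mult (gr x) g"
    using principal_solution[OF s] by blast
  have "g \<subseteq> candidates s"
  proof (rule subrelI)
    fix \<xi> \<omega> assume "(\<xi>, \<omega>) \<in> g"
    then have "(\<xi>, blinfun_apply x \<omega>) \<in> f x" if "x \<in> I0" "ker s \<subseteq> ker x" for x :: "'a \<Rightarrow>\<^sub>L 'a"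
      unfolding g(2)[OF that] by (rule aff_multI) simp
    then show "(\<xi>, \<omega>) \<in> candidates s" by (simp add: candidates_def)
  qed
  then have "closure (Domain (candidates s)) = UNIV"
    using affD(3)[OF g(1)] closure_mono[OF Domain_mono] by (metis top.extremum_uniqueI)
  then show ?thesis
    by (simp add: dm_Domain[OF ginv_candidates] zero_fibre_candidates[OF s] dm1_UNIV)
qed

text \<open>The intersected relation determines a value only up to the common kernel; confining
  values to the orthogonal complement of that kernel makes it single-valued.\<close>

definition limit_solution :: "(nat \<Rightarrow> ('a \<Rightarrow>\<^sub>L 'a)) \<Rightarrow> ('a \<times> 'a) set" where
  "limit_solution s = (\<Inter>n. candidates (s n)) \<inter> (UNIV \<times> ortho (\<Inter>n. ker (s n)))"

text \<open>Solutions for the single \<open>s n\<close> are not compared with each other, only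
  dimensions are: both sides of \<open>dm_candidates\<close> pass to the intersection, so the
  intersected relation still has a domain of full dimension, which is therefore dense.\<close>

lemma limit_solution:
  assumes s: "\<And>n. s n \<in> I0" and dec: "\<And>n. ker (s (Suc n)) \<subseteq> ker (s n)"
  shows limit_solution_aff: "limit_solution s \<in> aff"
    and limit_solution_eq: "x \<in> I0 \<Longrightarrow> ker (s n) \<subseteq> ker x \<Longrightarrow> f x = aff_mult (gr x) (limit_solution s)"
proof -
  let ?V = "\<Inter>n. candidates (s n)" and ?Z = "\<Inter>n. ker (s n)"
  have gZ: "ginv G ?Z" using I0_N s by (intro ginv_Inter) (auto intro!: ginv_ker)
  have gV: "ginv (amp ` G) ?V" using ginv_candidates by (intro ginv_Inter) auto
  have Vdec: "candidates (s (Suc n)) \<subseteq> candidates (s n)" for n by (intro candidates_antimono dec)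
  have "(\<lambda>n. dm (candidates (s n))) \<longlonglongrightarrow> dm ?V" by (intro dm_Inter_tendsto ginv_candidates Vdec)
  moreover have "(\<lambda>n. unit_dm + dm1 (ker (s n))) \<longlonglongrightarrow> unit_dm + dm1 ?Z"
    by (intro tendsto_add tendsto_const dm1_Inter_tendsto ginv_ker I0_N s dec)
  ultimately have dmV: "dm ?V = unit_dm + dm1 ?Z"
    unfolding dm_candidates[OF s] by (rule LIMSEQ_unique)
  have "{\<omega>. (0, \<omega>) \<in> ?V} = (\<Inter>n. {\<omega>. (0, \<omega>) \<in> candidates (s n)})" by blast
  then have fib: "{\<omega>. (0, \<omega>) \<in> ?V} = ?Z" by (simp add: zero_fibre_candidates[OF s])
  then have denseV: "closure (Domain ?V) = UNIV"
    using dm_Domain[OF gV] dmV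
    by (intro dm1_eq_imp_eq ginv_closure_Domain gV) (auto simp: dm1_UNIV)
  note Z = ginvD(1,2)[OF gZ] and V = ginvD(1,2)[OF gV]
  have goZ: "ginv G (ortho ?Z)" by (intro ginv_ortho hadj_G ginvD[OF gZ])
  have "Domain (limit_solution s) = Domain ?V"
  proof
    show "Domain ?V \<subseteq> Domain (limit_solution s)"
    proof
      fix \<xi> assume "\<xi> \<in> Domain ?V"
      then obtain \<omega> where \<omega>: "(\<xi>, \<omega>) \<in> ?V" by (elim DomainE)
      have "orth_proj ?Z \<omega> \<in> {\<omega>. (0, \<omega>) \<in> ?V}" unfolding fib by (rule orth_proj_in[OF Z])
      then have "(0, orth_proj ?Z \<omega>) \<in> ?V" by (rule CollectD)
      with \<omega> have "(\<xi>, \<omega>) - (0, orth_proj ?Z \<omega>) \<in> ?V" by (rule subspace_diff[OF V(1)])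
      then have "(\<xi>, \<omega> - orth_proj ?Z \<omega>) \<in> limit_solution s"
        using diff_orth_proj_ortho[OF Z, of \<omega>] by (simp add: limit_solution_def)
      then show "\<xi> \<in> Domain (limit_solution s)" by blast
    qed
  qed (auto simp: limit_solution_def)
  then have dense: "closure (Domain (limit_solution s)) = UNIV" using denseV by simp
  have "ginv (amp ` G) (UNIV \<times> ortho ?Z)"
    using ginvD(3)[OF goZ] by (auto simp: ginv_def intro!: subspace_Times closed_Times)
  then have ginv_u: "ginv (amp ` G) (limit_solution s)"
    unfolding limit_solution_def by (intro ginv_Int gV)
  have "{\<omega>. (0, \<omega>) \<in> limit_solution s} = {0}"
  proof -
    have "{\<omega>. (0, \<omega>) \<in> limit_solution s} = {\<omega>. (0, \<omega>) \<in> ?V} \<inter> ortho ?Z"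
      unfolding limit_solution_def by blast
    also have "\<dots> = ?Z \<inter> ortho ?Z" by (simp only: fib)
    also have "\<dots> = {0}"
    proof -
      have "z = 0" if "z \<in> ?Z" "z \<in> ortho ?Z" for z
      proof -
        have "inner z z = 0" using that unfolding ortho_def by blast
        then show ?thesis by simp
      qed
      then show ?thesis using subspace_0[OF Z(1)] subspace_0[OF subspace_ortho] by blast
    qed
    finally show ?thesis .
  qed
  then have "single_valued (limit_solution s)"
    using single_valued_iff_zero_fibre[OF ginvD(1)[OF ginv_u]] by simp
  then show u: "limit_solution s \<in> aff" using ginv_u dense by (simp add: aff_def)
  show "f x = aff_mult (gr x) (limit_solution s)" if x: "x \<in> I0" "ker (s n) \<subseteq> ker x"
  proof (rule aff_eqI[OF f_aff[OF x(1)] _ ess_dense_Domain[OF u]])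
    show "aff_mult (gr x) (limit_solution s) \<in> aff" by (intro aff_mult_closed gr_aff I0_N x u)
    fix \<xi> assume "\<xi> \<in> Domain (limit_solution s)"
    then obtain \<omega> where \<omega>: "(\<xi>, \<omega>) \<in> limit_solution s" by (elim DomainE)
    then have "(\<xi>, \<omega>) \<in> candidates (s n)" by (simp add: limit_solution_def)
    then have "(\<xi>, x \<omega>) \<in> f x" using x unfolding candidates_def by blast
    moreover have "(\<xi>, x \<omega>) \<in> aff_mult (gr x) (limit_solution s)" using \<omega> by (rule aff_multI) simp
    ultimately show "\<exists>y. (\<xi>, y) \<in> f x \<and> (\<xi>, y) \<in> aff_mult (gr x) (limit_solution s)" by blast
  qed
qed

text \<open>This makes the kernels directed downwards: with \<open>hadj x\<close> and
  \<open>hadj y\<close> as left coefficients the sum stays in the left ideal, and a sum of squares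
  vanishes only where both terms do.\<close>

lemma sum_of_squares_I0:
  assumes "x \<in> I0" "y \<in> I0"
  shows "(hadj x o\<^sub>L x) + (hadj y o\<^sub>L y) \<in> I0"
    and "ker ((hadj x o\<^sub>L x) + (hadj y o\<^sub>L y)) = ker x \<inter> ker y"
proof -
  show "(hadj x o\<^sub>L x) + (hadj y o\<^sub>L y) \<in> I0"
    using assms I0_A0 by (intro I0_add I0_compose A0_hadj) auto
  show "ker ((hadj x o\<^sub>L x) + (hadj y o\<^sub>L y)) = ker x \<inter> ker y"
  proof (intro Set.set_eqI iffI)
    fix z assume "z \<in> ker ((hadj x o\<^sub>L x) + (hadj y o\<^sub>L y))"
    then have "inner (hadj x (x z) + hadj y (y z)) z = 0" by (simp add: blinfun.add_left)
    then have "inner (x z) (x z) + inner (y z) (y z) = 0"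
      using hadj'[of "x z" x z] hadj'[of "y z" y z] by (simp add: inner_add_left)
    moreover have "0 \<le> inner (x z) (x z)" "0 \<le> inner (y z) (y z)" by auto
    ultimately have "inner (x z) (x z) = 0" "inner (y z) (y z) = 0" by linarith+
    then show "z \<in> ker x \<inter> ker y" by simp
  qed (simp add: blinfun.add_left)
qed

text \<open>The infimum of the dimensions \<open>dm1 (ker x)\<close> need not be attained, but it is
  approached by a sequence, which sums of squares turn into one with decreasing kernels.\<close>

lemma minimizing_sequence:
  obtains s where "\<And>n. s n \<in> I0" "\<And>n. ker (s (Suc n)) \<subseteq> ker (s n)"
    "\<And>x. x \<in> I0 \<Longrightarrow> (\<Inter>n. ker (s n)) \<subseteq> ker x"
proof -
  define D where "D = (\<lambda>x. dm1 (ker x)) ` I0"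
  have D: "D \<noteq> {}" "bdd_below D"
    using I0_0 dm1_nonneg[OF ginv_ker] I0_N by (auto simp: D_def intro!: bdd_belowI[where m=0])
  have "\<exists>x\<in>I0. dm1 (ker x) < Inf D + 1 / real (Suc n)" for n
  proof -
    have "Inf D < Inf D + 1 / real (Suc n)" by simp
    from cInf_lessD[OF D(1) this] show ?thesis by (auto simp: D_def)
  qed
  then obtain x where x: "\<And>n. x n \<in> I0" "\<And>n. dm1 (ker (x n)) < Inf D + 1 / real (Suc n)" by metis
  define s where "s = rec_nat (x 0) (\<lambda>n y. (hadj y o\<^sub>L y) + (hadj (x (Suc n)) o\<^sub>L x (Suc n)))"
  have s0: "s 0 = x 0"
    and sS: "s (Suc n) = (hadj (s n) o\<^sub>L s n) + (hadj (x (Suc n)) o\<^sub>L x (Suc n))" for n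
    by (simp_all add: s_def)
  have sI: "s n \<in> I0" for n
    by (induction n) (auto simp only: s0 sS x intro!: sum_of_squares_I0)
  have kS: "ker (s (Suc n)) = ker (s n) \<inter> ker (x (Suc n))" for n
    unfolding sS by (rule sum_of_squares_I0[OF sI x(1)])
  have dec: "ker (s (Suc n)) \<subseteq> ker (s n)" for n unfolding kS by blast
  have kx: "ker (s n) \<subseteq> ker (x n)" for n
  proof (cases n)
    case 0 then show ?thesis by (simp add: s0)
  next
    case (Suc m) then show ?thesis unfolding Suc kS by blast
  qed
  let ?Z = "\<Inter>n. ker (s n)"
  have gZ: "ginv G ?Z" using I0_N sI by (intro ginv_Inter) (auto intro!: ginv_ker)
  have "dm1 ?Z \<le> Inf D + 1 / real (Suc n)" for n
  proof -
    have "dm1 ?Z \<le> dm1 (ker (x n))"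
      using kx[of n] by (intro dm1_mono gZ ginv_ker I0_N x) blast
    then show ?thesis using x(2)[of n] by linarith
  qed
  moreover have "(\<lambda>n. Inf D + 1 / real (Suc n)) \<longlonglongrightarrow> Inf D + 0"
    by (intro tendsto_add tendsto_const)
      (use LIMSEQ_inverse_real_of_nat in \<open>simp add: inverse_eq_divide\<close>)
  ultimately have dZ: "dm1 ?Z \<le> Inf D" by (intro LIMSEQ_le_const) auto
  \<comment> \<open>Adjoining \<open>y\<close> to every term cannot push the limit dimension below
    the infimum, so \<open>?Z \<inter> ker y\<close> has the dimension of \<open>?Z\<close>.\<close>
  have "?Z \<subseteq> ker y" if y: "y \<in> I0" for y
  proof -
    let ?s = "\<lambda>n. (hadj (s n) o\<^sub>L s n) + (hadj y o\<^sub>L y)"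
    have k: "ker (?s n) = ker (s n) \<inter> ker y" for n by (rule sum_of_squares_I0[OF sI y])
    have sI': "?s n \<in> I0" for n by (rule sum_of_squares_I0[OF sI y])
    have "(\<lambda>n. dm1 (ker (?s n))) \<longlonglongrightarrow> dm1 (\<Inter>n. ker (?s n))"
    proof (rule dm1_Inter_tendsto)
      show "ginv G (ker (?s n))" for n by (intro ginv_ker I0_N sI')
      show "ker (?s (Suc n)) \<subseteq> ker (?s n)" for n unfolding k using dec[of n] by blast
    qed
    moreover have "Inf D \<le> dm1 (ker (?s n))" for n
      using sI'[of n] by (intro cInf_lower D) (simp only: D_def image_eqI)
    ultimately have "Inf D \<le> dm1 (\<Inter>n. ker (?s n))" by (intro LIMSEQ_le_const) auto
    moreover have "(\<Inter>n. ker (?s n)) = ?Z \<inter> ker y" unfolding k by blast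
    ultimately have "?Z \<inter> ker y = ?Z"
      using dZ by (intro dm1_eq_imp_eq ginv_Int gZ ginv_ker I0_N y) auto
    then show ?thesis by blast
  qed
  then show thesis using that sI dec by blast
qed

text \<open>For a given \<open>x\<close> no single \<open>ker (s n)\<close> need lie in
  \<open>ker x\<close>, only their intersection does. Adjoining \<open>x\<close> to every term
  leaves the intersection unchanged, so the new limit solution is contained in the old one and
  equals it by maximality, while now already the first kernel lies in \<open>ker x\<close>.\<close>

lemma ideal_hom_right_mult: "\<exists>u\<in>aff. \<forall>x\<in>I0. f x = aff_mult (gr x) u"
proof -
  obtain s where s: "\<And>n. s n \<in> I0" "\<And>n. ker (s (Suc n)) \<subseteq> ker (s n)"
    "\<And>x. x \<in> I0 \<Longrightarrow> (\<Inter>n. ker (s n)) \<subseteq> ker x" using minimizing_sequence by blast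
  have "f x = aff_mult (gr x) (limit_solution s)" if x: "x \<in> I0" for x
  proof -
    let ?s = "\<lambda>n. (hadj (s n) o\<^sub>L s n) + (hadj x o\<^sub>L x)"
    have k: "ker (?s n) = ker (s n) \<inter> ker x" for n by (rule sum_of_squares_I0[OF s(1) x])
    have sI': "?s n \<in> I0" for n by (rule sum_of_squares_I0[OF s(1) x])
    have dec': "ker (?s (Suc n)) \<subseteq> ker (?s n)" for n unfolding k using s(2)[of n] by blast
    have eq: "(\<Inter>n. ker (?s n)) = (\<Inter>n. ker (s n))" unfolding k using s(3)[OF x] by blast
    have "candidates (?s n) \<subseteq> candidates (s n)" for n
      by (rule candidates_antimono) (unfold k, blast)
    then have "limit_solution ?s \<subseteq> limit_solution s"
      unfolding limit_solution_def eq by (intro Int_mono INF_mono' order_refl)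
    then have "limit_solution ?s = limit_solution s"
      by (intro aff_maximal limit_solution_aff sI' dec' s)
    moreover have "ker (?s 0) \<subseteq> ker x" unfolding k by blast
    then have "f x = aff_mult (gr x) (limit_solution ?s)"
      by (intro limit_solution_eq[where n=0] sI' dec' x)
    ultimately show ?thesis by simp
  qed
  then show ?thesis using limit_solution_aff[of s] s by blast
qed

end

section \<open>Operators on complex Hilbert spaces\<close>

lemma cinner_scaleC_right: "cinner x (scaleC c y) = cnj c * cinner x (y :: 'a::complex_hilbert)"
  by (metis cinner_scaleC_left cinner_commute complex_cnj_mult)

lemma cinner_eq_Complex: "cinner x y = Complex (inner x y) (inner x (scaleC \<i> (y :: 'a::complex_hilbert)))"
  by (simp add: inner_eq_Re_cinner cinner_scaleC_right complex_eq_iff)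

lemma norm_scaleC: "norm (scaleC c x) = cmod c * norm (x :: 'a::complex_hilbert)"
proof -
  have "Im (cinner x x) = 0" by (metis cinner_commute complex_cnj_cancel_iff Reals_cnj_iff complex_is_Real_iff)
  then have x: "cinner x x = complex_of_real ((norm x)\<^sup>2)"
    by (simp add: complex_eq_iff inner_eq_Re_cinner power2_norm_eq_inner)
  have "(norm (scaleC c x))\<^sup>2 = Re (c * cnj c * cinner x x)"
    by (simp add: power2_norm_eq_inner inner_eq_Re_cinner cinner_scaleC_right cinner_scaleC_left mult_ac)
  also have "\<dots> = (cmod c * norm x)\<^sup>2"
    by (simp add: x complex_norm_square[symmetric] power_mult_distrib)
  finally show ?thesis by (simp add: power2_eq_iff_nonneg)
qed

lemma bounded_linear_scaleC: "bounded_linear (scaleC c :: 'a::complex_hilbert \<Rightarrow> 'a)"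
proof (rule bounded_linear_intro[where K="cmod c"])
  show "scaleC c (r *\<^sub>R x) = r *\<^sub>R scaleC c x" for r and x :: 'a
    by (simp add: scaleC_of_real[symmetric] scaleC_scaleC mult.commute)
qed (auto simp: scaleC_add_right norm_scaleC)

definition imag :: "'a::complex_hilbert \<Rightarrow>\<^sub>L 'a" where "imag = Blinfun (scaleC \<i>)"

lemma imag_apply [simp]: "imag x = scaleC \<i> x"
  by (simp add: imag_def bounded_linear_Blinfun_apply bounded_linear_scaleC)

lemma scaleC_eq: "scaleC c x = Re c *\<^sub>R x + Im c *\<^sub>R imag (x :: 'a::complex_hilbert)"
proof -
  have "complex_of_real (Re c) + complex_of_real (Im c) * \<i> = c" by (simp add: complex_eq_iff)
  then have "scaleC c x = scaleC (complex_of_real (Re c) + complex_of_real (Im c) * \<i>) x" by simp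
  also have "\<dots> = Re c *\<^sub>R x + Im c *\<^sub>R imag x"
    by (simp only: scaleC_add_left scaleC_of_real scaleC_scaleC[symmetric] imag_apply)
  finally show ?thesis .
qed

lemma bounded_ops_iff: "T \<in> bounded_ops \<longleftrightarrow> (\<forall>x. blinfun_apply T (imag x) = imag (T x))"
proof
  show "\<forall>x. T (imag x) = imag (T x)" if "T \<in> bounded_ops" using that by (simp add: bounded_ops_def)
  assume "\<forall>x. T (imag x) = imag (T x)"
  then show "T \<in> bounded_ops"
    by (simp add: bounded_ops_def scaleC_eq blinfun.bilinear_simps del: imag_apply)
qed

lemma hadj_imag: "hadj imag = - imag"
proof (rule hadj_unique)
  fix x y :: 'a
  show "inner (imag x) y = inner x ((- imag) y)"
    by (simp add: blinfun.minus_left inner_eq_Re_cinner cinner_scaleC_left)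
      (simp add: inner_eq_Re_cinner[symmetric] inner_minus_right, simp add: inner_eq_Re_cinner cinner_scaleC_right)
qed

lemma hadj_bounded_ops: assumes "T \<in> bounded_ops" shows "hadj T \<in> bounded_ops"
proof -
  have "T o\<^sub>L imag = imag o\<^sub>L T" using assms by (intro blinfun_eqI) (simp add: bounded_ops_iff)
  from arg_cong[OF this, of hadj] have "(- imag) o\<^sub>L hadj T = hadj T o\<^sub>L (- imag)"
    by (simp only: hadj_compose hadj_imag)
  then have "((- imag) o\<^sub>L hadj T) x = (hadj T o\<^sub>L (- imag)) x" for x by simp
  then show ?thesis by (simp add: bounded_ops_iff blinfun.bilinear_simps)
qed

text \<open>The imaginary part of \<open>cinner x y\<close> is
  \<open>inner x (scaleC \<i> y)\<close>, so for an operator commuting with i the real adjoint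
  identity implies the complex one.\<close>

lemma adj_eq_hadj: assumes "T \<in> bounded_ops" shows "adj T = hadj T"
  unfolding adj_def
proof (rule the_equality)
  have "scaleC \<i> (hadj T y) = hadj T (scaleC \<i> y)" for y
    using hadj_bounded_ops[OF assms] by (simp add: bounded_ops_def)
  then show "\<forall>x y. cinner (T x) y = cinner x (hadj T y)"
    by (simp add: cinner_eq_Complex hadj)
  fix S assume S: "\<forall>x y. cinner (T x) y = cinner x (blinfun_apply S y)"
  then have "inner (T x) y = inner x (S y)" for x y by (simp add: inner_eq_Re_cinner)
  then show "S = hadj T" by (rule hadj_unique[symmetric])
qed

lemma commutant_eq_hcomm: "commutant S = hcomm (insert imag S)"
proof -
  have "T o\<^sub>L s = s o\<^sub>L T \<longleftrightarrow> (\<forall>x. T (s x) = s (T x))" for T s :: "'a \<Rightarrow>\<^sub>L 'a"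
  proof
    show "\<forall>x. T (s x) = s (T x)" if eq: "T o\<^sub>L s = s o\<^sub>L T"
    proof
      fix x
      have "(T o\<^sub>L s) x = (s o\<^sub>L T) x" by (simp only: eq)
      then show "T (s x) = s (T x)" by simp
    qed
  qed (auto intro: blinfun_eqI)
  then show ?thesis by (auto simp: commutant_def hcomm_def bounded_ops_iff)
qed

lemma scaleC_op_apply [simp]: "blinfun_apply (scaleC_op c T) x = scaleC c (T x)"
  unfolding scaleC_op_def
  by (subst bounded_linear_Blinfun_apply)
    (auto intro: bounded_linear_compose[OF bounded_linear_scaleC blinfun.bounded_linear_right])

lemma scaleC_op_of_real: "scaleC_op (complex_of_real c) T = c *\<^sub>R T"
  by (rule blinfun_eqI) (simp add: scaleC_of_real blinfun.scaleR_left)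

lemma scaleC_op_imag: "scaleC_op \<i> T = imag o\<^sub>L T"
  by (rule blinfun_eqI) simp

text \<open>For 0 \<le> T \<le> 1 this is T^2 \<le> T. It comes from positivity of \<open>T\<close>
  at \<open>x - T x\<close> and from T \<le> 1 at \<open>T x\<close>.\<close>

lemma hpos_norm_square_le:
  assumes "hpos T" "\<And>x. inner (T x) x \<le> (norm x)\<^sup>2"
  shows "(norm (T x))\<^sup>2 \<le> inner (T x) x"
proof -
  have s: "inner (T (T x)) x = inner (T x) (T x)"
    using assms(1) by (simp add: hpos_def hadj)
  have "0 \<le> inner (T (x - T x)) (x - T x)" using assms(1) by (simp add: hpos_def)
  also have "\<dots> = inner (T x) x - 2 * (norm (T x))\<^sup>2 + inner (T (T x)) (T x)"
    by (simp add: blinfun.diff_right inner_diff_left inner_diff_right s power2_norm_eq_inner)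
  also have "inner (T (T x)) (T x) \<le> (norm (T x))\<^sup>2" by (rule assms(2))
  finally show ?thesis by simp
qed

text \<open>For n \<le> m the difference \<open>r n - r m\<close> lies between 0 and 1, so
  \<open>hpos_norm_square_le\<close> bounds the squared distance of \<open>r n x\<close> and
  \<open>r m x\<close> by the drop of the quadratic form, which converges.\<close>

lemma decreasing_positive_convergent:
  fixes r :: "nat \<Rightarrow> 'a::{real_inner,banach} \<Rightarrow>\<^sub>L 'a"
  assumes pos: "\<And>n. hpos (r n)" and le: "\<And>n x. inner (r n x) x \<le> (norm x)\<^sup>2"
    and dec: "\<And>n x. inner (r (Suc n) x) x \<le> inner (r n x) x"
  shows "\<exists>R. hpos R \<and> (\<forall>x. (\<lambda>n. r n x) \<longlonglongrightarrow> blinfun_apply R x)"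
proof -
  have anti: "inner (r m x) x \<le> inner (r n x) x" if "n \<le> m" for n m x
    using dec that by (rule lift_Suc_antimono_le)
  have key: "(norm (r n x - r m x))\<^sup>2 \<le> inner (r n x) x - inner (r m x) x" if "n \<le> m" for n m x
  proof -
    have "hpos (r n - r m)"
      using pos[of n] pos[of m] anti[OF that]
      by (auto simp: hpos_def hadj_diff blinfun.diff_left inner_diff_left)
    moreover have "inner ((r n - r m) y) y \<le> (norm y)\<^sup>2" for y
    proof -
      have "0 \<le> inner (r m y) y" using pos[of m] by (auto simp: hpos_def)
      then show ?thesis using le[of n y] by (simp add: blinfun.diff_left inner_diff_left)
    qed
    ultimately have "(norm ((r n - r m) x))\<^sup>2 \<le> inner ((r n - r m) x) x" by (rule hpos_norm_square_le)
    then show ?thesis by (simp add: blinfun.diff_left inner_diff_left)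
  qed
  have conv: "convergent (\<lambda>n. r n x)" for x
  proof (intro Cauchy_convergent CauchyI)
    fix e :: real assume e: "e > 0"
    define a where "a n = inner (r n x) x" for n
    have "convergent a"
    proof (intro Bseq_monoseq_convergent decseq_imp_monoseq)
      show "decseq a" using anti by (auto simp: decseq_def a_def)
      then show "Bseq a"
        using pos by (intro decseq_bounded[where B=0]) (auto simp: a_def hpos_def)
    qed
    then obtain M where M: "\<And>m n. m \<ge> M \<Longrightarrow> n \<ge> M \<Longrightarrow> norm (a m - a n) < e\<^sup>2"
      using CauchyD[OF convergent_Cauchy, of a "e\<^sup>2"] e by auto
    have *: "norm (r n x - r m x) < e" if "M \<le> n" "n \<le> m" for n m
    proof -
      have "(norm (r n x - r m x))\<^sup>2 < e\<^sup>2"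
        using M[of n m] that key[OF that(2), of x] by (simp add: a_def)
      then show ?thesis using e by (simp add: power_less_imp_less_base)
    qed
    have "norm (r n x - r m x) < e" if "M \<le> n" "M \<le> m" for n m
      using *[of n m] *[of m n] that by (cases "n \<le> m") (auto simp: norm_minus_commute)
    then show "\<exists>M. \<forall>m\<ge>M. \<forall>n\<ge>M. norm (r m x - r n x) < e" by blast
  qed
  define g where "g x = lim (\<lambda>n. r n x)" for x
  have g: "(\<lambda>n. r n x) \<longlonglongrightarrow> g x" for x using conv by (simp add: g_def convergent_LIMSEQ_iff)
  have nr: "norm (r n x) \<le> norm x" for n x
  proof -
    have "(norm (r n x))\<^sup>2 \<le> (norm x)\<^sup>2" using hpos_norm_square_le[OF pos le, of n x] le[of n x] by linarith
    then show ?thesis by (rule power2_le_imp_le) simp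
  qed
  have "bounded_linear g"
  proof (rule bounded_linear_intro[where K=1])
    show "g (x + y) = g x + g y" for x y
      using tendsto_add[OF g[of x] g[of y]] g[of "x + y"]
      by (auto simp: blinfun.add_right intro: LIMSEQ_unique)
    show "g (c *\<^sub>R x) = c *\<^sub>R g x" for c x
      using tendsto_scaleR[OF tendsto_const g[of x], of c] g[of "c *\<^sub>R x"]
      by (auto simp: blinfun.scaleR_right intro: LIMSEQ_unique)
    show "norm (g x) \<le> norm x * 1" for x
      using tendsto_norm[OF g[of x]] nr[of _ x] by (auto intro: LIMSEQ_le_const2)
  qed
  then have R: "(\<lambda>n. r n x) \<longlonglongrightarrow> Blinfun g x" for x
    using g by (simp add: bounded_linear_Blinfun_apply)
  have "hpos (Blinfun g)"
    unfolding hpos_def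
  proof (intro conjI allI)
    have "inner (Blinfun g x) y = inner x (Blinfun g y)" for x y
    proof (rule LIMSEQ_unique)
      show "(\<lambda>n. inner (r n x) y) \<longlonglongrightarrow> inner (Blinfun g x) y" by (intro tendsto_intros R)
      have "inner (r n x) y = inner x (r n y)" for n using pos[of n] by (simp add: hpos_def hadj)
      then show "(\<lambda>n. inner (r n x) y) \<longlonglongrightarrow> inner x (Blinfun g y)" by (auto intro!: tendsto_intros R)
    qed
    then show "hadj (Blinfun g) = Blinfun g" by (rule hadj_unique)
    have "(\<lambda>n. inner (r n x) x) \<longlonglongrightarrow> inner (Blinfun g x) x" for x by (intro tendsto_intros R)
    then show "0 \<le> inner (Blinfun g x) x" for x
      by (rule LIMSEQ_le_const) (use pos in \<open>auto simp: hpos_def\<close>)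
  qed
  then show ?thesis using R by blast
qed

lemma hcomm_strong_limit:
  assumes "\<And>n. r n \<in> hcomm G" "\<And>x. (\<lambda>n. blinfun_apply (r n) x) \<longlonglongrightarrow> blinfun_apply R x"
  shows "R \<in> hcomm G"
proof -
  have "R (S x) = S (R x)" if "S \<in> G" for S x
  proof (rule LIMSEQ_unique)
    show "(\<lambda>n. r n (S x)) \<longlonglongrightarrow> R (S x)" by (rule assms)
    have "r n (S x) = S (r n x)" for n by (rule hcomm_D[OF assms(1) that])
    then show "(\<lambda>n. r n (S x)) \<longlonglongrightarrow> S (R x)" by (auto intro!: tendsto_intros assms)
  qed
  then show ?thesis by (auto simp: hcomm_def)
qed

text \<open>The extension is the closure of the graph: the bound survives in the closure and makes
  it single-valued, completeness makes it total. The data are indexed by \<open>A\<close> because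
  \<eta> is a map into the completion and not an inclusion.\<close>

lemma blinfun_extension_from_dense:
  fixes \<eta> :: "'b::real_vector \<Rightarrow> 'k::{real_normed_vector}" and g :: "'b \<Rightarrow> 'l::banach"
  assumes A: "subspace A" and dense: "closure (\<eta> ` A) = UNIV"
    and eta: "\<And>a b. a \<in> A \<Longrightarrow> b \<in> A \<Longrightarrow> \<eta> (a + b) = \<eta> a + \<eta> b"
      "\<And>c a. a \<in> A \<Longrightarrow> \<eta> (c *\<^sub>R a) = c *\<^sub>R \<eta> a"
    and g: "\<And>a b. a \<in> A \<Longrightarrow> b \<in> A \<Longrightarrow> g (a + b) = g a + g b"
      "\<And>c a. a \<in> A \<Longrightarrow> g (c *\<^sub>R a) = c *\<^sub>R g a"
    and bound: "\<And>a. a \<in> A \<Longrightarrow> norm (g a) \<le> C * norm (\<eta> a)"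
  shows "\<exists>T. \<forall>a\<in>A. blinfun_apply T (\<eta> a) = g a"
proof -
  define \<Gamma>0 where "\<Gamma>0 = (\<lambda>a. (\<eta> a, g a)) ` A"
  define \<Gamma> where "\<Gamma> = closure \<Gamma>0"
  have "subspace \<Gamma>0"
    unfolding subspace_def
  proof (intro conjI ballI allI)
    have "\<eta> 0 = 0" "g 0 = 0" using eta(2)[OF subspace_0[OF A], of 0] g(2)[OF subspace_0[OF A], of 0] by simp_all
    then show "0 \<in> \<Gamma>0" unfolding \<Gamma>0_def using subspace_0[OF A] by (auto simp: zero_prod_def intro!: image_eqI[where x=0])
    show "x + y \<in> \<Gamma>0" if "x \<in> \<Gamma>0" "y \<in> \<Gamma>0" for x y
    proof -
      obtain a b where ab: "a \<in> A" "b \<in> A" "x = (\<eta> a, g a)" "y = (\<eta> b, g b)" using \<open>x \<in> \<Gamma>0\<close> \<open>y \<in> \<Gamma>0\<close> by (auto simp: \<Gamma>0_def)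
      then show ?thesis unfolding \<Gamma>0_def using subspace_add[OF A ab(1,2)]
        by (intro image_eqI[where x="a + b"]) (simp_all add: eta g)
    qed
    show "c *\<^sub>R x \<in> \<Gamma>0" if "x \<in> \<Gamma>0" for c x
    proof -
      obtain a where a: "a \<in> A" "x = (\<eta> a, g a)" using \<open>x \<in> \<Gamma>0\<close> by (auto simp: \<Gamma>0_def)
      then show ?thesis unfolding \<Gamma>0_def using subspace_scale[OF A a(1)]
        by (intro image_eqI[where x="c *\<^sub>R a"]) (simp_all add: eta g)
    qed
  qed
  then have sub: "subspace \<Gamma>" unfolding \<Gamma>_def by (rule subspace_closure)
  have "closed {v :: 'k \<times> 'l. norm (snd v) \<le> C * norm (fst v)}"
    by (intro closed_Collect_le continuous_intros)
  then have "\<Gamma> \<subseteq> {v. norm (snd v) \<le> C * norm (fst v)}"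
    unfolding \<Gamma>_def by (rule closure_minimal[rotated]) (auto simp: \<Gamma>0_def bound)
  then have bd: "norm y \<le> C * norm x" if "(x, y) \<in> \<Gamma>" for x y using that by auto
  have uniq: "y = z" if "(x, y) \<in> \<Gamma>" "(x, z) \<in> \<Gamma>" for x y z
    using bd[of 0 "y - z"] subspace_diff[OF sub that] by simp
  have total: "\<exists>y. (x, y) \<in> \<Gamma>" for x
  proof -
    have "x \<in> closure (\<eta> ` A)" using dense by simp
    then obtain f where f: "\<And>n. f n \<in> \<eta> ` A" "f \<longlonglongrightarrow> x" unfolding closure_sequential by auto
    then have "\<forall>n. \<exists>a. a \<in> A \<and> f n = \<eta> a" by auto
    then obtain b where b: "\<And>n. b n \<in> A" "\<And>n. f n = \<eta> (b n)" by metis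
    have in\<Gamma>: "(\<eta> (b n), g (b n)) \<in> \<Gamma>" for n
      unfolding \<Gamma>_def by (rule subsetD[OF closure_subset]) (auto simp: \<Gamma>0_def b)
    have C: "norm (g (b m) - g (b n)) \<le> \<bar>C\<bar> * norm (f m - f n)" for m n
    proof -
      have "norm (g (b m) - g (b n)) \<le> C * norm (f m - f n)"
        using bd subspace_diff[OF sub in\<Gamma>[of m] in\<Gamma>[of n]] by (simp add: b)
      also have "\<dots> \<le> \<bar>C\<bar> * norm (f m - f n)" by (intro mult_right_mono) auto
      finally show ?thesis .
    qed
    have "Cauchy (\<lambda>n. g (b n))"
    proof (rule CauchyI)
      fix e :: real assume e: "e > 0"
      then have "0 < e / (\<bar>C\<bar> + 1)" by (simp add: add_nonneg_pos)
      then obtain M where M: "\<And>m n. m \<ge> M \<Longrightarrow> n \<ge> M \<Longrightarrow> norm (f m - f n) < e / (\<bar>C\<bar> + 1)"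
        using CauchyD[OF LIMSEQ_imp_Cauchy[OF f(2)]] by blast
      have "norm (g (b m) - g (b n)) < e" if "m \<ge> M" "n \<ge> M" for m n
      proof -
        have "norm (g (b m) - g (b n)) \<le> (\<bar>C\<bar> + 1) * norm (f m - f n)"
          using C[of m n] by (simp add: distrib_right add_increasing2)
        also have "\<dots> < (\<bar>C\<bar> + 1) * (e / (\<bar>C\<bar> + 1))"
          using M[OF that] by (intro mult_strict_left_mono) (auto simp: add_nonneg_pos)
        also have "\<dots> = e" by (simp add: add_nonneg_pos less_imp_neq[symmetric])
        finally show ?thesis .
      qed
      then show "\<exists>M. \<forall>m\<ge>M. \<forall>n\<ge>M. norm (g (b m) - g (b n)) < e" by blast
    qed
    then obtain y where "(\<lambda>n. g (b n)) \<longlonglongrightarrow> y" using Cauchy_convergent convergent_def by blast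
    moreover have "(\<lambda>n. \<eta> (b n)) \<longlonglongrightarrow> x" using f(2) by (simp only: b(2)[symmetric])
    ultimately have "(\<lambda>n. (\<eta> (b n), g (b n))) \<longlonglongrightarrow> (x, y)" by (intro tendsto_Pair)
    then have "(x, y) \<in> \<Gamma>"
      by (rule Lim_in_closed_set[rotated 3]) (auto simp: in\<Gamma>, simp add: \<Gamma>_def)
    then show ?thesis ..
  qed
  define h where "h x = (THE y. (x, y) \<in> \<Gamma>)" for x
  have h: "(x, h x) \<in> \<Gamma>" for x
    unfolding h_def by (rule theI') (use total uniq in blast)
  have "bounded_linear h"
  proof (rule bounded_linear_intro[where K=C])
    show "h (x + y) = h x + h y" for x y using uniq[OF h] subspace_add[OF sub h[of x] h[of y]] by simp
    show "h (c *\<^sub>R x) = c *\<^sub>R h x" for c x using uniq[OF h] subspace_scale[OF sub h[of x], of c] by simp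
    show "norm (h x) \<le> norm x * C" for x using bd[OF h[of x]] by (simp add: mult.commute)
  qed
  moreover have "h (\<eta> a) = g a" if "a \<in> A" for a
    by (rule uniq[OF h]) (auto simp: \<Gamma>_def \<Gamma>0_def that intro!: subsetD[OF closure_subset])
  ultimately show ?thesis by (intro exI[of _ "Blinfun h"]) (simp add: bounded_linear_Blinfun_apply)
qed

lemma blinfun_eq_on_dense:
  fixes S T :: "'a::real_normed_vector \<Rightarrow>\<^sub>L 'b::real_normed_vector"
  assumes "closure D = UNIV" "\<And>x. x \<in> D \<Longrightarrow> S x = T x"
  shows "S = T"
proof -
  have "closed {x. S x = T x}" by (intro closed_Collect_eq continuous_intros)
  then have "closure D \<subseteq> {x. S x = T x}" by (intro closure_minimal) (use assms(2) in auto)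
  then show ?thesis using assms(1) by (intro blinfun_eqI) auto
qed

section \<open>The standard representation of a finite von Neumann algebra\<close>

locale finite_vna =
  fixes A :: "('h::complex_hilbert \<Rightarrow>\<^sub>L 'h) set"
    and tr :: "('h \<Rightarrow>\<^sub>L 'h) \<Rightarrow> complex"
    and \<eta> :: "('h \<Rightarrow>\<^sub>L 'h) \<Rightarrow> 'k::complex_hilbert"
  assumes finite: "finite_von_neumann_algebra A tr" and l2: "l2_completion A tr \<eta>"
begin

text \<open>The bicommutant identity puts \<open>A\<close> in the form \<open>hcomm\<close>, which
  gives closure under sums, products, resolvents and strong limits at once.\<close>

lemma A_eq_hcomm: "A = hcomm (insert imag (commutant A))"
  using finite by (simp add: finite_von_neumann_algebra_def von_neumann_algebra_def commutant_eq_hcomm)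

lemma A_bounded_ops: "a \<in> A \<Longrightarrow> a \<in> bounded_ops"
  using finite by (auto simp: finite_von_neumann_algebra_def von_neumann_algebra_def)

lemma A_hadj: "a \<in> A \<Longrightarrow> hadj a \<in> A"
  using finite A_bounded_ops adj_eq_hadj[of a]
  by (auto simp: finite_von_neumann_algebra_def von_neumann_algebra_def)

lemma A_compose: "a \<in> A \<Longrightarrow> b \<in> A \<Longrightarrow> a o\<^sub>L b \<in> A"
  using hcomm_compose A_eq_hcomm by metis

lemma A_add: "a \<in> A \<Longrightarrow> b \<in> A \<Longrightarrow> a + b \<in> A"
  using hcomm_add A_eq_hcomm by metis

lemma A_diff: "a \<in> A \<Longrightarrow> b \<in> A \<Longrightarrow> a - b \<in> A"
  using hcomm_diff A_eq_hcomm by metis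

lemma A_uminus: "a \<in> A \<Longrightarrow> - a \<in> A"
  using hcomm_uminus A_eq_hcomm by metis

lemma A_scaleR: "a \<in> A \<Longrightarrow> c *\<^sub>R a \<in> A"
  using hcomm_scaleR A_eq_hcomm by metis

lemma A_0 [simp]: "0 \<in> A"
  using hcomm_0 A_eq_hcomm by metis

lemma A_id [simp]: "id_blinfun \<in> A"
  using hcomm_id A_eq_hcomm by metis

lemma A_sum: "(\<And>i. i \<in> I \<Longrightarrow> f i \<in> A) \<Longrightarrow> (\<Sum>i\<in>I. f i) \<in> A"
  by (induction I rule: infinite_finite_induct) (auto intro: A_add)

lemma A_resolvent: "a \<in> A \<Longrightarrow> hpos a \<Longrightarrow> resolvent a \<in> A"
  using hcomm_resolvent A_eq_hcomm by metis

lemma A_strong_limit: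
  assumes "\<And>n. r n \<in> A" "\<And>x. (\<lambda>n. blinfun_apply (r n) x) \<longlonglongrightarrow> blinfun_apply R x" shows "R \<in> A"
proof -
  have "R \<in> hcomm (insert imag (commutant A))"
    by (rule hcomm_strong_limit[of r]) (use assms A_eq_hcomm in auto)
  then show ?thesis using A_eq_hcomm by simp
qed

lemma A_imag_compose: "a \<in> A \<Longrightarrow> imag o\<^sub>L a \<in> A"
proof -
  have "imag \<in> hcomm (insert imag (commutant A))"
    by (auto simp: hcomm_def commutant_def bounded_ops_iff)
  then show "a \<in> A \<Longrightarrow> imag o\<^sub>L a \<in> A" using A_eq_hcomm A_compose by metis
qed

lemma subspace_A: "subspace A"
  by (simp add: subspace_def A_add A_scaleR)

section \<open>The trace, used through its real part\<close>

definition trr :: "('h \<Rightarrow>\<^sub>L 'h) \<Rightarrow> real" where "trr a = Re (tr a)"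

lemma trace_props: "normal_faithful_trace A tr"
  using finite by (simp add: finite_von_neumann_algebra_def)

lemma trr_add: "a \<in> A \<Longrightarrow> b \<in> A \<Longrightarrow> trr (a + b) = trr a + trr b"
  using trace_props by (simp add: normal_faithful_trace_def trr_def)

lemma trr_scaleR: "a \<in> A \<Longrightarrow> trr (c *\<^sub>R a) = c * trr a"
  using trace_props by (simp add: normal_faithful_trace_def trr_def flip: scaleC_op_of_real)

lemma trr_0 [simp]: "trr 0 = 0"
  using trr_scaleR[of 0 0] by simp

lemma trr_diff: "a \<in> A \<Longrightarrow> b \<in> A \<Longrightarrow> trr (a - b) = trr a - trr b"
  using trr_add[of "a - b" b] A_diff[of a b] by simp

lemma trr_comm: "a \<in> A \<Longrightarrow> b \<in> A \<Longrightarrow> trr (a o\<^sub>L b) = trr (b o\<^sub>L a)"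
  using trace_props by (simp add: normal_faithful_trace_def trr_def)

text \<open>Positivity in the real sense controls only the real part of \<open>cinner\<close>; the
  imaginary part vanishes because the self-adjoint difference commutes with i, whose adjoint is
  -i.\<close>

lemma op_le_if_hpos:
  fixes S T :: "'h \<Rightarrow>\<^sub>L 'h"
  assumes "S \<in> bounded_ops" "T \<in> bounded_ops" "hpos (T - S)" shows "op_le S T"
proof -
  define D where "D = T - S"
  have Di: "D (imag x) = imag (D x)" for x
    using assms(1,2) by (simp add: D_def bounded_ops_iff blinfun.bilinear_simps del: imag_apply)
  have D: "hadj D = D" "0 \<le> inner (D x) x" for x using assms(3) by (auto simp: D_def hpos_def)
  have im: "inner x (imag z) = - inner z (imag x)" for x z :: 'h
    using hadj'[of x imag z] by (simp add: hadj_imag blinfun.minus_left inner_commute del: imag_apply)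
  have "inner (D x) (imag x) = 0" for x :: 'h
    using hadj[of D x "imag x"] im[of x "D x"] by (simp add: D(1) Di del: imag_apply)
  then have "cinner (D x) x = complex_of_real (inner (D x) x)" for x
    by (simp add: cinner_eq_Complex complex_eq_iff)
  then show ?thesis using D(2) by (simp add: op_le_def flip: D_def)
qed

lemma trr_nonneg: "a \<in> A \<Longrightarrow> hpos a \<Longrightarrow> 0 \<le> trr a"
  using trace_props op_le_if_hpos[of 0 a] A_bounded_ops[of a] A_bounded_ops[OF A_0]
  by (simp add: normal_faithful_trace_def trr_def)

lemma trr_faithful:
  assumes a: "a \<in> A" "hpos a" "trr a = 0" shows "a = 0"
proof -
  have le: "op_le 0 a" using op_le_if_hpos[of 0 a] A_bounded_ops[of a] A_bounded_ops[OF A_0] a by simp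
  then have "tr a \<in> \<real>" using trace_props a by (simp add: normal_faithful_trace_def)
  then have "tr a = 0" using a(3) by (simp add: trr_def complex_eq_iff complex_is_Real_iff)
  then show ?thesis using trace_props a le by (simp add: normal_faithful_trace_def)
qed

lemma trr_mono: "a \<in> A \<Longrightarrow> b \<in> A \<Longrightarrow> hpos (b - a) \<Longrightarrow> trr a \<le> trr b"
  using trr_nonneg[of "b - a"] by (simp add: A_diff trr_diff)

text \<open>The one place where normality of the trace enters: the strong limit of an increasing
  sequence is its supremum in \<open>A\<close>.\<close>

lemma trr_increasing_limit:
  assumes q: "\<And>n. q n \<in> A" "\<And>n. hpos (q n)" "\<And>n. hpos (q (Suc n) - q n)"
    and Q: "Q \<in> A" "\<And>x. (\<lambda>n. blinfun_apply (q n) x) \<longlonglongrightarrow> blinfun_apply Q x"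
    and bound: "\<And>n. trr (q n) \<le> c"
  shows "trr Q \<le> c"
proof -
  have inc: "hpos (q m - q n)" if "n \<le> m" for n m
    using that
  proof (induction m rule: dec_induct)
    case (step k)
    have "hpos ((q k - q n) + (q (Suc k) - q k))" by (intro hpos_add step q)
    then show ?case by simp
  qed simp
  have bo: "q n \<in> bounded_ops" "Q \<in> bounded_ops" for n using A_bounded_ops q Q by auto
  have hQ: "hadj Q = Q"
  proof (rule hadj_unique, rule LIMSEQ_unique)
    fix x y
    show "(\<lambda>n. inner (q n x) y) \<longlonglongrightarrow> inner (Q x) y" by (intro tendsto_intros Q)
    have "inner (q n x) y = inner x (q n y)" for n using q(2)[of n] by (simp add: hpos_def hadj)
    then show "(\<lambda>n. inner (q n x) y) \<longlonglongrightarrow> inner x (Q y)" by (auto intro!: tendsto_intros Q)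
  qed
  have "hpos (Q - q n)" for n
    unfolding hpos_def
  proof (intro conjI allI)
    show "hadj (Q - q n) = Q - q n" using hQ q(2)[of n] by (simp add: hadj_diff hpos_def)
    fix x
    have "(\<lambda>m. inner (q m x) x - inner (q n x) x) \<longlonglongrightarrow> inner (Q x) x - inner (q n x) x"
      by (intro tendsto_intros Q)
    moreover have "0 \<le> inner (q m x) x - inner (q n x) x" if "n \<le> m" for m
      using inc[OF that] by (simp add: hpos_def blinfun.diff_left inner_diff_left)
    ultimately have "0 \<le> inner (Q x) x - inner (q n x) x"
      by (intro LIMSEQ_le_const) blast+
    then show "0 \<le> inner ((Q - q n) x) x" by (simp add: blinfun.diff_left inner_diff_left)
  qed
  then have le: "op_le (q n) Q" for n by (intro op_le_if_hpos bo)
  have lub: "is_lub_in A (range q) Q"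
    unfolding is_lub_in_def
  proof (intro conjI ballI impI)
    fix t assume t: "t \<in> A" "\<forall>d\<in>range q. op_le d t"
    show "op_le Q t"
      unfolding op_le_def
    proof (intro allI conjI)
      fix x
      have lim: "(\<lambda>n. (t - q n) x) \<longlonglongrightarrow> (t - Q) x"
        unfolding blinfun.diff_left by (intro tendsto_intros Q)
      have 1: "(\<lambda>n. inner ((t - q n) x) x) \<longlonglongrightarrow> inner ((t - Q) x) x" by (intro tendsto_intros lim)
      have 2: "(\<lambda>n. inner ((t - q n) x) (scaleC \<i> x)) \<longlonglongrightarrow> inner ((t - Q) x) (scaleC \<i> x)"
        by (intro tendsto_intros lim)
      have 3: "0 \<le> inner ((t - q n) x) x" "inner ((t - q n) x) (scaleC \<i> x) = 0" for n
        using t(2) by (auto simp: op_le_def cinner_eq_Complex complex_is_Real_iff)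
      show "0 \<le> Re (cinner ((t - Q) x) x)"
        unfolding inner_eq_Re_cinner[symmetric] using 1 3(1) by (intro LIMSEQ_le_const) auto
      have "inner ((t - Q) x) (scaleC \<i> x) = 0" using 2 unfolding 3(2) by (simp add: LIMSEQ_const_iff)
      then show "cinner ((t - Q) x) x \<in> \<real>" by (simp add: cinner_eq_Complex complex_is_Real_iff)
    qed
  qed (use Q le in auto)
  have dir: "\<forall>d\<in>range q. \<forall>e\<in>range q. \<exists>f\<in>range q. op_le d f \<and> op_le e f"
  proof (intro ballI)
    fix d e assume "d \<in> range q" "e \<in> range q"
    then obtain m n where "d = q m" "e = q n" by auto
    then show "\<exists>f\<in>range q. op_le d f \<and> op_le e f"
      by (intro bexI[of _ "q (max m n)"] conjI op_le_if_hpos) (simp_all add: bo inc)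
  qed
  have pos: "\<forall>d\<in>range q. op_le 0 d"
    using q(2) A_bounded_ops[OF A_0] bo by (auto intro!: op_le_if_hpos)
  have normal: "Re (tr s) = (SUP d\<in>D. Re (tr d))"
    if "D \<subseteq> A" "D \<noteq> {}" "\<forall>d\<in>D. op_le 0 d" "\<forall>d\<in>D. \<forall>e\<in>D. \<exists>f\<in>D. op_le d f \<and> op_le e f" "is_lub_in A D s"
    for D s
    using trace_props that unfolding normal_faithful_trace_def by metis
  have "trr Q = (SUP d\<in>range q. trr d)"
    unfolding trr_def using q(1) by (intro normal pos dir lub) auto
  also have "\<dots> \<le> c" using bound by (intro cSUP_least) auto
  finally show ?thesis .
qed

section \<open>Trace norms and multiplication in \<open>l\<^sup>2(A)\<close>\<close>

lemma eta_add: "a \<in> A \<Longrightarrow> b \<in> A \<Longrightarrow> \<eta> (a + b) = \<eta> a + \<eta> b"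
  using l2 by (simp add: l2_completion_def)

lemma eta_scaleR: "a \<in> A \<Longrightarrow> \<eta> (c *\<^sub>R a) = c *\<^sub>R \<eta> a"
  using l2 by (simp add: l2_completion_def scaleC_of_real flip: scaleC_op_of_real)

lemma eta_imag: "a \<in> A \<Longrightarrow> \<eta> (imag o\<^sub>L a) = imag (\<eta> a)"
  using l2 by (simp add: l2_completion_def flip: scaleC_op_imag)

lemma eta_dense: "closure (\<eta> ` A) = UNIV"
  using l2 by (simp add: l2_completion_def)

lemma eta_0 [simp]: "\<eta> 0 = 0"
  using eta_scaleR[of 0 0] by simp

lemma eta_diff: "a \<in> A \<Longrightarrow> b \<in> A \<Longrightarrow> \<eta> (a - b) = \<eta> a - \<eta> b"
  using eta_add[of "a - b" b] A_diff[of a b] by simp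

lemma inner_eta: "a \<in> A \<Longrightarrow> b \<in> A \<Longrightarrow> inner (\<eta> a) (\<eta> b) = trr (a o\<^sub>L hadj b)"
  using l2 adj_eq_hadj[OF A_bounded_ops, of b]
  by (simp add: l2_completion_def inner_eq_Re_cinner trr_def)

lemma norm_eta: "a \<in> A \<Longrightarrow> (norm (\<eta> a))\<^sup>2 = trr (hadj a o\<^sub>L a)"
  using inner_eta[of a a] trr_comm[of a "hadj a"] A_hadj by (simp add: power2_norm_eq_inner)

lemma norm_eta': "a \<in> A \<Longrightarrow> (norm (\<eta> a))\<^sup>2 = trr (a o\<^sub>L hadj a)"
  using inner_eta[of a a] by (simp add: power2_norm_eq_inner)

text \<open>The square of \<open>norm a\<close> minus \<open>hadj a o\<^sub>L a\<close> is positive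
  and stays so after conjugation by \<open>b\<close>; the trace is monotone.\<close>

lemma norm_eta_left:
  assumes a: "a \<in> A" "b \<in> A" shows "norm (\<eta> (a o\<^sub>L b)) \<le> norm a * norm (\<eta> b)"
proof -
  let ?X = "(norm a)\<^sup>2 *\<^sub>R (hadj b o\<^sub>L b) - (hadj (a o\<^sub>L b) o\<^sub>L (a o\<^sub>L b))"
  have "hpos ?X"
    unfolding hpos_def
  proof (intro conjI allI)
    show "hadj ?X = ?X" by (simp add: hadj_diff hadj_scaleR hadj_compose)
    fix x
    have "norm (a (b x)) \<le> norm a * norm (b x)" by (rule norm_blinfun)
    then have "(norm (a (b x)))\<^sup>2 \<le> (norm a)\<^sup>2 * (norm (b x))\<^sup>2"
      by (metis norm_ge_zero power_mono power_mult_distrib)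
    then show "0 \<le> inner (?X x) x"
      using hadj'[of "b x" b x] hadj'[of "a (b x)" a "b x"] hadj'[of "hadj a (a (b x))" b x]
      by (simp add: blinfun.bilinear_simps inner_diff_left hadj_compose power2_norm_eq_inner)
  qed
  then have "trr (hadj (a o\<^sub>L b) o\<^sub>L (a o\<^sub>L b)) \<le> trr ((norm a)\<^sup>2 *\<^sub>R (hadj b o\<^sub>L b))"
    by (intro trr_mono A_compose A_hadj A_scaleR a)
  then have "(norm (\<eta> (a o\<^sub>L b)))\<^sup>2 \<le> (norm a * norm (\<eta> b))\<^sup>2"
    by (simp add: norm_eta a A_compose A_hadj trr_scaleR power_mult_distrib)
  then show ?thesis by (rule power2_le_imp_le) simp
qed

lemma norm_eta_hadj: "a \<in> A \<Longrightarrow> norm (\<eta> (hadj a)) = norm (\<eta> a)"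
  using norm_eta[of "hadj a"] norm_eta'[of a] A_hadj[of a]
  by (metis hadj_hadj norm_ge_zero power2_eq_iff_nonneg)

text \<open>Adjoints exchange left and right multiplication, and they preserve the norm by the trace
  property.\<close>

lemma norm_eta_right:
  assumes "a \<in> A" "b \<in> A" shows "norm (\<eta> (a o\<^sub>L b)) \<le> norm (hadj b) * norm (\<eta> a)"
  using norm_eta_left[OF A_hadj[OF assms(2)] A_hadj[OF assms(1)]] norm_eta_hadj[of "a o\<^sub>L b"] norm_eta_hadj[of a]
    assms by (simp add: hadj_compose A_compose)

definition lreg :: "('h \<Rightarrow>\<^sub>L 'h) \<Rightarrow> ('k \<Rightarrow>\<^sub>L 'k)" where "lreg a = left_reg A \<eta> a"

lemma blinfun_eq_on_eta: "(\<And>b. b \<in> A \<Longrightarrow> blinfun_apply S (\<eta> b) = blinfun_apply T (\<eta> b)) \<Longrightarrow> S = T"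
  by (rule blinfun_eq_on_dense[OF eta_dense]) auto

text \<open>This secures the \<open>THE\<close> in \<open>left_reg\<close>: the extension exists by
  boundedness and is unique by density.\<close>

lemma lreg_eta: assumes "a \<in> A" "b \<in> A" shows "lreg a (\<eta> b) = \<eta> (a o\<^sub>L b)"
proof -
  have "\<exists>T. \<forall>b\<in>A. blinfun_apply T (\<eta> b) = \<eta> (a o\<^sub>L b)"
  proof (rule blinfun_extension_from_dense[OF subspace_A eta_dense])
    show "\<eta> (a o\<^sub>L (b + c)) = \<eta> (a o\<^sub>L b) + \<eta> (a o\<^sub>L c)" if "b \<in> A" "c \<in> A" for b c
    proof -
      have "a o\<^sub>L (b + c) = (a o\<^sub>L b) + (a o\<^sub>L c)" by (rule blinfun_eqI) (simp add: blinfun.bilinear_simps)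
      then show ?thesis using that assms by (simp add: eta_add A_compose)
    qed
    show "\<eta> (a o\<^sub>L (r *\<^sub>R b)) = r *\<^sub>R \<eta> (a o\<^sub>L b)" if "b \<in> A" for r b
    proof -
      have "a o\<^sub>L (r *\<^sub>R b) = r *\<^sub>R (a o\<^sub>L b)" by (rule blinfun_eqI) (simp add: blinfun.bilinear_simps)
      then show ?thesis using that assms by (simp add: eta_scaleR A_compose)
    qed
  qed (use eta_add eta_scaleR norm_eta_left assms in auto)
  then have "\<exists>!T. \<forall>b\<in>A. blinfun_apply T (\<eta> b) = \<eta> (a o\<^sub>L b)"
    using blinfun_eq_on_eta by (metis (no_types, lifting))
  from theI'[OF this] show ?thesis using assms by (simp add: lreg_def left_reg_def)
qed

text \<open>Right multiplication. It commutes with left multiplication and so supplies the elements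
  of \<open>G\<close> that move the vector \<Omega> through a dense set.\<close>

definition rreg :: "('h \<Rightarrow>\<^sub>L 'h) \<Rightarrow> ('k \<Rightarrow>\<^sub>L 'k)" where
  "rreg b = (SOME T. \<forall>a\<in>A. blinfun_apply T (\<eta> a) = \<eta> (a o\<^sub>L b))"

lemma rreg_eta: assumes "a \<in> A" "b \<in> A" shows "rreg b (\<eta> a) = \<eta> (a o\<^sub>L b)"
proof -
  have "\<exists>T. \<forall>a\<in>A. blinfun_apply T (\<eta> a) = \<eta> (a o\<^sub>L b)"
  proof (rule blinfun_extension_from_dense[OF subspace_A eta_dense])
    show "\<eta> ((a + c) o\<^sub>L b) = \<eta> (a o\<^sub>L b) + \<eta> (c o\<^sub>L b)" if "a \<in> A" "c \<in> A" for a c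
    proof -
      have "(a + c) o\<^sub>L b = (a o\<^sub>L b) + (c o\<^sub>L b)" by (rule blinfun_eqI) (simp add: blinfun.bilinear_simps)
      then show ?thesis using that assms by (simp add: eta_add A_compose)
    qed
    show "\<eta> ((r *\<^sub>R a) o\<^sub>L b) = r *\<^sub>R \<eta> (a o\<^sub>L b)" if "a \<in> A" for r a
    proof -
      have "(r *\<^sub>R a) o\<^sub>L b = r *\<^sub>R (a o\<^sub>L b)" by (rule blinfun_eqI) (simp add: blinfun.bilinear_simps)
      then show ?thesis using that assms by (simp add: eta_scaleR A_compose)
    qed
  qed (use eta_add eta_scaleR norm_eta_right assms in auto)
  from someI_ex[OF this] show ?thesis using assms by (simp add: rreg_def)
qed

text \<open>The conjugation \<open>a \<mapsto> a\<^sup>*\<close>, which is isometric because \<open>tr\<close> is a trace.\<close>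

definition star :: "'k \<Rightarrow>\<^sub>L 'k" where
  "star = (SOME T. \<forall>a\<in>A. blinfun_apply T (\<eta> a) = \<eta> (hadj a))"

lemma star_eta: assumes "a \<in> A" shows "star (\<eta> a) = \<eta> (hadj a)"
proof -
  have "\<exists>T. \<forall>a\<in>A. blinfun_apply T (\<eta> a) = \<eta> (hadj a)"
    by (rule blinfun_extension_from_dense[OF subspace_A eta_dense, where C=1])
      (auto simp: eta_add eta_scaleR hadj_add hadj_scaleR A_hadj norm_eta_hadj)
  from someI_ex[OF this] show ?thesis using assms by (simp add: star_def)
qed

lemma eq_0_if_ortho_eta:
  assumes "\<And>c. c \<in> A \<Longrightarrow> inner v (\<eta> c) = 0" shows "v = 0"
proof -
  have "closed {x. inner v x = 0}" by (intro closed_Collect_eq continuous_intros)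
  moreover have "\<eta> ` A \<subseteq> {x. inner v x = 0}" using assms by auto
  ultimately have "closure (\<eta> ` A) \<subseteq> {x. inner v x = 0}" by (rule closure_minimal[rotated])
  moreover have "v \<in> closure (\<eta> ` A)" by (simp add: eta_dense)
  ultimately have "v \<in> {x. inner v x = 0}" by (rule subsetD)
  then show ?thesis by simp
qed

lemma blinfun_inner_eq_on_eta:
  fixes S T :: "'k \<Rightarrow>\<^sub>L 'k"
  assumes "\<And>b c. b \<in> A \<Longrightarrow> c \<in> A \<Longrightarrow> inner (S (\<eta> b)) (\<eta> c) = inner (T (\<eta> b)) (\<eta> c)"
  shows "S = T"
proof (rule blinfun_eq_on_eta)
  fix b assume b: "b \<in> A"
  have "S (\<eta> b) - T (\<eta> b) = 0"
    by (rule eq_0_if_ortho_eta) (use assms b in \<open>simp add: inner_diff_left\<close>)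
  then show "S (\<eta> b) = T (\<eta> b)" by simp
qed

lemma hadj_lreg: assumes a: "a \<in> A" shows "hadj (lreg a) = lreg (hadj a)"
proof (rule blinfun_inner_eq_on_eta)
  fix b c assume bc: "b \<in> A" "c \<in> A"
  have "inner (hadj (lreg a) (\<eta> b)) (\<eta> c) = inner (\<eta> b) (\<eta> (a o\<^sub>L c))"
    by (simp add: lreg_eta a bc flip: hadj')
  also have "\<dots> = trr ((b o\<^sub>L hadj c) o\<^sub>L hadj a)"
    by (simp add: inner_eta A_compose a bc hadj_compose blinfun_compose_assoc)
  also have "\<dots> = trr (hadj a o\<^sub>L (b o\<^sub>L hadj c))" by (intro trr_comm A_compose A_hadj a bc)
  also have "\<dots> = inner (lreg (hadj a) (\<eta> b)) (\<eta> c)"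
    by (simp add: lreg_eta inner_eta A_compose A_hadj a bc hadj_compose blinfun_compose_assoc)
  finally show "inner (hadj (lreg a) (\<eta> b)) (\<eta> c) = inner (lreg (hadj a) (\<eta> b)) (\<eta> c)" .
qed

lemma hadj_rreg: assumes a: "a \<in> A" shows "hadj (rreg a) = rreg (hadj a)"
proof (rule blinfun_inner_eq_on_eta)
  fix b c assume bc: "b \<in> A" "c \<in> A"
  have "inner (hadj (rreg a) (\<eta> b)) (\<eta> c) = inner (\<eta> b) (\<eta> (c o\<^sub>L a))"
    by (simp add: rreg_eta a bc flip: hadj')
  also have "\<dots> = inner (rreg (hadj a) (\<eta> b)) (\<eta> c)"
    by (simp add: rreg_eta inner_eta A_compose A_hadj a bc hadj_compose blinfun_compose_assoc)
  finally show "inner (hadj (rreg a) (\<eta> b)) (\<eta> c) = inner (rreg (hadj a) (\<eta> b)) (\<eta> c)" .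
qed

lemma hadj_star: "hadj star = star"
proof (rule blinfun_inner_eq_on_eta)
  fix b c assume bc: "b \<in> A" "c \<in> A"
  have "inner (hadj star (\<eta> b)) (\<eta> c) = trr (b o\<^sub>L c)"
    by (simp add: star_eta inner_eta A_hadj bc flip: hadj')
  also have "\<dots> = trr (c o\<^sub>L b)" by (intro trr_comm bc)
  also have "\<dots> = inner (\<eta> c) (star (\<eta> b))" by (simp add: star_eta inner_eta A_hadj bc)
  finally show "inner (hadj star (\<eta> b)) (\<eta> c) = inner (star (\<eta> b)) (\<eta> c)" by (simp add: inner_commute)
qed

lemma star_star: "star (star x) = x"
proof -
  have "star o\<^sub>L star = id_blinfun" by (rule blinfun_eq_on_eta) (simp add: star_eta A_hadj)
  then have "(star o\<^sub>L star) x = x" by simp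
  then show ?thesis by simp
qed

lemma inner_star: "inner (star x) (star y) = inner x y"
  by (metis hadj hadj_star star_star)

lemma lreg_compose: "a \<in> A \<Longrightarrow> b \<in> A \<Longrightarrow> lreg (a o\<^sub>L b) = lreg a o\<^sub>L lreg b"
  by (rule blinfun_eq_on_eta) (simp add: lreg_eta A_compose blinfun_compose_assoc)

lemma lreg_add:
  assumes "a \<in> A" "b \<in> A" shows "lreg (a + b) = lreg a + lreg b"
proof (rule blinfun_eq_on_eta)
  fix c assume c: "c \<in> A"
  have "(a + b) o\<^sub>L c = (a o\<^sub>L c) + (b o\<^sub>L c)" by (rule blinfun_eqI) (simp add: blinfun.bilinear_simps)
  then show "lreg (a + b) (\<eta> c) = (lreg a + lreg b) (\<eta> c)"
    using assms c by (simp add: lreg_eta A_add A_compose eta_add blinfun.add_left)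
qed

lemma lreg_scaleR:
  assumes "a \<in> A" shows "lreg (r *\<^sub>R a) = r *\<^sub>R lreg a"
proof (rule blinfun_eq_on_eta)
  fix c assume c: "c \<in> A"
  have "(r *\<^sub>R a) o\<^sub>L c = r *\<^sub>R (a o\<^sub>L c)" by (rule blinfun_eqI) (simp add: blinfun.bilinear_simps)
  then show "lreg (r *\<^sub>R a) (\<eta> c) = (r *\<^sub>R lreg a) (\<eta> c)"
    using assms c by (simp add: lreg_eta A_scaleR A_compose eta_scaleR blinfun.scaleR_left)
qed

lemma lreg_id [simp]: "lreg id_blinfun = id_blinfun"
proof (rule blinfun_eq_on_eta)
  fix b assume "b \<in> A"
  moreover have "id_blinfun o\<^sub>L b = b" by (rule blinfun_eqI) simp
  ultimately show "lreg id_blinfun (\<eta> b) = id_blinfun (\<eta> b)" by (simp add: lreg_eta)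
qed

lemma lreg_0 [simp]: "lreg 0 = 0"
  using lreg_scaleR[of 0 0] by simp

lemma lreg_diff: "a \<in> A \<Longrightarrow> b \<in> A \<Longrightarrow> lreg (a - b) = lreg a - lreg b"
  using lreg_add[of "a - b" b] A_diff[of a b] by simp

lemma lreg_imag: assumes "a \<in> A" shows "lreg a (imag x) = imag (lreg a x)"
proof -
  have "lreg a o\<^sub>L imag = imag o\<^sub>L lreg a"
  proof (rule blinfun_eq_on_eta)
    fix b assume b: "b \<in> A"
    have "a o\<^sub>L (imag o\<^sub>L b) = imag o\<^sub>L (a o\<^sub>L b)"
      using A_bounded_ops[OF assms] by (intro blinfun_eqI) (simp add: bounded_ops_iff)
    then show "(lreg a o\<^sub>L imag) (\<eta> b) = (imag o\<^sub>L lreg a) (\<eta> b)"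
      using assms b by (simp add: lreg_eta A_compose A_imag_compose del: imag_apply flip: eta_imag)
  qed
  then have "(lreg a o\<^sub>L imag) x = (imag o\<^sub>L lreg a) x" by simp
  then show ?thesis by simp
qed

lemma rreg_imag: assumes "a \<in> A" shows "rreg a (imag x) = imag (rreg a x)"
proof -
  have "rreg a o\<^sub>L imag = imag o\<^sub>L rreg a"
    using assms by (intro blinfun_eq_on_eta)
      (simp add: rreg_eta A_compose A_imag_compose blinfun_compose_assoc del: imag_apply flip: eta_imag)
  then have "(rreg a o\<^sub>L imag) x = (imag o\<^sub>L rreg a) x" by simp
  then show ?thesis by simp
qed

lemma lreg_rreg: assumes "a \<in> A" "b \<in> A" shows "lreg a (rreg b x) = rreg b (lreg a x)"
proof -
  have "lreg a o\<^sub>L rreg b = rreg b o\<^sub>L lreg a"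
    using assms by (intro blinfun_eq_on_eta) (simp add: lreg_eta rreg_eta A_compose blinfun_compose_assoc)
  then have "(lreg a o\<^sub>L rreg b) x = (rreg b o\<^sub>L lreg a) x" by simp
  then show ?thesis by simp
qed

section \<open>The cyclic vector and the commutant of left multiplication\<close>

definition \<Omega> :: 'k where "\<Omega> = \<eta> id_blinfun"

definition G :: "('k \<Rightarrow>\<^sub>L 'k) set" where "G = commutant (lreg ` A)"

lemma G_eq: "G = hcomm (insert imag (lreg ` A))"
  by (simp add: G_def commutant_eq_hcomm)

lemma lreg_\<Omega>: assumes "a \<in> A" shows "lreg a \<Omega> = \<eta> a"
proof -
  have "a o\<^sub>L id_blinfun = a" by (rule blinfun_eqI) simp
  then show ?thesis using assms by (simp add: \<Omega>_def lreg_eta)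
qed

lemma rreg_\<Omega>: assumes "a \<in> A" shows "rreg a \<Omega> = \<eta> a"
proof -
  have "id_blinfun o\<^sub>L a = a" by (rule blinfun_eqI) simp
  then show ?thesis using assms by (simp add: \<Omega>_def rreg_eta)
qed

lemma rreg_G: "a \<in> A \<Longrightarrow> rreg a \<in> G"
  by (auto simp: G_eq hcomm_def rreg_imag lreg_rreg simp del: imag_apply)

text \<open>Hence invariance under \<open>G\<close> includes invariance under complex scalars, and the real theory of
  \<open>tracial\<close> applies.\<close>

lemma imag_G: "imag \<in> G"
  by (auto simp: G_eq hcomm_def lreg_imag simp del: imag_apply)

lemma hadj_G: "S \<in> G \<Longrightarrow> hadj S \<in> G"
proof -
  assume S: "S \<in> G"
  have "S \<in> bounded_ops" using S by (simp add: G_def commutant_def)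
  from hadj_bounded_ops[OF this] have bo: "hadj S \<in> bounded_ops" .
  moreover have "hadj S o\<^sub>L lreg a = lreg a o\<^sub>L hadj S" if "a \<in> A" for a
  proof -
    have "S o\<^sub>L lreg (hadj a) = lreg (hadj a) o\<^sub>L S"
      using S A_hadj[OF that] by (simp add: G_def commutant_def)
    then have "S o\<^sub>L hadj (lreg a) = hadj (lreg a) o\<^sub>L S" by (simp only: hadj_lreg[OF that])
    from arg_cong[OF this, of hadj] show ?thesis by (simp add: hadj_compose)
  qed
  ultimately show ?thesis by (simp add: G_def commutant_def)
qed

lemma lreg_N: "a \<in> A \<Longrightarrow> lreg a \<in> hcomm G"
  by (auto simp: G_eq hcomm_def)

text \<open>On the image of \<open>A\<close> this is how \<open>star\<close> was built. For an
  arbitrary element of the commutant of \<open>G\<close> it follows by pairing with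
  \<open>\<eta> b\<close>, since \<open>x\<close> commutes with right multiplication by
  \<open>b\<close>.\<close>

lemma star_hcomm: assumes x: "x \<in> hcomm G" shows "star (x \<Omega>) = hadj x \<Omega>"
proof -
  have "inner (star (x \<Omega>) - hadj x \<Omega>) (\<eta> b) = 0" if b: "b \<in> A" for b
  proof -
    have "inner (star (x \<Omega>)) (\<eta> b) = inner (x \<Omega>) (\<eta> (hadj b))"
      using hadj[of star "x \<Omega>" "\<eta> b"] by (simp add: hadj_star star_eta b)
    also have "\<dots> = inner (x \<Omega>) (hadj (rreg b) \<Omega>)" by (simp add: hadj_rreg rreg_\<Omega> A_hadj b)
    also have "\<dots> = inner (rreg b (x \<Omega>)) \<Omega>" by (simp add: hadj)
    also have "\<dots> = inner (x (\<eta> b)) \<Omega>"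
      using hcomm_D[OF x rreg_G[OF b], of \<Omega>] by (simp add: rreg_\<Omega> b)
    also have "\<dots> = inner (hadj x \<Omega>) (\<eta> b)" by (subst hadj'[symmetric]) (rule inner_commute)
    finally show ?thesis by (simp add: inner_diff_left)
  qed
  then have "star (x \<Omega>) - hadj x \<Omega> = 0" by (rule eq_0_if_ortho_eta)
  then show ?thesis by simp
qed

text \<open>The trace identity holds on the whole commutant of \<open>G\<close> because
  \<open>star\<close> is isometric and implements the adjoint there. \<Omega> separates because
  right multiplications lie in \<open>G\<close> and move it through a dense set.\<close>

lemma tracial_G: "tracial G \<Omega>"
proof
  show "hadj S \<in> G" if "S \<in> G" for S using hadj_G that .
  show "inner (x (y \<Omega>)) \<Omega> = inner (y (x \<Omega>)) \<Omega>" if x: "x \<in> hcomm G" and y: "y \<in> hcomm G" for x y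
  proof -
    have hx: "hadj x \<in> hcomm G" by (rule hcomm_hadj[OF hadj_G x])
    have "inner (x (y \<Omega>)) \<Omega> = inner (star (y \<Omega>)) (star (hadj x \<Omega>))" unfolding inner_star by (rule hadj)
    also have "\<dots> = inner (hadj y \<Omega>) (x \<Omega>)" by (simp add: star_hcomm y hx)
    also have "\<dots> = inner (y (x \<Omega>)) \<Omega>" by (metis hadj inner_commute)
    finally show ?thesis .
  qed
  show "x = 0" if x: "x \<in> hcomm G" and 0: "x \<Omega> = 0" for x
  proof (rule blinfun_eq_on_eta)
    fix b assume b: "b \<in> A"
    have "x (rreg b \<Omega>) = rreg b (x \<Omega>)" by (rule hcomm_D[OF x rreg_G[OF b]])
    then show "x (\<eta> b) = blinfun_apply 0 (\<eta> b)" using 0 b by (simp add: rreg_\<Omega>)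
  qed
qed

sublocale T: tracial G \<Omega> by (rule tracial_G)

lemma norm_eta_le: "a \<in> A \<Longrightarrow> norm (\<eta> a) \<le> norm a * norm \<Omega>"
proof -
  assume a: "a \<in> A"
  have "a o\<^sub>L id_blinfun = a" by (rule blinfun_eqI) simp
  then show ?thesis using norm_eta_left[OF a A_id] by (simp add: \<Omega>_def)
qed

text \<open>On the dense vectors \<open>\<eta> b\<close> the quadratic form is the trace of the
  positive element \<open>hadj b o\<^sub>L (a o\<^sub>L b)\<close>.\<close>

lemma hpos_lreg:
  assumes a: "a \<in> A" "hpos a" shows "hpos (lreg a)"
  unfolding hpos_def
proof (intro conjI allI)
  show "hadj (lreg a) = lreg a" using a by (simp add: hadj_lreg hpos_def)
  have "closed {x. 0 \<le> inner (lreg a x) x}" by (intro closed_Collect_le continuous_intros)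
  moreover have "\<eta> ` A \<subseteq> {x. 0 \<le> inner (lreg a x) x}"
  proof clarify
    fix b assume b: "b \<in> A"
    have "hpos (hadj b o\<^sub>L (a o\<^sub>L b))"
      unfolding hpos_def
    proof (intro conjI allI)
      show "hadj (hadj b o\<^sub>L (a o\<^sub>L b)) = hadj b o\<^sub>L (a o\<^sub>L b)"
        using a(2) by (simp add: hpos_def hadj_compose blinfun_compose_assoc)
      show "0 \<le> inner ((hadj b o\<^sub>L (a o\<^sub>L b)) x) x" for x
        using a(2) hadj[of "hadj b" "a (b x)" x] by (simp add: hpos_def)
    qed
    then have "0 \<le> trr (hadj b o\<^sub>L (a o\<^sub>L b))" by (intro trr_nonneg A_compose A_hadj a b)
    also have "\<dots> = trr ((a o\<^sub>L b) o\<^sub>L hadj b)" by (intro trr_comm A_compose A_hadj a b)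
    also have "\<dots> = inner (lreg a (\<eta> b)) (\<eta> b)" by (simp add: lreg_eta inner_eta A_compose a b)
    finally show "0 \<le> inner (lreg a (\<eta> b)) (\<eta> b)" .
  qed
  ultimately have "closure (\<eta> ` A) \<subseteq> {x. 0 \<le> inner (lreg a x) x}" by (rule closure_minimal[rotated])
  then show "0 \<le> inner (lreg a x) x" for x using eta_dense by auto
qed

end

context finite_vna
begin

text \<open>If the vectors \<open>\<eta> (c n)\<close> converge fast enough to \<open>x \<Omega>\<close>, then the weighted sum of
  the squares of the differences \<open>d n\<close> is so small in trace that the inverse of \<open>1 + \<Sum> 4\<^sup>n d\<^sub>n\<^sup>* d\<^sub>n\<close>
  exists as an injective element \<open>r\<close> of \<open>A\<close>; then \<open>c n r\<close> converges in norm.\<close>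

lemma right_denominator:
  assumes x: "x \<in> T.N"
  shows "\<exists>r\<in>A. \<exists>y\<in>A. lreg r \<in> T.NI \<and> x o\<^sub>L lreg r = lreg y"
proof -
  \<comment> \<open>At this rate consecutive vectors differ by at most (1/4)^n, as (1/2) (1/4 + 1)
    \<le> 1.\<close>
  have "\<exists>c\<in>A. dist (\<eta> c) (x \<Omega>) < (1/2) * (1/4)^n" for n :: nat
  proof -
    have "x \<Omega> \<in> closure (\<eta> ` A)" "0 < (1/2) * (1/4::real)^n" using eta_dense by auto
    then show ?thesis unfolding closure_approachable by blast
  qed
  then obtain c where c: "\<And>n. c n \<in> A" "\<And>n. dist (\<eta> (c n)) (x \<Omega>) < (1/2) * (1/4)^n" by metis
  define d where "d n = c (Suc n) - c n" for n
  have dA: "d n \<in> A" for n unfolding d_def by (intro A_diff c)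
  \<comment> \<open>The squared norm of \<open>\<eta> (d n)\<close> is at most 16^-n. The weight 4^n
    leaves traces of size 4^-n, still summable, and yields the operator bound 2^-n for
    \<open>d n o\<^sub>L r 0\<close> below.\<close>
  define e where "e n = (4::real)^n *\<^sub>R (hadj (d n) o\<^sub>L d n)" for n
  have eA: "e n \<in> A" for n unfolding e_def by (intro A_scaleR A_compose A_hadj dA)
  have e_pos: "hpos (e n)" for n unfolding e_def by (intro hpos_scaleR hpos_hadj_compose) simp
  have tr_e: "trr (e n) \<le> (1/4)^n" for n
  proof -
    have "norm (\<eta> (d n)) \<le> dist (\<eta> (c (Suc n))) (x \<Omega>) + dist (\<eta> (c n)) (x \<Omega>)"
      unfolding d_def using c(1) by (simp add: eta_diff dist_triangle2 flip: dist_norm)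
    also have "\<dots> \<le> (1/2) * (1/4)^Suc n + (1/2) * (1/4)^n" by (intro add_mono less_imp_le c)
    also have "\<dots> \<le> (1/4)^n" by simp
    finally have "(norm (\<eta> (d n)))\<^sup>2 \<le> ((1/4)^n)\<^sup>2" by (intro power_mono) auto
    then have "trr (e n) \<le> 4^n * ((1/4)^n)\<^sup>2"
      unfolding e_def by (simp add: trr_scaleR A_compose A_hadj dA norm_eta)
    also have "\<dots> = (1/4)^n" by (simp add: power2_eq_square power_divide)
    finally show ?thesis .
  qed
  \<comment> \<open>The block of \<open>k\<close> terms starting at \<open>m\<close>. The full sum
    may diverge, so only finite blocks are formed and the limit in \<open>k\<close> is taken after
    inversion.\<close>
  define s where "s m k = (\<Sum>i=m..<m+k. e i)" for m k
  have sA: "s m k \<in> A" for m k unfolding s_def by (intro A_sum eA)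
  have s_pos: "hpos (s m k)" for m k unfolding s_def by (intro hpos_sum e_pos)
  have s_Suc: "s m (Suc k) = s m k + e (m + k)" for m k by (simp add: s_def)
  have s_split: "s 0 (m + k) = s 0 m + s m k" for m k
    unfolding s_def using sum.atLeastLessThan_concat[of 0 m "m + k" e] by simp
  have tr_s: "trr (s m k) \<le> 2 * (1/4)^m" for m k
  proof -
    \<comment> \<open>The subtracted term closes the induction: 2 (1/4)^j exceeds 2 (1/4)^(j+1) by
      more than (1/4)^j, the bound for the new term.\<close>
    have "trr (s m k) \<le> 2 * (1/4)^m - 2 * (1/4)^(m + k)"
    proof (induction k)
      case (Suc k)
      have "trr (s m (Suc k)) = trr (s m k) + trr (e (m + k))"
        unfolding s_Suc by (intro trr_add sA eA)
      moreover have "(1/4::real)^(m + Suc k) = (1/4)^(m + k) / 4" "0 \<le> (1/4::real)^(m + k)" by simp_all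
      ultimately show ?case using Suc tr_e[of "m + k"] by linarith
    qed (simp add: s_def)
    moreover have "0 \<le> (1/4::real)^(m + k)" by simp
    ultimately show ?thesis by linarith
  qed
  define rk where "rk m k = resolvent (s m k)" for m k
  have rkA: "rk m k \<in> A" for m k unfolding rk_def by (intro A_resolvent sA s_pos)
  have rk_pos: "hpos (rk m k)" for m k unfolding rk_def by (intro hpos_resolvent s_pos)
  have rk_le: "inner (rk m k v) v \<le> (norm v)\<^sup>2" for m k v
    unfolding rk_def by (intro inner_resolvent_le s_pos)
  have rk_dec: "inner (rk m (Suc k) v) v \<le> inner (rk m k v) v" for m k v
  proof -
    have "inner w w + inner (s m k w) w \<le> 1 * (inner w w + inner (s m (Suc k) w) w)" for w
      using e_pos[of "m + k"] by (simp add: s_Suc blinfun.add_left inner_add_left hpos_def)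
    from resolvent_antimono[OF s_pos s_pos _ this] show ?thesis by (simp add: rk_def)
  qed
  have "\<exists>R. hpos R \<and> (\<forall>v. (\<lambda>k. rk m k v) \<longlonglongrightarrow> blinfun_apply R v)" for m
    by (intro decreasing_positive_convergent rk_pos rk_le rk_dec)
  then obtain r where r_pos: "\<And>m. hpos (r m)" and r: "\<And>m v. (\<lambda>k. rk m k v) \<longlonglongrightarrow> r m v" by metis
  have rA: "r m \<in> A" for m by (rule A_strong_limit[of "rk m", OF rkA r])
  have lim: "(\<lambda>k. inner (rk m k v) w) \<longlonglongrightarrow> inner (r m v) w" for m v w by (intro tendsto_intros r)
  have r_le: "inner (r m v) v \<le> (norm v)\<^sup>2" for m v
    by (rule LIMSEQ_le_const2[OF lim]) (use rk_le in auto)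
  \<comment> \<open>\<open>r m\<close> stands for the inverse of 1 plus the tail from
    \<open>m\<close> on, and \<open>q m\<close> measures its distance from 1. Its trace is small
    because 1 - (1 + s)^-1 \<le> s for every finite block and normality passes to the limit.\<close>
  define q where "q m = id_blinfun - r m" for m
  have qA: "q m \<in> A" for m unfolding q_def by (intro A_diff A_id rA)
  have q_pos: "hpos (q m)" for m
    using r_pos[of m] r_le[of m]
    by (simp add: q_def hpos_def hadj_diff blinfun.diff_left inner_diff_left power2_norm_eq_inner)
  have q_le: "inner (q m v) v \<le> (norm v)\<^sup>2" for m v
    using r_pos[of m] by (simp add: q_def hpos_def blinfun.diff_left inner_diff_left power2_norm_eq_inner)
  have tr_q: "trr (q m) \<le> 2 * (1/4)^m" for m
  proof (rule trr_increasing_limit[of "\<lambda>k. id_blinfun - rk m k"])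
    show "id_blinfun - rk m k \<in> A" for k by (intro A_diff A_id rkA)
    show "hpos (id_blinfun - rk m k)" for k
      using rk_pos[of m k] rk_le[of m k]
      by (simp add: hpos_def hadj_diff blinfun.diff_left inner_diff_left power2_norm_eq_inner)
    show "hpos (id_blinfun - rk m (Suc k) - (id_blinfun - rk m k))" for k
      using rk_pos[of m k] rk_pos[of m "Suc k"] rk_dec[of m k]
      by (simp add: hpos_def hadj_diff blinfun.diff_left inner_diff_left)
    show "(\<lambda>k. (id_blinfun - rk m k) v) \<longlonglongrightarrow> q m v" for v
      unfolding q_def blinfun.diff_left by (intro tendsto_intros r)
    show "trr (id_blinfun - rk m k) \<le> 2 * (1/4)^m" for k
    proof -
      have "hpos (s m k - (id_blinfun - rk m k))"
        unfolding hpos_def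
      proof (intro conjI allI)
        show "hadj (s m k - (id_blinfun - rk m k)) = s m k - (id_blinfun - rk m k)"
          using s_pos[of m k] rk_pos[of m k] by (simp add: hpos_def hadj_diff)
        show "0 \<le> inner ((s m k - (id_blinfun - rk m k)) v) v" for v
          using resolvent_variational[OF s_pos, of v v m k]
          by (simp add: rk_def blinfun.diff_left inner_diff_left)
      qed
      then have "trr (id_blinfun - rk m k) \<le> trr (s m k)" by (intro trr_mono A_diff A_id rkA sA)
      then show ?thesis using tr_s[of m k] by linarith
    qed
  qed (intro qA)
  have eta_q: "(\<lambda>m. \<eta> (q m)) \<longlonglongrightarrow> 0"
  proof -
    have "(norm (\<eta> (q m)))\<^sup>2 \<le> 2 * (1/4)^m" for m
    proof -
      have "hpos (q m - (hadj (q m) o\<^sub>L q m))"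
        unfolding hpos_def
      proof (intro conjI allI)
        show "hadj (q m - (hadj (q m) o\<^sub>L q m)) = q m - (hadj (q m) o\<^sub>L q m)"
          using q_pos[of m] by (simp add: hpos_def hadj_diff hadj_compose)
        show "0 \<le> inner ((q m - (hadj (q m) o\<^sub>L q m)) v) v" for v
          using hpos_norm_square_le[OF q_pos q_le, of m v]
          by (simp add: blinfun.diff_left inner_diff_left power2_norm_eq_inner flip: hadj')
      qed
      then have "(norm (\<eta> (q m)))\<^sup>2 \<le> trr (q m)"
        unfolding norm_eta[OF qA] by (intro trr_mono A_compose A_hadj qA)
      then show ?thesis using tr_q[of m] by linarith
    qed
    moreover have "(\<lambda>m. 2 * (1/4::real)^m) \<longlonglongrightarrow> 0"
      by (intro tendsto_mult_right_zero LIMSEQ_power_zero) simp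
    ultimately have "(\<lambda>m. (norm (\<eta> (q m)))\<^sup>2) \<longlonglongrightarrow> 0"
      by (intro Lim_null_comparison[of "\<lambda>m. (norm (\<eta> (q m)))\<^sup>2" "\<lambda>m. 2 * (1/4)^m"]) simp_all
    then have "(\<lambda>m. sqrt ((norm (\<eta> (q m)))\<^sup>2)) \<longlonglongrightarrow> sqrt 0" by (intro tendsto_intros)
    then show ?thesis by (simp add: tendsto_norm_zero_iff)
  qed
  have norm_lreg_r: "norm (lreg (r m)) \<le> 1" for m
  proof (rule norm_blinfun_bound)
    fix v
    have hp: "hpos (lreg (r m))" by (intro hpos_lreg rA r_pos)
    have le: "inner (lreg (r m) v) v \<le> (norm v)\<^sup>2" for v
      using hpos_lreg[OF qA q_pos, of m]
      by (simp add: q_def lreg_diff rA hpos_def blinfun.diff_left inner_diff_left power2_norm_eq_inner)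
    have "(norm (lreg (r m) v))\<^sup>2 \<le> (norm v)\<^sup>2"
      using hpos_norm_square_le[OF hp le, of v] le[of v] by linarith
    then show "norm (lreg (r m) v) \<le> 1 * norm v" using power2_le_imp_le by fastforce
  qed simp
  have lreg_r_tendsto: "(\<lambda>m. lreg (r m) v) \<longlonglongrightarrow> id_blinfun v" for v
  proof (rule tendsto_blinfun_on_closure[OF norm_lreg_r])
    show "v \<in> closure (\<eta> ` A)" using eta_dense by simp
    fix w assume "w \<in> \<eta> ` A"
    then obtain b where b: "b \<in> A" "w = \<eta> b" by auto
    have "lreg (r m) w = w - rreg b (\<eta> (q m))" for m
    proof -
      have "r m o\<^sub>L b = b - (q m o\<^sub>L b)" by (rule blinfun_eqI) (simp add: q_def blinfun.bilinear_simps)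
      then show ?thesis
        using b by (simp add: lreg_eta rA rreg_eta qA eta_diff A_compose)
    qed
    moreover have "(\<lambda>m. w - rreg b (\<eta> (q m))) \<longlonglongrightarrow> w - rreg b 0" by (intro tendsto_intros eta_q)
    ultimately show "(\<lambda>m. lreg (r m) w) \<longlonglongrightarrow> id_blinfun w" by simp
  qed
  \<comment> \<open>The first \<open>m\<close> terms enlarge 1 + s by at most the factor 1 +
    \<open>norm (s 0 m)\<close>, so every \<open>r m\<close> is dominated by a multiple of
    \<open>r 0\<close>.\<close>
  have r_compare: "hpos ((1 + norm (s 0 m)) *\<^sub>R r 0 - r m)" for m
    unfolding hpos_def
  proof (intro conjI allI)
    let ?K = "1 + norm (s 0 m)"
    show "hadj (?K *\<^sub>R r 0 - r m) = ?K *\<^sub>R r 0 - r m"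
      using r_pos[of 0] r_pos[of m] by (simp add: hpos_def hadj_diff hadj_scaleR)
    fix v
    have "inner (rk m k v) v \<le> ?K * inner (rk 0 (m + k) v) v" for k
    proof -
      have "inner w w + inner (s 0 (m + k) w) w \<le> ?K * (inner w w + inner (s m k w) w)" for w
      proof -
        have "inner (s 0 m w) w \<le> norm (s 0 m w) * norm w" by (rule norm_cauchy_schwarz)
        also have "\<dots> \<le> (norm (s 0 m) * norm w) * norm w" by (intro mult_right_mono norm_blinfun) simp
        finally have "inner (s 0 m w) w \<le> norm (s 0 m) * inner w w"
          by (simp add: power2_norm_eq_inner[symmetric] power2_eq_square)
        moreover have "0 \<le> norm (s 0 m) * inner (s m k w) w"
          using s_pos[of m k] by (simp add: hpos_def)
        ultimately show ?thesis
          unfolding s_split blinfun.add_left inner_add_left by (simp add: algebra_simps)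
      qed
      then show ?thesis
        unfolding rk_def by (intro resolvent_antimono s_pos) (auto simp: add_pos_nonneg)
    qed
    moreover have "(\<lambda>k. inner (rk 0 (m + k) v) v) \<longlonglongrightarrow> inner (r 0 v) v"
      using LIMSEQ_ignore_initial_segment[OF lim[of 0 v v], of m] by (simp add: add.commute)
    then have "(\<lambda>k. ?K * inner (rk 0 (m + k) v) v) \<longlonglongrightarrow> ?K * inner (r 0 v) v"
      by (rule tendsto_mult_left)
    ultimately have "inner (r m v) v \<le> ?K * inner (r 0 v) v"
      by (intro LIMSEQ_le[OF lim]) auto
    then show "0 \<le> inner ((?K *\<^sub>R r 0 - r m) v) v"
      by (simp add: blinfun.bilinear_simps inner_diff_left)
  qed
  \<comment> \<open>If \<open>lreg (r 0)\<close> kills a vector, the comparison makes the quadratic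
    form of every \<open>lreg (r m)\<close> vanish at it, while these operators converge strongly to
    1.\<close>
  have "lreg (r 0) \<in> T.NI"
  proof (rule T.NI_I[OF lreg_N[OF rA]])
    fix v assume v: "lreg (r 0) v = 0"
    have "inner (lreg (r m) v) v \<le> 0" for m
    proof -
      have "hpos (lreg ((1 + norm (s 0 m)) *\<^sub>R r 0 - r m))"
        by (intro hpos_lreg r_compare A_diff A_scaleR rA)
      then have "0 \<le> inner (lreg ((1 + norm (s 0 m)) *\<^sub>R r 0 - r m) v) v" by (simp add: hpos_def)
      then show ?thesis
        by (simp add: lreg_diff lreg_scaleR A_scaleR rA blinfun.diff_left blinfun.scaleR_left inner_diff_left v)
    qed
    moreover have "(\<lambda>m. inner (lreg (r m) v) v) \<longlonglongrightarrow> inner (id_blinfun v) v"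
      by (intro tendsto_intros lreg_r_tendsto)
    ultimately have "inner v v \<le> 0" by (intro LIMSEQ_le_const2) auto
    then have "inner v v = 0" using inner_ge_zero[of v] by linarith
    then show "v = 0" by simp
  qed
  moreover have "\<exists>y\<in>A. x o\<^sub>L lreg (r 0) = lreg y"
  proof -
    \<comment> \<open>\<open>e n\<close> is a summand of \<open>s 0 k\<close> once n < k, and (1 +
      s)^-1 s (1 + s)^-1 \<le> 1.\<close>
    have dr: "norm (d n o\<^sub>L r 0) \<le> (1/2)^n" for n
    proof (rule norm_blinfun_bound)
      fix v
      have "norm (d n (rk 0 k v)) \<le> (1/2)^n * norm v" if k: "n < k" for k
      proof -
        let ?w = "rk 0 k v"
        have "4^n * (norm (d n ?w))\<^sup>2 = inner (e n ?w) ?w"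
          by (simp add: e_def blinfun.scaleR_left power2_norm_eq_inner hadj inner_commute)
        also have "\<dots> \<le> inner (s 0 k ?w) ?w"
        proof -
          have "s 0 k = e n + (\<Sum>i\<in>{0..<k} - {n}. e i)"
            unfolding s_def using k by (simp add: sum.remove[of "{0..<k}" n])
          moreover have "hpos (\<Sum>i\<in>{0..<k} - {n}. e i)" by (intro hpos_sum e_pos)
          ultimately show ?thesis by (simp add: blinfun.add_left inner_add_left hpos_def)
        qed
        also have "\<dots> \<le> inner (rk 0 k v) v"
          using inner_resolvent_eq[OF s_pos, of 0 k v] by (simp add: rk_def)
        also have "\<dots> \<le> (norm v)\<^sup>2" by (rule rk_le)
        finally have "4^n * (norm (d n ?w))\<^sup>2 \<le> (norm v)\<^sup>2" .
        moreover have "(4::real)^n = (2^n)\<^sup>2" by (simp add: power2_eq_square flip: power_mult_distrib)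
        ultimately have "(2^n * norm (d n ?w))\<^sup>2 \<le> (norm v)\<^sup>2" by (simp add: power_mult_distrib)
        then have "2^n * norm (d n ?w) \<le> norm v" by (rule power2_le_imp_le) simp
        then show ?thesis by (simp add: power_divide field_simps)
      qed
      moreover have "(\<lambda>k. norm (d n (rk 0 k v))) \<longlonglongrightarrow> norm (d n (r 0 v))" by (intro tendsto_intros r)
      ultimately have "norm (d n (r 0 v)) \<le> (1/2)^n * norm v"
        by (intro LIMSEQ_le_const2) (auto intro!: exI[of _ "Suc n"])
      then show "norm ((d n o\<^sub>L r 0) v) \<le> (1/2)^n * norm v" by simp
    qed simp
    have "(c (Suc n) o\<^sub>L r 0) - (c n o\<^sub>L r 0) = d n o\<^sub>L r 0" for n
      by (rule blinfun_eqI) (simp add: d_def blinfun.bilinear_simps)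
    then have cauchy: "norm ((c (Suc n) o\<^sub>L r 0) - (c n o\<^sub>L r 0)) \<le> (1/2)^n" for n using dr by simp
    have "summable (\<lambda>n. (c (Suc n) o\<^sub>L r 0) - (c n o\<^sub>L r 0))"
      by (rule summable_comparison_test'[of "\<lambda>n. (1/2)^n" 0]) (use cauchy in auto)
    then have "convergent (\<lambda>n. \<Sum>i<n. (c (Suc i) o\<^sub>L r 0) - (c i o\<^sub>L r 0))"
      by (simp add: summable_iff_convergent)
    then obtain y' where "(\<lambda>n. (c n o\<^sub>L r 0) - (c 0 o\<^sub>L r 0)) \<longlonglongrightarrow> y'"
      using sum_lessThan_telescope[of "\<lambda>n. c n o\<^sub>L r 0"] by (auto simp: convergent_def)
    from tendsto_add[OF this tendsto_const[of "c 0 o\<^sub>L r 0"]]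
    obtain y where y: "(\<lambda>n. c n o\<^sub>L r 0) \<longlonglongrightarrow> y" by auto
    have crA: "c n o\<^sub>L r 0 \<in> A" for n by (intro A_compose c rA)
    have "(\<lambda>n. (c n o\<^sub>L r 0) v) \<longlonglongrightarrow> y v" for v by (intro blinfun.tendsto tendsto_const y)
    from A_strong_limit[OF crA this] have yA: "y \<in> A" .
    have "(\<lambda>n. \<eta> (c n o\<^sub>L r 0)) \<longlonglongrightarrow> \<eta> y"
    proof -
      have "(\<lambda>n. norm ((c n o\<^sub>L r 0) - y) * norm \<Omega>) \<longlonglongrightarrow> norm (y - y) * norm \<Omega>"
        by (intro tendsto_intros y)
      then have "(\<lambda>n. norm ((c n o\<^sub>L r 0) - y) * norm \<Omega>) \<longlonglongrightarrow> 0" by simp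
      moreover have "norm (\<eta> (c n o\<^sub>L r 0) - \<eta> y) \<le> norm ((c n o\<^sub>L r 0) - y) * norm \<Omega>" for n
        using norm_eta_le[OF A_diff[OF crA yA]] by (simp add: eta_diff crA yA)
      ultimately have "(\<lambda>n. \<eta> (c n o\<^sub>L r 0) - \<eta> y) \<longlonglongrightarrow> 0"
        by (intro Lim_null_comparison[of "\<lambda>n. \<eta> (c n o\<^sub>L r 0) - \<eta> y"
              "\<lambda>n. norm ((c n o\<^sub>L r 0) - y) * norm \<Omega>"] always_eventually allI)
      then show ?thesis by (simp add: LIM_zero_iff)
    qed
    \<comment> \<open>The same sequence also converges to the right translate of
      \<open>x \<Omega>\<close> by \<open>r 0\<close>. Comparing the limits identifies
      \<open>x o\<^sub>L lreg (r 0)\<close> with \<open>lreg y\<close> at \<Omega>, and \<Omega>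
      separates.\<close>
    moreover have "(\<lambda>n. \<eta> (c n o\<^sub>L r 0)) \<longlonglongrightarrow> rreg (r 0) (x \<Omega>)"
    proof -
      have "(\<lambda>n. dist (\<eta> (c n)) (x \<Omega>)) \<longlonglongrightarrow> 0"
      proof (rule tendsto_sandwich[of "\<lambda>_. 0", OF _ _ tendsto_const])
        show "(\<lambda>n. (1/2) * (1/4::real)^n) \<longlonglongrightarrow> 0" by (intro tendsto_mult_right_zero LIMSEQ_power_zero) simp
        show "\<forall>\<^sub>F n in sequentially. dist (\<eta> (c n)) (x \<Omega>) \<le> (1/2) * (1/4)^n"
          by (intro always_eventually allI less_imp_le c)
      qed simp
      then have "(\<lambda>n. \<eta> (c n)) \<longlonglongrightarrow> x \<Omega>" by (rule iffD2[OF tendsto_dist_iff])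
      then have "(\<lambda>n. rreg (r 0) (\<eta> (c n))) \<longlonglongrightarrow> rreg (r 0) (x \<Omega>)" by (intro tendsto_intros)
      then show ?thesis using c rA by (simp add: rreg_eta)
    qed
    ultimately have "rreg (r 0) (x \<Omega>) = \<eta> y" by (intro LIMSEQ_unique)
    then have "x (lreg (r 0) \<Omega>) = lreg y \<Omega>"
      using hcomm_D[OF x rreg_G[OF rA], of 0 \<Omega>] by (simp add: lreg_\<Omega> rreg_\<Omega> rA yA)
    then have "((x o\<^sub>L lreg (r 0)) - lreg y) \<Omega> = 0" by (simp add: blinfun.diff_left)
    then have "(x o\<^sub>L lreg (r 0)) - lreg y = 0"
      by (intro T.separating hcomm_diff hcomm_compose x lreg_N rA yA)
    then show ?thesis using yA by auto
  qed
  ultimately show ?thesis using rA by blast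
qed

lemma left_denominator:
  assumes x: "x \<in> T.N"
  shows "\<exists>r\<in>A. \<exists>y\<in>A. lreg r \<in> T.NI \<and> lreg r o\<^sub>L x = lreg y"
proof -
  obtain r y where ry: "r \<in> A" "y \<in> A" "lreg r \<in> T.NI" "hadj x o\<^sub>L lreg r = lreg y"
    using right_denominator[OF T.hadj_N[OF x]] by blast
  have "lreg (hadj r) o\<^sub>L x = lreg (hadj y)"
    using arg_cong[OF ry(4), of hadj]
    unfolding hadj_compose hadj_hadj hadj_lreg[OF ry(1)] hadj_lreg[OF ry(2)] .
  moreover have "lreg (hadj r) \<in> T.NI" using T.NI_hadj[OF ry(3)] by (simp add: hadj_lreg ry)
  ultimately show ?thesis using ry A_hadj by blast
qed

lemma lreg_inject:
  assumes "a \<in> A" "b \<in> A" "lreg a = lreg b" shows "a = b"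
proof -
  have "\<eta> (a - b) = 0" using lreg_\<Omega>[OF assms(1)] lreg_\<Omega>[OF assms(2)] assms by (simp add: eta_diff)
  then have "trr (hadj (a - b) o\<^sub>L (a - b)) = 0" using norm_eta[OF A_diff[OF assms(1,2)]] by simp
  then have "hadj (a - b) o\<^sub>L (a - b) = 0"
    by (intro trr_faithful hpos_hadj_compose A_compose A_hadj A_diff assms)
  then have "(hadj (a - b) o\<^sub>L (a - b)) v = 0" for v by simp
  then have "(a - b) v = 0" for v using hadj_compose_zero_iff[of "a - b" v] by simp
  then have "a - b = 0" by (intro blinfun_eqI) simp
  then show ?thesis by simp
qed

text \<open>Complex linearity of the graph comes from \<open>imag\<close> in \<open>G\<close>; in
  the other direction real scalars are special complex ones.\<close>

lemma affiliated_eq: "affiliated (left_reg A \<eta> ` A) = T.aff"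
proof -
  have im: "left_reg A \<eta> ` A = lreg ` A" by (simp add: lreg_def)
  have 1: "T \<in> T.aff" if T: "T \<in> affiliated (left_reg A \<eta> ` A)" for T
  proof -
    have c: "closed_densely_defined T"
      and inv: "\<And>S x y. S \<in> G \<Longrightarrow> (x, y) \<in> T \<Longrightarrow> (blinfun_apply S x, blinfun_apply S y) \<in> T"
      using T unfolding affiliated_def im G_def by auto
    have l: "(0, 0) \<in> T" "single_valued T"
      "\<And>x y x' y'. (x, y) \<in> T \<Longrightarrow> (x', y') \<in> T \<Longrightarrow> (x + x', y + y') \<in> T"
      "\<And>c x y. (x, y) \<in> T \<Longrightarrow> (scaleC c x, scaleC c y) \<in> T"
      using c unfolding closed_densely_defined_def linear_operator_def by blast+
    have "(r *\<^sub>R x, r *\<^sub>R y) \<in> T" if "(x, y) \<in> T" for r x y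
      using l(4)[OF that, of "complex_of_real r"] by (simp add: scaleC_of_real)
    then have "subspace T" using l(1,3) by (auto simp: subspace_def zero_prod_def)
    then show ?thesis
      using c inv l(2) by (auto simp: T.aff_def ginv_def closed_densely_defined_def)
  qed
  have 2: "T \<in> affiliated (left_reg A \<eta> ` A)" if T: "T \<in> T.aff" for T
  proof -
    note sub = T.affD(4)[OF T]
    have "(scaleC c x, scaleC c y) \<in> T" if "(x, y) \<in> T" for c x y
    proof -
      have "Re c *\<^sub>R (x, y) + Im c *\<^sub>R (imag x, imag y) \<in> T"
        using that by (intro subspace_add subspace_scale sub T.aff_invariant[OF T imag_G])
      then show ?thesis by (simp add: scaleC_eq del: imag_apply)
    qed
    moreover have "(x + x', y + y') \<in> T" if "(x, y) \<in> T" "(x', y') \<in> T" for x y x' y'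
      using subspace_add[OF sub that] by simp
    moreover have "(0, 0) \<in> T" using subspace_0[OF sub] by (simp add: zero_prod_def)
    ultimately show ?thesis
      using T.affD[OF T] T.aff_invariant[OF T]
      unfolding affiliated_def im G_def[symmetric] closed_densely_defined_def linear_operator_def by auto
  qed
  show ?thesis using 1 2 by blast
qed

section \<open>Transfer to the rings of the definitions\<close>

lemma op_graph_eq_gr: "op_graph a = gr a"
  by (auto simp: op_graph_def)

lemma affiliated_ring_eq: "affiliated_ring A \<eta> = T.aff_ring"
  by (simp add: affiliated_ring_def T.aff_ring_def affiliated_eq op_graph_eq_gr
      aff_mult_def[abs_def] aff_add_def[abs_def])

lemma affiliated_incl_eq: "affiliated_incl A \<eta> a = gr (lreg a)"
  by (simp add: affiliated_incl_def op_graph_eq_gr lreg_def)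

lemma ring_op_ring: "ring (op_ring A)"
proof (intro ringI abelian_groupI monoidI)
  show "\<exists>y\<in>carrier (op_ring A). y \<oplus>\<^bsub>op_ring A\<^esub> x = \<zero>\<^bsub>op_ring A\<^esub>" if "x \<in> carrier (op_ring A)" for x
    using that A_uminus by (intro bexI[of _ "- x"]) (auto simp: op_ring_def)
  show "(x \<oplus>\<^bsub>op_ring A\<^esub> y) \<otimes>\<^bsub>op_ring A\<^esub> z = x \<otimes>\<^bsub>op_ring A\<^esub> z \<oplus>\<^bsub>op_ring A\<^esub> y \<otimes>\<^bsub>op_ring A\<^esub> z" for x y z
    by (simp add: op_ring_def, rule blinfun_eqI) (simp add: blinfun.bilinear_simps)
  show "z \<otimes>\<^bsub>op_ring A\<^esub> (x \<oplus>\<^bsub>op_ring A\<^esub> y) = z \<otimes>\<^bsub>op_ring A\<^esub> x \<oplus>\<^bsub>op_ring A\<^esub> z \<otimes>\<^bsub>op_ring A\<^esub> y" for x y z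
    by (simp add: op_ring_def, rule blinfun_eqI) (simp add: blinfun.bilinear_simps)
  show "\<one>\<^bsub>op_ring A\<^esub> \<otimes>\<^bsub>op_ring A\<^esub> x = x" "x \<otimes>\<^bsub>op_ring A\<^esub> \<one>\<^bsub>op_ring A\<^esub> = x" for x
    by (simp add: op_ring_def, rule blinfun_eqI, simp)+
qed (auto simp: op_ring_def A_add A_compose add.assoc add.commute blinfun_compose_assoc)

lemma ring_affiliated_ring: "ring (affiliated_ring A \<eta>)"
  by (simp add: affiliated_ring_eq T.ring_aff_ring)

lemma affiliated_incl_hom: "affiliated_incl A \<eta> \<in> ring_hom (op_ring A) (affiliated_ring A \<eta>)"
  by (rule ring_hom_memI)
    (simp_all add: affiliated_ring_eq affiliated_incl_eq op_ring_def T.aff_ring_def T.gr_aff lreg_N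
      lreg_compose lreg_add T.gr_mult T.gr_add)

lemma affiliated_incl_inj: "inj_on (affiliated_incl A \<eta>) (carrier (op_ring A))"
  by (auto simp: inj_on_def affiliated_incl_eq T.gr_inject op_ring_def intro: lreg_inject)

text \<open>A fraction over \<open>N\<close> is cleared in two rounds: \<open>r\<close> carries the
  denominator \<open>t\<close> into \<open>A\<close>, then \<open>r'\<close> carries the numerator
  \<open>lreg r o\<^sub>L b\<close> into \<open>A\<close>. The resulting denominator is still
  injective, hence a unit.\<close>

lemma affiliated_denominator:
  assumes u: "u \<in> carrier (affiliated_ring A \<eta>)"
  shows "\<exists>s\<in>carrier (op_ring A). \<exists>a\<in>carrier (op_ring A).
    affiliated_incl A \<eta> s \<in> Units (affiliated_ring A \<eta>) \<and>
    affiliated_incl A \<eta> s \<otimes>\<^bsub>affiliated_ring A \<eta>\<^esub> u = affiliated_incl A \<eta> a"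
proof -
  have u: "u \<in> T.aff" using u by (simp add: affiliated_ring_eq T.aff_ring_def)
  obtain t b where tb: "t \<in> T.NI" "b \<in> T.N" "aff_mult (gr t) u = gr b"
    using T.aff_denominator[OF u] by blast
  obtain r y where r: "r \<in> A" "y \<in> A" "lreg r \<in> T.NI" "lreg r o\<^sub>L t = lreg y"
    using left_denominator[OF T.NI_N[OF tb(1)]] by blast
  obtain r' z where r': "r' \<in> A" "z \<in> A" "lreg r' \<in> T.NI" "lreg r' o\<^sub>L (lreg r o\<^sub>L b) = lreg z"
    using left_denominator[OF hcomm_compose[OF T.NI_N[OF r(3)] tb(2)]] by blast
  have eq: "lreg (r' o\<^sub>L y) = lreg r' o\<^sub>L (lreg r o\<^sub>L t)" by (simp add: lreg_compose r r')
  have NI: "lreg (r' o\<^sub>L y) \<in> T.NI" unfolding eq by (intro T.NI_compose r' r tb)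
  have "aff_mult (gr (lreg (r' o\<^sub>L y))) u = aff_mult (gr (lreg r' o\<^sub>L lreg r)) (aff_mult (gr t) u)"
    unfolding eq blinfun_compose_assoc[symmetric]
    by (simp add: T.gr_mult hcomm_compose lreg_N r r' T.NI_N[OF tb(1)] T.aff_mult_assoc T.gr_aff u T.aff_mult_closed)
  also have "\<dots> = gr (lreg z)"
    unfolding tb(3) r'(4)[symmetric]
    by (simp add: T.gr_mult hcomm_compose lreg_N r r' tb flip: blinfun_compose_assoc)
  finally have "aff_mult (gr (lreg (r' o\<^sub>L y))) u = gr (lreg z)" .
  moreover have "gr (lreg (r' o\<^sub>L y)) \<in> Units T.aff_ring"
    using T.gr_NI_unit[OF NI] T.gr_aff[OF T.NI_N[OF NI]]
    by (auto simp: Units_def T.aff_ring_def)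
  ultimately show ?thesis
    unfolding affiliated_ring_eq affiliated_incl_eq
    using r r' A_compose[OF r'(1) r(2)] by (auto simp: op_ring_def T.aff_ring_def)
qed

text \<open>This is \<open>ideal_hom_right_mult\<close> transported along the injective map
  \<open>lreg\<close>.\<close>

lemma affiliated_ideal_hom:
  assumes I: "I \<subseteq> carrier (op_ring A)" "\<zero>\<^bsub>op_ring A\<^esub> \<in> I"
    "\<And>x y. x \<in> I \<Longrightarrow> y \<in> I \<Longrightarrow> x \<oplus>\<^bsub>op_ring A\<^esub> y \<in> I"
    "\<And>a x. a \<in> carrier (op_ring A) \<Longrightarrow> x \<in> I \<Longrightarrow> a \<otimes>\<^bsub>op_ring A\<^esub> x \<in> I"
    and f: "\<And>x. x \<in> I \<Longrightarrow> f x \<in> carrier (affiliated_ring A \<eta>)"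
    "\<And>a x. a \<in> carrier (op_ring A) \<Longrightarrow> x \<in> I \<Longrightarrow>
        f (a \<otimes>\<^bsub>op_ring A\<^esub> x) = affiliated_incl A \<eta> a \<otimes>\<^bsub>affiliated_ring A \<eta>\<^esub> f x"
  shows "\<exists>u\<in>carrier (affiliated_ring A \<eta>). \<forall>x\<in>I.
    f x = affiliated_incl A \<eta> x \<otimes>\<^bsub>affiliated_ring A \<eta>\<^esub> u"
proof -
  have IA: "x \<in> A" if "x \<in> I" for x using I(1) that by (auto simp: op_ring_def)
  define g where "g = inv_into A lreg"
  have g: "g (lreg a) = a" if "a \<in> A" for a
    unfolding g_def using that lreg_inject by (intro inv_into_f_f) (auto simp: inj_on_def)
  interpret ideal_hom G \<Omega> "lreg ` A" "lreg ` I" "\<lambda>x. f (g x)"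
  proof
    show "lreg ` A \<subseteq> T.N" using lreg_N by auto
    show "a o\<^sub>L b \<in> lreg ` A" if "a \<in> lreg ` A" "b \<in> lreg ` A" for a b
      using that by (auto simp: A_compose simp flip: lreg_compose)
    show "hadj a \<in> lreg ` A" if "a \<in> lreg ` A" for a using that by (auto simp: hadj_lreg A_hadj)
    show "\<exists>r\<in>lreg ` A \<inter> T.NI. r o\<^sub>L x \<in> lreg ` A" if "x \<in> T.N" for x
      using left_denominator[OF that] by blast
    show "lreg ` I \<subseteq> lreg ` A" using IA by auto
    show "0 \<in> lreg ` I" using I(2) by (intro image_eqI[of _ _ 0]) (simp_all add: op_ring_def)
    show "x + y \<in> lreg ` I" if "x \<in> lreg ` I" "y \<in> lreg ` I" for x y
      using that I(3) IA by (auto simp: op_ring_def simp flip: lreg_add)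
    show "a o\<^sub>L x \<in> lreg ` I" if "a \<in> lreg ` A" "x \<in> lreg ` I" for a x
      using that I(4) IA by (auto simp: op_ring_def simp flip: lreg_compose)
    show "f (g x) \<in> T.aff" if "x \<in> lreg ` I" for x
      using that f(1) IA by (auto simp: g affiliated_ring_eq T.aff_ring_def)
    show "f (g (a o\<^sub>L x)) = aff_mult (gr a) (f (g x))" if "a \<in> lreg ` A" "x \<in> lreg ` I" for a x
      using that f(2) IA
      by (auto simp: g op_ring_def A_compose affiliated_incl_eq affiliated_ring_eq T.aff_ring_def
          simp flip: lreg_compose)
  qed
  obtain u where u: "u \<in> T.aff" "\<And>x. x \<in> lreg ` I \<Longrightarrow> f (g x) = aff_mult (gr x) u"
    using ideal_hom_right_mult by blast
  have "f x = aff_mult (gr (lreg x)) u" if "x \<in> I" for x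
    using u(2)[of "lreg x"] that IA by (simp add: g)
  then show ?thesis using u(1) by (auto simp: affiliated_ring_eq affiliated_incl_eq T.aff_ring_def)
qed

end

section \<open>Extension of scalars\<close>

locale scalar_extension =
  fixes R :: "('r, 'a) ring_scheme" and U :: "('s, 'b) ring_scheme" and \<phi> :: "'r \<Rightarrow> 's"
    and M :: "('r, 'm, 'c) module_scheme"
  assumes U: "ring U" and hom: "\<phi> \<in> ring_hom R U" and M: "left_module R M"
begin

sublocale U: ring U by (rule U)
sublocale M: left_module R M by (rule M)

abbreviation F where "F \<equiv> free_Abelian_group (carrier U \<times> carrier M)"
abbreviation K where "K \<equiv> tensor_null R U \<phi> M"
abbreviation T where "T \<equiv> extend_scalars R U \<phi> M"
abbreviation pure where "pure \<equiv> pure_tensor R U \<phi> M"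

lemma hom_closed: "r \<in> carrier R \<Longrightarrow> \<phi> r \<in> carrier U"
  using hom by (rule ring_hom_closed)

lemma F_diff: "x \<in> carrier F \<Longrightarrow> y \<in> carrier F \<Longrightarrow> x - y \<in> carrier F"
  using keys_diff[of x y] by auto

lemma F_add: "x \<in> carrier F \<Longrightarrow> y \<in> carrier F \<Longrightarrow> x + y \<in> carrier F"
  using keys_add[of x y] by auto

lemma F_of: "s \<in> carrier U \<Longrightarrow> m \<in> carrier M \<Longrightarrow> frag_of (s, m) \<in> carrier F"
  by (simp del: carrier_free_Abelian_group_iff)

lemma tensor_relations_cases [consumes 1, case_names add_left add_right balanced]:
  assumes "x \<in> tensor_relations R U \<phi> M"
  obtains s t m where "s \<in> carrier U" "t \<in> carrier U" "m \<in> carrier M"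
      "x = frag_of (s \<oplus>\<^bsub>U\<^esub> t, m) - frag_of (s, m) - frag_of (t, m)"
    | s m n where "s \<in> carrier U" "m \<in> carrier M" "n \<in> carrier M"
      "x = frag_of (s, m \<oplus>\<^bsub>M\<^esub> n) - frag_of (s, m) - frag_of (s, n)"
    | s r m where "s \<in> carrier U" "r \<in> carrier R" "m \<in> carrier M"
      "x = frag_of (s \<otimes>\<^bsub>U\<^esub> \<phi> r, m) - frag_of (s, r \<odot>\<^bsub>M\<^esub> m)"
  using assms unfolding tensor_relations_def
  by (elim UnE CollectE exE conjE)
    ((rule that(1), assumption+) | (rule that(2), assumption+) | (rule that(3), assumption+))+

lemma relations_F: "tensor_relations R U \<phi> M \<subseteq> carrier F"
  unfolding tensor_relations_def using hom_closed
  by (auto simp del: carrier_free_Abelian_group_iff intro!: F_diff F_of)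

lemma subgroup_K: "subgroup K F"
  unfolding tensor_null_def by (rule group.generate_is_subgroup[OF group_free_Abelian_group relations_F])

lemma K_F: "x \<in> K \<Longrightarrow> x \<in> carrier F"
  using subgroup.subset[OF subgroup_K] by blast

lemma K_0: "0 \<in> K" using subgroup.one_closed[OF subgroup_K] by simp

lemma K_add: "x \<in> K \<Longrightarrow> y \<in> K \<Longrightarrow> x + y \<in> K" using subgroup.m_closed[OF subgroup_K] by simp

lemma K_uminus: "x \<in> K \<Longrightarrow> - x \<in> K"
  using subgroup.m_inv_closed[OF subgroup_K, of x] K_F[of x] by simp

lemma K_relation: "x \<in> tensor_relations R U \<phi> M \<Longrightarrow> x \<in> K"
  unfolding tensor_null_def by (rule generate.incl)

lemma coset_def: "K #>\<^bsub>F\<^esub> x = (\<lambda>k. k + x) ` K"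
  by (auto simp: r_coset_def)

lemma coset_eqI: assumes "x - y \<in> K" shows "K #>\<^bsub>F\<^esub> x = K #>\<^bsub>F\<^esub> y"
proof -
  have *: "K #>\<^bsub>F\<^esub> a \<subseteq> K #>\<^bsub>F\<^esub> b" if "a - b \<in> K" for a b
  proof
    fix z assume "z \<in> K #>\<^bsub>F\<^esub> a"
    then obtain k where "k \<in> K" "z = k + a" by (auto simp: coset_def)
    then show "z \<in> K #>\<^bsub>F\<^esub> b"
      unfolding coset_def using K_add[OF \<open>k \<in> K\<close> that] by (intro image_eqI[of _ _ "k + (a - b)"]) auto
  qed
  have "y - x \<in> K" using K_uminus[OF assms] by simp
  then show ?thesis using *[OF assms] *[of y x] by blast
qed

lemma coset_eqD:
  assumes "K #>\<^bsub>F\<^esub> x = K #>\<^bsub>F\<^esub> y" shows "x - y \<in> K"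
proof -
  have "x \<in> K #>\<^bsub>F\<^esub> x" unfolding coset_def using K_0 by (intro image_eqI[of _ _ 0]) auto
  then have "x \<in> K #>\<^bsub>F\<^esub> y" using assms by simp
  then show ?thesis by (auto simp: coset_def)
qed

lemma normal_K: "K \<lhd> F"
  by (rule comm_group.subgroup_imp_normal[OF abelian_free_Abelian_group subgroup_K])

lemma carrier_T: "carrier T = (\<lambda>x. K #>\<^bsub>F\<^esub> x) ` carrier F"
  by (simp add: extend_scalars_def Let_def carrier_FactGroup)

lemma zero_T: "\<zero>\<^bsub>T\<^esub> = K #>\<^bsub>F\<^esub> 0"
  by (simp add: extend_scalars_def Let_def coset_def)

lemma add_T: "x \<in> carrier F \<Longrightarrow> y \<in> carrier F \<Longrightarrow> (K #>\<^bsub>F\<^esub> x) \<oplus>\<^bsub>T\<^esub> (K #>\<^bsub>F\<^esub> y) = K #>\<^bsub>F\<^esub> (x + y)"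
  using normal.rcos_sum[OF normal_K, of x y] by (simp add: extend_scalars_def Let_def)

lemma abelian_group_T: "abelian_group T"
proof -
  interpret Q: comm_group "F Mod K"
    by (rule comm_group.abelian_FactGroup[OF abelian_free_Abelian_group subgroup_K])
  have T: "carrier T = carrier (F Mod K)" "x \<oplus>\<^bsub>T\<^esub> y = x \<otimes>\<^bsub>F Mod K\<^esub> y" "\<zero>\<^bsub>T\<^esub> = \<one>\<^bsub>F Mod K\<^esub>" for x y
    by (simp_all add: extend_scalars_def Let_def)
  show ?thesis
    by (rule abelian_groupI, unfold T)
      (rule Q.m_closed Q.one_closed Q.m_assoc Q.m_comm Q.l_one Q.l_inv_ex; assumption)+
qed

sublocale T: abelian_group T by (rule abelian_group_T)

definition lmult :: "'s \<Rightarrow> ('s \<times> 'm \<Rightarrow>\<^sub>0 int) \<Rightarrow> ('s \<times> 'm \<Rightarrow>\<^sub>0 int)" where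
  "lmult s = frag_extend (\<lambda>(t, m). frag_of (s \<otimes>\<^bsub>U\<^esub> t, m))"

lemma lmult_simps [simp]:
  "lmult s 0 = 0" "lmult s (x + y) = lmult s x + lmult s y" "lmult s (x - y) = lmult s x - lmult s y"
  "lmult s (- x) = - lmult s x" "lmult s (frag_of (t, m)) = frag_of (s \<otimes>\<^bsub>U\<^esub> t, m)"
  by (simp_all add: lmult_def frag_extend_add frag_extend_diff frag_extend_minus)

lemma lmult_F: assumes s: "s \<in> carrier U" and x: "x \<in> carrier F" shows "lmult s x \<in> carrier F"
proof -
  have "Poly_Mapping.keys x \<subseteq> carrier U \<times> carrier M" using x by simp
  then show ?thesis
  proof (rule free_Abelian_group_induct)
    show "lmult s 0 \<in> carrier F" by simp
    show "lmult s (x - y) \<in> carrier F" if "lmult s x \<in> carrier F" "lmult s y \<in> carrier F" for x y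
      unfolding lmult_simps using that by (rule F_diff)
    show "lmult s (frag_of a) \<in> carrier F" if "a \<in> carrier U \<times> carrier M" for a
      using that s F_of by (cases a) (simp del: carrier_free_Abelian_group_iff)
  qed
qed

text \<open>Left multiplication sends each defining relation to a relation of the same kind, so it
  descends to cosets.\<close>

lemma lmult_K: assumes s: "s \<in> carrier U" and x: "x \<in> K" shows "lmult s x \<in> K"
proof -
  have rel: "lmult s x \<in> K" if "x \<in> tensor_relations R U \<phi> M" for x
  proof (rule K_relation)
    from that show "lmult s x \<in> tensor_relations R U \<phi> M"
    proof (cases rule: tensor_relations_cases)
      case (add_left t t' m)
      then have "lmult s x = frag_of ((s \<otimes>\<^bsub>U\<^esub> t) \<oplus>\<^bsub>U\<^esub> (s \<otimes>\<^bsub>U\<^esub> t'), m)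
          - frag_of (s \<otimes>\<^bsub>U\<^esub> t, m) - frag_of (s \<otimes>\<^bsub>U\<^esub> t', m)"
        using s by (simp add: U.r_distr)
      then show ?thesis using add_left s U.m_closed unfolding tensor_relations_def by blast
    next
      case (add_right t m n)
      then show ?thesis using s U.m_closed unfolding tensor_relations_def by auto
    next
      case (balanced t r m)
      then have "lmult s x = frag_of ((s \<otimes>\<^bsub>U\<^esub> t) \<otimes>\<^bsub>U\<^esub> \<phi> r, m) - frag_of (s \<otimes>\<^bsub>U\<^esub> t, r \<odot>\<^bsub>M\<^esub> m)"
        using s hom_closed by (simp add: U.m_assoc)
      then show ?thesis using balanced s U.m_closed unfolding tensor_relations_def by blast
    qed
  qed
  have "x \<in> generate F (tensor_relations R U \<phi> M)" using x by (simp add: tensor_null_def)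
  then show ?thesis
  proof (induction x rule: generate.induct)
    case one then show ?case by (simp add: K_0)
  next
    case (incl h) then show ?case by (rule rel)
  next
    case (inv h)
    then have "h \<in> carrier F" using relations_F by blast
    then show ?case using K_uminus[OF rel[OF inv]] by simp
  next
    case (eng x y) then show ?case by (simp add: K_add)
  qed
qed

lemma smult_T:
  assumes s: "s \<in> carrier U" and x: "x \<in> carrier F"
  shows "s \<odot>\<^bsub>T\<^esub> (K #>\<^bsub>F\<^esub> x) = K #>\<^bsub>F\<^esub> lmult s x"
proof -
  have const: "K #>\<^bsub>F\<^esub> lmult s y = K #>\<^bsub>F\<^esub> lmult s x" if "y \<in> K #>\<^bsub>F\<^esub> x" for y
  proof (rule coset_eqI)
    from that obtain k where "k \<in> K" "y = k + x" by (auto simp: coset_def)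
    then show "lmult s y - lmult s x \<in> K" using lmult_K[OF s] by simp
  qed
  have "K #>\<^bsub>F\<^esub> x \<noteq> {}" unfolding coset_def using K_0 by auto
  then have "(\<Union>y\<in>K #>\<^bsub>F\<^esub> x. K #>\<^bsub>F\<^esub> lmult s y) = K #>\<^bsub>F\<^esub> lmult s x"
    using const by (rule SUP_eq_const)
  then show ?thesis by (simp add: extend_scalars_def Let_def lmult_def)
qed

section \<open>Pure tensors, induction and the universal property\<close>

lemma pure_eq: "pure s m = K #>\<^bsub>F\<^esub> frag_of (s, m)"
  by (simp add: pure_tensor_def)

lemma pure_T: "s \<in> carrier U \<Longrightarrow> m \<in> carrier M \<Longrightarrow> pure s m \<in> carrier T"
  unfolding carrier_T pure_eq by (intro imageI F_of)

lemma pure_add_left: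
  assumes "s \<in> carrier U" "t \<in> carrier U" "m \<in> carrier M"
  shows "pure (s \<oplus>\<^bsub>U\<^esub> t) m = pure s m \<oplus>\<^bsub>T\<^esub> pure t m"
proof -
  have "frag_of (s \<oplus>\<^bsub>U\<^esub> t, m) - frag_of (s, m) - frag_of (t, m) \<in> K"
    using assms by (intro K_relation) (auto simp: tensor_relations_def)
  then have "frag_of (s \<oplus>\<^bsub>U\<^esub> t, m) - (frag_of (s, m) + frag_of (t, m)) \<in> K" by (simp add: diff_diff_eq)
  from coset_eqI[OF this] show ?thesis using assms by (simp add: pure_eq add_T F_of del: carrier_free_Abelian_group_iff)
qed

lemma pure_add_right:
  assumes "s \<in> carrier U" "m \<in> carrier M" "n \<in> carrier M"
  shows "pure s (m \<oplus>\<^bsub>M\<^esub> n) = pure s m \<oplus>\<^bsub>T\<^esub> pure s n"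
proof -
  have "frag_of (s, m \<oplus>\<^bsub>M\<^esub> n) - frag_of (s, m) - frag_of (s, n) \<in> K"
    using assms by (intro K_relation) (auto simp: tensor_relations_def)
  then have "frag_of (s, m \<oplus>\<^bsub>M\<^esub> n) - (frag_of (s, m) + frag_of (s, n)) \<in> K" by (simp add: diff_diff_eq)
  from coset_eqI[OF this] show ?thesis using assms by (simp add: pure_eq add_T F_of del: carrier_free_Abelian_group_iff)
qed

lemma pure_balanced:
  assumes "s \<in> carrier U" "r \<in> carrier R" "m \<in> carrier M"
  shows "pure (s \<otimes>\<^bsub>U\<^esub> \<phi> r) m = pure s (r \<odot>\<^bsub>M\<^esub> m)"
  unfolding pure_eq using assms
  by (intro coset_eqI K_relation) (auto simp: tensor_relations_def)

lemma smult_pure: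
  assumes "s \<in> carrier U" "t \<in> carrier U" "m \<in> carrier M"
  shows "s \<odot>\<^bsub>T\<^esub> pure t m = pure (s \<otimes>\<^bsub>U\<^esub> t) m"
  using assms by (simp add: pure_eq smult_T F_of del: carrier_free_Abelian_group_iff)

lemma smult_T_closed: "s \<in> carrier U \<Longrightarrow> x \<in> carrier T \<Longrightarrow> s \<odot>\<^bsub>T\<^esub> x \<in> carrier T"
  unfolding carrier_T by (auto simp: smult_T lmult_F simp del: carrier_free_Abelian_group_iff)

lemma smult_T_add:
  assumes "s \<in> carrier U" "x \<in> carrier T" "y \<in> carrier T"
  shows "s \<odot>\<^bsub>T\<^esub> (x \<oplus>\<^bsub>T\<^esub> y) = s \<odot>\<^bsub>T\<^esub> x \<oplus>\<^bsub>T\<^esub> s \<odot>\<^bsub>T\<^esub> y"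
  using assms unfolding carrier_T
  by (auto simp: smult_T add_T lmult_F F_add simp del: carrier_free_Abelian_group_iff)

lemma smult_T_zero: "s \<in> carrier U \<Longrightarrow> s \<odot>\<^bsub>T\<^esub> \<zero>\<^bsub>T\<^esub> = \<zero>\<^bsub>T\<^esub>"
  using smult_T[of s 0] by (simp add: zero_T)

text \<open>Minus a pure tensor is again pure, with the sign moved into the scalar. Induction on the
  free abelian group proceeds by differences, so the claim is carried for \<open>y\<close> and
  \<open>- y\<close> together.\<close>

lemma T_induct [consumes 1, case_names zero pure add]:
  assumes x: "x \<in> carrier T" and zero: "P \<zero>\<^bsub>T\<^esub>"
    and pure: "\<And>s m. s \<in> carrier U \<Longrightarrow> m \<in> carrier M \<Longrightarrow> P (pure s m)"
    and add: "\<And>x y. x \<in> carrier T \<Longrightarrow> y \<in> carrier T \<Longrightarrow> P x \<Longrightarrow> P y \<Longrightarrow> P (x \<oplus>\<^bsub>T\<^esub> y)"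
  shows "P x"
proof -
  have neg: "K #>\<^bsub>F\<^esub> (- frag_of (s, m)) = pure (\<ominus>\<^bsub>U\<^esub> s) m" if sm: "s \<in> carrier U" "m \<in> carrier M" for s m
  proof -
    have z: "pure \<zero>\<^bsub>U\<^esub> m = \<zero>\<^bsub>T\<^esub>"
      using pure_add_left[of "\<zero>\<^bsub>U\<^esub>" "\<zero>\<^bsub>U\<^esub>" m] sm pure_T[of "\<zero>\<^bsub>U\<^esub>" m]
      by (metis T.add.l_cancel_one' U.l_zero U.zero_closed)
    have "pure (\<ominus>\<^bsub>U\<^esub> s) m \<oplus>\<^bsub>T\<^esub> pure s m = \<zero>\<^bsub>T\<^esub>"
      using pure_add_left[of "\<ominus>\<^bsub>U\<^esub> s" s m] sm z by (simp add: U.l_neg)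
    then have "K #>\<^bsub>F\<^esub> (frag_of (\<ominus>\<^bsub>U\<^esub> s, m) + frag_of (s, m)) = K #>\<^bsub>F\<^esub> 0"
      using sm by (simp add: pure_eq add_T F_of zero_T del: carrier_free_Abelian_group_iff)
    from K_uminus[OF coset_eqD[OF this]]
    have "- frag_of (s, m) - frag_of (\<ominus>\<^bsub>U\<^esub> s, m) \<in> K" by (subst minus_diff_commute) simp
    then show ?thesis unfolding pure_eq by (rule coset_eqI)
  qed
  have F_neg: "- y \<in> carrier F" if "y \<in> carrier F" for y using that by simp
  have "P (K #>\<^bsub>F\<^esub> y) \<and> P (K #>\<^bsub>F\<^esub> (- y))" if y: "Poly_Mapping.keys y \<subseteq> carrier U \<times> carrier M" for y
    using y
  proof (rule free_Abelian_group_induct)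
    show "P (K #>\<^bsub>F\<^esub> 0) \<and> P (K #>\<^bsub>F\<^esub> (- 0))" using zero by (simp add: zero_T)
  next
    fix x y
    assume k: "Poly_Mapping.keys x \<subseteq> carrier U \<times> carrier M" "Poly_Mapping.keys y \<subseteq> carrier U \<times> carrier M"
      and IH: "P (K #>\<^bsub>F\<^esub> x) \<and> P (K #>\<^bsub>F\<^esub> (- x))" "P (K #>\<^bsub>F\<^esub> y) \<and> P (K #>\<^bsub>F\<^esub> (- y))"
    have F: "x \<in> carrier F" "y \<in> carrier F" "- x \<in> carrier F" "- y \<in> carrier F" using k by auto
    have cT: "K #>\<^bsub>F\<^esub> z \<in> carrier T" if "z \<in> carrier F" for z unfolding carrier_T using that by (rule imageI)
    have "P ((K #>\<^bsub>F\<^esub> x) \<oplus>\<^bsub>T\<^esub> (K #>\<^bsub>F\<^esub> (- y)))" "P ((K #>\<^bsub>F\<^esub> y) \<oplus>\<^bsub>T\<^esub> (K #>\<^bsub>F\<^esub> (- x)))"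
      using IH by (auto intro!: add cT F simp del: carrier_free_Abelian_group_iff)
    then show "P (K #>\<^bsub>F\<^esub> (x - y)) \<and> P (K #>\<^bsub>F\<^esub> (- (x - y)))"
      using F by (simp add: add_T del: carrier_free_Abelian_group_iff)
  next
    fix a assume "a \<in> carrier U \<times> carrier M"
    then obtain s m where a: "a = (s, m)" "s \<in> carrier U" "m \<in> carrier M" by auto
    then show "P (K #>\<^bsub>F\<^esub> frag_of a) \<and> P (K #>\<^bsub>F\<^esub> (- frag_of a))"
      using pure[of s m] pure[of "\<ominus>\<^bsub>U\<^esub> s" m] by (simp add: neg flip: pure_eq)
  qed
  then show ?thesis using x unfolding carrier_T by auto
qed

lemma left_module_T: "left_module U T"
proof (intro left_module.intro left_module_axioms.intro U abelian_group_T)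
  show "s \<odot>\<^bsub>T\<^esub> x \<in> carrier T" if "s \<in> carrier U" "x \<in> carrier T" for s x
    using that by (rule smult_T_closed)
  show "s \<odot>\<^bsub>T\<^esub> (x \<oplus>\<^bsub>T\<^esub> y) = s \<odot>\<^bsub>T\<^esub> x \<oplus>\<^bsub>T\<^esub> s \<odot>\<^bsub>T\<^esub> y"
    if "s \<in> carrier U" "x \<in> carrier T" "y \<in> carrier T" for s x y using that by (rule smult_T_add)
  show "(s \<oplus>\<^bsub>U\<^esub> t) \<odot>\<^bsub>T\<^esub> x = s \<odot>\<^bsub>T\<^esub> x \<oplus>\<^bsub>T\<^esub> t \<odot>\<^bsub>T\<^esub> x"
    if st: "s \<in> carrier U" "t \<in> carrier U" and x: "x \<in> carrier T" for s t x
    using x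
  proof (induction rule: T_induct)
    case (pure u m)
    then show ?case using st by (simp add: smult_pure U.l_distr pure_add_left)
  next
    case (add x y)
    then show ?case using st by (simp add: smult_T_add smult_T_closed T.a_ac)
  qed (simp add: smult_T_zero st)
  show "(s \<otimes>\<^bsub>U\<^esub> t) \<odot>\<^bsub>T\<^esub> x = s \<odot>\<^bsub>T\<^esub> (t \<odot>\<^bsub>T\<^esub> x)"
    if st: "s \<in> carrier U" "t \<in> carrier U" and x: "x \<in> carrier T" for s t x
    using x
  proof (induction rule: T_induct)
    case (pure u m)
    then show ?case using st by (simp add: smult_pure U.m_assoc)
  next
    case (add x y)
    then show ?case using st by (simp add: smult_T_add smult_T_closed)
  qed (simp add: smult_T_zero st)
  show "\<one>\<^bsub>U\<^esub> \<odot>\<^bsub>T\<^esub> x = x" if "x \<in> carrier T" for x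
    using that by (induction rule: T_induct) (simp_all add: smult_T_zero smult_T_add smult_pure)
qed

text \<open>The universal property for balanced maps. It yields an additive map; linearity is
  checked afterwards on pure tensors.\<close>

lemma T_lift:
  assumes B: "abelian_group B"
    and closed: "\<And>s m. s \<in> carrier U \<Longrightarrow> m \<in> carrier M \<Longrightarrow> \<beta> s m \<in> carrier B"
    and addl: "\<And>s t m. s \<in> carrier U \<Longrightarrow> t \<in> carrier U \<Longrightarrow> m \<in> carrier M \<Longrightarrow>
        \<beta> (s \<oplus>\<^bsub>U\<^esub> t) m = \<beta> s m \<oplus>\<^bsub>B\<^esub> \<beta> t m"
    and addr: "\<And>s m n. s \<in> carrier U \<Longrightarrow> m \<in> carrier M \<Longrightarrow> n \<in> carrier M \<Longrightarrow>
        \<beta> s (m \<oplus>\<^bsub>M\<^esub> n) = \<beta> s m \<oplus>\<^bsub>B\<^esub> \<beta> s n"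
    and bal: "\<And>s r m. s \<in> carrier U \<Longrightarrow> r \<in> carrier R \<Longrightarrow> m \<in> carrier M \<Longrightarrow>
        \<beta> (s \<otimes>\<^bsub>U\<^esub> \<phi> r) m = \<beta> s (r \<odot>\<^bsub>M\<^esub> m)"
  obtains h where "\<And>x. x \<in> carrier T \<Longrightarrow> h x \<in> carrier B"
    "\<And>x y. x \<in> carrier T \<Longrightarrow> y \<in> carrier T \<Longrightarrow> h (x \<oplus>\<^bsub>T\<^esub> y) = h x \<oplus>\<^bsub>B\<^esub> h y"
    "\<And>s m. s \<in> carrier U \<Longrightarrow> m \<in> carrier M \<Longrightarrow> h (pure s m) = \<beta> s m"
proof -
  interpret B: abelian_group B by (rule B)
  have "(\<lambda>(s, m). \<beta> s m) ` (carrier U \<times> carrier M) \<subseteq> carrier (add_monoid B)" using closed by auto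
  from comm_group.free_Abelian_group_universal[OF B.a_comm_group this]
  obtain h where h: "h \<in> hom F (add_monoid B)"
    and h_of: "\<And>z. z \<in> carrier U \<times> carrier M \<Longrightarrow> h (frag_of z) = (\<lambda>(s, m). \<beta> s m) z" by blast
  have h_closed: "h x \<in> carrier B" if "x \<in> carrier F" for x using hom_in_carrier[OF h that] by simp
  have h_add: "h (x + y) = h x \<oplus>\<^bsub>B\<^esub> h y" if "x \<in> carrier F" "y \<in> carrier F" for x y
    using hom_mult[OF h that] by simp
  have h_diff: "h (x - y) = h x \<ominus>\<^bsub>B\<^esub> h y" if "x \<in> carrier F" "y \<in> carrier F" for x y
  proof -
    have "h x = h (x - y) \<oplus>\<^bsub>B\<^esub> h y" using h_add[OF F_diff[OF that] that(2)] by simp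
    then show ?thesis using h_closed[OF F_diff[OF that]] h_closed[OF that(2)]
      by (simp add: a_minus_def B.a_assoc B.r_neg)
  qed
  have h_0: "h 0 = \<zero>\<^bsub>B\<^esub>" using h_diff[of 0 0] h_closed[of 0] by (simp add: a_minus_def B.r_neg)
  have rel: "h x = \<zero>\<^bsub>B\<^esub>" if "x \<in> tensor_relations R U \<phi> M" for x
  proof -
    have b: "(a \<oplus>\<^bsub>B\<^esub> b) \<ominus>\<^bsub>B\<^esub> a \<ominus>\<^bsub>B\<^esub> b = \<zero>\<^bsub>B\<^esub>" if "a \<in> carrier B" "b \<in> carrier B" for a b
      using that B.r_neg[of "a \<oplus>\<^bsub>B\<^esub> b"] by (simp add: a_minus_def B.minus_add B.a_assoc)
    from that show ?thesis
    proof (cases rule: tensor_relations_cases)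
      case A: (add_left s t m)
      then show ?thesis
        by (simp add: h_diff F_diff F_of h_of addl b closed del: carrier_free_Abelian_group_iff)
    next
      case A: (add_right s m n)
      then show ?thesis
        by (simp add: h_diff F_diff F_of h_of addr b closed del: carrier_free_Abelian_group_iff)
    next
      case A: (balanced s r m)
      then show ?thesis
        by (simp add: h_diff F_diff F_of h_of bal closed hom_closed a_minus_def B.r_neg
            del: carrier_free_Abelian_group_iff)
    qed
  qed
  have h_K: "h x = \<zero>\<^bsub>B\<^esub>" if "x \<in> K" for x
  proof -
    have "x \<in> generate F (tensor_relations R U \<phi> M)" using that by (simp add: tensor_null_def)
    then show ?thesis
    proof (induction x rule: generate.induct)
      case (inv x)
      then have x: "x \<in> carrier F" using relations_F by blast
      then have "inv\<^bsub>F\<^esub> x = 0 - x" by simp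
      then show ?case using h_diff[OF _ x, of 0] h_0 rel[OF inv] by (simp add: a_minus_def)
    next
      case (eng x y)
      then have "x \<in> carrier F" "y \<in> carrier F" using K_F unfolding tensor_null_def by blast+
      then show ?case using eng by (simp add: h_add del: carrier_free_Abelian_group_iff)
    qed (auto simp: h_0 rel)
  qed
  have "h x = h y" if xy: "x \<in> carrier F" "y \<in> carrier F" "K #>\<^bsub>F\<^esub> x = K #>\<^bsub>F\<^esub> y" for x y
  proof -
    have "h (x - y) = \<zero>\<^bsub>B\<^esub>" by (rule h_K[OF coset_eqD[OF xy(3)]])
    then show ?thesis
      using h_add[OF F_diff[OF xy(1,2)] xy(2)] h_closed[OF xy(2)] by simp
  qed
  from FactGroup_universal[OF h normal_K this]
  obtain g where g: "g \<in> hom (F Mod K) (add_monoid B)" "\<And>x. x \<in> carrier F \<Longrightarrow> g (K #>\<^bsub>F\<^esub> x) = h x" by blast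
  show thesis
  proof
    show "g x \<in> carrier B" if "x \<in> carrier T" for x
      using that unfolding carrier_T by (auto simp: g h_closed simp del: carrier_free_Abelian_group_iff)
    show "g (x \<oplus>\<^bsub>T\<^esub> y) = g x \<oplus>\<^bsub>B\<^esub> g y" if "x \<in> carrier T" "y \<in> carrier T" for x y
      using that unfolding carrier_T
      by (auto simp: g h_add add_T F_add simp del: carrier_free_Abelian_group_iff)
    show "g (pure s m) = \<beta> s m" if "s \<in> carrier U" "m \<in> carrier M" for s m
      using that by (simp add: pure_eq g F_of h_of del: carrier_free_Abelian_group_iff)
  qed
qed

end

section \<open>Left modules\<close>

context left_module
begin

lemma smult_r_zero: assumes "a \<in> carrier R" shows "a \<odot>\<^bsub>M\<^esub> \<zero>\<^bsub>M\<^esub> = \<zero>\<^bsub>M\<^esub>"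
proof -
  have "a \<odot>\<^bsub>M\<^esub> \<zero>\<^bsub>M\<^esub> = a \<odot>\<^bsub>M\<^esub> \<zero>\<^bsub>M\<^esub> \<oplus>\<^bsub>M\<^esub> a \<odot>\<^bsub>M\<^esub> \<zero>\<^bsub>M\<^esub>"
    using smult_r_distr[OF assms, of "\<zero>\<^bsub>M\<^esub>" "\<zero>\<^bsub>M\<^esub>"] by simp
  then show ?thesis using assms by (metis M.add.l_cancel_one' M.zero_closed smult_closed)
qed

lemma smult_l_zero: assumes "x \<in> carrier M" shows "\<zero> \<odot>\<^bsub>M\<^esub> x = \<zero>\<^bsub>M\<^esub>"
proof -
  have "\<zero> \<odot>\<^bsub>M\<^esub> x = \<zero> \<odot>\<^bsub>M\<^esub> x \<oplus>\<^bsub>M\<^esub> \<zero> \<odot>\<^bsub>M\<^esub> x"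
    using smult_l_distr[of "\<zero>" "\<zero>" x] assms by simp
  then show ?thesis using assms by (metis M.add.l_cancel_one' R.zero_closed smult_closed)
qed

lemma smult_l_minus:
  assumes "a \<in> carrier R" "x \<in> carrier M" shows "(\<ominus> a) \<odot>\<^bsub>M\<^esub> x = \<ominus>\<^bsub>M\<^esub> (a \<odot>\<^bsub>M\<^esub> x)"
proof -
  have "(\<ominus> a) \<odot>\<^bsub>M\<^esub> x \<oplus>\<^bsub>M\<^esub> a \<odot>\<^bsub>M\<^esub> x = \<zero>\<^bsub>M\<^esub>"
    using smult_l_distr[of "\<ominus> a" a x] assms by (simp add: R.l_neg smult_l_zero)
  then show ?thesis using assms by (intro M.minus_equality[symmetric]) auto
qed

lemma submoduleI':
  assumes "N \<subseteq> carrier M" "\<zero>\<^bsub>M\<^esub> \<in> N" "\<And>x y. x \<in> N \<Longrightarrow> y \<in> N \<Longrightarrow> x \<oplus>\<^bsub>M\<^esub> y \<in> N"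
    "\<And>a x. a \<in> carrier R \<Longrightarrow> x \<in> N \<Longrightarrow> a \<odot>\<^bsub>M\<^esub> x \<in> N"
  shows "submodule N R M"
proof -
  have "\<ominus>\<^bsub>M\<^esub> x \<in> N" if "x \<in> N" for x
  proof -
    have "(\<ominus> \<one>) \<odot>\<^bsub>M\<^esub> x \<in> N" using that by (intro assms(4)) auto
    then show ?thesis using that assms(1) smult_l_minus[of "\<one>" x] by auto
  qed
  then show ?thesis
    using assms by (intro submodule.intro subgroup.intro submodule_axioms.intro) (auto simp: a_inv_def)
qed

lemma submoduleD:
  assumes "submodule N R M"
  shows "N \<subseteq> carrier M" "\<zero>\<^bsub>M\<^esub> \<in> N" "\<And>x y. x \<in> N \<Longrightarrow> y \<in> N \<Longrightarrow> x \<oplus>\<^bsub>M\<^esub> y \<in> N"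
    "\<And>a x. a \<in> carrier R \<Longrightarrow> x \<in> N \<Longrightarrow> a \<odot>\<^bsub>M\<^esub> x \<in> N" "\<And>x. x \<in> N \<Longrightarrow> \<ominus>\<^bsub>M\<^esub> x \<in> N"
  using subgroup.subset[OF submodule.axioms(1)[OF assms]] subgroup.one_closed[OF submodule.axioms(1)[OF assms]]
    subgroup.m_closed[OF submodule.axioms(1)[OF assms]] submodule.smult_closed[OF assms]
    subgroup.m_inv_closed[OF submodule.axioms(1)[OF assms]] by (auto simp: a_inv_def)

lemma left_module_submodule:
  assumes "submodule N R M" shows "left_module R (M\<lparr>carrier := N\<rparr>)"
proof -
  note N = submoduleD[OF assms]
  have NM: "x \<in> carrier M" if "x \<in> N" for x using N(1) that by blast
  have ab: "abelian_group (M\<lparr>carrier := N\<rparr>)"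
  proof (rule abelian_groupI)
    show "\<exists>y\<in>carrier (M\<lparr>carrier := N\<rparr>). y \<oplus>\<^bsub>M\<lparr>carrier := N\<rparr>\<^esub> x = \<zero>\<^bsub>M\<lparr>carrier := N\<rparr>\<^esub>"
      if "x \<in> carrier (M\<lparr>carrier := N\<rparr>)" for x
      using that N by (intro bexI[of _ "\<ominus>\<^bsub>M\<^esub> x"]) (auto simp: M.l_neg)
  qed (use N NM in \<open>auto simp: M.a_assoc intro: M.a_comm\<close>)
  show ?thesis
    by (intro left_module.intro left_module_axioms.intro ab R.ring_axioms)
      (use N(4) NM in \<open>auto simp: smult_l_distr smult_r_distr smult_assoc\<close>)
qed

lemma smult_finsum:
  assumes "a \<in> carrier R" "finite J" "f \<in> J \<rightarrow> carrier M"
  shows "a \<odot>\<^bsub>M\<^esub> finsum M f J = finsum M (\<lambda>k. a \<odot>\<^bsub>M\<^esub> f k) J"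
  using assms(2,3)
proof (induction J rule: finite_induct)
  case empty
  then show ?case using assms(1) by (simp add: smult_r_zero)
next
  case (insert k J)
  then show ?case using assms(1)
    by (subst M.finsum_insert) (auto simp: M.finsum_insert smult_r_distr Pi_iff intro!: M.finsum_closed)
qed

lemma finite_sum_hom:
  assumes "abelian_group B" "finite J" "f \<in> J \<rightarrow> carrier M"
    and h: "\<And>x. x \<in> carrier M \<Longrightarrow> h x \<in> carrier B"
      "\<And>x y. x \<in> carrier M \<Longrightarrow> y \<in> carrier M \<Longrightarrow> h (x \<oplus>\<^bsub>M\<^esub> y) = h x \<oplus>\<^bsub>B\<^esub> h y"
  shows "h (finsum M f J) = finsum B (\<lambda>k. h (f k)) J"
proof -
  interpret B: abelian_group B by fact
  have h0: "h \<zero>\<^bsub>M\<^esub> = \<zero>\<^bsub>B\<^esub>"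
    using h(1)[OF M.zero_closed] h(2)[OF M.zero_closed M.zero_closed]
    by (metis B.add.l_cancel_one' M.l_zero M.zero_closed)
  show ?thesis using assms(2,3)
  proof (induction J rule: finite_induct)
    case empty then show ?case by (simp add: h0)
  next
    case (insert k J)
    then show ?case
      by (subst M.finsum_insert) (auto simp: B.finsum_insert h Pi_iff intro!: M.finsum_closed)
  qed
qed

end

lemma lmod_homD:
  assumes "f \<in> lmod_hom R M N"
  shows "x \<in> carrier M \<Longrightarrow> f x \<in> carrier N"
    "x \<in> carrier M \<Longrightarrow> y \<in> carrier M \<Longrightarrow> f (x \<oplus>\<^bsub>M\<^esub> y) = f x \<oplus>\<^bsub>N\<^esub> f y"
    "a \<in> carrier R \<Longrightarrow> x \<in> carrier M \<Longrightarrow> f (a \<odot>\<^bsub>M\<^esub> x) = a \<odot>\<^bsub>N\<^esub> f x"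
  using assms by (auto simp: lmod_hom_def)

lemma lmod_hom_zero:
  assumes "left_module R M" "left_module R N" "f \<in> lmod_hom R M N"
  shows "f \<zero>\<^bsub>M\<^esub> = \<zero>\<^bsub>N\<^esub>"
proof -
  interpret M: left_module R M by fact
  interpret N: left_module R N by fact
  have "f \<zero>\<^bsub>M\<^esub> = f (\<zero>\<^bsub>R\<^esub> \<odot>\<^bsub>M\<^esub> \<zero>\<^bsub>M\<^esub>)" by (simp add: M.smult_r_zero)
  also have "\<dots> = \<zero>\<^bsub>R\<^esub> \<odot>\<^bsub>N\<^esub> f \<zero>\<^bsub>M\<^esub>" by (intro lmod_homD[OF assms(3)]) auto
  also have "\<dots> = \<zero>\<^bsub>N\<^esub>" by (intro N.smult_l_zero lmod_homD[OF assms(3)]) auto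
  finally show ?thesis .
qed

text \<open>The regular left module, whose submodules are the left ideals.\<close>

definition ring_module :: "('r, 'a) ring_scheme \<Rightarrow> ('r, 'r) module" where
  "ring_module R = \<lparr>carrier = carrier R, monoid.mult = undefined, monoid.one = undefined,
     ring.zero = \<zero>\<^bsub>R\<^esub>, ring.add = (\<oplus>\<^bsub>R\<^esub>), smult = (\<otimes>\<^bsub>R\<^esub>)\<rparr>"

lemma left_module_ring_module:
  assumes "ring R" shows "left_module R (ring_module R)"
proof -
  interpret ring R by fact
  have ab: "abelian_group (ring_module R)"
  proof (rule abelian_groupI)
    show "\<exists>y\<in>carrier (ring_module R). y \<oplus>\<^bsub>ring_module R\<^esub> x = \<zero>\<^bsub>ring_module R\<^esub>"
      if "x \<in> carrier (ring_module R)" for x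
      using that by (intro bexI[of _ "\<ominus>\<^bsub>R\<^esub> x"]) (auto simp: ring_module_def l_neg)
  qed (auto simp: ring_module_def a_assoc intro: a_comm)
  show ?thesis
    by (intro left_module.intro left_module_axioms.intro ab assms)
      (auto simp: ring_module_def l_distr r_distr m_assoc)
qed

section \<open>Baer's criterion\<close>

text \<open>Extending \<open>f\<close> to the whole ring amounts to choosing the image
  \<open>e\<close> of 1.\<close>

definition baer_property :: "('r, 'a) ring_scheme \<Rightarrow> ('r, 'e, 'b) module_scheme \<Rightarrow> bool" where
  "baer_property R E \<longleftrightarrow> (\<forall>I f. submodule I R (ring_module R) \<and>
     f \<in> lmod_hom R ((ring_module R)\<lparr>carrier := I\<rparr>) E \<longrightarrow>
     (\<exists>e\<in>carrier E. \<forall>x\<in>I. f x = x \<odot>\<^bsub>E\<^esub> e))"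

locale baer_extension =
  fixes R :: "('r, 'a) ring_scheme" and E :: "('r, 'e, 'b) module_scheme"
    and L :: "('r, 'l, 'c) module_scheme"
  assumes E: "left_module R E" and L: "left_module R L" and baer: "baer_property R E"
begin

sublocale E: left_module R E by (rule E)
sublocale L: left_module R L by (rule L)

text \<open>Graphs of homomorphisms from submodules of \<open>L\<close> to \<open>E\<close>.\<close>

definition partial_hom :: "('l \<times> 'e) set \<Rightarrow> bool" where
  "partial_hom \<Gamma> \<longleftrightarrow> \<Gamma> \<subseteq> carrier L \<times> carrier E \<and> (\<zero>\<^bsub>L\<^esub>, \<zero>\<^bsub>E\<^esub>) \<in> \<Gamma> \<and>
     (\<forall>x y x' y'. (x, y) \<in> \<Gamma> \<and> (x', y') \<in> \<Gamma> \<longrightarrow> (x \<oplus>\<^bsub>L\<^esub> x', y \<oplus>\<^bsub>E\<^esub> y') \<in> \<Gamma>) \<and>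
     (\<forall>a\<in>carrier R. \<forall>x y. (x, y) \<in> \<Gamma> \<longrightarrow> (a \<odot>\<^bsub>L\<^esub> x, a \<odot>\<^bsub>E\<^esub> y) \<in> \<Gamma>) \<and>
     (\<forall>y. (\<zero>\<^bsub>L\<^esub>, y) \<in> \<Gamma> \<longrightarrow> y = \<zero>\<^bsub>E\<^esub>)"

lemma partial_homD:
  assumes "partial_hom \<Gamma>"
  shows "(x, y) \<in> \<Gamma> \<Longrightarrow> x \<in> carrier L" "(x, y) \<in> \<Gamma> \<Longrightarrow> y \<in> carrier E" "(\<zero>\<^bsub>L\<^esub>, \<zero>\<^bsub>E\<^esub>) \<in> \<Gamma>"
    "(x, y) \<in> \<Gamma> \<Longrightarrow> (x', y') \<in> \<Gamma> \<Longrightarrow> (x \<oplus>\<^bsub>L\<^esub> x', y \<oplus>\<^bsub>E\<^esub> y') \<in> \<Gamma>"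
    "a \<in> carrier R \<Longrightarrow> (x, y) \<in> \<Gamma> \<Longrightarrow> (a \<odot>\<^bsub>L\<^esub> x, a \<odot>\<^bsub>E\<^esub> y) \<in> \<Gamma>"
    "(\<zero>\<^bsub>L\<^esub>, y) \<in> \<Gamma> \<Longrightarrow> y = \<zero>\<^bsub>E\<^esub>"
  using assms unfolding partial_hom_def by blast+

lemma partial_hom_diff:
  assumes \<Gamma>: "partial_hom \<Gamma>" and xy: "(x, y) \<in> \<Gamma>" "(x', y') \<in> \<Gamma>"
  shows "(x \<ominus>\<^bsub>L\<^esub> x', y \<ominus>\<^bsub>E\<^esub> y') \<in> \<Gamma>"
proof -
  note D = partial_homD[OF \<Gamma>]
  have "((\<ominus>\<^bsub>R\<^esub> \<one>\<^bsub>R\<^esub>) \<odot>\<^bsub>L\<^esub> x', (\<ominus>\<^bsub>R\<^esub> \<one>\<^bsub>R\<^esub>) \<odot>\<^bsub>E\<^esub> y') \<in> \<Gamma>"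
    using xy by (intro D) auto
  then have "(\<ominus>\<^bsub>L\<^esub> x', \<ominus>\<^bsub>E\<^esub> y') \<in> \<Gamma>"
    using D(1,2)[OF xy(2)] by (simp add: L.smult_l_minus E.smult_l_minus)
  then show ?thesis using D(4)[OF xy(1)] by (simp add: a_minus_def)
qed

lemma partial_hom_unique:
  assumes \<Gamma>: "partial_hom \<Gamma>" and xy: "(x, y) \<in> \<Gamma>" "(x, y') \<in> \<Gamma>" shows "y = y'"
proof -
  note D = partial_homD[OF \<Gamma>]
  have "(\<zero>\<^bsub>L\<^esub>, y \<ominus>\<^bsub>E\<^esub> y') \<in> \<Gamma>"
    using partial_hom_diff[OF \<Gamma> xy] D(1)[OF xy(1)] by (simp add: a_minus_def L.M.r_neg)
  then have 0: "y \<ominus>\<^bsub>E\<^esub> y' = \<zero>\<^bsub>E\<^esub>" by (rule D(6))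
  have "y = (y \<ominus>\<^bsub>E\<^esub> y') \<oplus>\<^bsub>E\<^esub> y'"
    using D(2)[OF xy(1)] D(2)[OF xy(2)] by (simp add: a_minus_def E.M.a_assoc E.M.l_neg)
  then show ?thesis using 0 D(2)[OF xy(2)] by simp
qed

text \<open>The scalars that carry \<open>x\<close> into the domain form a left ideal; the Baer
  property yields a value \<open>e\<close> for \<open>x\<close> compatible with \<Gamma> on it, and
  \<Gamma> is enlarged by the multiples of \<open>(x, e)\<close>.\<close>

lemma partial_hom_extend:
  assumes \<Gamma>: "partial_hom \<Gamma>" and x: "x \<in> carrier L"
  shows "\<exists>\<Gamma>'. partial_hom \<Gamma>' \<and> \<Gamma> \<subseteq> \<Gamma>' \<and> x \<in> Domain \<Gamma>'"
proof -
  note D = partial_homD[OF \<Gamma>]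
  define I where "I = {a \<in> carrier R. a \<odot>\<^bsub>L\<^esub> x \<in> Domain \<Gamma>}"
  define f where "f a = (THE y. (a \<odot>\<^bsub>L\<^esub> x, y) \<in> \<Gamma>)" for a
  have f_eq: "f a = y" if "(a \<odot>\<^bsub>L\<^esub> x, y) \<in> \<Gamma>" for a y
    unfolding f_def using that partial_hom_unique[OF \<Gamma>] by blast
  have f: "(a \<odot>\<^bsub>L\<^esub> x, f a) \<in> \<Gamma>" if "a \<in> I" for a
    using that f_eq by (auto simp: I_def)
  interpret RM: left_module R "ring_module R"
    by (rule left_module_ring_module[OF E.R.ring_axioms])
  have I_add: "(( a \<oplus>\<^bsub>R\<^esub> b) \<odot>\<^bsub>L\<^esub> x, f a \<oplus>\<^bsub>E\<^esub> f b) \<in> \<Gamma>" if "a \<in> I" "b \<in> I" for a b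
    using D(4)[OF f[OF that(1)] f[OF that(2)]] that x by (simp add: I_def L.smult_l_distr)
  have I_mult: "((a \<otimes>\<^bsub>R\<^esub> b) \<odot>\<^bsub>L\<^esub> x, a \<odot>\<^bsub>E\<^esub> f b) \<in> \<Gamma>" if "a \<in> carrier R" "b \<in> I" for a b
    using D(5)[OF that(1) f[OF that(2)]] that x by (simp add: I_def L.smult_assoc)
  have sub_I: "submodule I R (ring_module R)"
  proof (rule RM.submoduleI')
    show "\<zero>\<^bsub>ring_module R\<^esub> \<in> I" using D(3) x by (auto simp: I_def ring_module_def L.smult_l_zero)
    show "a \<oplus>\<^bsub>ring_module R\<^esub> b \<in> I" if "a \<in> I" "b \<in> I" for a b
      using I_add[OF that] that by (auto simp: I_def ring_module_def)
    show "a \<odot>\<^bsub>ring_module R\<^esub> b \<in> I" if "a \<in> carrier R" "b \<in> I" for a b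
      using I_mult[OF that] that by (auto simp: I_def ring_module_def)
  qed (auto simp: I_def ring_module_def)
  have hom_f: "f \<in> lmod_hom R ((ring_module R)\<lparr>carrier := I\<rparr>) E"
    using D(2)[OF f] f_eq[OF I_add] f_eq[OF I_mult] by (auto simp: lmod_hom_def ring_module_def)
  from baer[unfolded baer_property_def, rule_format, OF conjI[OF sub_I hom_f]]
  obtain e where e: "e \<in> carrier E" "\<And>a. a \<in> I \<Longrightarrow> f a = a \<odot>\<^bsub>E\<^esub> e" by blast
  define \<Gamma>' where "\<Gamma>' = {(y \<oplus>\<^bsub>L\<^esub> a \<odot>\<^bsub>L\<^esub> x, z \<oplus>\<^bsub>E\<^esub> a \<odot>\<^bsub>E\<^esub> e) | y z a. (y, z) \<in> \<Gamma> \<and> a \<in> carrier R}"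
  have \<Gamma>'I: "(u, v) \<in> \<Gamma>'" if "(y, z) \<in> \<Gamma>" "a \<in> carrier R" "u = y \<oplus>\<^bsub>L\<^esub> a \<odot>\<^bsub>L\<^esub> x" "v = z \<oplus>\<^bsub>E\<^esub> a \<odot>\<^bsub>E\<^esub> e" for u v y z a
    using that unfolding \<Gamma>'_def by blast
  have sub: "\<Gamma> \<subseteq> \<Gamma>'"
  proof (rule subrelI)
    fix y z assume "(y, z) \<in> \<Gamma>"
    then show "(y, z) \<in> \<Gamma>'"
      using D(1,2) x e by (intro \<Gamma>'I[of y z "\<zero>\<^bsub>R\<^esub>"]) (auto simp: L.smult_l_zero E.smult_l_zero)
  qed
  have "(x, e) \<in> \<Gamma>'" using D(3) x e by (intro \<Gamma>'I[of "\<zero>\<^bsub>L\<^esub>" "\<zero>\<^bsub>E\<^esub>" "\<one>\<^bsub>R\<^esub>"]) auto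
  then have dom: "x \<in> Domain \<Gamma>'" by blast
  have "partial_hom \<Gamma>'"
    unfolding partial_hom_def
  proof (intro conjI allI impI ballI)
    show "\<Gamma>' \<subseteq> carrier L \<times> carrier E" using D(1,2) x e by (auto simp: \<Gamma>'_def)
    show "(\<zero>\<^bsub>L\<^esub>, \<zero>\<^bsub>E\<^esub>) \<in> \<Gamma>'" using D(3) sub by blast
    show "(u \<oplus>\<^bsub>L\<^esub> u', v \<oplus>\<^bsub>E\<^esub> v') \<in> \<Gamma>'" if "(u, v) \<in> \<Gamma>' \<and> (u', v') \<in> \<Gamma>'" for u v u' v'
    proof -
      obtain y z a where 1: "(y, z) \<in> \<Gamma>" "a \<in> carrier R" "u = y \<oplus>\<^bsub>L\<^esub> a \<odot>\<^bsub>L\<^esub> x" "v = z \<oplus>\<^bsub>E\<^esub> a \<odot>\<^bsub>E\<^esub> e"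
        using \<open>(u, v) \<in> \<Gamma>' \<and> _\<close> unfolding \<Gamma>'_def by blast
      obtain y' z' a' where 2: "(y', z') \<in> \<Gamma>" "a' \<in> carrier R" "u' = y' \<oplus>\<^bsub>L\<^esub> a' \<odot>\<^bsub>L\<^esub> x" "v' = z' \<oplus>\<^bsub>E\<^esub> a' \<odot>\<^bsub>E\<^esub> e"
        using \<open>_ \<and> (u', v') \<in> \<Gamma>'\<close> unfolding \<Gamma>'_def by blast
      note c = D(1)[OF 1(1)] D(1)[OF 2(1)] D(2)[OF 1(1)] D(2)[OF 2(1)] 1(2) 2(2) x e(1)
      show ?thesis
        by (rule \<Gamma>'I[OF D(4)[OF 1(1) 2(1)] E.R.a_closed[OF 1(2) 2(2)]])
          (use c in \<open>simp_all add: 1 2 L.smult_l_distr E.smult_l_distr L.M.a_ac E.M.a_ac\<close>)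
    qed
    show "(b \<odot>\<^bsub>L\<^esub> u, b \<odot>\<^bsub>E\<^esub> v) \<in> \<Gamma>'" if b: "b \<in> carrier R" and uv: "(u, v) \<in> \<Gamma>'" for b u v
    proof -
      obtain y z a where 1: "(y, z) \<in> \<Gamma>" "a \<in> carrier R" "u = y \<oplus>\<^bsub>L\<^esub> a \<odot>\<^bsub>L\<^esub> x" "v = z \<oplus>\<^bsub>E\<^esub> a \<odot>\<^bsub>E\<^esub> e"
        using uv unfolding \<Gamma>'_def by blast
      note c = D(1)[OF 1(1)] D(2)[OF 1(1)] 1(2) b x e(1)
      show ?thesis
        by (rule \<Gamma>'I[OF D(5)[OF b 1(1)] E.R.m_closed[OF b 1(2)]])
          (use c in \<open>simp_all add: 1 L.smult_r_distr E.smult_r_distr L.smult_assoc E.smult_assoc\<close>)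
    qed
    \<comment> \<open>Well-definedness: if y + a x = 0, then \<open>a\<close> lies in
      \<open>I\<close>, and a e is the value of \<Gamma> at a x = -y, namely -z.\<close>
    show "v = \<zero>\<^bsub>E\<^esub>" if uv: "(\<zero>\<^bsub>L\<^esub>, v) \<in> \<Gamma>'" for v
    proof -
      obtain y z a where 1: "(y, z) \<in> \<Gamma>" "a \<in> carrier R" "\<zero>\<^bsub>L\<^esub> = y \<oplus>\<^bsub>L\<^esub> a \<odot>\<^bsub>L\<^esub> x" "v = z \<oplus>\<^bsub>E\<^esub> a \<odot>\<^bsub>E\<^esub> e"
        using uv unfolding \<Gamma>'_def by blast
      have c: "y \<in> carrier L" "z \<in> carrier E" "a \<odot>\<^bsub>L\<^esub> x \<in> carrier L" using D(1,2)[OF 1(1)] 1(2) x by auto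
      have ax: "a \<odot>\<^bsub>L\<^esub> x = \<ominus>\<^bsub>L\<^esub> y"
        using 1(3) c by (metis L.M.minus_equality L.M.minus_minus L.M.a_comm)
      have "(\<zero>\<^bsub>L\<^esub> \<ominus>\<^bsub>L\<^esub> y, \<zero>\<^bsub>E\<^esub> \<ominus>\<^bsub>E\<^esub> z) \<in> \<Gamma>" by (rule partial_hom_diff[OF \<Gamma> D(3) 1(1)])
      then have *: "(a \<odot>\<^bsub>L\<^esub> x, \<ominus>\<^bsub>E\<^esub> z) \<in> \<Gamma>" using c by (simp add: ax a_minus_def)
      then have "a \<in> I" using 1(2) by (auto simp: I_def)
      then have "a \<odot>\<^bsub>E\<^esub> e = \<ominus>\<^bsub>E\<^esub> z" using e(2) f_eq[OF *] by simp
      then show ?thesis using c by (simp add: 1(4) E.M.r_neg)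
    qed
  qed
  then show ?thesis using sub dom by blast
qed

text \<open>Ordering graphs by inclusion makes unions of chains partial homomorphisms again; a
  maximal one is total by \<open>partial_hom_extend\<close>.\<close>

lemma extension_exists:
  assumes N: "submodule N R L" and f: "f \<in> lmod_hom R (L\<lparr>carrier := N\<rparr>) E"
  shows "\<exists>g\<in>lmod_hom R L E. \<forall>x\<in>N. g x = f x"
proof -
  note N' = L.submoduleD[OF N]
  define \<Gamma>0 where "\<Gamma>0 = {(x, f x) | x. x \<in> N}"
  have f': "x \<in> N \<Longrightarrow> f x \<in> carrier E" "x \<in> N \<Longrightarrow> y \<in> N \<Longrightarrow> f (x \<oplus>\<^bsub>L\<^esub> y) = f x \<oplus>\<^bsub>E\<^esub> f y"
    "a \<in> carrier R \<Longrightarrow> x \<in> N \<Longrightarrow> f (a \<odot>\<^bsub>L\<^esub> x) = a \<odot>\<^bsub>E\<^esub> f x" for x y a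
    using lmod_homD[OF f] by auto
  have f0: "f \<zero>\<^bsub>L\<^esub> = \<zero>\<^bsub>E\<^esub>"
    using lmod_hom_zero[OF L.left_module_submodule[OF N] E f] by simp
  have \<Gamma>0: "partial_hom \<Gamma>0"
    unfolding partial_hom_def
  proof (intro conjI allI impI ballI)
    show "\<Gamma>0 \<subseteq> carrier L \<times> carrier E" using N'(1) f'(1) by (auto simp: \<Gamma>0_def)
    show "(\<zero>\<^bsub>L\<^esub>, \<zero>\<^bsub>E\<^esub>) \<in> \<Gamma>0" using N'(2) f0 by (auto simp: \<Gamma>0_def)
    show "(x \<oplus>\<^bsub>L\<^esub> x', y \<oplus>\<^bsub>E\<^esub> y') \<in> \<Gamma>0" if "(x, y) \<in> \<Gamma>0 \<and> (x', y') \<in> \<Gamma>0" for x y x' y'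
      using that N'(3) f'(2) by (auto simp: \<Gamma>0_def)
    show "(a \<odot>\<^bsub>L\<^esub> x, a \<odot>\<^bsub>E\<^esub> y) \<in> \<Gamma>0" if "a \<in> carrier R" "(x, y) \<in> \<Gamma>0" for a x y
      using that N'(4) f'(3) by (auto simp: \<Gamma>0_def)
    show "y = \<zero>\<^bsub>E\<^esub>" if "(\<zero>\<^bsub>L\<^esub>, y) \<in> \<Gamma>0" for y using that f0 by (auto simp: \<Gamma>0_def)
  qed
  define \<G> where "\<G> = {\<Gamma>. partial_hom \<Gamma> \<and> \<Gamma>0 \<subseteq> \<Gamma>}"
  have "\<exists>\<Gamma>\<in>\<G>. \<forall>X\<in>\<G>. \<Gamma> \<subseteq> X \<longrightarrow> X = \<Gamma>"
  proof (rule subset_Zorn_nonempty)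
    show "\<G> \<noteq> {}" using \<Gamma>0 by (auto simp: \<G>_def)
    fix \<C> assume ne: "\<C> \<noteq> {}" and ch: "subset.chain \<G> \<C>"
    have C: "partial_hom \<Gamma>" "\<Gamma>0 \<subseteq> \<Gamma>" if "\<Gamma> \<in> \<C>" for \<Gamma>
      using ch that by (auto simp: subset_chain_def \<G>_def)
    have pair: "\<exists>\<Gamma>\<in>\<C>. p \<in> \<Gamma> \<and> q \<in> \<Gamma>" if "p \<in> \<Union>\<C>" "q \<in> \<Union>\<C>" for p q
    proof -
      from that obtain X Y where XY: "X \<in> \<C>" "p \<in> X" "Y \<in> \<C>" "q \<in> Y" by (elim UnionE)
      then have "X \<subseteq> Y \<or> Y \<subseteq> X" using ch by (auto simp: subset_chain_def)
      then show ?thesis using XY by blast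
    qed
    have "partial_hom (\<Union>\<C>)"
      unfolding partial_hom_def
    proof (intro conjI allI impI ballI)
      show "\<Union>\<C> \<subseteq> carrier L \<times> carrier E" using C(1) unfolding partial_hom_def by blast
      show "(\<zero>\<^bsub>L\<^esub>, \<zero>\<^bsub>E\<^esub>) \<in> \<Union>\<C>" using ne partial_homD(3)[OF C(1)] by blast
      show "(x \<oplus>\<^bsub>L\<^esub> x', y \<oplus>\<^bsub>E\<^esub> y') \<in> \<Union>\<C>" if "(x, y) \<in> \<Union>\<C> \<and> (x', y') \<in> \<Union>\<C>" for x y x' y'
        using pair[of "(x, y)" "(x', y')"] that partial_homD(4)[OF C(1)] by blast
      show "(a \<odot>\<^bsub>L\<^esub> x, a \<odot>\<^bsub>E\<^esub> y) \<in> \<Union>\<C>" if "a \<in> carrier R" "(x, y) \<in> \<Union>\<C>" for a x y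
        using that partial_homD(5)[OF C(1)] by blast
      show "y = \<zero>\<^bsub>E\<^esub>" if "(\<zero>\<^bsub>L\<^esub>, y) \<in> \<Union>\<C>" for y using that partial_homD(6)[OF C(1)] by blast
    qed
    then show "\<Union>\<C> \<in> \<G>" using ne C(2) by (auto simp: \<G>_def)
  qed
  then obtain \<Gamma> where \<Gamma>: "partial_hom \<Gamma>" "\<Gamma>0 \<subseteq> \<Gamma>"
    and max: "\<And>X. partial_hom X \<Longrightarrow> \<Gamma>0 \<subseteq> X \<Longrightarrow> \<Gamma> \<subseteq> X \<Longrightarrow> X = \<Gamma>" by (auto simp: \<G>_def)
  have total: "\<exists>y. (x, y) \<in> \<Gamma>" if x: "x \<in> carrier L" for x
  proof -
    obtain X where X: "partial_hom X" "\<Gamma> \<subseteq> X" "x \<in> Domain X" using partial_hom_extend[OF \<Gamma>(1) x] by blast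
    then have "X = \<Gamma>" using \<Gamma>(2) by (intro max) auto
    then show ?thesis using X(3) by blast
  qed
  define g where "g x = (THE y. (x, y) \<in> \<Gamma>)" for x
  have g_eq: "g x = y" if "(x, y) \<in> \<Gamma>" for x y
    unfolding g_def using that partial_hom_unique[OF \<Gamma>(1)] by blast
  have g: "(x, g x) \<in> \<Gamma>" if "x \<in> carrier L" for x using total[OF that] g_eq by auto
  note D = partial_homD[OF \<Gamma>(1)]
  have "g \<in> lmod_hom R L E"
    unfolding lmod_hom_def
  proof (intro CollectI conjI ballI funcsetI)
    show "g x \<in> carrier E" if "x \<in> carrier L" for x using D(2)[OF g[OF that]] .
    show "g (x \<oplus>\<^bsub>L\<^esub> y) = g x \<oplus>\<^bsub>E\<^esub> g y" if "x \<in> carrier L" "y \<in> carrier L" for x y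
      by (rule g_eq[OF D(4)[OF g[OF that(1)] g[OF that(2)]]])
    show "g (a \<odot>\<^bsub>L\<^esub> x) = a \<odot>\<^bsub>E\<^esub> g x" if "a \<in> carrier R" "x \<in> carrier L" for a x
      by (rule g_eq[OF D(5)[OF that(1) g[OF that(2)]]])
  qed
  moreover have "g x = f x" if "x \<in> N" for x using that \<Gamma>(2) by (intro g_eq) (auto simp: \<Gamma>0_def)
  ultimately show ?thesis by blast
qed

end

section \<open>Rings of left quotients\<close>

text \<open>The denominators are the elements of \<open>R\<close> that become units in
  \<open>U\<close>; the left Ore condition is a consequence (\<open>ore\<close>).\<close>

locale ore_extension =
  fixes R :: "('r, 'a) ring_scheme" and U :: "('s, 'b) ring_scheme" and \<phi> :: "'r \<Rightarrow> 's"
  assumes R: "ring R" and U: "ring U" and hom: "\<phi> \<in> ring_hom R U" and inj: "inj_on \<phi> (carrier R)"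
    and denominator: "u \<in> carrier U \<Longrightarrow>
      \<exists>s\<in>carrier R. \<exists>a\<in>carrier R. \<phi> s \<in> Units U \<and> \<phi> s \<otimes>\<^bsub>U\<^esub> u = \<phi> a"
begin

sublocale R: ring R by (rule R)
sublocale U: ring U by (rule U)

definition den :: "'r set" where "den = {s \<in> carrier R. \<phi> s \<in> Units U}"

lemma phi_closed [simp]: "a \<in> carrier R \<Longrightarrow> \<phi> a \<in> carrier U" using hom by (rule ring_hom_closed)
lemma phi_mult: "a \<in> carrier R \<Longrightarrow> b \<in> carrier R \<Longrightarrow> \<phi> (a \<otimes>\<^bsub>R\<^esub> b) = \<phi> a \<otimes>\<^bsub>U\<^esub> \<phi> b"
  using hom by (rule ring_hom_mult)
lemma phi_add: "a \<in> carrier R \<Longrightarrow> b \<in> carrier R \<Longrightarrow> \<phi> (a \<oplus>\<^bsub>R\<^esub> b) = \<phi> a \<oplus>\<^bsub>U\<^esub> \<phi> b"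
  using hom by (rule ring_hom_add)
lemma phi_one: "\<phi> \<one>\<^bsub>R\<^esub> = \<one>\<^bsub>U\<^esub>" using hom by (rule ring_hom_one)
lemma phi_zero: "\<phi> \<zero>\<^bsub>R\<^esub> = \<zero>\<^bsub>U\<^esub>" using hom R U by (rule ring_hom_zero)
lemma phi_inject: "a \<in> carrier R \<Longrightarrow> b \<in> carrier R \<Longrightarrow> \<phi> a = \<phi> b \<Longrightarrow> a = b"
  using inj by (auto dest: inj_onD)

lemma den_carrier: "s \<in> den \<Longrightarrow> s \<in> carrier R" and den_Units: "s \<in> den \<Longrightarrow> \<phi> s \<in> Units U"
  by (auto simp: den_def)

lemma den_one: "\<one>\<^bsub>R\<^esub> \<in> den" by (simp add: den_def phi_one)

lemma den_mult: "s \<in> den \<Longrightarrow> t \<in> den \<Longrightarrow> s \<otimes>\<^bsub>R\<^esub> t \<in> den"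
  by (simp add: den_def phi_mult)

lemma den_inv: "s \<in> den \<Longrightarrow> inv\<^bsub>U\<^esub> (\<phi> s) \<in> carrier U" by (simp add: den_Units)

lemma den_l_cancel: "s \<in> den \<Longrightarrow> u \<in> carrier U \<Longrightarrow> v \<in> carrier U \<Longrightarrow>
    \<phi> s \<otimes>\<^bsub>U\<^esub> u = \<phi> s \<otimes>\<^bsub>U\<^esub> v \<Longrightarrow> u = v"
  using U.Units_l_cancel[OF den_Units] by blast

lemma den_r_cancel:
  assumes "s \<in> den" "a \<in> carrier R" "b \<in> carrier R" "a \<otimes>\<^bsub>R\<^esub> s = b \<otimes>\<^bsub>R\<^esub> s" shows "a = b"
proof (rule phi_inject[OF assms(2,3)])
  note s = den_carrier[OF assms(1)] den_Units[OF assms(1)]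
  have "\<phi> a \<otimes>\<^bsub>U\<^esub> \<phi> s = \<phi> b \<otimes>\<^bsub>U\<^esub> \<phi> s" using assms s by (simp flip: phi_mult)
  then have "\<phi> a \<otimes>\<^bsub>U\<^esub> \<phi> s \<otimes>\<^bsub>U\<^esub> inv\<^bsub>U\<^esub> (\<phi> s) = \<phi> b \<otimes>\<^bsub>U\<^esub> \<phi> s \<otimes>\<^bsub>U\<^esub> inv\<^bsub>U\<^esub> (\<phi> s)" by simp
  then show "\<phi> a = \<phi> b" using assms s by (simp add: U.m_assoc U.Units_r_inv)
qed

lemma denominator':
  assumes "u \<in> carrier U" obtains s a where "s \<in> den" "a \<in> carrier R" "\<phi> s \<otimes>\<^bsub>U\<^esub> u = \<phi> a"
  using denominator[OF assms] by (auto simp: den_def)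

text \<open>\<open>t\<close> is a denominator of the element \<phi>(a) \<phi>(s)^-1 of
  \<open>U\<close>.\<close>

lemma ore:
  assumes "s \<in> den" "a \<in> carrier R"
  obtains t b where "t \<in> den" "b \<in> carrier R" "t \<otimes>\<^bsub>R\<^esub> a = b \<otimes>\<^bsub>R\<^esub> s"
proof -
  note s = den_carrier[OF assms(1)] den_Units[OF assms(1)] den_inv[OF assms(1)]
  have "\<phi> a \<otimes>\<^bsub>U\<^esub> inv\<^bsub>U\<^esub> (\<phi> s) \<in> carrier U" using assms s by simp
  from denominator'[OF this] obtain t b
    where t: "t \<in> den" "b \<in> carrier R" "\<phi> t \<otimes>\<^bsub>U\<^esub> (\<phi> a \<otimes>\<^bsub>U\<^esub> inv\<^bsub>U\<^esub> (\<phi> s)) = \<phi> b" .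
  note tc = den_carrier[OF t(1)]
  have "\<phi> b \<otimes>\<^bsub>U\<^esub> \<phi> s = \<phi> t \<otimes>\<^bsub>U\<^esub> (\<phi> a \<otimes>\<^bsub>U\<^esub> (inv\<^bsub>U\<^esub> (\<phi> s) \<otimes>\<^bsub>U\<^esub> \<phi> s))"
    using t tc assms s by (simp add: U.m_assoc flip: t(3))
  then have "\<phi> (b \<otimes>\<^bsub>R\<^esub> s) = \<phi> (t \<otimes>\<^bsub>R\<^esub> a)" using t tc assms s by (simp add: phi_mult U.Units_l_inv)
  then have "t \<otimes>\<^bsub>R\<^esub> a = b \<otimes>\<^bsub>R\<^esub> s" using t tc assms s by (intro phi_inject) auto
  then show ?thesis using t that by blast
qed

lemma common_denominator:
  assumes "u \<in> carrier U" "v \<in> carrier U"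
  obtains s a b where "s \<in> den" "a \<in> carrier R" "b \<in> carrier R" "\<phi> s \<otimes>\<^bsub>U\<^esub> u = \<phi> a" "\<phi> s \<otimes>\<^bsub>U\<^esub> v = \<phi> b"
proof -
  obtain s a where s: "s \<in> den" "a \<in> carrier R" "\<phi> s \<otimes>\<^bsub>U\<^esub> u = \<phi> a" using denominator'[OF assms(1)] .
  note sc = den_carrier[OF s(1)]
  have "\<phi> s \<otimes>\<^bsub>U\<^esub> v \<in> carrier U" using sc assms by simp
  from denominator'[OF this] obtain t b where t: "t \<in> den" "b \<in> carrier R" "\<phi> t \<otimes>\<^bsub>U\<^esub> (\<phi> s \<otimes>\<^bsub>U\<^esub> v) = \<phi> b" .
  note tc = den_carrier[OF t(1)]
  show ?thesis
  proof (rule that[OF den_mult[OF t(1) s(1)] R.m_closed[OF tc s(2)] t(2)])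
    show "\<phi> (t \<otimes>\<^bsub>R\<^esub> s) \<otimes>\<^bsub>U\<^esub> u = \<phi> (t \<otimes>\<^bsub>R\<^esub> a)"
      using s sc t tc assms by (simp add: phi_mult U.m_assoc)
    show "\<phi> (t \<otimes>\<^bsub>R\<^esub> s) \<otimes>\<^bsub>U\<^esub> v = \<phi> b" using s sc t tc assms by (simp add: phi_mult U.m_assoc)
  qed
qed

section \<open>Torsion and divisibility with respect to the denominators\<close>

definition torsion :: "('r, 'm, 'c) module_scheme \<Rightarrow> 'm set" where
  "torsion M = {m \<in> carrier M. \<exists>s\<in>den. s \<odot>\<^bsub>M\<^esub> m = \<zero>\<^bsub>M\<^esub>}"

text \<open>For sums and for scalar multiples the Ore condition finds a denominator that absorbs the
  given ones.\<close>

lemma submodule_torsion: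
  assumes "left_module R M" shows "submodule (torsion M) R M"
proof -
  interpret M: left_module R M by fact
  show ?thesis
  proof (rule M.submoduleI')
    show "\<zero>\<^bsub>M\<^esub> \<in> torsion M" using den_one M.smult_r_zero[OF R.one_closed] unfolding torsion_def by blast
    show "x \<oplus>\<^bsub>M\<^esub> y \<in> torsion M" if xy: "x \<in> torsion M" "y \<in> torsion M" for x y
    proof -
      obtain s t where st: "s \<in> den" "s \<odot>\<^bsub>M\<^esub> x = \<zero>\<^bsub>M\<^esub>" "t \<in> den" "t \<odot>\<^bsub>M\<^esub> y = \<zero>\<^bsub>M\<^esub>"
        and c: "x \<in> carrier M" "y \<in> carrier M" using xy by (auto simp: torsion_def)
      obtain p b where p: "p \<in> den" "b \<in> carrier R" "p \<otimes>\<^bsub>R\<^esub> s = b \<otimes>\<^bsub>R\<^esub> t"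
        using ore[OF st(3) den_carrier[OF st(1)]] .
      note d = den_carrier[OF st(1)] den_carrier[OF st(3)] den_carrier[OF p(1)]
      have "(p \<otimes>\<^bsub>R\<^esub> s) \<odot>\<^bsub>M\<^esub> x = \<zero>\<^bsub>M\<^esub>" using st d c by (simp add: M.smult_assoc M.smult_r_zero)
      moreover have "(p \<otimes>\<^bsub>R\<^esub> s) \<odot>\<^bsub>M\<^esub> y = \<zero>\<^bsub>M\<^esub>"
        unfolding p(3) using st d c p by (simp add: M.smult_assoc M.smult_r_zero)
      ultimately have "(p \<otimes>\<^bsub>R\<^esub> s) \<odot>\<^bsub>M\<^esub> (x \<oplus>\<^bsub>M\<^esub> y) = \<zero>\<^bsub>M\<^esub>"
        using d c by (simp add: M.smult_r_distr)
      then show ?thesis using c den_mult[OF p(1) st(1)] by (auto simp: torsion_def)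
    qed
    show "a \<odot>\<^bsub>M\<^esub> x \<in> torsion M" if a: "a \<in> carrier R" and x: "x \<in> torsion M" for a x
    proof -
      obtain s where s: "s \<in> den" "s \<odot>\<^bsub>M\<^esub> x = \<zero>\<^bsub>M\<^esub>" and c: "x \<in> carrier M" using x by (auto simp: torsion_def)
      obtain t b where t: "t \<in> den" "b \<in> carrier R" "t \<otimes>\<^bsub>R\<^esub> a = b \<otimes>\<^bsub>R\<^esub> s" using ore[OF s(1) a] .
      note d = den_carrier[OF s(1)] den_carrier[OF t(1)]
      have "t \<odot>\<^bsub>M\<^esub> (a \<odot>\<^bsub>M\<^esub> x) = (b \<otimes>\<^bsub>R\<^esub> s) \<odot>\<^bsub>M\<^esub> x"
        using a c d by (simp add: M.smult_assoc flip: t(3))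
      also have "\<dots> = \<zero>\<^bsub>M\<^esub>" using t d c s by (simp add: M.smult_assoc M.smult_r_zero)
      finally show ?thesis using a c t(1) by (auto simp: torsion_def)
    qed
  qed (auto simp: torsion_def)
qed

text \<open>The torsion submodule of \<open>E\<close> meets the image of \<open>M\<close> only in
  images of torsion elements, so essentiality forces it to vanish.\<close>

lemma torsion_essential_extension:
  assumes ess: "essential_extension R M E i" and M: "torsion M = {\<zero>\<^bsub>M\<^esub>}"
  shows "torsion E = {\<zero>\<^bsub>E\<^esub>}"
proof -
  have lm: "left_module R M" "left_module R E" and i: "i \<in> lmod_hom R M E" "inj_on i (carrier M)"
    and e: "\<And>N. submodule N R E \<Longrightarrow> N \<inter> i ` carrier M = {\<zero>\<^bsub>E\<^esub>} \<Longrightarrow> N = {\<zero>\<^bsub>E\<^esub>}"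
    using ess unfolding essential_extension_def by blast+
  interpret M: left_module R M by fact
  interpret E: left_module R E by fact
  note tE = E.submoduleD[OF submodule_torsion[OF lm(2)]]
  note i0 = lmod_hom_zero[OF lm i(1)]
  have "m = \<zero>\<^bsub>M\<^esub>" if m: "m \<in> carrier M" "i m \<in> torsion E" for m
  proof -
    obtain s where s: "s \<in> den" "s \<odot>\<^bsub>E\<^esub> i m = \<zero>\<^bsub>E\<^esub>" using m by (auto simp: torsion_def)
    note d = den_carrier[OF s(1)]
    have "i (s \<odot>\<^bsub>M\<^esub> m) = i \<zero>\<^bsub>M\<^esub>" using lmod_homD(3)[OF i(1) d m(1)] s(2) i0 by simp
    then have "s \<odot>\<^bsub>M\<^esub> m = \<zero>\<^bsub>M\<^esub>" using inj_onD[OF i(2)] d m by simp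
    then have "m \<in> torsion M" using s m by (auto simp: torsion_def)
    then show ?thesis using M by simp
  qed
  then have "torsion E \<inter> i ` carrier M = {\<zero>\<^bsub>E\<^esub>}" using tE(2) i0 by force
  from e[OF submodule_torsion[OF lm(2)] this] show ?thesis .
qed

text \<open>Injective modules are divisible: extend \<open>a s \<mapsto> a e\<close> from the left ideal \<open>R s\<close> to \<open>R\<close>.\<close>

lemma injective_divisible:
  assumes E: "injective_module TYPE('r) R E" and s: "s \<in> den" and e: "e \<in> carrier E"
  shows "\<exists>y\<in>carrier E. s \<odot>\<^bsub>E\<^esub> y = e"
proof -
  have lE: "left_module R E" using E by (simp add: injective_module_def)
  interpret E: left_module R E by fact
  interpret L: left_module R "ring_module R" by (rule left_module_ring_module[OF R])
  note sc = den_carrier[OF s]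
  define I where "I = (\<lambda>a. a \<otimes>\<^bsub>R\<^esub> s) ` carrier R"
  define f where "f x = (THE a. a \<in> carrier R \<and> a \<otimes>\<^bsub>R\<^esub> s = x) \<odot>\<^bsub>E\<^esub> e" for x
  have f: "f (a \<otimes>\<^bsub>R\<^esub> s) = a \<odot>\<^bsub>E\<^esub> e" if "a \<in> carrier R" for a
  proof -
    have "(THE b. b \<in> carrier R \<and> b \<otimes>\<^bsub>R\<^esub> s = a \<otimes>\<^bsub>R\<^esub> s) = a"
      using that den_r_cancel[OF s] by (intro the_equality) auto
    then show ?thesis by (simp add: f_def)
  qed
  have sI: "submodule I R (ring_module R)"
  proof (rule L.submoduleI')
    show "I \<subseteq> carrier (ring_module R)" using sc by (auto simp: I_def ring_module_def)
    show "\<zero>\<^bsub>ring_module R\<^esub> \<in> I" unfolding I_def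
      using sc by (intro image_eqI[of _ _ "\<zero>\<^bsub>R\<^esub>"]) (auto simp: ring_module_def)
    show "x \<oplus>\<^bsub>ring_module R\<^esub> y \<in> I" if "x \<in> I" "y \<in> I" for x y
    proof -
      obtain a b where "a \<in> carrier R" "x = a \<otimes>\<^bsub>R\<^esub> s" "b \<in> carrier R" "y = b \<otimes>\<^bsub>R\<^esub> s"
        using \<open>x \<in> I\<close> \<open>y \<in> I\<close> by (auto simp: I_def)
      then show ?thesis unfolding I_def
        using sc by (intro image_eqI[of _ _ "a \<oplus>\<^bsub>R\<^esub> b"]) (auto simp: ring_module_def R.l_distr)
    qed
    show "b \<odot>\<^bsub>ring_module R\<^esub> x \<in> I" if "b \<in> carrier R" "x \<in> I" for b x
    proof -
      obtain a where "a \<in> carrier R" "x = a \<otimes>\<^bsub>R\<^esub> s" using \<open>x \<in> I\<close> by (auto simp: I_def)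
      then show ?thesis unfolding I_def
        using sc \<open>b \<in> carrier R\<close> by (intro image_eqI[of _ _ "b \<otimes>\<^bsub>R\<^esub> a"]) (auto simp: ring_module_def R.m_assoc)
    qed
  qed
  have "f \<in> lmod_hom R ((ring_module R)\<lparr>carrier := I\<rparr>) E"
  proof -
    have "f (a \<otimes>\<^bsub>R\<^esub> s \<oplus>\<^bsub>R\<^esub> b \<otimes>\<^bsub>R\<^esub> s) = f (a \<otimes>\<^bsub>R\<^esub> s) \<oplus>\<^bsub>E\<^esub> f (b \<otimes>\<^bsub>R\<^esub> s)"
      if "a \<in> carrier R" "b \<in> carrier R" for a b
      using f[of "a \<oplus>\<^bsub>R\<^esub> b"] f[OF that(1)] f[OF that(2)] that sc e by (simp add: R.l_distr E.smult_l_distr)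
    moreover have "f (b \<otimes>\<^bsub>R\<^esub> (a \<otimes>\<^bsub>R\<^esub> s)) = b \<odot>\<^bsub>E\<^esub> f (a \<otimes>\<^bsub>R\<^esub> s)"
      if "a \<in> carrier R" "b \<in> carrier R" for a b
      using f[of "b \<otimes>\<^bsub>R\<^esub> a"] f[OF that(1)] that sc e by (simp add: R.m_assoc E.smult_assoc)
    ultimately show ?thesis using f e by (auto simp: lmod_hom_def ring_module_def I_def)
  qed
  then obtain g where g: "g \<in> lmod_hom R (ring_module R) E" "\<And>x. x \<in> I \<Longrightarrow> g x = f x"
    using E sI L.left_module_axioms unfolding injective_module_def by blast
  have g1: "g \<one>\<^bsub>R\<^esub> \<in> carrier E" using lmod_homD(1)[OF g(1)] by (simp add: ring_module_def)
  have "s \<odot>\<^bsub>E\<^esub> g \<one>\<^bsub>R\<^esub> = g (s \<odot>\<^bsub>ring_module R\<^esub> \<one>\<^bsub>R\<^esub>)"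
    using lmod_homD(3)[OF g(1), of s "\<one>\<^bsub>R\<^esub>"] sc by (simp add: ring_module_def)
  also have "s \<odot>\<^bsub>ring_module R\<^esub> \<one>\<^bsub>R\<^esub> = \<one>\<^bsub>R\<^esub> \<otimes>\<^bsub>R\<^esub> s" using sc by (simp add: ring_module_def)
  also have "g (\<one>\<^bsub>R\<^esub> \<otimes>\<^bsub>R\<^esub> s) = f (\<one>\<^bsub>R\<^esub> \<otimes>\<^bsub>R\<^esub> s)"
    using R.one_closed by (intro g(2)) (auto simp only: I_def)
  also have "\<dots> = e" using f[of "\<one>\<^bsub>R\<^esub>"] e by simp
  finally show ?thesis using g1 by blast
qed

end

text \<open>A torsion-free divisible module over \<open>R\<close> is a module over the ring of quotients.\<close>

locale ore_divisible = ore_extension R U \<phi>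
  for R :: "('r, 'a) ring_scheme" and U :: "('s, 'b) ring_scheme" and \<phi> :: "'r \<Rightarrow> 's" +
  fixes E :: "('r, 'e, 'c) module_scheme"
  assumes E: "left_module R E" and torsion_free: "torsion E = {\<zero>\<^bsub>E\<^esub>}"
    and divisible: "s \<in> den \<Longrightarrow> e \<in> carrier E \<Longrightarrow> \<exists>y\<in>carrier E. s \<odot>\<^bsub>E\<^esub> y = e"
begin

sublocale E: left_module R E by (rule E)

lemma den_smult_cancel:
  assumes "s \<in> den" "x \<in> carrier E" "y \<in> carrier E" "s \<odot>\<^bsub>E\<^esub> x = s \<odot>\<^bsub>E\<^esub> y" shows "x = y"
proof -
  note sc = den_carrier[OF assms(1)]
  have "s \<odot>\<^bsub>E\<^esub> (\<ominus>\<^bsub>E\<^esub> y) = \<ominus>\<^bsub>E\<^esub> (s \<odot>\<^bsub>E\<^esub> y)"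
  proof (rule E.M.minus_equality[symmetric])
    show "s \<odot>\<^bsub>E\<^esub> (\<ominus>\<^bsub>E\<^esub> y) \<oplus>\<^bsub>E\<^esub> s \<odot>\<^bsub>E\<^esub> y = \<zero>\<^bsub>E\<^esub>"
      using sc assms by (simp add: E.M.l_neg E.smult_r_zero flip: E.smult_r_distr)
  qed (use sc assms in auto)
  then have "s \<odot>\<^bsub>E\<^esub> (x \<oplus>\<^bsub>E\<^esub> \<ominus>\<^bsub>E\<^esub> y) = \<zero>\<^bsub>E\<^esub>"
    using sc assms by (simp add: E.smult_r_distr E.M.r_neg)
  then have "x \<oplus>\<^bsub>E\<^esub> \<ominus>\<^bsub>E\<^esub> y \<in> torsion E" using assms by (auto simp: torsion_def)
  then have "x \<oplus>\<^bsub>E\<^esub> \<ominus>\<^bsub>E\<^esub> y = \<zero>\<^bsub>E\<^esub>" using torsion_free by simp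
  then have "\<ominus>\<^bsub>E\<^esub> (\<ominus>\<^bsub>E\<^esub> y) = x" using assms by (intro E.M.minus_equality) auto
  then show ?thesis using assms by simp
qed

text \<open>The product u e is the y with s y = a e for every way of writing s u = a; quantifying
  over all of them builds independence of the fraction into the definition.\<close>

definition act :: "'s \<Rightarrow> 'e \<Rightarrow> 'e" where
  "act u e = (THE y. y \<in> carrier E \<and> (\<forall>s\<in>carrier R. \<forall>a\<in>carrier R. \<phi> s \<otimes>\<^bsub>U\<^esub> u = \<phi> a \<longrightarrow> s \<odot>\<^bsub>E\<^esub> y = a \<odot>\<^bsub>E\<^esub> e))"

text \<open>One fraction for \<open>u\<close> determines y: the Ore condition brings a second
  fraction to a common left multiple with it, and the factor \<open>t\<close> is cancelled since
  \<open>E\<close> is torsion-free.\<close>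

lemma act_aux:
  assumes u: "u \<in> carrier U" and e: "e \<in> carrier E" and s: "s \<in> den" "a \<in> carrier R" "\<phi> s \<otimes>\<^bsub>U\<^esub> u = \<phi> a"
    and y: "y \<in> carrier E" "s \<odot>\<^bsub>E\<^esub> y = a \<odot>\<^bsub>E\<^esub> e"
    and s': "s' \<in> carrier R" "a' \<in> carrier R" "\<phi> s' \<otimes>\<^bsub>U\<^esub> u = \<phi> a'"
  shows "s' \<odot>\<^bsub>E\<^esub> y = a' \<odot>\<^bsub>E\<^esub> e"
proof -
  obtain t b where t: "t \<in> den" "b \<in> carrier R" "t \<otimes>\<^bsub>R\<^esub> s' = b \<otimes>\<^bsub>R\<^esub> s" using ore[OF s(1) s'(1)] .
  note c = den_carrier[OF s(1)] den_carrier[OF t(1)]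
  have "\<phi> (t \<otimes>\<^bsub>R\<^esub> a') = \<phi> (t \<otimes>\<^bsub>R\<^esub> s') \<otimes>\<^bsub>U\<^esub> u"
    using c s' u by (simp add: phi_mult U.m_assoc)
  also have "\<dots> = \<phi> (b \<otimes>\<^bsub>R\<^esub> a)" unfolding t(3) using c s t u by (simp add: phi_mult U.m_assoc)
  finally have ta: "t \<otimes>\<^bsub>R\<^esub> a' = b \<otimes>\<^bsub>R\<^esub> a" using c s s' t by (intro phi_inject) auto
  have "t \<odot>\<^bsub>E\<^esub> (s' \<odot>\<^bsub>E\<^esub> y) = (b \<otimes>\<^bsub>R\<^esub> s) \<odot>\<^bsub>E\<^esub> y" using c s' y by (simp add: E.smult_assoc flip: t(3))
  also have "\<dots> = (b \<otimes>\<^bsub>R\<^esub> a) \<odot>\<^bsub>E\<^esub> e" using c t y s e by (simp add: E.smult_assoc)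
  also have "\<dots> = t \<odot>\<^bsub>E\<^esub> (a' \<odot>\<^bsub>E\<^esub> e)" using c s' e by (simp add: E.smult_assoc flip: ta)
  finally have "t \<odot>\<^bsub>E\<^esub> (s' \<odot>\<^bsub>E\<^esub> y) = t \<odot>\<^bsub>E\<^esub> (a' \<odot>\<^bsub>E\<^esub> e)" .
  from den_smult_cancel[OF t(1) _ _ this] show ?thesis using s' y(1) e by simp
qed

lemma act_eqI:
  assumes u: "u \<in> carrier U" and e: "e \<in> carrier E" and s: "s \<in> den" "a \<in> carrier R" "\<phi> s \<otimes>\<^bsub>U\<^esub> u = \<phi> a"
    and y: "y \<in> carrier E" "s \<odot>\<^bsub>E\<^esub> y = a \<odot>\<^bsub>E\<^esub> e"
  shows "act u e = y"
  unfolding act_def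
proof (rule the_equality)
  show "y \<in> carrier E \<and> (\<forall>s\<in>carrier R. \<forall>a\<in>carrier R. \<phi> s \<otimes>\<^bsub>U\<^esub> u = \<phi> a \<longrightarrow> s \<odot>\<^bsub>E\<^esub> y = a \<odot>\<^bsub>E\<^esub> e)"
    using act_aux[OF u e s y] y(1) by blast
  fix z assume z: "z \<in> carrier E \<and> (\<forall>s\<in>carrier R. \<forall>a\<in>carrier R. \<phi> s \<otimes>\<^bsub>U\<^esub> u = \<phi> a \<longrightarrow> s \<odot>\<^bsub>E\<^esub> z = a \<odot>\<^bsub>E\<^esub> e)"
  then have "s \<odot>\<^bsub>E\<^esub> z = s \<odot>\<^bsub>E\<^esub> y" using s den_carrier[OF s(1)] y by simp
  then show "z = y" using den_smult_cancel[OF s(1)] z y by blast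
qed

lemma act:
  assumes u: "u \<in> carrier U" and e: "e \<in> carrier E"
  shows act_closed: "act u e \<in> carrier E"
    and act_smult: "s \<in> carrier R \<Longrightarrow> a \<in> carrier R \<Longrightarrow> \<phi> s \<otimes>\<^bsub>U\<^esub> u = \<phi> a \<Longrightarrow> s \<odot>\<^bsub>E\<^esub> act u e = a \<odot>\<^bsub>E\<^esub> e"
proof -
  obtain t b where t: "t \<in> den" "b \<in> carrier R" "\<phi> t \<otimes>\<^bsub>U\<^esub> u = \<phi> b" using denominator'[OF u] .
  obtain y where y: "y \<in> carrier E" "t \<odot>\<^bsub>E\<^esub> y = b \<odot>\<^bsub>E\<^esub> e" using divisible[OF t(1)] t(2) e by blast
  have eq: "act u e = y" by (rule act_eqI[OF u e t y])
  show "act u e \<in> carrier E" using eq y by simp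
  show "s \<odot>\<^bsub>E\<^esub> act u e = a \<odot>\<^bsub>E\<^esub> e" if "s \<in> carrier R" "a \<in> carrier R" "\<phi> s \<otimes>\<^bsub>U\<^esub> u = \<phi> a"
    unfolding eq by (rule act_aux[OF u e t y that])
qed

lemma act_add_left:
  assumes "u \<in> carrier U" "v \<in> carrier U" "e \<in> carrier E"
  shows "act (u \<oplus>\<^bsub>U\<^esub> v) e = act u e \<oplus>\<^bsub>E\<^esub> act v e"
proof -
  obtain s a b where s: "s \<in> den" "a \<in> carrier R" "b \<in> carrier R" "\<phi> s \<otimes>\<^bsub>U\<^esub> u = \<phi> a" "\<phi> s \<otimes>\<^bsub>U\<^esub> v = \<phi> b"
    using common_denominator[OF assms(1,2)] .
  note c = den_carrier[OF s(1)]
  show ?thesis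
  proof (rule act_eqI[OF _ assms(3) s(1) R.a_closed[OF s(2,3)]])
    show "\<phi> s \<otimes>\<^bsub>U\<^esub> (u \<oplus>\<^bsub>U\<^esub> v) = \<phi> (a \<oplus>\<^bsub>R\<^esub> b)" using assms c s by (simp add: U.r_distr phi_add)
    show "s \<odot>\<^bsub>E\<^esub> (act u e \<oplus>\<^bsub>E\<^esub> act v e) = (a \<oplus>\<^bsub>R\<^esub> b) \<odot>\<^bsub>E\<^esub> e"
      using assms c s by (simp add: E.smult_r_distr E.smult_l_distr act_closed act_smult[of u e s a] act_smult[of v e s b])
  qed (use assms act_closed in auto)
qed

lemma act_add_right:
  assumes "u \<in> carrier U" "x \<in> carrier E" "y \<in> carrier E"
  shows "act u (x \<oplus>\<^bsub>E\<^esub> y) = act u x \<oplus>\<^bsub>E\<^esub> act u y"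
proof -
  obtain s a where s: "s \<in> den" "a \<in> carrier R" "\<phi> s \<otimes>\<^bsub>U\<^esub> u = \<phi> a" using denominator'[OF assms(1)] .
  note c = den_carrier[OF s(1)]
  show ?thesis
  proof (rule act_eqI[OF assms(1) _ s])
    show "s \<odot>\<^bsub>E\<^esub> (act u x \<oplus>\<^bsub>E\<^esub> act u y) = a \<odot>\<^bsub>E\<^esub> (x \<oplus>\<^bsub>E\<^esub> y)"
      using assms c s by (simp add: E.smult_r_distr act_closed act_smult[of u _ s a])
  qed (use assms act_closed in auto)
qed

lemma act_balanced:
  assumes "u \<in> carrier U" "r \<in> carrier R" "e \<in> carrier E"
  shows "act (u \<otimes>\<^bsub>U\<^esub> \<phi> r) e = act u (r \<odot>\<^bsub>E\<^esub> e)"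
proof -
  obtain s a where s: "s \<in> den" "a \<in> carrier R" "\<phi> s \<otimes>\<^bsub>U\<^esub> u = \<phi> a" using denominator'[OF assms(1)] .
  note c = den_carrier[OF s(1)]
  show ?thesis
  proof (rule act_eqI[OF _ assms(3) s(1) R.m_closed[OF s(2) assms(2)]])
    show "\<phi> s \<otimes>\<^bsub>U\<^esub> (u \<otimes>\<^bsub>U\<^esub> \<phi> r) = \<phi> (a \<otimes>\<^bsub>R\<^esub> r)"
      using assms c s by (simp add: phi_mult flip: U.m_assoc)
    show "s \<odot>\<^bsub>E\<^esub> act u (r \<odot>\<^bsub>E\<^esub> e) = (a \<otimes>\<^bsub>R\<^esub> r) \<odot>\<^bsub>E\<^esub> e"
      using assms c s by (simp add: E.smult_assoc act_smult[of u _ s a])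
  qed (use assms act_closed in auto)
qed

lemma act_mult_left:
  assumes "u \<in> carrier U" "r \<in> carrier R" "e \<in> carrier E"
  shows "act (\<phi> r \<otimes>\<^bsub>U\<^esub> u) e = r \<odot>\<^bsub>E\<^esub> act u e"
proof -
  obtain s a where s: "s \<in> den" "a \<in> carrier R" "\<phi> s \<otimes>\<^bsub>U\<^esub> u = \<phi> a" using denominator'[OF assms(1)] .
  obtain t b where t: "t \<in> den" "b \<in> carrier R" "t \<otimes>\<^bsub>R\<^esub> r = b \<otimes>\<^bsub>R\<^esub> s" using ore[OF s(1) assms(2)] .
  note c = den_carrier[OF s(1)] den_carrier[OF t(1)] act_closed[OF assms(1,3)]
  show ?thesis
  proof (rule act_eqI[OF _ assms(3) t(1) R.m_closed[OF t(2) s(2)]])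
    have "\<phi> t \<otimes>\<^bsub>U\<^esub> (\<phi> r \<otimes>\<^bsub>U\<^esub> u) = \<phi> (t \<otimes>\<^bsub>R\<^esub> r) \<otimes>\<^bsub>U\<^esub> u"
      using assms c by (simp add: phi_mult U.m_assoc)
    also have "\<dots> = \<phi> (b \<otimes>\<^bsub>R\<^esub> a)" unfolding t(3) using assms c s t by (simp add: phi_mult U.m_assoc)
    finally show "\<phi> t \<otimes>\<^bsub>U\<^esub> (\<phi> r \<otimes>\<^bsub>U\<^esub> u) = \<phi> (b \<otimes>\<^bsub>R\<^esub> a)" .
    have "t \<odot>\<^bsub>E\<^esub> (r \<odot>\<^bsub>E\<^esub> act u e) = (b \<otimes>\<^bsub>R\<^esub> s) \<odot>\<^bsub>E\<^esub> act u e"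
      using assms c by (simp add: E.smult_assoc flip: t(3))
    also have "\<dots> = (b \<otimes>\<^bsub>R\<^esub> a) \<odot>\<^bsub>E\<^esub> e"
      using assms c s t by (simp add: E.smult_assoc act_smult[of u _ s a])
    finally show "t \<odot>\<^bsub>E\<^esub> (r \<odot>\<^bsub>E\<^esub> act u e) = (b \<otimes>\<^bsub>R\<^esub> a) \<odot>\<^bsub>E\<^esub> e" .
  qed (use assms c in auto)
qed

lemma act_one: "e \<in> carrier E \<Longrightarrow> act \<one>\<^bsub>U\<^esub> e = e"
  by (rule act_eqI[OF _ _ den_one R.one_closed]) (auto simp: phi_one)

end

section \<open>The tensor product over a ring of left quotients\<close>

locale ore_tensor = ore_extension R U \<phi> + scalar_extension R U \<phi> M
  for R :: "('r, 'a) ring_scheme" and U :: "('s, 'b) ring_scheme" and \<phi> :: "'r \<Rightarrow> 's"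
    and M :: "('r, 'm) module"
begin

abbreviation TR where "TR \<equiv> restrict_scalars \<phi> T"

lemma TR_simps [simp]:
  "carrier TR = carrier T" "x \<oplus>\<^bsub>TR\<^esub> y = x \<oplus>\<^bsub>T\<^esub> y" "\<zero>\<^bsub>TR\<^esub> = \<zero>\<^bsub>T\<^esub>" "r \<odot>\<^bsub>TR\<^esub> x = \<phi> r \<odot>\<^bsub>T\<^esub> x"
  by (simp_all add: restrict_scalars_def)

lemma left_module_TR: "left_module R TR"
proof -
  interpret TM: left_module U T by (rule left_module_T)
  have ab: "abelian_group TR"
  proof (rule abelian_groupI)
    show "\<exists>y\<in>carrier TR. y \<oplus>\<^bsub>TR\<^esub> x = \<zero>\<^bsub>TR\<^esub>" if "x \<in> carrier TR" for x
      using that by (intro bexI[of _ "\<ominus>\<^bsub>T\<^esub> x"]) (auto simp: T.l_neg)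
    show "x \<oplus>\<^bsub>TR\<^esub> y = y \<oplus>\<^bsub>TR\<^esub> x" if "x \<in> carrier TR" "y \<in> carrier TR" for x y
      using that T.a_comm by simp
  qed (simp_all add: T.a_assoc)
  show ?thesis
    by (intro left_module.intro left_module_axioms.intro ab R)
      (simp_all add: TM.smult_l_distr TM.smult_r_distr TM.smult_assoc phi_add phi_mult phi_one)
qed

lemma pure_one_hom: "(\<lambda>m. pure \<one>\<^bsub>U\<^esub> m) \<in> lmod_hom R M TR"
  using pure_balanced[of "\<one>\<^bsub>U\<^esub>"]
  by (auto simp: lmod_hom_def pure_T pure_add_right smult_pure)

text \<open>For a pure tensor, s u = a gives s (u \<otimes> m) = 1 \<otimes> a m; for a sum the Ore
  condition supplies a common left multiple of the two denominators.\<close>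

lemma tensor_denominator:
  assumes "x \<in> carrier T"
  shows "\<exists>s\<in>den. \<exists>m\<in>carrier M. \<phi> s \<odot>\<^bsub>T\<^esub> x = pure \<one>\<^bsub>U\<^esub> m"
  using assms
proof (induction rule: T_induct)
  case zero
  have "pure \<one>\<^bsub>U\<^esub> \<zero>\<^bsub>M\<^esub> = \<zero>\<^bsub>T\<^esub>"
    using lmod_hom_zero[OF M left_module_TR pure_one_hom] by simp
  then show ?case
    using den_one by (intro bexI[of _ "\<one>\<^bsub>R\<^esub>"] bexI[of _ "\<zero>\<^bsub>M\<^esub>"]) (auto simp: phi_one smult_T_zero)
next
  case (pure u m)
  obtain s a where s: "s \<in> den" "a \<in> carrier R" "\<phi> s \<otimes>\<^bsub>U\<^esub> u = \<phi> a" using denominator'[OF pure(1)] .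
  have "\<phi> s \<odot>\<^bsub>T\<^esub> pure u m = pure \<one>\<^bsub>U\<^esub> (a \<odot>\<^bsub>M\<^esub> m)"
    using pure_balanced[of "\<one>\<^bsub>U\<^esub>" a m] pure s den_carrier[OF s(1)] by (simp add: smult_pure)
  then show ?case using s pure by blast
next
  case (add x y)
  obtain s m where s: "s \<in> den" "m \<in> carrier M" "\<phi> s \<odot>\<^bsub>T\<^esub> x = pure \<one>\<^bsub>U\<^esub> m" using add by blast
  obtain t n where t: "t \<in> den" "n \<in> carrier M" "\<phi> t \<odot>\<^bsub>T\<^esub> y = pure \<one>\<^bsub>U\<^esub> n" using add by blast
  obtain p b where p: "p \<in> den" "b \<in> carrier R" "p \<otimes>\<^bsub>R\<^esub> s = b \<otimes>\<^bsub>R\<^esub> t" using ore[OF t(1) den_carrier[OF s(1)]] .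
  interpret TR: left_module R TR by (rule left_module_TR)
  note c = den_carrier[OF s(1)] den_carrier[OF t(1)] den_carrier[OF p(1)]
  have x: "(p \<otimes>\<^bsub>R\<^esub> s) \<odot>\<^bsub>TR\<^esub> x = pure \<one>\<^bsub>U\<^esub> (p \<odot>\<^bsub>M\<^esub> m)"
    using lmod_homD(3)[OF pure_one_hom c(3) s(2)] TR.smult_assoc[OF c(3,1), of x] add s by simp
  have y: "(p \<otimes>\<^bsub>R\<^esub> s) \<odot>\<^bsub>TR\<^esub> y = pure \<one>\<^bsub>U\<^esub> (b \<odot>\<^bsub>M\<^esub> n)"
    unfolding p(3) using lmod_homD(3)[OF pure_one_hom p(2) t(2)] TR.smult_assoc[OF p(2) c(2), of y] add t by simp
  have "(p \<otimes>\<^bsub>R\<^esub> s) \<odot>\<^bsub>TR\<^esub> (x \<oplus>\<^bsub>TR\<^esub> y) = pure \<one>\<^bsub>U\<^esub> (p \<odot>\<^bsub>M\<^esub> m) \<oplus>\<^bsub>TR\<^esub> pure \<one>\<^bsub>U\<^esub> (b \<odot>\<^bsub>M\<^esub> n)"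
    using TR.smult_r_distr[of "p \<otimes>\<^bsub>R\<^esub> s" x y] add c x y by simp
  also have "\<dots> = pure \<one>\<^bsub>U\<^esub> (p \<odot>\<^bsub>M\<^esub> m \<oplus>\<^bsub>M\<^esub> b \<odot>\<^bsub>M\<^esub> n)" using c p s t by (simp add: pure_add_right)
  finally show ?case
    using den_mult[OF p(1) s(1)] c p s t
    by (intro bexI[of _ "p \<otimes>\<^bsub>R\<^esub> s"] bexI[of _ "p \<odot>\<^bsub>M\<^esub> m \<oplus>\<^bsub>M\<^esub> b \<odot>\<^bsub>M\<^esub> n"]) auto
qed

lemma den_smult_T_cancel:
  assumes s: "s \<in> den" and x: "x \<in> carrier T" and 0: "\<phi> s \<odot>\<^bsub>T\<^esub> x = \<zero>\<^bsub>T\<^esub>" shows "x = \<zero>\<^bsub>T\<^esub>"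
proof -
  interpret TM: left_module U T by (rule left_module_T)
  have "x = (inv\<^bsub>U\<^esub> (\<phi> s) \<otimes>\<^bsub>U\<^esub> \<phi> s) \<odot>\<^bsub>T\<^esub> x" using x den_Units[OF s] by (simp add: U.Units_l_inv)
  also have "\<dots> = inv\<^bsub>U\<^esub> (\<phi> s) \<odot>\<^bsub>T\<^esub> (\<phi> s \<odot>\<^bsub>T\<^esub> x)"
    using x den_inv[OF s] den_carrier[OF s] by (intro TM.smult_assoc) auto
  finally show ?thesis using 0 den_inv[OF s] by (simp add: smult_T_zero)
qed

text \<open>A denominator moves a nonzero \<open>x\<close> into the image of \<open>M\<close>, and
  the result is nonzero because the denominator acts invertibly.\<close>

lemma essential_tensor:
  assumes inj: "inj_on (pure \<one>\<^bsub>U\<^esub>) (carrier M)"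
  shows "essential_extension R M TR (pure \<one>\<^bsub>U\<^esub>)"
  unfolding essential_extension_def
proof (intro conjI allI impI M left_module_TR inj)
  show "pure \<one>\<^bsub>U\<^esub> \<in> lmod_hom R M TR" using pure_one_hom by simp
  interpret TR: left_module R TR by (rule left_module_TR)
  fix N assume N: "submodule N R TR \<and> N \<inter> pure \<one>\<^bsub>U\<^esub> ` carrier M = {\<zero>\<^bsub>TR\<^esub>}"
  note N' = TR.submoduleD[OF conjunct1[OF N]]
  have "x = \<zero>\<^bsub>T\<^esub>" if x: "x \<in> N" for x
  proof -
    have xT: "x \<in> carrier T" using x N'(1) by auto
    obtain s m where s: "s \<in> den" "m \<in> carrier M" "\<phi> s \<odot>\<^bsub>T\<^esub> x = pure \<one>\<^bsub>U\<^esub> m" using tensor_denominator[OF xT] by blast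
    have "\<phi> s \<odot>\<^bsub>T\<^esub> x \<in> N" using N'(4)[OF den_carrier[OF s(1)] x] by simp
    then have "\<phi> s \<odot>\<^bsub>T\<^esub> x = \<zero>\<^bsub>T\<^esub>" using N s by auto
    then show ?thesis by (rule den_smult_T_cancel[OF s(1) xT])
  qed
  then have "N \<subseteq> {\<zero>\<^bsub>TR\<^esub>}" by (intro subsetI) simp
  moreover have "{\<zero>\<^bsub>TR\<^esub>} \<subseteq> N" using N'(2) by simp
  ultimately show "N = {\<zero>\<^bsub>TR\<^esub>}" by (rule subset_antisym)
qed

text \<open>Injectivity is tested on denominators: if h x = 0 and s x = 1 \<otimes> m, then i m = s
  h(x) = 0, so m = 0 and s x = 0, and \<open>s\<close> acts invertibly.\<close>

lemma tensor_embeds_in_envelope: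
  assumes env: "injective_envelope TYPE('r) R M E i" and tf: "torsion M = {\<zero>\<^bsub>M\<^esub>}"
  shows "\<exists>j\<in>lmod_hom R TR E. inj_on j (carrier TR) \<and> (\<forall>m\<in>carrier M. j (pure \<one>\<^bsub>U\<^esub> m) = i m)"
proof -
  have inj_E: "injective_module TYPE('r) R E" and ess: "essential_extension R M E i"
    using env by (auto simp: injective_envelope_def)
  have lE: "left_module R E" and i: "i \<in> lmod_hom R M E" "inj_on i (carrier M)"
    using ess by (auto simp: essential_extension_def)
  interpret E: ore_divisible R U \<phi> E
    by (intro ore_divisible.intro ore_divisible_axioms.intro ore_extension_axioms lE
        torsion_essential_extension[OF ess tf] injective_divisible[OF inj_E])
  note ic = lmod_homD[OF i(1)]
  obtain h where h: "\<And>x. x \<in> carrier T \<Longrightarrow> h x \<in> carrier E"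
    "\<And>x y. x \<in> carrier T \<Longrightarrow> y \<in> carrier T \<Longrightarrow> h (x \<oplus>\<^bsub>T\<^esub> y) = h x \<oplus>\<^bsub>E\<^esub> h y"
    "\<And>u m. u \<in> carrier U \<Longrightarrow> m \<in> carrier M \<Longrightarrow> h (pure u m) = E.act u (i m)"
    by (rule T_lift[of E "\<lambda>u m. E.act u (i m)", OF E.E.M.abelian_group_axioms])
      (auto simp: ic E.act_closed E.act_add_left E.act_add_right E.act_balanced)
  have h0: "h \<zero>\<^bsub>T\<^esub> = \<zero>\<^bsub>E\<^esub>"
    using h(1,2)[of "\<zero>\<^bsub>T\<^esub>"] h(2)[of "\<zero>\<^bsub>T\<^esub>" "\<zero>\<^bsub>T\<^esub>"]
    by (metis E.E.M.add.l_cancel_one' T.l_zero T.zero_closed)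
  have h_smult: "h (\<phi> r \<odot>\<^bsub>T\<^esub> x) = r \<odot>\<^bsub>E\<^esub> h x" if r: "r \<in> carrier R" and x: "x \<in> carrier T" for r x
    using x
  proof (induction rule: T_induct)
    case zero then show ?case using r by (simp add: smult_T_zero h0 E.E.smult_r_zero)
  next
    case (pure u m)
    then show ?case using r ic by (simp add: smult_pure h(3) E.act_mult_left)
  next
    case (add x y)
    then show ?case using r by (simp add: smult_T_add smult_T_closed h(1,2) E.E.smult_r_distr)
  qed
  have hom: "h \<in> lmod_hom R TR E" using h h_smult by (auto simp: lmod_hom_def)
  have hi: "h (pure \<one>\<^bsub>U\<^esub> m) = i m" if "m \<in> carrier M" for m using that ic by (simp add: h(3) E.act_one)
  have ker: "x = \<zero>\<^bsub>T\<^esub>" if x: "x \<in> carrier T" "h x = \<zero>\<^bsub>E\<^esub>" for x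
  proof -
    obtain s m where s: "s \<in> den" "m \<in> carrier M" "\<phi> s \<odot>\<^bsub>T\<^esub> x = pure \<one>\<^bsub>U\<^esub> m" using tensor_denominator[OF x(1)] by blast
    have "i m = h (\<phi> s \<odot>\<^bsub>T\<^esub> x)" using s hi by simp
    also have "\<dots> = \<zero>\<^bsub>E\<^esub>" using h_smult[OF den_carrier[OF s(1)] x(1)] x den_carrier[OF s(1)] by (simp add: E.E.smult_r_zero)
    finally have "i m = i \<zero>\<^bsub>M\<^esub>" using lmod_hom_zero[OF M lE i(1)] by simp
    then have "m = \<zero>\<^bsub>M\<^esub>" using inj_onD[OF i(2)] s by simp
    then have "\<phi> s \<odot>\<^bsub>T\<^esub> x = \<zero>\<^bsub>T\<^esub>"
      using s lmod_hom_zero[OF M left_module_TR pure_one_hom] by simp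
    then show ?thesis by (rule den_smult_T_cancel[OF s(1) x(1)])
  qed
  have "inj_on h (carrier TR)"
  proof (rule inj_onI)
    fix x y assume xy: "x \<in> carrier TR" "y \<in> carrier TR" "h x = h y"
    have "h (x \<oplus>\<^bsub>T\<^esub> \<ominus>\<^bsub>T\<^esub> y) \<oplus>\<^bsub>E\<^esub> h y = h x"
      using xy h(2)[of "x \<oplus>\<^bsub>T\<^esub> \<ominus>\<^bsub>T\<^esub> y" y] by (simp add: T.a_assoc T.l_neg)
    then have "h (x \<oplus>\<^bsub>T\<^esub> \<ominus>\<^bsub>T\<^esub> y) = \<zero>\<^bsub>E\<^esub>"
      using xy h(1) by (metis E.E.M.add.r_cancel_one' T.a_inv_closed T.add.m_closed TR_simps(1))
    then have "x \<oplus>\<^bsub>T\<^esub> \<ominus>\<^bsub>T\<^esub> y = \<zero>\<^bsub>T\<^esub>" using xy by (intro ker) auto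
    then have "\<ominus>\<^bsub>T\<^esub> (\<ominus>\<^bsub>T\<^esub> y) = x" using xy by (intro T.minus_equality) auto
    then show "x = y" using xy by simp
  qed
  then show ?thesis using hom hi by blast
qed

end

section \<open>Finitely generated projective modules\<close>

lemma free_module_simps:
  "x \<in> carrier (free_module R I) \<longleftrightarrow> x \<in> I \<rightarrow>\<^sub>E carrier R \<and> finite {i\<in>I. x i \<noteq> \<zero>\<^bsub>R\<^esub>}"
  "\<zero>\<^bsub>free_module R I\<^esub> = (\<lambda>i\<in>I. \<zero>\<^bsub>R\<^esub>)"
  "x \<oplus>\<^bsub>free_module R I\<^esub> y = (\<lambda>i\<in>I. x i \<oplus>\<^bsub>R\<^esub> y i)"
  "a \<odot>\<^bsub>free_module R I\<^esub> x = (\<lambda>i\<in>I. a \<otimes>\<^bsub>R\<^esub> x i)"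
  by (simp_all add: free_module_def)

lemma hom_to_free_module_zero:
  assumes "left_module R M" "f \<in> lmod_hom R M (free_module R I)"
  shows "f \<zero>\<^bsub>M\<^esub> = (\<lambda>i\<in>I. \<zero>\<^bsub>R\<^esub>)"
proof -
  interpret M: left_module R M by fact
  have c: "f \<zero>\<^bsub>M\<^esub> \<in> carrier (free_module R I)" by (intro lmod_homD(1)[OF assms(2)]) simp
  have "f \<zero>\<^bsub>M\<^esub> = f (\<zero>\<^bsub>R\<^esub> \<odot>\<^bsub>M\<^esub> \<zero>\<^bsub>M\<^esub>)" by (simp add: M.smult_r_zero)
  also have "\<dots> = \<zero>\<^bsub>R\<^esub> \<odot>\<^bsub>free_module R I\<^esub> f \<zero>\<^bsub>M\<^esub>" by (intro lmod_homD(3)[OF assms(2)]) auto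
  also have "\<dots> = (\<lambda>i\<in>I. \<zero>\<^bsub>R\<^esub>)"
    unfolding free_module_simps using c
    by (intro restrict_ext M.R.l_null) (auto simp: free_module_simps)
  finally show ?thesis .
qed

text \<open>The finitely many generators have their coordinates supported in a finite set
  \<open>J\<close>. The elements supported in \<open>J\<close> form a submodule, hence all of
  \<open>M\<close>, and the splitting reduces to the coordinates in \<open>J\<close>.\<close>

lemma fg_projective_dual_basis:
  fixes R :: "('r, 'a) ring_scheme" and M :: "('r, 'm, 'b) module_scheme"
  assumes "fg_projective R M"
  shows "\<exists>(J :: 'm set) c e. finite J \<and> (\<forall>k\<in>J. c k \<in> lmod_hom R M (ring_module R)) \<and>
    (\<forall>k\<in>J. e k \<in> carrier M) \<and> (\<forall>m\<in>carrier M. m = finsum M (\<lambda>k. c k m \<odot>\<^bsub>M\<^esub> e k) J)"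
proof -
  have lM: "left_module R M" and fg: "finitely_generated R M" and pr: "projective_module R M"
    using assms by (auto simp: fg_projective_def finitely_generated_def)
  interpret M: left_module R M by fact
  obtain S where S: "finite S" "S \<subseteq> carrier M" "\<And>N. submodule N R M \<Longrightarrow> S \<subseteq> N \<Longrightarrow> N = carrier M"
    using fg unfolding finitely_generated_def by blast
  obtain I :: "'m set" and i p where i: "i \<in> lmod_hom R M (free_module R I)"
    and p: "p \<in> lmod_hom R (free_module R I) M" and pi: "\<And>x. x \<in> carrier M \<Longrightarrow> p (i x) = x"
    using pr unfolding projective_module_def by blast
  have ic: "i m k \<in> carrier R" if "m \<in> carrier M" "k \<in> I" for m k
    using lmod_homD(1)[OF i that(1)] that(2) by (auto simp: free_module_simps)
  have i_add: "i (x \<oplus>\<^bsub>M\<^esub> y) k = i x k \<oplus>\<^bsub>R\<^esub> i y k" if "x \<in> carrier M" "y \<in> carrier M" "k \<in> I" for x y k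
    using lmod_homD(2)[OF i that(1,2)] that(3) by (simp add: free_module_simps)
  have i_smult: "i (a \<odot>\<^bsub>M\<^esub> x) k = a \<otimes>\<^bsub>R\<^esub> i x k" if "a \<in> carrier R" "x \<in> carrier M" "k \<in> I" for a x k
    using lmod_homD(3)[OF i that(1,2)] that(3) by (simp add: free_module_simps)
  define J where "J = (\<Union>x\<in>S. {k\<in>I. i x k \<noteq> \<zero>\<^bsub>R\<^esub>})"
  have fJ: "finite J" unfolding J_def
    using S(1,2) lmod_homD(1)[OF i] by (intro finite_UN_I) (auto simp: free_module_simps)
  have JI: "J \<subseteq> I" by (auto simp: J_def)
  define N where "N = {m\<in>carrier M. \<forall>k\<in>I - J. i m k = \<zero>\<^bsub>R\<^esub>}"
  have "submodule N R M"
  proof (rule M.submoduleI')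
    show "\<zero>\<^bsub>M\<^esub> \<in> N" using hom_to_free_module_zero[OF lM i] by (simp add: N_def)
    show "x \<oplus>\<^bsub>M\<^esub> y \<in> N" if "x \<in> N" "y \<in> N" for x y using that by (auto simp: N_def i_add)
    show "a \<odot>\<^bsub>M\<^esub> x \<in> N" if "a \<in> carrier R" "x \<in> N" for a x using that by (auto simp: N_def i_smult)
  qed (auto simp: N_def)
  moreover have "S \<subseteq> N" using S(2) by (auto simp: N_def J_def)
  ultimately have N: "N = carrier M" by (rule S(3))
  define \<delta> where "\<delta> k = (\<lambda>j\<in>I. if j = k then \<one>\<^bsub>R\<^esub> else \<zero>\<^bsub>R\<^esub>)" for k
  have dc: "\<delta> k \<in> carrier (free_module R I)" for k
  proof -
    have "{j \<in> I. \<delta> k j \<noteq> \<zero>\<^bsub>R\<^esub>} \<subseteq> {k}" by (auto simp: \<delta>_def)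
    then show ?thesis by (auto simp: free_module_simps \<delta>_def intro: finite_subset)
  qed
  have p0: "p (\<lambda>i\<in>I. \<zero>\<^bsub>R\<^esub>) = \<zero>\<^bsub>M\<^esub>"
    using pi[OF M.M.zero_closed] hom_to_free_module_zero[OF lM i] by simp
  have expand: "p x = finsum M (\<lambda>k. x k \<odot>\<^bsub>M\<^esub> p (\<delta> k)) K"
    if "finite K" "K \<subseteq> I" "x \<in> carrier (free_module R I)" "\<forall>j\<in>I - K. x j = \<zero>\<^bsub>R\<^esub>" for K x
    using that
  proof (induction K arbitrary: x rule: finite_induct)
    case empty
    then have "x = (\<lambda>i\<in>I. \<zero>\<^bsub>R\<^esub>)" by (auto simp: free_module_simps fun_eq_iff PiE_def extensional_def)
    then show ?case by (simp only: M.M.finsum_empty p0)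
  next
    case (insert k K)
    define x' where "x' = (\<lambda>j\<in>I. if j = k then \<zero>\<^bsub>R\<^esub> else x j)"
    have xR: "x j \<in> carrier R" if "j \<in> I" for j using insert.prems(2) that by (auto simp: free_module_simps)
    have kI: "k \<in> I" and KI: "K \<subseteq> I" using insert.prems by auto
    have "{j \<in> I. x' j \<noteq> \<zero>\<^bsub>R\<^esub>} \<subseteq> {j \<in> I. x j \<noteq> \<zero>\<^bsub>R\<^esub>}" by (auto simp: x'_def)
    then have "finite {j \<in> I. x' j \<noteq> \<zero>\<^bsub>R\<^esub>}"
      using insert.prems(2) unfolding free_module_simps by (blast intro: finite_subset)
    moreover have "x' \<in> I \<rightarrow>\<^sub>E carrier R" using xR by (auto simp: x'_def)
    ultimately have x'c: "x' \<in> carrier (free_module R I)" by (simp add: free_module_simps)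
    have x_eq: "x = (x k \<odot>\<^bsub>free_module R I\<^esub> \<delta> k) \<oplus>\<^bsub>free_module R I\<^esub> x'"
      using insert.prems(2) xR xR[OF kI]
      by (auto simp: free_module_simps x'_def \<delta>_def fun_eq_iff PiE_def extensional_def)
    have dxc: "x k \<odot>\<^bsub>free_module R I\<^esub> \<delta> k \<in> carrier (free_module R I)"
    proof -
      have "{j \<in> I. (x k \<odot>\<^bsub>free_module R I\<^esub> \<delta> k) j \<noteq> \<zero>\<^bsub>R\<^esub>} \<subseteq> {k}"
        using xR[OF kI] by (auto simp: free_module_simps \<delta>_def)
      then show ?thesis using xR[OF kI] by (auto simp: free_module_simps \<delta>_def intro: finite_subset)
    qed
    have "p x = p (x k \<odot>\<^bsub>free_module R I\<^esub> \<delta> k) \<oplus>\<^bsub>M\<^esub> p x'"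
      by (subst x_eq) (rule lmod_homD(2)[OF p dxc x'c])
    also have "p (x k \<odot>\<^bsub>free_module R I\<^esub> \<delta> k) = x k \<odot>\<^bsub>M\<^esub> p (\<delta> k)"
      by (rule lmod_homD(3)[OF p xR[OF kI] dc])
    also have "p x' = finsum M (\<lambda>j. x' j \<odot>\<^bsub>M\<^esub> p (\<delta> j)) K"
      using insert.prems KI by (intro insert.IH x'c) (auto simp: x'_def)
    also have "\<dots> = finsum M (\<lambda>j. x j \<odot>\<^bsub>M\<^esub> p (\<delta> j)) K"
      using insert.hyps KI xR lmod_homD(1)[OF p dc] by (intro M.M.finsum_cong') (auto simp: x'_def)
    finally show ?case
      using insert.hyps KI kI xR lmod_homD(1)[OF p dc] by (subst M.M.finsum_insert) auto
  qed
  show ?thesis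
  proof (intro exI[of _ J] exI[of _ "\<lambda>k m. i m k"] exI[of _ "\<lambda>k. p (\<delta> k)"] conjI ballI)
    show "(\<lambda>m. i m k) \<in> lmod_hom R M (ring_module R)" if "k \<in> J" for k
      using that JI by (auto simp: lmod_hom_def ring_module_def ic i_add i_smult)
    show "m = finsum M (\<lambda>k. i m k \<odot>\<^bsub>M\<^esub> p (\<delta> k)) J" if m: "m \<in> carrier M" for m
      using expand[OF fJ JI lmod_homD(1)[OF i m]] pi[OF m] m N by (auto simp: N_def)
  qed (use fJ lmod_homD(1)[OF p dc] in auto)
qed

text \<open>The supremum in \<open>vn_dim\<close> over an empty set would be -\<infinity>; the zero
  submodule makes it 0 for a torsion module.\<close>

lemma fg_projective_zero:
  assumes Z: "left_module R Z" "carrier Z = {\<zero>\<^bsub>Z\<^esub>}" shows "fg_projective R Z"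
proof -
  interpret Z: left_module R Z by fact
  have "N = carrier Z" if "submodule N R Z" for N using Z.submoduleD(1,2)[OF that] Z(2) by auto
  then have "finitely_generated R Z"
    unfolding finitely_generated_def using Z(1) by (intro conjI exI[of _ "{}"]) auto
  moreover have "projective_module R Z"
    unfolding projective_module_def
  proof (intro conjI Z(1) exI[of _ "{}"] exI[of _ "\<lambda>_ _. undefined"] exI[of _ "\<lambda>_. \<zero>\<^bsub>Z\<^esub>"] ballI)
    show "(\<lambda>_ _. undefined) \<in> lmod_hom R Z (free_module R {})"
      by (auto simp: lmod_hom_def free_module_simps)
    show "(\<lambda>_. \<zero>\<^bsub>Z\<^esub>) \<in> lmod_hom R (free_module R {}) Z"
      by (auto simp: lmod_hom_def Z.smult_r_zero)
  qed (use Z(2) in auto)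
  ultimately show ?thesis by (simp add: fg_projective_def)
qed

context ore_extension
begin

text \<open>Coordinates embed a projective module into a free one, and a denominator is no left zero
  divisor since it becomes a unit in \<open>U\<close>.\<close>

lemma torsion_projective:
  fixes P :: "('r, 'm, 'c) module_scheme"
  assumes "projective_module R P" shows "torsion P = {\<zero>\<^bsub>P\<^esub>}"
proof -
  have lP: "left_module R P" using assms by (simp add: projective_module_def)
  interpret P: left_module R P by fact
  obtain I :: "'m set" and i p where i: "i \<in> lmod_hom R P (free_module R I)" and pi: "\<And>x. x \<in> carrier P \<Longrightarrow> p (i x) = x"
    using assms unfolding projective_module_def by blast
  note i0 = hom_to_free_module_zero[OF lP i]
  have "x = \<zero>\<^bsub>P\<^esub>" if x: "x \<in> torsion P" for x
  proof -
    obtain s where s: "s \<in> den" "s \<odot>\<^bsub>P\<^esub> x = \<zero>\<^bsub>P\<^esub>" and xP: "x \<in> carrier P" using x by (auto simp: torsion_def)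
    note sc = den_carrier[OF s(1)]
    have ix: "i x \<in> carrier (free_module R I)" using lmod_homD(1)[OF i xP] .
    have "s \<odot>\<^bsub>free_module R I\<^esub> i x = (\<lambda>k\<in>I. \<zero>\<^bsub>R\<^esub>)"
      using lmod_homD(3)[OF i sc xP] s(2) i0 by simp
    then have sx: "s \<otimes>\<^bsub>R\<^esub> i x k = \<zero>\<^bsub>R\<^esub>" if "k \<in> I" for k
      using that by (metis free_module_simps(4) restrict_apply')
    have "i x k = \<zero>\<^bsub>R\<^esub>" if k: "k \<in> I" for k
    proof -
      have c: "i x k \<in> carrier R" using ix k by (auto simp: free_module_simps)
      have "\<phi> s \<otimes>\<^bsub>U\<^esub> \<phi> (i x k) = \<phi> s \<otimes>\<^bsub>U\<^esub> \<zero>\<^bsub>U\<^esub>"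
        using sx[OF k] sc c by (simp add: phi_zero flip: phi_mult)
      then have "\<phi> (i x k) = \<phi> \<zero>\<^bsub>R\<^esub>" using c by (simp add: phi_zero den_l_cancel[OF s(1)])
      then show ?thesis using c by (intro phi_inject) auto
    qed
    then have "i x = (\<lambda>k\<in>I. \<zero>\<^bsub>R\<^esub>)" using ix by (auto simp: free_module_simps fun_eq_iff PiE_def extensional_def)
    then have "i x = i \<zero>\<^bsub>P\<^esub>" using i0 by simp
    from arg_cong[OF this, of p] show ?thesis unfolding pi[OF xP] pi[OF P.M.zero_closed] .
  qed
  moreover have "\<zero>\<^bsub>P\<^esub> \<in> torsion P" using P.submoduleD(2)[OF submodule_torsion[OF lP]] .
  ultimately show ?thesis by blast
qed

definition quotient_module :: "('r, 's) module" where
  "quotient_module = \<lparr>carrier = carrier U, monoid.mult = undefined, monoid.one = undefined,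
     ring.zero = \<zero>\<^bsub>U\<^esub>, ring.add = (\<oplus>\<^bsub>U\<^esub>), smult = (\<lambda>r u. \<phi> r \<otimes>\<^bsub>U\<^esub> u)\<rparr>"

lemma quotient_module_simps [simp]:
  "carrier quotient_module = carrier U" "\<zero>\<^bsub>quotient_module\<^esub> = \<zero>\<^bsub>U\<^esub>"
  "x \<oplus>\<^bsub>quotient_module\<^esub> y = x \<oplus>\<^bsub>U\<^esub> y" "r \<odot>\<^bsub>quotient_module\<^esub> u = \<phi> r \<otimes>\<^bsub>U\<^esub> u"
  by (simp_all add: quotient_module_def)

lemma left_module_quotient_module: "left_module R quotient_module"
proof -
  have ab: "abelian_group quotient_module"
  proof (rule abelian_groupI)
    show "\<exists>y\<in>carrier quotient_module. y \<oplus>\<^bsub>quotient_module\<^esub> x = \<zero>\<^bsub>quotient_module\<^esub>"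
      if "x \<in> carrier quotient_module" for x
      using that by (intro bexI[of _ "\<ominus>\<^bsub>U\<^esub> x"]) (auto simp: U.l_neg)
  qed (auto simp: U.a_assoc intro: U.a_comm)
  show ?thesis
    by (intro left_module.intro left_module_axioms.intro ab R)
      (simp_all add: U.l_distr U.r_distr U.m_assoc phi_add phi_mult phi_one)
qed

end

context ore_tensor
begin

text \<open>The map induced by \<open>c\<close> from the tensor product to U \<otimes> R =
  U.\<close>

lemma coordinate_exists:
  assumes c: "c \<in> lmod_hom R M (ring_module R)"
  obtains h where "h \<in> lmod_hom R TR quotient_module"
    "\<And>u m. u \<in> carrier U \<Longrightarrow> m \<in> carrier M \<Longrightarrow> h (pure u m) = u \<otimes>\<^bsub>U\<^esub> \<phi> (c m)"
proof -
  have cc: "c m \<in> carrier R" if "m \<in> carrier M" for m using lmod_homD(1)[OF c that] by (simp add: ring_module_def)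
  have ca: "c (m \<oplus>\<^bsub>M\<^esub> n) = c m \<oplus>\<^bsub>R\<^esub> c n" if "m \<in> carrier M" "n \<in> carrier M" for m n
    using lmod_homD(2)[OF c that] by (simp add: ring_module_def)
  have cs: "c (r \<odot>\<^bsub>M\<^esub> m) = r \<otimes>\<^bsub>R\<^esub> c m" if "r \<in> carrier R" "m \<in> carrier M" for r m
    using lmod_homD(3)[OF c that] by (simp add: ring_module_def)
  obtain h where h: "\<And>x. x \<in> carrier T \<Longrightarrow> h x \<in> carrier U"
    "\<And>x y. x \<in> carrier T \<Longrightarrow> y \<in> carrier T \<Longrightarrow> h (x \<oplus>\<^bsub>T\<^esub> y) = h x \<oplus>\<^bsub>U\<^esub> h y"
    "\<And>u m. u \<in> carrier U \<Longrightarrow> m \<in> carrier M \<Longrightarrow> h (pure u m) = u \<otimes>\<^bsub>U\<^esub> \<phi> (c m)"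
    by (rule T_lift[of U "\<lambda>u m. u \<otimes>\<^bsub>U\<^esub> \<phi> (c m)", OF U.abelian_group_axioms])
      (auto simp: cc ca cs phi_add phi_mult U.l_distr U.r_distr U.m_assoc)
  have h0: "h \<zero>\<^bsub>T\<^esub> = \<zero>\<^bsub>U\<^esub>"
    using h(1)[of "\<zero>\<^bsub>T\<^esub>"] h(2)[of "\<zero>\<^bsub>T\<^esub>" "\<zero>\<^bsub>T\<^esub>"]
    by (metis U.add.l_cancel_one' T.l_zero T.zero_closed)
  have "h (\<phi> r \<odot>\<^bsub>T\<^esub> x) = \<phi> r \<otimes>\<^bsub>U\<^esub> h x" if r: "r \<in> carrier R" and x: "x \<in> carrier T" for r x
    using x
  proof (induction rule: T_induct)
    case zero then show ?case using r by (simp add: smult_T_zero h0)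
  next
    case (pure u m)
    then show ?case using r cc by (simp add: smult_pure h(3) U.m_assoc)
  next
    case (add x y)
    then show ?case using r by (simp add: smult_T_add smult_T_closed h(1,2) U.r_distr)
  qed
  then have "h \<in> lmod_hom R TR quotient_module" using h by (auto simp: lmod_hom_def)
  then show ?thesis using that h(3) by blast
qed

lemma pure_finsum:
  assumes "u \<in> carrier U" "finite J" "f \<in> J \<rightarrow> carrier M"
  shows "pure u (finsum M f J) = finsum T (\<lambda>k. pure u (f k)) J"
  by (rule M.finite_sum_hom[OF abelian_group_T assms(2,3)])
    (use assms(1) in \<open>auto simp: pure_T pure_add_right\<close>)

text \<open>For a dual basis \<open>c k\<close>, \<open>e k\<close> the maps \<open>h k\<close> and
  u \<mapsto> u \<otimes> e k make the tensor product a retract of a finite power of U. A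
  homomorphism into it is extended one coordinate at a time by Baer's criterion, for test modules of
  any type.\<close>

lemma fg_projective_tensor_envelope:
  assumes fgp: "fg_projective R M" and baer: "baer_property R quotient_module"
  shows "injective_envelope TYPE('l) R M TR (pure \<one>\<^bsub>U\<^esub>)"
proof -
  obtain J :: "'m set" and c e where J: "finite J"
    and c': "\<forall>k\<in>J. c k \<in> lmod_hom R M (ring_module R)" and e': "\<forall>k\<in>J. e k \<in> carrier M"
    and basis': "\<forall>m\<in>carrier M. m = finsum M (\<lambda>k. c k m \<odot>\<^bsub>M\<^esub> e k) J"
    using fg_projective_dual_basis[OF fgp] by (elim exE conjE)
  note c = bspec[OF c'] and e = bspec[OF e'] and basis = bspec[OF basis']
  have cc: "c k m \<in> carrier R" if "k \<in> J" "m \<in> carrier M" for k m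
    using lmod_homD(1)[OF c[OF that(1)] that(2)] by (simp add: ring_module_def)
  have "\<forall>k\<in>J. \<exists>h. h \<in> lmod_hom R TR quotient_module \<and>
      (\<forall>u\<in>carrier U. \<forall>m\<in>carrier M. h (pure u m) = u \<otimes>\<^bsub>U\<^esub> \<phi> (c k m))"
    by (intro ballI, rule coordinate_exists[OF c], assumption, intro exI conjI ballI)
  then obtain h where h: "\<And>k. k \<in> J \<Longrightarrow> h k \<in> lmod_hom R TR quotient_module"
    and h_pure: "\<And>k u m. k \<in> J \<Longrightarrow> u \<in> carrier U \<Longrightarrow> m \<in> carrier M \<Longrightarrow> h k (pure u m) = u \<otimes>\<^bsub>U\<^esub> \<phi> (c k m)"
    unfolding bchoice_iff by blast
  have hc: "h k x \<in> carrier U" if "k \<in> J" "x \<in> carrier T" for k x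
    using lmod_homD(1)[OF h[OF that(1)]] that(2) by simp
  have ha: "h k (x \<oplus>\<^bsub>T\<^esub> y) = h k x \<oplus>\<^bsub>U\<^esub> h k y" if "k \<in> J" "x \<in> carrier T" "y \<in> carrier T" for k x y
    using lmod_homD(2)[OF h[OF that(1)]] that(2,3) by simp
  have h0: "h k \<zero>\<^bsub>T\<^esub> = \<zero>\<^bsub>U\<^esub>" if "k \<in> J" for k
    using lmod_hom_zero[OF left_module_TR left_module_quotient_module h[OF that]] by simp
  interpret TM: left_module U T by (rule left_module_T)
  have pure_0: "pure \<zero>\<^bsub>U\<^esub> m = \<zero>\<^bsub>T\<^esub>" if "m \<in> carrier M" for m
    using smult_pure[of "\<zero>\<^bsub>U\<^esub>" "\<one>\<^bsub>U\<^esub>" m] TM.smult_l_zero[OF pure_T[of "\<one>\<^bsub>U\<^esub>" m]] that by simp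
  \<comment> \<open>The dual basis identity persists after tensoring: on pure tensors balancing
    moves the scalar \<open>c k m\<close> across.\<close>
  have T_basis: "finsum T (\<lambda>k. pure (h k x) (e k)) J = x" if "x \<in> carrier T" for x
    using that
  proof (induction rule: T_induct)
    case zero
    have "finsum T (\<lambda>k. pure (h k \<zero>\<^bsub>T\<^esub>) (e k)) J = finsum T (\<lambda>k. \<zero>\<^bsub>T\<^esub>) J"
      using h0 e pure_0 by (intro T.finsum_cong') auto
    then show ?case by simp
  next
    case (pure u m)
    have "finsum T (\<lambda>k. pure (h k (pure u m)) (e k)) J = finsum T (\<lambda>k. pure u (c k m \<odot>\<^bsub>M\<^esub> e k)) J"
      using pure cc e by (intro T.finsum_cong') (auto simp: h_pure pure_balanced intro!: pure_T)
    also have "\<dots> = pure u (finsum M (\<lambda>k. c k m \<odot>\<^bsub>M\<^esub> e k) J)"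
      using pure cc e J by (intro pure_finsum[symmetric]) auto
    also have "\<dots> = pure u m" using basis[OF pure(2)] by simp
    finally show ?case .
  next
    case (add x y)
    have "finsum T (\<lambda>k. pure (h k (x \<oplus>\<^bsub>T\<^esub> y)) (e k)) J
        = finsum T (\<lambda>k. pure (h k x) (e k) \<oplus>\<^bsub>T\<^esub> pure (h k y) (e k)) J"
      using add hc e by (intro T.finsum_cong') (auto simp: ha pure_add_left intro!: pure_T)
    also have "\<dots> = finsum T (\<lambda>k. pure (h k x) (e k)) J \<oplus>\<^bsub>T\<^esub> finsum T (\<lambda>k. pure (h k y) (e k)) J"
      using add hc e by (intro T.finsum_addf) (auto intro!: pure_T)
    finally show ?case using add by simp
  qed
  have inj: "inj_on (pure \<one>\<^bsub>U\<^esub>) (carrier M)"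
  proof (rule inj_onI)
    fix m n assume mn: "m \<in> carrier M" "n \<in> carrier M" "pure \<one>\<^bsub>U\<^esub> m = pure \<one>\<^bsub>U\<^esub> n"
    have "c k m = c k n" if k: "k \<in> J" for k
    proof (rule phi_inject[OF cc[OF k mn(1)] cc[OF k mn(2)]])
      show "\<phi> (c k m) = \<phi> (c k n)"
        using h_pure[OF k U.one_closed mn(1)] h_pure[OF k U.one_closed mn(2)] mn cc[OF k] by simp
    qed
    then have "finsum M (\<lambda>k. c k m \<odot>\<^bsub>M\<^esub> e k) J = finsum M (\<lambda>k. c k n \<odot>\<^bsub>M\<^esub> e k) J"
      using cc e mn by (intro M.M.finsum_cong') auto
    then show "m = n" using basis[OF mn(1)] basis[OF mn(2)] by simp
  qed
  have "injective_module TYPE('l) R TR"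
    unfolding injective_module_def
  proof (intro conjI allI impI left_module_TR)
    fix L :: "('r, 'l) module" and N f
    assume *: "left_module R L \<and> submodule N R L \<and> f \<in> lmod_hom R (L\<lparr>carrier := N\<rparr>) TR"
    then have f: "f \<in> lmod_hom R (L\<lparr>carrier := N\<rparr>) TR" by blast
    interpret baer_extension R quotient_module L
      using * left_module_quotient_module baer by (intro baer_extension.intro) auto
    have "\<forall>k\<in>J. \<exists>g. g \<in> lmod_hom R L quotient_module \<and> (\<forall>x\<in>N. g x = h k (f x))"
      unfolding Bex_def[symmetric]
    proof (intro ballI extension_exists)
      fix k assume k: "k \<in> J"
      show "submodule N R L" using * by blast
      show "(\<lambda>x. h k (f x)) \<in> lmod_hom R (L\<lparr>carrier := N\<rparr>) quotient_module"
        using lmod_homD[OF f] lmod_homD[OF h[OF k]] by (auto simp: lmod_hom_def)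
    qed
    then obtain g where g: "\<And>k. k \<in> J \<Longrightarrow> g k \<in> lmod_hom R L quotient_module"
      and gN: "\<And>k x. k \<in> J \<Longrightarrow> x \<in> N \<Longrightarrow> g k x = h k (f x)"
      unfolding bchoice_iff by blast
    have gc: "g k x \<in> carrier U" if "k \<in> J" "x \<in> carrier L" for k x
      using lmod_homD(1)[OF g[OF that(1)] that(2)] by simp
    define G where "G x = finsum T (\<lambda>k. pure (g k x) (e k)) J" for x
    have pc: "(\<lambda>k. pure (g k x) (e k)) \<in> J \<rightarrow> carrier T" if "x \<in> carrier L" for x
      using gc e that by (auto intro!: pure_T)
    have "G \<in> lmod_hom R L TR"
      unfolding lmod_hom_def
    proof (intro CollectI conjI ballI funcsetI)
      show "G x \<in> carrier TR" if "x \<in> carrier L" for x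
        using pc[OF that] by (simp add: G_def T.finsum_closed)
      show "G (x \<oplus>\<^bsub>L\<^esub> y) = G x \<oplus>\<^bsub>TR\<^esub> G y" if xy: "x \<in> carrier L" "y \<in> carrier L" for x y
      proof -
        have "G (x \<oplus>\<^bsub>L\<^esub> y) = finsum T (\<lambda>k. pure (g k x) (e k) \<oplus>\<^bsub>T\<^esub> pure (g k y) (e k)) J"
          unfolding G_def using lmod_homD(2)[OF g xy] gc e xy
          by (intro T.finsum_cong') (auto simp: pure_add_left intro!: pure_T)
        also have "\<dots> = G x \<oplus>\<^bsub>T\<^esub> G y" unfolding G_def by (intro T.finsum_addf pc xy)
        finally show ?thesis by simp
      qed
      show "G (r \<odot>\<^bsub>L\<^esub> x) = r \<odot>\<^bsub>TR\<^esub> G x" if rx: "r \<in> carrier R" "x \<in> carrier L" for r x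
      proof -
        have "G (r \<odot>\<^bsub>L\<^esub> x) = finsum T (\<lambda>k. \<phi> r \<odot>\<^bsub>T\<^esub> pure (g k x) (e k)) J"
          unfolding G_def using lmod_homD(3)[OF g rx] gc e rx
          by (intro T.finsum_cong') (auto simp: smult_pure intro!: pure_T)
        also have "\<dots> = \<phi> r \<odot>\<^bsub>T\<^esub> G x"
          unfolding G_def using rx by (intro TM.smult_finsum[symmetric] J pc) auto
        finally show ?thesis by simp
      qed
    qed
    moreover have "G x = f x" if x: "x \<in> N" for x
    proof -
      have fx: "f x \<in> carrier T" using lmod_homD(1)[OF f, of x] x by simp
      have "G x = finsum T (\<lambda>k. pure (h k (f x)) (e k)) J"
        unfolding G_def using x gN hc[OF _ fx] e by (intro T.finsum_cong') (auto intro!: pure_T)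
      then show ?thesis using T_basis[OF fx] by simp
    qed
    ultimately show "\<exists>g\<in>lmod_hom R L TR. \<forall>x\<in>N. g x = f x" by blast
  qed
  then show ?thesis using essential_tensor[OF inj] by (simp add: injective_envelope_def)
qed

end

section \<open>Torsion and the class \<open>P\<close>\<close>

context finite_vna
begin

lemma ore_extension_affiliated:
  "ore_extension (op_ring A) (affiliated_ring A \<eta>) (affiliated_incl A \<eta>)"
  by (intro ore_extension.intro ring_op_ring ring_affiliated_ring affiliated_incl_hom affiliated_incl_inj
      affiliated_denominator)

sublocale Q: ore_extension "op_ring A" "affiliated_ring A \<eta>" "affiliated_incl A \<eta>"
  by (rule ore_extension_affiliated)

lemma baer_affiliated: "baer_property (op_ring A) Q.quotient_module"
  unfolding baer_property_def
proof (intro allI impI)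
  fix I f
  assume *: "submodule I (op_ring A) (ring_module (op_ring A)) \<and>
    f \<in> lmod_hom (op_ring A) ((ring_module (op_ring A))\<lparr>carrier := I\<rparr>) Q.quotient_module"
  interpret L: left_module "op_ring A" "ring_module (op_ring A)"
    by (rule left_module_ring_module[OF ring_op_ring])
  note I = L.submoduleD[OF conjunct1[OF *]] and f = lmod_homD[OF conjunct2[OF *]]
  have "\<exists>u\<in>carrier (affiliated_ring A \<eta>). \<forall>x\<in>I.
      f x = affiliated_incl A \<eta> x \<otimes>\<^bsub>affiliated_ring A \<eta>\<^esub> u"
    by (rule affiliated_ideal_hom) (use I f in \<open>auto simp: ring_module_def\<close>)
  then show "\<exists>u\<in>carrier Q.quotient_module. \<forall>x\<in>I. f x = x \<odot>\<^bsub>Q.quotient_module\<^esub> u" by simp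
qed

lemma tr_0: "tr 0 = 0"
proof -
  have "\<forall>a\<in>A. \<forall>b\<in>A. tr (a + b) = tr a + tr b"
    using trace_props by (simp add: normal_faithful_trace_def)
  from bspec[OF bspec[OF this A_0] A_0] have "tr (0 + 0) = tr 0 + tr 0" .
  then show ?thesis by simp
qed

text \<open>\<open>fgp_dim\<close> selects its value by \<open>SOME\<close>, so every admissible
  matrix has to be considered: if its image has one element, it kills the unit vectors and its
  diagonal is zero.\<close>

lemma fgp_dim_zero:
  assumes Z: "left_module (op_ring A) Z" "carrier Z = {\<zero>\<^bsub>Z\<^esub>}"
  shows "fgp_dim A tr Z = 0"
  unfolding fgp_dim_def
proof (rule some_equality)
  interpret Z: left_module "op_ring A" Z by fact
  have c0: "carrier (matrix_image A 0 (\<lambda>_ _. 0)) = {\<lambda>_. undefined}"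
    by (auto simp: matrix_image_def matrix_map_def free_module_def)
  have "lmod_isomorphic (op_ring A) (matrix_image A 0 (\<lambda>_ _. 0)) Z"
    unfolding lmod_isomorphic_def
  proof (intro bexI[of _ "\<lambda>_. \<zero>\<^bsub>Z\<^esub>"])
    show "bij_betw (\<lambda>_. \<zero>\<^bsub>Z\<^esub>) (carrier (matrix_image A 0 (\<lambda>_ _. 0))) (carrier Z)"
      unfolding c0 Z(2) by (auto simp: bij_betw_def)
    show "(\<lambda>_. \<zero>\<^bsub>Z\<^esub>) \<in> lmod_hom (op_ring A) (matrix_image A 0 (\<lambda>_ _. 0)) Z"
      by (auto simp: lmod_hom_def Z.smult_r_zero)
  qed
  then show "\<exists>n F. projection_matrix A n F \<and> lmod_isomorphic (op_ring A) (matrix_image A n F) Z \<and>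
      0 = Re (\<Sum>i<n. tr (F i i))"
    by (intro exI[of _ 0] exI[of _ "\<lambda>_ _. 0"]) (simp add: projection_matrix_def)
next
  fix d
  assume "\<exists>n F. projection_matrix A n F \<and> lmod_isomorphic (op_ring A) (matrix_image A n F) Z \<and>
      d = Re (\<Sum>i<n. tr (F i i))"
  then obtain n F where iso: "lmod_isomorphic (op_ring A) (matrix_image A n F) Z"
    and d: "d = Re (\<Sum>i<n. tr (F i i))" by blast
  obtain g where g: "bij_betw g (carrier (matrix_image A n F)) (carrier Z)"
    using iso by (auto simp: lmod_isomorphic_def)
  have eq: "x = y" if "x \<in> carrier (matrix_image A n F)" "y \<in> carrier (matrix_image A n F)" for x y
  proof -
    have "g x \<in> carrier Z" "g y \<in> carrier Z" using that g by (auto simp: bij_betw_def)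
    then have "g x = g y" using Z(2) by simp
    then show ?thesis using that g by (auto simp: bij_betw_def dest: inj_onD)
  qed
  have "F i i = 0" if i: "i < n" for i
  proof -
    let ?D = "\<lambda>k\<in>{..<n}. if k = i then id_blinfun else 0"
    have "?D \<in> carrier (free_module (op_ring A) {..<n})" "(\<lambda>k\<in>{..<n}. 0) \<in> carrier (free_module (op_ring A) {..<n})"
      by (auto simp: free_module_def op_ring_def)
    then have "matrix_map n F ?D \<in> carrier (matrix_image A n F)"
      "matrix_map n F (\<lambda>k\<in>{..<n}. 0) \<in> carrier (matrix_image A n F)"
      by (auto simp: matrix_image_def)
    from eq[OF this] have "matrix_map n F ?D i = matrix_map n F (\<lambda>k\<in>{..<n}. 0) i" by simp
    moreover have "matrix_map n F ?D i = (\<Sum>k<n. if k = i then F i i else 0)"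
    proof -
      have "?D k o\<^sub>L F k i = (if k = i then F i i else 0)" if "k < n" for k
        using that by (intro blinfun_eqI) auto
      then show ?thesis using i by (simp add: matrix_map_def)
    qed
    moreover have "matrix_map n F (\<lambda>k\<in>{..<n}. 0) i = 0"
    proof -
      have "(\<lambda>k\<in>{..<n}. 0) k o\<^sub>L F k i = 0" if "k < n" for k using that by (intro blinfun_eqI) auto
      then show ?thesis using i by (simp add: matrix_map_def)
    qed
    ultimately show ?thesis using i by simp
  qed
  then show "d = 0" by (simp add: d tr_0)
qed

text \<open>A projective submodule of the torsion submodule is both torsion and torsion-free, hence
  zero. The supremum therefore runs over the zero module alone and equals 0, and membership in the
  class removes the torsion.\<close>

lemma class_P_torsion_free:
  assumes P: "class_P A tr M" shows "Q.torsion M = {\<zero>\<^bsub>M\<^esub>}"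
proof -
  have lM: "left_module (op_ring A) M" using P by (simp add: class_P_def)
  interpret M: left_module "op_ring A" M by fact
  let ?N = "Q.torsion M"
  note sN = Q.submodule_torsion[OF lM]
  note lN = M.left_module_submodule[OF sN]
  interpret N: left_module "op_ring A" "M\<lparr>carrier := ?N\<rparr>" by (rule lN)
  have zero: "X = {\<zero>\<^bsub>M\<^esub>}"
    if X: "submodule X (op_ring A) (M\<lparr>carrier := ?N\<rparr>)" "fg_projective (op_ring A) (M\<lparr>carrier := X\<rparr>)" for X
  proof -
    have "projective_module (op_ring A) (M\<lparr>carrier := X\<rparr>)" using X(2) by (simp add: fg_projective_def)
    from Q.torsion_projective[OF this] have "Q.torsion (M\<lparr>carrier := X\<rparr>) = {\<zero>\<^bsub>M\<^esub>}" by simp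
    moreover have "X \<subseteq> Q.torsion (M\<lparr>carrier := X\<rparr>)"
      using N.submoduleD(1)[OF X(1)] by (auto simp: Q.torsion_def)
    ultimately show ?thesis using N.submoduleD(2)[OF X(1)] by auto
  qed
  have s0: "submodule {\<zero>\<^bsub>M\<^esub>} (op_ring A) (M\<lparr>carrier := ?N\<rparr>)"
    using N.submoduleD(2) M.submoduleD(2)[OF sN]
    by (intro N.submoduleI') (auto simp: M.smult_r_zero)
  have l0: "left_module (op_ring A) (M\<lparr>carrier := {\<zero>\<^bsub>M\<^esub>}\<rparr>)" using N.left_module_submodule[OF s0] by simp
  have fg0: "fg_projective (op_ring A) (M\<lparr>carrier := {\<zero>\<^bsub>M\<^esub>}\<rparr>)" using l0 by (intro fg_projective_zero) auto
  have d0: "fgp_dim A tr (M\<lparr>carrier := {\<zero>\<^bsub>M\<^esub>}\<rparr>) = 0" using l0 by (intro fgp_dim_zero) auto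
  have "{ereal (fgp_dim A tr ((M\<lparr>carrier := ?N\<rparr>)\<lparr>carrier := X\<rparr>)) | X.
      submodule X (op_ring A) (M\<lparr>carrier := ?N\<rparr>) \<and> fg_projective (op_ring A) ((M\<lparr>carrier := ?N\<rparr>)\<lparr>carrier := X\<rparr>)} = {0}"
  proof (intro Set.set_eqI iffI)
    fix z assume "z \<in> {0 :: ereal}"
    then show "z \<in> {ereal (fgp_dim A tr ((M\<lparr>carrier := ?N\<rparr>)\<lparr>carrier := X\<rparr>)) | X.
      submodule X (op_ring A) (M\<lparr>carrier := ?N\<rparr>) \<and> fg_projective (op_ring A) ((M\<lparr>carrier := ?N\<rparr>)\<lparr>carrier := X\<rparr>)}"
      using s0 fg0 d0 by (intro CollectI exI[of _ "{\<zero>\<^bsub>M\<^esub>}"]) (simp add: zero_ereal_def)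
  qed (use zero d0 in \<open>auto simp: zero_ereal_def\<close>)
  then have "vn_dim A tr (M\<lparr>carrier := ?N\<rparr>) = 0" by (simp add: vn_dim_def)
  then show ?thesis using P sN unfolding class_P_def by blast
qed

end

text \<open>In the first part \<open>E\<close> is any injective envelope, with injectivity required
  only against test modules of the operator type, which suffices for divisibility; the copy of the
  tensor product is the image of \<open>j\<close>. In the second part injectivity is obtained
  against every test type \<open>'c\<close>.\<close>

theorem theorem5p1:
  fixes A :: "('h::complex_hilbert \<Rightarrow>\<^sub>L 'h) set"
    and tr :: "('h \<Rightarrow>\<^sub>L 'h) \<Rightarrow> complex"
    and \<eta> :: "('h \<Rightarrow>\<^sub>L 'h) \<Rightarrow> 'k::complex_hilbert"
    and M :: "('h \<Rightarrow>\<^sub>L 'h, 'm) module"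
  assumes "finite_von_neumann_algebra A tr"
    and "l2_completion A tr \<eta>"
    and "left_module (op_ring A) M"
  shows "(class_P A tr M \<longrightarrow>
            (\<forall>(E :: ('h \<Rightarrow>\<^sub>L 'h, 'e) module) i.
               injective_envelope TYPE('h \<Rightarrow>\<^sub>L 'h) (op_ring A) M E i \<longrightarrow>
               (\<exists>j\<in>lmod_hom (op_ring A) (affiliated_tensor A \<eta> M) E.
                  inj_on j (carrier (affiliated_tensor A \<eta> M)) \<and>
                  (\<forall>m\<in>carrier M. j (affiliated_tensor_map A \<eta> M m) = i m))))
       \<and> (fg_projective (op_ring A) M \<longrightarrow>
            injective_envelope TYPE('c) (op_ring A) M
              (affiliated_tensor A \<eta> M) (affiliated_tensor_map A \<eta> M))"
proof -
  interpret finite_vna A tr \<eta> using assms(1,2) by (rule finite_vna.intro)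
  interpret O: ore_tensor "op_ring A" "affiliated_ring A \<eta>" "affiliated_incl A \<eta>" M
    by (intro ore_tensor.intro ore_extension_affiliated scalar_extension.intro
        ring_affiliated_ring affiliated_incl_hom assms(3))
  have T: "affiliated_tensor A \<eta> M = O.TR" by (simp add: affiliated_tensor_def)
  have map: "affiliated_tensor_map A \<eta> M = O.pure \<one>\<^bsub>affiliated_ring A \<eta>\<^esub>"
    by (rule ext) (simp add: affiliated_tensor_map_def)
  show ?thesis
    unfolding T map
    using O.tensor_embeds_in_envelope class_P_torsion_free
      O.fg_projective_tensor_envelope[OF _ baer_affiliated] by blast
qed

end
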